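(* Let $k\in\{1,4\}$, so that $n_k=3k+2$ equals $5$ or $14$, and let $(M,g,\Upsilon)$ be an $H_k$ structure on an $n_k$-dimensional manifold $M$. Then $(M,g,\Upsilon)$ admits a characteristic connection if and only if it is nearly integrable, i.e. if and only if $$(\nabla^{LC}_v\Upsilon)(v,v,v)\equiv 0$$ for every vector field $v$ on $M$, where $\nabla^{LC}$ is the Levi-Civita connection of $g$.
   Context: Summation over repeated indices is understood. **$H_k$ structure.** For $k\in\{1,2,4,8\}$ put $n_k=3k+2$. An $H_k$ structure on an $n_k$-dimensional Riemannian manifold $(M,g)$ is a rank 3 tensor field $\Upsilon$ such that, in orthonormal frames, (i) $\Upsilon_{IJK}=\Upsilon_{(IJK)}$ (totally symmetric); (ii) $\Upsilon_{IJJ}=0$; (iii) $\Upsilon_{JKI}\Upsilon_{LMI}+\Upsilon_{LJI}\Upsilon_{KMI}+\Upsilon_{KLI}\Upsilon_{JMI}=g_{JK}g_{LM}+g_{LJ}g_{KM}+g_{KL}g_{JM}$. **Model tensor $\Upsilon^1$.** Let $\mathbb K=\mathbb R,\mathbb C,\mathbb H,\mathbb O$ for $k=1,2,4,8$. Octonion units: $e_0=1$, $e_\mu^2=-1$, $e_\mu e_\nu=-e_\nu e_\mu$ for $\mu\ne\nu$ in $\{1,\dots,7\}$, $e_\mu e_{\mu+1}=e_{\mu+3}$ (indices mod 7), together with the relations obtained by cyclically permuting each triple $(e_\mu,e_{\mu+1},e_{\mu+3})$. Put $X^1=x^1e_0+x^6e_1+x^9e_2+x^{10}e_4+x^{15}e_3+x^{16}e_5+x^{17}e_6+x^{18}e_7$,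 $X^2=x^2e_0+x^7e_1+x^{11}e_2+x^{12}e_4+x^{19}e_3+x^{20}e_5+x^{21}e_6+x^{22}e_7$, $X^3=x^3e_0+x^8e_1+x^{13}e_2+x^{14}e_4+x^{23}e_3+x^{24}e_5+x^{25}e_6+x^{26}e_7$, with $x^I=0$ for $I>n_k$, and $$A=\begin{pmatrix}x^5-\sqrt3x^4&\sqrt3X^3&\sqrt3X^2\\ \sqrt3\,\overline{X^3}&x^5+\sqrt3x^4&\sqrt3X^1\\ \sqrt3\,\overline{X^2}&\sqrt3\,\overline{X^1}&-2x^5\end{pmatrix}.$$ With $\det_1A=a_{11}a_{22}a_{33}-a_{12}a_{21}a_{33}-a_{13}a_{22}a_{31}-a_{11}a_{23}a_{32}+a_{13}(a_{32}a_{21})+(a_{12}a_{23})a_{31}$, the symmetric tensor $\Upsilon^1$ on $\mathbb R^{n_k}$ is defined by $\Upsilon^1_{IJK}x^Ix^Jx^K=\tfrac12\det_1A$. **The algebra $\mathfrak h_k$ and adapted coframes.** $H_k$ is the stabilizer of $\Upsilon^1$ in $\mathbf{SO}(n_k)$ (the image of $\mathbf{SO}(3),\mathbf{SU}(3),\mathbf{Sp}(3),\mathbf F_4$ for $k=1,2,4,8$ in an irreducible representation), and $\mathfrak h_k\subset\mathfrak{so}(n_k)=\bigwedge^2\mathbb R^{n_k}$ is its Lie algebra. An adapted coframe is a local orthonormal coframe $(\theta^I)$ with $\Upsilon=\Upsilon^1_{IJK}\theta^I\theta^J\theta^K$. Such coframes exist locally and are given up to $H_k$ transformations. **Characteristic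 connection.** In an adapted coframe write the Levi-Civita connection 1-form as $\Gamma^{LC}_{IJ}=\Gamma^{LC}_{IJK}\theta^K$, so pointwise $\Gamma^{LC}\in\mathfrak{so}(n_k)\otimes\mathbb R^{n_k}$. If $\Gamma^{LC}$ admits a unique decomposition $\Gamma^{LC}=\Gamma+\tfrac12T$ with $\Gamma\in\mathfrak h_k\otimes\mathbb R^{n_k}$ and $T\in\bigwedge^3\mathbb R^{n_k}$, then the $\mathfrak h_k$-valued connection $\Gamma$ is called the characteristic connection of $(M,g,\Upsilon)$; $T$ is its totally skew-symmetric torsion. *)

theory Defs
  imports "HOL-Analysis.Analysis"
begin

section \<open>Smooth manifolds and tensor fields\<close>

text \<open>For open \<open>S\<close>, \<open>Ck_on m S f\<close> says that \<open>f\<close> is \<open>m\<close> times continuously differentiable on \<open>S\<close>.\<close>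

primrec Ck_on ::
  "nat \<Rightarrow> 'e::euclidean_space set \<Rightarrow> ('e \<Rightarrow> 'b::real_normed_vector) \<Rightarrow> bool" where
  "Ck_on 0 S f \<longleftrightarrow> continuous_on S f"
| "Ck_on (Suc m) S f \<longleftrightarrow>
     (\<forall>x\<in>S. f differentiable (at x)) \<and> (\<forall>v. Ck_on m S (\<lambda>x. frechet_derivative f (at x) v))"

definition smooth_on :: "'e::euclidean_space set \<Rightarrow> ('e \<Rightarrow> 'b::real_normed_vector) \<Rightarrow> bool" where
  "smooth_on S f \<longleftrightarrow> (\<forall>m. Ck_on m S f)"

text \<open>A chart is a pair of its domain and its coordinate map.\<close>

type_synonym ('a, 'e) chart = "'a set \<times> ('a \<Rightarrow> 'e)"

definition is_chart :: "'a topology \<Rightarrow> ('a, 'e::euclidean_space) chart \<Rightarrow> bool" where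
  "is_chart X c \<longleftrightarrow> openin X (fst c) \<and> open (snd c ` fst c) \<and>
     homeomorphic_map (subtopology X (fst c)) (top_of_set (snd c ` fst c)) (snd c)"

definition chart_inv :: "('a, 'e) chart \<Rightarrow> 'e \<Rightarrow> 'a" where
  "chart_inv c = inv_into (fst c) (snd c)"

definition smooth_manifold :: "'a topology \<Rightarrow> ('a, 'e::euclidean_space) chart set \<Rightarrow> bool" where
  "smooth_manifold X A \<longleftrightarrow>
     Hausdorff_space X \<and> second_countable X \<and>
     (\<forall>c\<in>A. is_chart X c) \<and> topspace X = (\<Union>c\<in>A. fst c) \<and>
     (\<forall>c\<in>A. \<forall>c'\<in>A. smooth_on (snd c ` (fst c \<inter> fst c')) (snd c' \<circ> chart_inv c))"

text \<open>
  Tangent vectors and tensors are given by their representatives in the charts of the atlas: in a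
  chart \<open>c\<close> the tangent space at \<open>p\<close> is identified with the model space \<open>'e\<close>, and representatives
  in two charts are related by the derivative \<open>tmap c c' p\<close> of the change of coordinates.
  The value at \<open>(c, p)\<close> is meaningful only for \<open>c\<close> in the atlas and \<open>p\<close> in the domain of \<open>c\<close>.
\<close>

definition tmap :: "('a, 'e::euclidean_space) chart \<Rightarrow> ('a, 'e) chart \<Rightarrow> 'a \<Rightarrow> 'e \<Rightarrow> 'e" where
  "tmap c c' p = frechet_derivative (snd c' \<circ> chart_inv c) (at (snd c p))"

definition vector_field ::
  "('a, 'e::euclidean_space) chart set \<Rightarrow> (('a, 'e) chart \<Rightarrow> 'a \<Rightarrow> 'e) \<Rightarrow> bool" where
  "vector_field A v \<longleftrightarrow>
     (\<forall>c\<in>A. smooth_on (snd c ` fst c) (v c \<circ> chart_inv c)) \<and>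
     (\<forall>c\<in>A. \<forall>c'\<in>A. \<forall>p \<in> fst c \<inter> fst c'. v c' p = tmap c c' p (v c p))"

definition covector_field_on ::
  "('a, 'e::euclidean_space) chart set \<Rightarrow> 'a set \<Rightarrow> (('a, 'e) chart \<Rightarrow> 'a \<Rightarrow> 'e \<Rightarrow> real) \<Rightarrow> bool" where
  "covector_field_on A U w \<longleftrightarrow>
     (\<forall>c\<in>A. \<forall>p \<in> U \<inter> fst c. linear (w c p)) \<and>
     (\<forall>c\<in>A. \<forall>x. smooth_on (snd c ` (U \<inter> fst c)) ((\<lambda>q. w c q x) \<circ> chart_inv c)) \<and>
     (\<forall>c\<in>A. \<forall>c'\<in>A. \<forall>p \<in> U \<inter> fst c \<inter> fst c'. \<forall>x. w c p x = w c' p (tmap c c' p x))"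

definition riemannian_metric ::
  "('a, 'e::euclidean_space) chart set \<Rightarrow> (('a, 'e) chart \<Rightarrow> 'a \<Rightarrow> 'e \<Rightarrow> 'e \<Rightarrow> real) \<Rightarrow> bool" where
  "riemannian_metric A g \<longleftrightarrow>
     (\<forall>c\<in>A. \<forall>p \<in> fst c. bilinear (g c p) \<and>
        (\<forall>x y. g c p x y = g c p y x) \<and> (\<forall>x. x \<noteq> 0 \<longrightarrow> g c p x x > 0)) \<and>
     (\<forall>c\<in>A. \<forall>x y. smooth_on (snd c ` fst c) ((\<lambda>q. g c q x y) \<circ> chart_inv c)) \<and>
     (\<forall>c\<in>A. \<forall>c'\<in>A. \<forall>p \<in> fst c \<inter> fst c'. \<forall>x y.
        g c p x y = g c' p (tmap c c' p x) (tmap c c' p y))"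

definition tensor3_field ::
  "('a, 'e::euclidean_space) chart set \<Rightarrow> (('a, 'e) chart \<Rightarrow> 'a \<Rightarrow> 'e \<Rightarrow> 'e \<Rightarrow> 'e \<Rightarrow> real) \<Rightarrow> bool" where
  "tensor3_field A Y \<longleftrightarrow>
     (\<forall>c\<in>A. \<forall>p \<in> fst c. \<forall>x y.
        linear (\<lambda>z. Y c p z x y) \<and> linear (\<lambda>z. Y c p x z y) \<and> linear (\<lambda>z. Y c p x y z)) \<and>
     (\<forall>c\<in>A. \<forall>x y z. smooth_on (snd c ` fst c) ((\<lambda>q. Y c q x y z) \<circ> chart_inv c)) \<and>
     (\<forall>c\<in>A. \<forall>c'\<in>A. \<forall>p \<in> fst c \<inter> fst c'. \<forall>x y z.
        Y c p x y z = Y c' p (tmap c c' p x) (tmap c c' p y) (tmap c c' p z))"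


section \<open>The Levi-Civita connection\<close>

text \<open>Derivative at \<open>p\<close> of \<open>f\<close> in the direction whose representative in the chart \<open>c\<close> is \<open>x\<close>.\<close>

definition dird :: "('a, 'e::euclidean_space) chart \<Rightarrow> ('a \<Rightarrow> real) \<Rightarrow> 'a \<Rightarrow> 'e \<Rightarrow> real" where
  "dird c f p x = frechet_derivative (f \<circ> chart_inv c) (at (snd c p)) x"

text \<open>
  \<open>levi_civita g c p x y\<close> is the covariant derivative at \<open>p\<close>, in the direction \<open>x\<close>, of the vector
  field with constant components \<open>y\<close> in the chart \<open>c\<close> (so it encodes the Christoffel symbols).
  Since coordinate fields commute, vanishing torsion is the symmetry of this map; the last clause
  says that the connection is metric.
\<close>

definition levi_civita ::
  "(('a, 'e::euclidean_space) chart \<Rightarrow> 'a \<Rightarrow> 'e \<Rightarrow> 'e \<Rightarrow> real) \<Rightarrow> ('a, 'e) chart \<Rightarrow> 'a \<Rightarrow> 'e \<Rightarrow> 'e \<Rightarrow> 'e" where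
  "levi_civita g c p = (THE G. bilinear G \<and> (\<forall>x y. G x y = G y x) \<and>
     (\<forall>x y z. dird c (\<lambda>q. g c q y z) p x = g c p (G x y) z + g c p y (G x z)))"

definition nabla_covector ::
  "(('a, 'e::euclidean_space) chart \<Rightarrow> 'a \<Rightarrow> 'e \<Rightarrow> 'e \<Rightarrow> real) \<Rightarrow> (('a, 'e) chart \<Rightarrow> 'a \<Rightarrow> 'e \<Rightarrow> real) \<Rightarrow>
   ('a, 'e) chart \<Rightarrow> 'a \<Rightarrow> 'e \<Rightarrow> 'e \<Rightarrow> real" where
  "nabla_covector g w c p x y = dird c (\<lambda>q. w c q y) p x - w c p (levi_civita g c p x y)"

definition nabla_tensor3 ::
  "(('a, 'e::euclidean_space) chart \<Rightarrow> 'a \<Rightarrow> 'e \<Rightarrow> 'e \<Rightarrow> real) \<Rightarrow>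
   (('a, 'e) chart \<Rightarrow> 'a \<Rightarrow> 'e \<Rightarrow> 'e \<Rightarrow> 'e \<Rightarrow> real) \<Rightarrow>
   ('a, 'e) chart \<Rightarrow> 'a \<Rightarrow> 'e \<Rightarrow> 'e \<Rightarrow> 'e \<Rightarrow> 'e \<Rightarrow> real" where
  "nabla_tensor3 g Y c p x y1 y2 y3 = dird c (\<lambda>q. Y c q y1 y2 y3) p x
     - Y c p (levi_civita g c p x y1) y2 y3
     - Y c p y1 (levi_civita g c p x y2) y3
     - Y c p y1 y2 (levi_civita g c p x y3)"


section \<open>The model tensor\<close>

text \<open>An octonion is given by its coefficients with respect to \<open>e\<^sub>0, \<dots>, e\<^sub>7\<close>.\<close>

type_synonym octonion = "nat \<Rightarrow> real"

definition oct :: "real list \<Rightarrow> octonion" where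
  "oct xs = (\<lambda>r. if r < length xs then xs ! r else 0)"

abbreviation oct_of_real :: "real \<Rightarrow> octonion" where
  "oct_of_real a \<equiv> oct [a, 0, 0, 0, 0, 0, 0, 0]"

text \<open>The triples \<open>(\<mu>, \<mu> + 1, \<mu> + 3)\<close> modulo 7, with representatives \<open>1, \<dots>, 7\<close>.\<close>

definition oct_triples :: "(nat \<times> nat \<times> nat) set" where
  "oct_triples = {(1,2,4), (2,3,5), (3,4,6), (4,5,7), (5,6,1), (6,7,2), (7,1,3)}"

definition oct_pos :: "nat \<Rightarrow> nat \<Rightarrow> nat \<Rightarrow> bool" where
  "oct_pos i j r \<longleftrightarrow>
     (i, j, r) \<in> oct_triples \<or> (j, r, i) \<in> oct_triples \<or> (r, i, j) \<in> oct_triples"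

text \<open>\<open>oct_sc i j r\<close> is the coefficient of \<open>e\<^sub>r\<close> in \<open>e\<^sub>i e\<^sub>j\<close>.\<close>

definition oct_sc :: "nat \<Rightarrow> nat \<Rightarrow> nat \<Rightarrow> real" where
  "oct_sc i j r =
     (if i = 0 then (if j = r then 1 else 0)
      else if j = 0 then (if i = r then 1 else 0)
      else if i = j then (if r = 0 then - 1 else 0)
      else if oct_pos i j r then 1
      else if oct_pos j i r then - 1
      else 0)"

definition oct_mult :: "octonion \<Rightarrow> octonion \<Rightarrow> octonion"  (infixl \<open>\<odot>\<close> 70) where
  "x \<odot> y = (\<lambda>r. \<Sum>i\<le>7. \<Sum>j\<le>7. oct_sc i j r * x i * y j)"

definition oct_cnj :: "octonion \<Rightarrow> octonion" where
  "oct_cnj x = (\<lambda>r. if r = 0 then x r else - x r)"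

definition oct_scale :: "real \<Rightarrow> octonion \<Rightarrow> octonion" where
  "oct_scale a x = (\<lambda>r. a * x r)"

definition det1 :: "(nat \<Rightarrow> nat \<Rightarrow> octonion) \<Rightarrow> octonion" where
  "det1 a = (\<lambda>r. (a 1 1 \<odot> a 2 2 \<odot> a 3 3) r - (a 1 2 \<odot> a 2 1 \<odot> a 3 3) r
      - (a 1 3 \<odot> a 2 2 \<odot> a 3 1) r - (a 1 1 \<odot> a 2 3 \<odot> a 3 2) r
      + (a 1 3 \<odot> (a 3 2 \<odot> a 2 1)) r + ((a 1 2 \<odot> a 2 3) \<odot> a 3 1) r)"

definition dim_n :: "nat \<Rightarrow> nat" where
  "dim_n k = 3 * k + 2"

text \<open>
  Vectors of \<open>\<real>\<^sup>n\<close>, with \<open>n = dim_n k\<close>, are functions on the naturals whose entries with index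
  in \<open>{1..n}\<close> matter; the others are replaced by 0, which also cuts the octonions down to
  the reals, complex numbers or quaternions for \<open>k = 1, 2, 4\<close>.
\<close>

definition model_matrix :: "nat \<Rightarrow> (nat \<Rightarrow> real) \<Rightarrow> nat \<Rightarrow> nat \<Rightarrow> octonion" where
  "model_matrix k x0 =
    (let x = (\<lambda>I. if I \<in> {1..dim_n k} then x0 I else 0);
         X1 = oct [x 1, x 6, x 9,  x 15, x 10, x 16, x 17, x 18];
         X2 = oct [x 2, x 7, x 11, x 19, x 12, x 20, x 21, x 22];
         X3 = oct [x 3, x 8, x 13, x 23, x 14, x 24, x 25, x 26];
         s = sqrt 3
     in (\<lambda>i j.
       if (i, j) = (1, 1) then oct_of_real (x 5 - s * x 4)
       else if (i, j) = (1, 2) then oct_scale s X3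
       else if (i, j) = (1, 3) then oct_scale s X2
       else if (i, j) = (2, 1) then oct_scale s (oct_cnj X3)
       else if (i, j) = (2, 2) then oct_of_real (x 5 + s * x 4)
       else if (i, j) = (2, 3) then oct_scale s X1
       else if (i, j) = (3, 1) then oct_scale s (oct_cnj X2)
       else if (i, j) = (3, 2) then oct_scale s (oct_cnj X1)
       else if (i, j) = (3, 3) then oct_of_real (- 2 * x 5)
       else oct_of_real 0))"

text \<open>
  The unique symmetric tensor on \<open>\<real>\<^sup>n\<close> (extended by 0 to indices outside \<open>{1..n}\<close>) whose cubic
  form is half of \<open>det1\<close>; the equation is one between octonions, \<open>det1\<close> being real here.
\<close>

definition model_tensor :: "nat \<Rightarrow> nat \<Rightarrow> nat \<Rightarrow> nat \<Rightarrow> real" where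
  "model_tensor k = (THE Y.
     (\<forall>I J K. Y I J K = Y J I K \<and> Y I J K = Y I K J) \<and>
     (\<forall>I J K. \<not> {I, J, K} \<subseteq> {1..dim_n k} \<longrightarrow> Y I J K = 0) \<and>
     (\<forall>x. oct_of_real (\<Sum>I=1..dim_n k. \<Sum>J=1..dim_n k. \<Sum>K=1..dim_n k. Y I J K * x I * x J * x K)
        = oct_scale (1/2) (det1 (model_matrix k x))))"


section \<open>The group \<open>H\<^sub>k\<close> and its Lie algebra\<close>

text \<open>
  Matrices of size \<open>n\<close> are functions of two indices vanishing outside \<open>{1..n}\<close>, so that equality
  of matrices is equality of functions.
\<close>

definition matrices :: "nat \<Rightarrow> (nat \<Rightarrow> nat \<Rightarrow> real) set" where
  "matrices n = {a. \<forall>I J. \<not> {I, J} \<subseteq> {1..n} \<longrightarrow> a I J = 0}"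

definition id_matrix :: "nat \<Rightarrow> nat \<Rightarrow> nat \<Rightarrow> real" where
  "id_matrix n = (\<lambda>I J. if I \<in> {1..n} \<and> I = J then 1 else 0)"

definition det_matrix :: "nat \<Rightarrow> (nat \<Rightarrow> nat \<Rightarrow> real) \<Rightarrow> real" where
  "det_matrix n a = (\<Sum>p | p permutes {1..n}. of_int (sign p) * (\<Prod>I=1..n. a I (p I)))"

definition SO_group :: "nat \<Rightarrow> (nat \<Rightarrow> nat \<Rightarrow> real) set" where
  "SO_group n = {a \<in> matrices n.
     (\<forall>I\<in>{1..n}. \<forall>J\<in>{1..n}. (\<Sum>K=1..n. a K I * a K J) = (if I = J then 1 else 0)) \<and>
     det_matrix n a = 1}"

definition H_group :: "nat \<Rightarrow> (nat \<Rightarrow> nat \<Rightarrow> real) set" where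
  "H_group k = {a \<in> SO_group (dim_n k).
     \<forall>I\<in>{1..dim_n k}. \<forall>J\<in>{1..dim_n k}. \<forall>K\<in>{1..dim_n k}.
       (\<Sum>P=1..dim_n k. \<Sum>Q=1..dim_n k. \<Sum>R=1..dim_n k.
          model_tensor k P Q R * a P I * a Q J * a R K) = model_tensor k I J K}"

text \<open>The tangent space at the identity: velocities of curves in the group.\<close>

definition lie_algebra ::
  "nat \<Rightarrow> (nat \<Rightarrow> nat \<Rightarrow> real) set \<Rightarrow> (nat \<Rightarrow> nat \<Rightarrow> real) set" where
  "lie_algebra n H = {B. \<exists>a. (\<forall>t::real. a t \<in> H) \<and> a 0 = id_matrix n \<and>
     (\<forall>I J. ((\<lambda>t. a t I J) has_real_derivative B I J) (at 0))}"

definition h_algebra :: "nat \<Rightarrow> (nat \<Rightarrow> nat \<Rightarrow> real) set" where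
  "h_algebra k = lie_algebra (dim_n k) (H_group k)"

definition h_tensor_Rn :: "nat \<Rightarrow> (nat \<Rightarrow> nat \<Rightarrow> nat \<Rightarrow> real) set" where
  "h_tensor_Rn k = {G. (\<forall>K\<in>{1..dim_n k}. (\<lambda>I J. G I J K) \<in> h_algebra k) \<and>
     (\<forall>I J K. \<not> {I, J, K} \<subseteq> {1..dim_n k} \<longrightarrow> G I J K = 0)}"

definition three_forms :: "nat \<Rightarrow> (nat \<Rightarrow> nat \<Rightarrow> nat \<Rightarrow> real) set" where
  "three_forms n = {T. (\<forall>I J K. T I J K = - T J I K \<and> T I J K = - T I K J) \<and>
     (\<forall>I J K. \<not> {I, J, K} \<subseteq> {1..n} \<longrightarrow> T I J K = 0)}"


section \<open>\<open>H\<^sub>k\<close> structures and characteristic connections\<close>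

definition Hk_structure ::
  "nat \<Rightarrow> 'a topology \<Rightarrow> ('a, 'e::euclidean_space) chart set \<Rightarrow>
   (('a, 'e) chart \<Rightarrow> 'a \<Rightarrow> 'e \<Rightarrow> 'e \<Rightarrow> real) \<Rightarrow>
   (('a, 'e) chart \<Rightarrow> 'a \<Rightarrow> 'e \<Rightarrow> 'e \<Rightarrow> 'e \<Rightarrow> real) \<Rightarrow> bool" where
  "Hk_structure k X A g Y \<longleftrightarrow>
     k \<in> {1, 2, 4, 8} \<and> DIM('e) = dim_n k \<and>
     smooth_manifold X A \<and> riemannian_metric A g \<and> tensor3_field A Y \<and>
     (\<forall>c\<in>A. \<forall>p \<in> fst c. \<forall>b :: nat \<Rightarrow> 'e.
        (\<forall>I\<in>{1..dim_n k}. \<forall>J\<in>{1..dim_n k}. g c p (b I) (b J) = (if I = J then 1 else 0)) \<longrightarrow>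
        (let N = {1..dim_n k};
             y = (\<lambda>I J K. Y c p (b I) (b J) (b K));
             h = (\<lambda>I J. g c p (b I) (b J))
         in (\<forall>I\<in>N. \<forall>J\<in>N. \<forall>K\<in>N. y I J K = y J I K \<and> y I J K = y I K J) \<and>
            (\<forall>I\<in>N. (\<Sum>J\<in>N. y I J J) = 0) \<and>
            (\<forall>J\<in>N. \<forall>K\<in>N. \<forall>L\<in>N. \<forall>M\<in>N.
               (\<Sum>I\<in>N. y J K I * y L M I + y L J I * y K M I + y K L I * y J M I)
               = h J K * h L M + h L J * h K M + h K L * h J M)))"

text \<open>
  A coframe on \<open>U\<close> is a family \<open>\<theta> I\<close> of covector fields, \<open>I \<in> {1..n}\<close>; it is orthonormal when
  \<open>g = \<Sum>\<^sub>I \<theta>\<^sup>I \<otimes> \<theta>\<^sup>I\<close>, which for \<open>n\<close> the dimension entails linear independence.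
\<close>

definition adapted_coframe ::
  "nat \<Rightarrow> 'a topology \<Rightarrow> ('a, 'e::euclidean_space) chart set \<Rightarrow>
   (('a, 'e) chart \<Rightarrow> 'a \<Rightarrow> 'e \<Rightarrow> 'e \<Rightarrow> real) \<Rightarrow>
   (('a, 'e) chart \<Rightarrow> 'a \<Rightarrow> 'e \<Rightarrow> 'e \<Rightarrow> 'e \<Rightarrow> real) \<Rightarrow>
   'a set \<Rightarrow> (nat \<Rightarrow> ('a, 'e) chart \<Rightarrow> 'a \<Rightarrow> 'e \<Rightarrow> real) \<Rightarrow> bool" where
  "adapted_coframe k X A g Y U \<theta> \<longleftrightarrow>
     openin X U \<and> (\<forall>I\<in>{1..dim_n k}. covector_field_on A U (\<theta> I)) \<and>
     (\<forall>c\<in>A. \<forall>p \<in> U \<inter> fst c. \<forall>x y.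
        g c p x y = (\<Sum>I=1..dim_n k. \<theta> I c p x * \<theta> I c p y)) \<and>
     (\<forall>c\<in>A. \<forall>p \<in> U \<inter> fst c. \<forall>x y z.
        Y c p x y z = (\<Sum>I=1..dim_n k. \<Sum>J=1..dim_n k. \<Sum>K=1..dim_n k.
          model_tensor k I J K * \<theta> I c p x * \<theta> J c p y * \<theta> K c p z))"

definition dual_frame ::
  "nat \<Rightarrow> (nat \<Rightarrow> ('a, 'e::euclidean_space) chart \<Rightarrow> 'a \<Rightarrow> 'e \<Rightarrow> real) \<Rightarrow>
   ('a, 'e) chart \<Rightarrow> 'a \<Rightarrow> nat \<Rightarrow> 'e" where
  "dual_frame n \<theta> c p J = (THE v. \<forall>I\<in>{1..n}. \<theta> I c p v = (if I = J then 1 else 0))"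

text \<open>
  \<open>\<nabla>\<theta>\<^sup>I = - \<Gamma>\<^sub>I\<^sub>J \<theta>\<^sup>J\<close> and \<open>\<Gamma>\<^sub>I\<^sub>J = \<Gamma>\<^sub>I\<^sub>J\<^sub>K \<theta>\<^sup>K\<close>, so \<open>\<Gamma>\<^sub>I\<^sub>J\<^sub>K = - (\<nabla>\<^sub>K \<theta>\<^sup>I)(e\<^sub>J)\<close> in the dual frame.
\<close>

definition lc_coeff ::
  "nat \<Rightarrow> (('a, 'e::euclidean_space) chart \<Rightarrow> 'a \<Rightarrow> 'e \<Rightarrow> 'e \<Rightarrow> real) \<Rightarrow>
   (nat \<Rightarrow> ('a, 'e) chart \<Rightarrow> 'a \<Rightarrow> 'e \<Rightarrow> real) \<Rightarrow>
   ('a, 'e) chart \<Rightarrow> 'a \<Rightarrow> nat \<Rightarrow> nat \<Rightarrow> nat \<Rightarrow> real" where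
  "lc_coeff n g \<theta> c p I J K = (if {I, J, K} \<subseteq> {1..n} then
     - nabla_covector g (\<theta> I) c p (dual_frame n \<theta> c p K) (dual_frame n \<theta> c p J) else 0)"

text \<open>
  The first conjunct keeps the second one, which quantifies over all adapted coframes, from being
  vacuous. Smoothness of the two parts of the decomposition is automatic: where the pointwise
  decomposition is unique, they are fixed linear functions of the coefficients of \<open>\<Gamma>\<^sup>L\<^sup>C\<close>.
\<close>

definition admits_characteristic_connection ::
  "nat \<Rightarrow> 'a topology \<Rightarrow> ('a, 'e::euclidean_space) chart set \<Rightarrow>
   (('a, 'e) chart \<Rightarrow> 'a \<Rightarrow> 'e \<Rightarrow> 'e \<Rightarrow> real) \<Rightarrow>
   (('a, 'e) chart \<Rightarrow> 'a \<Rightarrow> 'e \<Rightarrow> 'e \<Rightarrow> 'e \<Rightarrow> real) \<Rightarrow> bool" where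
  "admits_characteristic_connection k X A g Y \<longleftrightarrow>
     (\<forall>p \<in> topspace X. \<exists>U \<theta>. p \<in> U \<and> adapted_coframe k X A g Y U \<theta>) \<and>
     (\<forall>U \<theta>. adapted_coframe k X A g Y U \<theta> \<longrightarrow>
        (\<forall>c\<in>A. \<forall>p \<in> U \<inter> fst c. \<exists>!D.
           fst D \<in> h_tensor_Rn k \<and> snd D \<in> three_forms (dim_n k) \<and>
           (\<forall>I J K. lc_coeff (dim_n k) g \<theta> c p I J K = fst D I J K + 1/2 * snd D I J K)))"

definition nearly_integrable ::
  "('a, 'e::euclidean_space) chart set \<Rightarrow>
   (('a, 'e) chart \<Rightarrow> 'a \<Rightarrow> 'e \<Rightarrow> 'e \<Rightarrow> real) \<Rightarrow>
   (('a, 'e) chart \<Rightarrow> 'a \<Rightarrow> 'e \<Rightarrow> 'e \<Rightarrow> 'e \<Rightarrow> real) \<Rightarrow> bool" where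
  "nearly_integrable A g Y \<longleftrightarrow>
     (\<forall>v. vector_field A v \<longrightarrow>
        (\<forall>c\<in>A. \<forall>p \<in> fst c. nabla_tensor3 g Y c p (v c p) (v c p) (v c p) (v c p) = 0))"

end

theory Submission
  imports Defs
begin

text \<open>
  Contracting \<open>\<Upsilon>\<close> with two vectors gives a commutative product on \<open>\<real>\<^sup>n\<close>, written \<open>x \<diamondop> y\<close>, with
  \<open>(x \<diamondop> x) \<diamondop> x = \<bar>x\<bar>\<^sup>2 x\<close>, and the Lie algebra of \<open>H\<^sub>k\<close> consists of its skew derivations. In an adapted
  coframe \<open>(\<nabla>\<^sub>x \<Upsilon>) (x, x, x) = - 3 \<langle>\<Gamma> x x, x \<diamondop> x\<rangle>\<close>. Since a three-form \<open>T\<close> satisfies \<open>T x x = 0\<close> and a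
  derivation is orthogonal to \<open>x \<diamondop> x\<close>, a characteristic connection makes this vanish. Conversely,
  near integrability says that \<open>A x x = \<Gamma> x x\<close> is orthogonal to \<open>x\<close> and \<open>x \<diamondop> x\<close>, and one has to find
  a linear map \<open>G\<close> into the derivations with \<open>A x x = G x x\<close>: then \<open>2 (\<Gamma> - G)\<close> is a three-form. It is
  unique because a derivation-valued \<open>G\<close> with \<open>G x x = 0\<close> vanishes.

  Three idempotents \<open>c\<^sub>i\<close> in a plane, the diagonal matrices, give a Peirce decomposition that identifies
  \<open>\<real>\<^sup>n\<close> with the traceless hermitian 3 by 3 matrices over the reals or the quaternions. Subtracting
  suitable derivations one makes \<open>A\<close> vanish on pairs of diagonal matrices, then on mixed pairs, then on
  pairs of off-diagonal ones. The same decomposition with smoothly varying idempotents yields adapted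
  coframes, and bump functions extend a tangent vector to a vector field.
\<close>

section \<open>Cartan products and their derivations\<close>

text \<open>Two choices keep the algebra elementary. An orthonormal frame of \<open>g\<close>
  carries the tensor at each point to a product on the model space with its standard inner product,
  so over a chart the product varies but the inner product does not. And no normal form of the
  product is assumed: the cubic identity yields idempotents, and vanishing traces give the three
  Peirce spaces equal dimension, so quaternion units can be chosen by formulas that depend smoothly
  on the point. The frame found in this way also supplies the symmetric tensor that the definite
  description \<open>model_tensor\<close> presupposes. Only the diagonal values \<open>A x x\<close>
  matter because \<Gamma> and a derivation valued map are both skew for every fixed direction; a
  difference that vanishes on equal arguments is then skew in the other pair of indices too. The
  equations for \<open>G\<close> are overdetermined on the off-diagonal matrices, where one
  imaginary entry is prescribed twice; near integrability together with a trivial imaginary centre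
  makes the two prescriptions agree.\<close>

lemma three_index [simp]:
  fixes i :: 3
  shows "i + 1 + 1 = i + 2" "i + 1 + 2 = i" "i + 2 + 1 = i" "i + 2 + 2 = i + 1"
    "i + 1 \<noteq> i" "i + 2 \<noteq> i" "i + 1 \<noteq> i + 2" "i + 2 \<noteq> i + 1" "i \<noteq> i + 1" "i \<noteq> i + 2"
  using exhaust_3[of i] by auto

lemma three_cases: "j = i \<or> j = i + 1 \<or> j = i + 2" for i j :: 3
  using exhaust_3[of i] exhaust_3[of j] by auto

lemma sum_3_from: "(\<Sum>j\<in>UNIV. f j) = f i + f (i + 1) + f (i + 2)" for i :: 3 and f :: "3 \<Rightarrow> 'a::comm_monoid_add"
proof -
  have "UNIV = {i, i + 1, i + 2}" using three_cases by blast
  then show ?thesis unfolding \<open>UNIV = _\<close> by (simp add: add.assoc)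
qed

text \<open>
  The tensor is \<open>(x \<diamondop> y) \<bullet> z\<close>; the last axiom is condition (iii) of an \<open>H\<^sub>k\<close> structure with three equal arguments,
  to which it is equivalent by polarisation.
\<close>

locale cartan_product = P: bounded_bilinear P
  for P :: "'e::euclidean_space \<Rightarrow> 'e \<Rightarrow> 'e" (infixl "\<diamondop>" 70) +
  assumes P_comm: "x \<diamondop> y = y \<diamondop> x"
    and P_sym: "(x \<diamondop> y) \<bullet> z = y \<bullet> (x \<diamondop> z)"
    and P_cube: "(x \<diamondop> x) \<diamondop> x = (x \<bullet> x) *\<^sub>R x"
begin

lemmas P_bil = P.add_left P.add_right P.diff_left P.diff_right P.minus_left P.minus_right
  P.scaleR_left P.scaleR_right P.zero_left P.zero_right

lemma P_sym': "(x \<diamondop> y) \<bullet> z = x \<bullet> (y \<diamondop> z)"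
  by (subst P_comm) (rule P_sym)

lemma P_cyc: "(x \<diamondop> y) \<bullet> z = (y \<diamondop> z) \<bullet> x"
  by (rule trans[OF P_sym' inner_commute])

text \<open>The part of the cube identity that is odd in \<open>y\<close>, taken from its values at
  \<open>x + y\<close> and \<open>x - y\<close>, with the term cubic in \<open>y\<close> removed.
  This is the linearisation from which the Peirce rules are read off.\<close>

lemma P_square: "(x \<diamondop> x) \<diamondop> y + 2 *\<^sub>R ((x \<diamondop> y) \<diamondop> x) = (x \<bullet> x) *\<^sub>R y + (2 * (x \<bullet> y)) *\<^sub>R x"
proof -
  have 1: "((x + y) \<diamondop> (x + y)) \<diamondop> (x + y) = ((x + y) \<bullet> (x + y)) *\<^sub>R (x + y)"
    and 2: "((x - y) \<diamondop> (x - y)) \<diamondop> (x - y) = ((x - y) \<bullet> (x - y)) *\<^sub>R (x - y)"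
    by (rule P_cube)+
  note 3 = P_cube[of y]
  have "2 *\<^sub>R ((x \<diamondop> x) \<diamondop> y + 2 *\<^sub>R ((x \<diamondop> y) \<diamondop> x)) = 2 *\<^sub>R ((x \<bullet> x) *\<^sub>R y + (2 * (x \<bullet> y)) *\<^sub>R x)"
    (is "?l = ?r")
  proof -
    have "?l = ((x + y) \<diamondop> (x + y)) \<diamondop> (x + y) - ((x - y) \<diamondop> (x - y)) \<diamondop> (x - y) - 2 *\<^sub>R ((y \<diamondop> y) \<diamondop> y)"
      using P_comm[of y x] by (simp add: P_bil algebra_simps scaleR_2)
    also have "\<dots> = ?r"
      unfolding 1 2 3 by (rule euclidean_eqI) (simp add: inner_add_left inner_add_right inner_diff_left
          inner_diff_right inner_commute[of y x] algebra_simps)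
    finally show ?thesis .
  qed
  then show ?thesis by simp
qed

lemma P_polar: "(x \<diamondop> y) \<diamondop> z + (y \<diamondop> z) \<diamondop> x + (z \<diamondop> x) \<diamondop> y
    = (x \<bullet> y) *\<^sub>R z + (y \<bullet> z) *\<^sub>R x + (z \<bullet> x) *\<^sub>R y"
proof -
  have "2 *\<^sub>R ((x \<diamondop> y) \<diamondop> z + (y \<diamondop> z) \<diamondop> x + (z \<diamondop> x) \<diamondop> y)
      = 2 *\<^sub>R ((x \<bullet> y) *\<^sub>R z + (y \<bullet> z) *\<^sub>R x + (z \<bullet> x) *\<^sub>R y)"
  proof -
    have "2 *\<^sub>R ((x \<diamondop> y) \<diamondop> z + (y \<diamondop> z) \<diamondop> x + (z \<diamondop> x) \<diamondop> y)
      = (((x + y) \<diamondop> (x + y)) \<diamondop> z + 2 *\<^sub>R (((x + y) \<diamondop> z) \<diamondop> (x + y)))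
       - ((x \<diamondop> x) \<diamondop> z + 2 *\<^sub>R ((x \<diamondop> z) \<diamondop> x)) - ((y \<diamondop> y) \<diamondop> z + 2 *\<^sub>R ((y \<diamondop> z) \<diamondop> y))"
      using P_comm[of y x] P_comm[of z x] P_comm[of z y] by (simp add: P_bil algebra_simps scaleR_2)
    also have "\<dots> = 2 *\<^sub>R ((x \<bullet> y) *\<^sub>R z + (y \<bullet> z) *\<^sub>R x + (z \<bullet> x) *\<^sub>R y)"
      unfolding P_square by (simp add: inner_add_left inner_add_right
          inner_commute[of y x] inner_commute[of z x] algebra_simps scaleR_2)
    finally show ?thesis .
  qed
  then show ?thesis by simp
qed

section \<open>Skew derivations\<close>

definition ders :: "('e \<Rightarrow> 'e) set" where
  "ders = {D. linear D \<and> (\<forall>x. D x \<bullet> x = 0) \<and> (\<forall>x. D x \<bullet> (x \<diamondop> x) = 0)}"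

lemma ders_linear: "D \<in> ders \<Longrightarrow> linear D" by (simp add: ders_def)

lemma ders_skew: assumes "D \<in> ders" shows "D x \<bullet> y = - (x \<bullet> D y)"
proof -
  have "D (x + y) \<bullet> (x + y) = 0" "D x \<bullet> x = 0" "D y \<bullet> y = 0"
    using assms by (auto simp: ders_def)
  then show ?thesis using ders_linear[OF assms]
    by (simp add: linear_add inner_add_left inner_add_right inner_commute)
qed

lemma ders_polar: assumes "D \<in> ders"
  shows "D x \<bullet> (y \<diamondop> z) + D y \<bullet> (z \<diamondop> x) + D z \<bullet> (x \<diamondop> y) = 0"
proof -
  note l = linear_add[OF ders_linear[OF assms]] linear_diff[OF ders_linear[OF assms]]
  have z: "D x \<bullet> (x \<diamondop> x) = 0" for x using assms by (auto simp: ders_def)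
  have q: "D y \<bullet> (x \<diamondop> x) + 2 * (D x \<bullet> (x \<diamondop> y)) = 0" for x y
    using z[of "x + y"] z[of "x - y"] z[of y] z[of x] P_comm[of y x]
    by (simp add: l P_bil inner_add_left inner_add_right inner_diff_left inner_diff_right)
  show ?thesis using q[of z "x + y"] q[of z x] q[of z y] P_comm[of y x] P_comm[of z x] P_comm[of z y]
    by (simp add: l P_bil inner_add_left inner_add_right)
qed

text \<open>Skewness moves \<open>D\<close> off the test vector and turns infinitesimal invariance
  of the trilinear form into the Leibniz rule.\<close>

lemma ders_product: assumes "D \<in> ders" shows "D (x \<diamondop> y) = D x \<diamondop> y + x \<diamondop> D y"
proof (rule euclidean_eqI)
  fix b :: 'e
  have "D (x \<diamondop> y) \<bullet> b = - (D b \<bullet> (x \<diamondop> y))"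
    using ders_skew[OF assms, of "x \<diamondop> y" b] by (simp add: inner_commute)
  also have "\<dots> = D x \<bullet> (y \<diamondop> b) + D y \<bullet> (b \<diamondop> x)"
    using ders_polar[OF assms, of x y b] by simp
  also have "\<dots> = (D x \<diamondop> y + x \<diamondop> D y) \<bullet> b"
    by (simp add: inner_add_left P_sym'[of "D x"] P_sym[of x "D y"] P_comm[of b x])
  finally show "D (x \<diamondop> y) \<bullet> b = (D x \<diamondop> y + x \<diamondop> D y) \<bullet> b" .
qed

lemma ders_add: "D \<in> ders \<Longrightarrow> D' \<in> ders \<Longrightarrow> (\<lambda>x. D x + D' x) \<in> ders"
  by (auto simp: ders_def linear_compose_add inner_add_left)

lemma ders_scale: "D \<in> ders \<Longrightarrow> (\<lambda>x. r *\<^sub>R D x) \<in> ders"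
  by (auto simp: ders_def linear_compose_scale_right)

lemma ders_zero: "(\<lambda>x. 0) \<in> ders"
  by (auto simp: ders_def linear_zero)

lemma ders_sum: "(\<And>i. i \<in> I \<Longrightarrow> D i \<in> ders) \<Longrightarrow> (\<lambda>x. \<Sum>i\<in>I. D i x) \<in> ders"
  by (induction I rule: infinite_finite_induct) (auto simp: ders_zero ders_add)

text \<open>For traceless hermitian matrices the Jordan product is \<open>x \<diamondop> y\<close>
  plus \<open>2 * (x \<bullet> y)\<close> times the identity. This is the commutator of the Jordan
  multiplications by \<open>x\<close> and \<open>y\<close>; the last term comes from the identity
  component.\<close>

definition inner_der :: "'e \<Rightarrow> 'e \<Rightarrow> 'e \<Rightarrow> 'e" where
  "inner_der x y z = x \<diamondop> (y \<diamondop> z) - y \<diamondop> (x \<diamondop> z) + 2 *\<^sub>R ((y \<bullet> z) *\<^sub>R x - (x \<bullet> z) *\<^sub>R y)"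

lemma inner_der_in_ders: "inner_der x y \<in> ders"
proof -
  have "linear (inner_der x y)"
    by (rule linearI) (simp_all add: inner_der_def P_bil inner_add_right algebra_simps)
  moreover have "inner_der x y z \<bullet> z = 0" for z
    using inner_commute[of "y \<diamondop> z" "x \<diamondop> z"]
    by (simp add: inner_der_def inner_add_left inner_diff_left P_sym[of x] P_sym[of y])
  moreover have "inner_der x y z \<bullet> (z \<diamondop> z) = 0" for z
  proof -
    \<comment> \<open>The first and the last term on the right are symmetric in \<open>x\<close> and
      \<open>y\<close> and drop out of the commutator. What the middle term leaves is cancelled by
      the correction in \<open>inner_der\<close>, which fixes its coefficient 2.\<close>
    have sq: "(x \<diamondop> (y \<diamondop> z)) \<bullet> (z \<diamondop> z)
        = (z \<bullet> z) * ((y \<diamondop> z) \<bullet> x) + 2 * (z \<bullet> x) * ((y \<diamondop> z) \<bullet> z) - 2 * ((y \<diamondop> z) \<bullet> ((x \<diamondop> z) \<diamondop> z))" for x y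
    proof -
      have "(x \<diamondop> (y \<diamondop> z)) \<bullet> (z \<diamondop> z) = (y \<diamondop> z) \<bullet> ((z \<diamondop> z) \<diamondop> x)"
        using P_sym[of x "y \<diamondop> z" "z \<diamondop> z"] by (simp add: P_comm[of x])
      also have "(z \<diamondop> z) \<diamondop> x = (z \<bullet> z) *\<^sub>R x + (2 * (z \<bullet> x)) *\<^sub>R z - 2 *\<^sub>R ((x \<diamondop> z) \<diamondop> z)"
        using P_square[of z x] P_comm[of z x] by (metis add_diff_cancel_right')
      finally show ?thesis by (simp add: inner_add_right inner_diff_right)
    qed
    have s: "(y \<diamondop> z) \<bullet> ((x \<diamondop> z) \<diamondop> z) = (x \<diamondop> z) \<bullet> ((y \<diamondop> z) \<diamondop> z)"
      by (subst inner_commute, subst P_sym', subst P_comm[of z], rule refl)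
    have s2: "(y \<diamondop> z) \<bullet> x = (x \<diamondop> z) \<bullet> y" by (simp add: P_cyc[of y] P_comm[of z x])
    have s3: "(y \<diamondop> z) \<bullet> z = y \<bullet> (z \<diamondop> z)" "(x \<diamondop> z) \<bullet> z = x \<bullet> (z \<diamondop> z)"
      by (rule P_sym')+
    show ?thesis
      unfolding inner_der_def inner_add_left inner_diff_left sq[of x y] sq[of y x]
      using s s2 by (simp add: s3 P_sym'[of x] P_sym'[of y] inner_commute[of z x] inner_commute[of z y] algebra_simps)
  qed
  ultimately show ?thesis by (simp add: ders_def)
qed

text \<open>For \<open>A x x = \<Gamma> x x\<close> the third condition is skewness of \<open>\<Gamma> x\<close> and the fourth one near integrability.\<close>

definition tangent :: "('e \<Rightarrow> 'e \<Rightarrow> 'e) \<Rightarrow> bool" where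
  "tangent A \<longleftrightarrow> bilinear A \<and> (\<forall>x y. A x y = A y x) \<and> (\<forall>x. A x x \<bullet> x = 0) \<and> (\<forall>x. A x x \<bullet> (x \<diamondop> x) = 0)"

definition sympart :: "('e \<Rightarrow> 'e \<Rightarrow> 'e) \<Rightarrow> 'e \<Rightarrow> 'e \<Rightarrow> 'e" where
  "sympart G x y = (1/2) *\<^sub>R (G x y + G y x)"

definition ders_valued :: "('e \<Rightarrow> 'e \<Rightarrow> 'e) \<Rightarrow> bool" where
  "ders_valued G \<longleftrightarrow> bilinear G \<and> (\<forall>x. G x \<in> ders)"

lemma ders_valued_add: "ders_valued G \<Longrightarrow> ders_valued G' \<Longrightarrow> ders_valued (\<lambda>x y. G x y + G' x y)"
  unfolding ders_valued_def bilinear_def by (auto simp: linear_compose_add ders_add)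

lemma ders_valuedI: "(\<And>y. linear (\<lambda>x. G x y)) \<Longrightarrow> (\<And>x. G x \<in> ders) \<Longrightarrow> ders_valued G"
  unfolding ders_valued_def bilinear_def using ders_linear by auto

text \<open>All conditions in \<open>tangent\<close> are linear and hold for symmetrised derivation
  valued maps, so corrections can be subtracted one after another.\<close>

lemma tangent_diff:
  assumes "tangent A" "ders_valued G" shows "tangent (\<lambda>x y. A x y - sympart G x y)"
proof -
  have b: "bilinear G" and d: "\<And>x. G x \<in> ders" using assms(2) by (auto simp: ders_valued_def)
  have "bilinear (sympart G)"
    using b unfolding bilinear_def sympart_def
    by (auto intro!: linear_compose_scale_right linear_compose_add)
  moreover have "bilinear A" using assms(1) by (simp add: tangent_def)
  ultimately have "bilinear (\<lambda>x y. A x y - sympart G x y)"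
    unfolding bilinear_def by (auto intro!: linear_compose_sub)
  moreover have "sympart G x x = G x x" for x by (simp add: sympart_def flip: scaleR_2)
  moreover have "G x x \<bullet> x = 0" "G x x \<bullet> (x \<diamondop> x) = 0" for x using d[of x] by (auto simp: ders_def)
  moreover have "sympart G x y = sympart G y x" for x y by (simp add: sympart_def add.commute)
  ultimately show ?thesis using assms(1) by (simp add: tangent_def inner_diff_left)
qed

lemma tangent_C:
  assumes "tangent A" shows "A x y \<bullet> z + A y z \<bullet> x + A z x \<bullet> y = 0"
proof -
  have b: "bilinear A" and s: "\<And>x y. A x y = A y x" and z: "\<And>x. A x x \<bullet> x = 0" using assms by (auto simp: tangent_def)
  note l = bilinear_ladd[OF b] bilinear_radd[OF b] bilinear_lsub[OF b] bilinear_rsub[OF b]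
    inner_add_left inner_add_right inner_diff_left inner_diff_right
  have q: "A x x \<bullet> y + 2 * (A x y \<bullet> x) = 0" for x y
    using z[of "x + y"] z[of "x - y"] z[of y] z[of x] s[of y x]
    by (simp add: l)
  show ?thesis using q[of "x + y" z] q[of x z] q[of y z] s[of y x] s[of z x]
    by (simp add: l)
qed

lemma tangent_Q1:
  assumes "tangent A" shows "A x y \<bullet> (x \<diamondop> x) + A x x \<bullet> (x \<diamondop> y) = 0"
proof -
  have b: "bilinear A" and s: "\<And>x y. A x y = A y x" and z: "\<And>x. A x x \<bullet> (x \<diamondop> x) = 0" using assms by (auto simp: tangent_def)
  note l = bilinear_ladd[OF b] bilinear_radd[OF b] bilinear_lsub[OF b] bilinear_rsub[OF b] bilinear_lmul[OF b] bilinear_rmul[OF b]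
    inner_add_left inner_add_right inner_diff_left inner_diff_right P_bil
  \<comment> \<open>Along \<open>x + t y\<close> the condition is a quartic polynomial in
    \<open>t\<close>; its odd part has two coefficients, and the values at 1, -1, 2, -2 isolate the
    linear one.\<close>
  show ?thesis
    using z[of "x + y"] z[of "x - y"] z[of "x + 2 *\<^sub>R y"] z[of "x - 2 *\<^sub>R y"] s[of y x] P_comm[of y x]
    by (simp add: l)
qed

lemma tangent_Q:
  assumes "tangent A" shows "A x y \<bullet> (z \<diamondop> w) + A x z \<bullet> (y \<diamondop> w) + A x w \<bullet> (y \<diamondop> z)
    + A y z \<bullet> (x \<diamondop> w) + A y w \<bullet> (x \<diamondop> z) + A z w \<bullet> (x \<diamondop> y) = 0"
proof -
  have b: "bilinear A" and s: "\<And>x y. A x y = A y x" using assms by (auto simp: tangent_def)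
  note l = bilinear_ladd[OF b] bilinear_radd[OF b] bilinear_lsub[OF b] bilinear_rsub[OF b]
    inner_add_left inner_add_right inner_diff_left inner_diff_right P_bil
  note Q1 = tangent_Q1[OF assms]
  have Q2: "2 * (A x y \<bullet> (x \<diamondop> z)) + A z y \<bullet> (x \<diamondop> x) + 2 * (A x z \<bullet> (x \<diamondop> y)) + A x x \<bullet> (z \<diamondop> y) = 0" for x y z
    using Q1[of "x + z" y] Q1[of "x - z" y] Q1[of z y] Q1[of x y] s[of z x] P_comm[of z x]
    by (simp add: l)
  show ?thesis
    using Q2[of "x + y" z w] Q2[of x z w] Q2[of y z w] s[of y x] s[of z x] s[of w x] s[of z y] s[of w y] s[of w z]
      P_comm[of y x] P_comm[of z x] P_comm[of w x] P_comm[of z y] P_comm[of w y] P_comm[of w z]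
    by (simp add: l)
qed

end

section \<open>Peirce decomposition and hermitian matrices\<close>

lemma inner_Basis_sum: "(\<Sum>b\<in>Basis. (b \<bullet> x) * (y \<bullet> b)) = x \<bullet> y" for x y :: "'e::euclidean_space"
  by (subst euclidean_inner[of x y]) (simp add: inner_commute)

lemma half_sum: "(1/2) *\<^sub>R a + b + (1/2) *\<^sub>R a = a + b" for a b :: "'e::real_vector"
  by (simp add: algebra_simps flip: scaleR_add_left)

text \<open>In the hermitian model \<open>c i\<close> is diagonal with one entry 2 and two entries
  -1, three times a primitive idempotent minus the identity. The three vectors lie at 120 degrees in
  the plane of traceless diagonal matrices.\<close>

locale peirce = cartan_product P
  for P :: "'e::euclidean_space \<Rightarrow> 'e \<Rightarrow> 'e" (infixl "\<diamondop>" 70) +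
  fixes c :: "3 \<Rightarrow> 'e"
  assumes c_idem [simp]: "c i \<diamondop> c i = c i"
    and c_norm [simp]: "c i \<bullet> c i = 1"
    and c_sum: "c i + c (i + 1) + c (i + 2) = 0"
begin

lemma c2: "c (i + 2) = - c i - c (i + 1)"
  using c_sum[of i] by (metis add.commute add_diff_cancel_left' diff_0 diff_diff_add)

text \<open>The table is forced: since \<open>c (i + 2)\<close> equals
  \<open>- c i - c (i + 1)\<close>, its idempotency determines the mixed product. The inner products
  follow from its norm in the same way.\<close>

lemma c_prod: "c i \<diamondop> c (i + 1) = c (i + 2)" "c (i + 1) \<diamondop> c i = c (i + 2)"
  "c i \<diamondop> c (i + 2) = c (i + 1)" "c (i + 2) \<diamondop> c i = c (i + 1)"
proof -
  have 1: "c i \<diamondop> c (i + 1) = c (i + 2)" for i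
  proof -
    have "(- c i - c (i + 1)) \<diamondop> (- c i - c (i + 1)) = - c i - c (i + 1)"
      using c_idem[of "i + 2"] by (simp add: c2)
    moreover have "2 *\<^sub>R (a \<diamondop> b) = 2 *\<^sub>R (- a - b)"
      if "(- a - b) \<diamondop> (- a - b) = - a - b" "a \<diamondop> a = a" "b \<diamondop> b = b" for a b
    proof -
      have "2 *\<^sub>R (a \<diamondop> b) = (- a - b) \<diamondop> (- a - b) - a \<diamondop> a - b \<diamondop> b"
        by (simp add: P_bil P_comm[of b a] scaleR_2)
      then show ?thesis unfolding that by (simp add: scaleR_2)
    qed
    ultimately have "2 *\<^sub>R (c i \<diamondop> c (i + 1)) = 2 *\<^sub>R (- c i - c (i + 1))" using c_idem by blast
    then show ?thesis by (simp add: c2)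
  qed
  show "c i \<diamondop> c (i + 1) = c (i + 2)" by (rule 1)
  then show "c (i + 1) \<diamondop> c i = c (i + 2)" by (subst P_comm)
  show "c (i + 2) \<diamondop> c i = c (i + 1)" using 1[of "i + 2"] by simp
  then show "c i \<diamondop> c (i + 2) = c (i + 1)" by (subst P_comm)
qed

lemma c_inner: "c i \<bullet> c (i + 1) = - 1/2" "c (i + 1) \<bullet> c i = - 1/2"
  "c i \<bullet> c (i + 2) = - 1/2" "c (i + 2) \<bullet> c i = - 1/2"
proof -
  have 1: "c i \<bullet> c (i + 1) = - 1/2" for i
  proof -
    have "(- c i - c (i + 1)) \<bullet> (- c i - c (i + 1)) = 1"
      using c_norm[of "i + 2"] by (simp add: c2)
    then show ?thesis by (simp add: inner_diff_left inner_diff_right inner_commute)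
  qed
  show "c i \<bullet> c (i + 1) = - 1/2" "c (i + 1) \<bullet> c i = - 1/2" using 1[of i] by (simp_all add: inner_commute)
  show "c i \<bullet> c (i + 2) = - 1/2" "c (i + 2) \<bullet> c i = - 1/2" using 1[of "i + 2"] by (simp_all add: inner_commute)
qed


text \<open>The Peirce space of \<open>c i\<close>; in the hermitian model, the off-diagonal entry
  that avoids row and column \<open>i\<close>.\<close>

definition V :: "3 \<Rightarrow> 'e set" where
  "V i = {x. \<forall>j. c j \<diamondop> x = (if j = i then - x else (1/2) *\<^sub>R x)}"

lemma V_c: "x \<in> V i \<Longrightarrow> c j \<diamondop> x = (if j = i then - x else (1/2) *\<^sub>R x)"
  "x \<in> V i \<Longrightarrow> x \<diamondop> c j = (if j = i then - x else (1/2) *\<^sub>R x)"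
  by (auto simp: V_def P_comm[of x])

lemma V_subspace: "subspace (V i)"
  by (auto simp: subspace_def V_def P_bil scaleR_add_right)

lemma V_inner_c: assumes "x \<in> V i" shows "x \<bullet> c j = 0"
proof -
  have "(c j \<diamondop> x) \<bullet> c j = x \<bullet> c j" by (simp add: P_sym)
  then show ?thesis by (auto simp: V_c[OF assms] split: if_splits)
qed

lemma V_inner_c': "x \<in> V i \<Longrightarrow> c j \<bullet> x = 0"
  using V_inner_c by (simp add: inner_commute)

lemma V_orth: assumes "x \<in> V i" "y \<in> V j" "i \<noteq> j" shows "x \<bullet> y = 0"
  using P_sym[of "c i" x y] assms(3) by (auto simp: V_c[OF assms(1)] V_c[OF assms(2)])

text \<open>On the complement of the plane, multiplication by \<open>c i\<close> is a root of
  \<open>2 t^2 + t - 1\<close>, so its only eigenvalues there are -1 and 1/2.\<close>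

lemma c_mult_perp: assumes "\<And>i. v \<bullet> c i = 0" shows "c i \<diamondop> (c i \<diamondop> v) = (1/2) *\<^sub>R (v - c i \<diamondop> v)"
proof -
  have "c i \<diamondop> v + 2 *\<^sub>R (c i \<diamondop> (c i \<diamondop> v)) = v"
    using P_square[of "c i" v] assms[of i] by (simp add: inner_commute[of v] P_comm[of "c i \<diamondop> v" "c i"])
  moreover have "x = (1/2) *\<^sub>R (v - a)" if "a + 2 *\<^sub>R x = v" for a x v :: 'e
    using that by auto
  ultimately show ?thesis by blast
qed

text \<open>The eigenvalue -1 of one idempotent forces 1/2 for the others: the defect
  \<open>?w\<close> is multiplied by 2 under \<open>c i\<close>, and 2 is not a root of the
  quadratic in \<open>c_mult_perp\<close>.\<close>

lemma V_I: assumes "\<And>i. v \<bullet> c i = 0" "c i \<diamondop> v = - v" shows "v \<in> V i"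
proof -
  have h: "c j \<diamondop> v = (1/2) *\<^sub>R v" if j: "c i + c j + c l = 0" "c i \<diamondop> c j = c l" "c i \<bullet> c j = - 1/2" for j l
  proof -
    let ?w = "c j \<diamondop> v - (1/2) *\<^sub>R v"
    have "c l \<diamondop> v + (c j \<diamondop> v) \<diamondop> c i + (v \<diamondop> c i) \<diamondop> c j = - (1/2) *\<^sub>R v"
      using P_polar[of "c i" "c j" v] by (simp add: j assms(1) inner_commute[of _ v])
    moreover have "c l = - c i - c j" using j(1) by (metis add.commute add_diff_cancel_left' diff_0 diff_diff_add)
    then have "c l \<diamondop> v = v - c j \<diamondop> v" by (simp add: P_bil assms(2))
    ultimately have e: "(v - c j \<diamondop> v) + c i \<diamondop> (c j \<diamondop> v) - c j \<diamondop> v = - (1/2) *\<^sub>R v"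
      by (simp add: P_comm[of v "c i"] P_comm[of _ "c i"] assms(2) P_comm[of v "c j"] P_bil)
    have L: "c i \<diamondop> (c j \<diamondop> v) = 2 *\<^sub>R (c j \<diamondop> v) - (3/2) *\<^sub>R v"
    proof -
      have "c i \<diamondop> (c j \<diamondop> v) = (v - c j \<diamondop> v + c i \<diamondop> (c j \<diamondop> v) - c j \<diamondop> v) - (v - c j \<diamondop> v) + c j \<diamondop> v" by simp
      also have "\<dots> = 2 *\<^sub>R (c j \<diamondop> v) - (3/2) *\<^sub>R v"
        unfolding e by (rule euclidean_eqI) (simp add: inner_diff_left inner_add_left)
      finally show ?thesis .
    qed
    have w: "c i \<diamondop> ?w = 2 *\<^sub>R ?w" unfolding P.diff_right P.scaleR_right L assms(2)
      by (rule euclidean_eqI) (simp add: inner_diff_left inner_add_left)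
    have "?w \<bullet> c m = 0" for m
    proof -
      have "c j \<diamondop> c m \<in> range c" using c_prod[of j] three_cases[of m j] by (metis c_idem rangeI)
      then show ?thesis using assms(1) by (auto simp: inner_diff_left P_sym[of "c j"])
    qed
    from c_mult_perp[OF this, of i] have "2 *\<^sub>R (2 *\<^sub>R ?w) = (1/2) *\<^sub>R (?w - 2 *\<^sub>R ?w)" by (simp only: w P.scaleR_right)
    moreover have "u = 0" if "2 *\<^sub>R (2 *\<^sub>R u) = (1/2) *\<^sub>R (u - 2 *\<^sub>R u)" for u :: 'e
    proof -
      have "(9/2) *\<^sub>R u = 2 *\<^sub>R (2 *\<^sub>R u) - (1/2) *\<^sub>R (u - 2 *\<^sub>R u)"
        by (rule euclidean_eqI) (simp add: inner_diff_left)
      then show ?thesis unfolding that by simp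
    qed
    ultimately have "?w = 0" by blast
    then show ?thesis by simp
  qed
  have "c (i + 1) \<diamondop> v = (1/2) *\<^sub>R v" by (rule h[of _ "i + 2"]) (simp_all add: c_sum c_prod c_inner)
  moreover have "c (i + 2) \<diamondop> v = (1/2) *\<^sub>R v" by (rule h[of _ "i + 1"]) (use c_sum[of i] in \<open>simp_all add: c_prod c_inner ac_simps\<close>)
  ultimately show ?thesis using assms(2) three_cases[of _ i] by (auto simp: V_def)
qed

text \<open>Orthogonal projection to the plane of the idempotents. Three unit vectors at 120 degrees
  form a tight frame with constant 3/2, hence the factor 2/3.\<close>

definition csum :: "'e \<Rightarrow> 'e" where "csum v = (2/3) *\<^sub>R (\<Sum>i\<in>UNIV. (v \<bullet> c i) *\<^sub>R c i)"

text \<open>Off the plane, \<open>(1 - 2 t) / 3\<close> takes the values 1 and 0 at the eigenvalues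
  -1 and 1/2, so this is the spectral projection to \<open>V i\<close>. It is polynomial in the
  data, which later gives smoothness for free.\<close>

definition pr :: "3 \<Rightarrow> 'e \<Rightarrow> 'e" where
  "pr i v = (1/3) *\<^sub>R ((v - csum v) - 2 *\<^sub>R (c i \<diamondop> (v - csum v)))"

lemma csum_linear: "linear csum"
  unfolding csum_def
  by (intro linear_compose_scale_right linear_compose_sum ballI) (auto intro!: linearI simp: inner_add_left algebra_simps)

lemma csum_inner: "csum v \<bullet> c i = v \<bullet> c i"
proof -
  have "v \<bullet> c (i + 2) = - (v \<bullet> c i) - v \<bullet> c (i + 1)" by (simp add: c2 inner_diff_right)
  then show ?thesis unfolding csum_def sum_3_from[of _ i] by (simp add: inner_add_left c_inner diff_divide_distrib)
qed

lemma csum_mult: assumes "x \<in> V i" shows "csum v \<diamondop> x = - (v \<bullet> c i) *\<^sub>R x"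
proof -
  have "v \<bullet> c (i + 2) = - (v \<bullet> c i) - v \<bullet> c (i + 1)" by (simp add: c2 inner_diff_right)
  then show ?thesis
    unfolding csum_def sum_3_from[of _ i]
    by (simp add: P_bil V_c[OF assms] diff_divide_distrib flip: scaleR_add_left scaleR_minus_left scaleR_diff_left)
qed

lemma pr_in_V: "pr i v \<in> V i"
proof (rule V_I)
  define w where "w = v - csum v"
  have w: "w \<bullet> c i = 0" for i by (simp add: w_def inner_diff_left csum_inner)
  have p: "pr i v = (1/3) *\<^sub>R (w - 2 *\<^sub>R (c i \<diamondop> w))" by (simp add: pr_def w_def)
  show "pr i v \<bullet> c j = 0" for j
  proof -
    have "c i \<diamondop> c j \<in> range c" using c_prod[of i] three_cases[of j i] by (metis c_idem rangeI)
    then show ?thesis using w by (auto simp: p inner_diff_left P_sym[of "c i"])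
  qed
  show "c i \<diamondop> pr i v = - pr i v"
    unfolding p P.scaleR_right P.diff_right c_mult_perp[OF w]
    by (rule euclidean_eqI) (simp add: inner_diff_left diff_divide_distrib)
qed

text \<open>The terms containing \<open>c i\<close> cancel because the idempotents sum to
  zero.\<close>

lemma pr_decomp: "v = csum v + (\<Sum>i\<in>UNIV. pr i v)"
proof -
  let ?w = "v - csum v"
  have "(\<Sum>i\<in>UNIV. pr i v) = (1/3) *\<^sub>R (3 *\<^sub>R ?w - 2 *\<^sub>R ((\<Sum>i\<in>UNIV. c i) \<diamondop> ?w))"
    unfolding pr_def scaleR_sum_right[symmetric] sum_subtractf P.sum_left by (simp add: scaleR_sum_right sum_constant_scaleR scaleR_diff_right)
  also have "(\<Sum>i\<in>UNIV. c i) = 0" using c_sum[of 0] by (simp only: sum_3_from[of c 0])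
  finally show ?thesis by (simp add: P_bil)
qed

lemma perp_eq_0: assumes "\<And>i. v \<bullet> c i = 0" "\<And>i x. x \<in> V i \<Longrightarrow> v \<bullet> x = 0" shows "v = 0"
proof -
  have "csum v = 0" using assms(1) by (simp add: csum_def)
  then have "v \<bullet> v = (\<Sum>i\<in>UNIV. v \<bullet> pr i v)" using pr_decomp[of v] by (metis add_0 inner_sum_right)
  also have "\<dots> = 0" using assms(2)[OF pr_in_V] by simp
  finally show ?thesis by simp
qed

lemma pr_adjoint: assumes "x \<in> V i" shows "pr i v \<bullet> x = v \<bullet> x"
proof -
  have c: "csum v \<bullet> x = 0" by (simp add: csum_def inner_sum_left V_inner_c'[OF assms])
  have "(c i \<diamondop> (v - csum v)) \<bullet> x = - (v \<bullet> x)"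
    unfolding P_sym by (simp add: V_c[OF assms] c inner_diff_left)
  then show ?thesis by (simp add: pr_def inner_diff_left c)
qed

text \<open>\<open>P_polar\<close> with \<open>c j\<close> for \<open>j \<noteq> i\<close> shows
  that, off the plane, \<open>x \<diamondop> y\<close> would have the eigenvalue -1 for both other
  idempotents. On every Peirce space at least one of them has the eigenvalue 1/2, so the product
  lies in the plane.\<close>

lemma V_sq: assumes x: "x \<in> V i" and y: "y \<in> V i" shows "x \<diamondop> y = - (x \<bullet> y) *\<^sub>R c i"
proof -
  let ?z = "x \<diamondop> y"
  have h: "c j \<diamondop> ?z = (x \<bullet> y) *\<^sub>R c j - ?z" if "j \<noteq> i" for j
  proof -
    have "(c j \<diamondop> x) \<diamondop> y + ?z \<diamondop> c j + (y \<diamondop> c j) \<diamondop> x = (x \<bullet> y) *\<^sub>R c j"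
      using P_polar[of "c j" x y] V_inner_c[OF x] V_inner_c[OF y] by (simp add: inner_commute[of "c j"])
    then have "(1/2) *\<^sub>R ?z + c j \<diamondop> ?z + (1/2) *\<^sub>R ?z = (x \<bullet> y) *\<^sub>R c j"
      using that by (auto simp: V_c[OF x] V_c[OF y] P_bil P_comm[of y x] P_comm[of ?z "c j"])
    moreover have "b = w - a" if "(1/2) *\<^sub>R a + b + (1/2) *\<^sub>R a = w" for a b w :: 'e
      by (rule euclidean_eqI) (simp add: inner_diff_left inner_add_left flip: that)
    ultimately show ?thesis by blast
  qed
  have "?z - (- (x \<bullet> y) *\<^sub>R c i) = 0"
  proof (rule perp_eq_0)
    fix j
    show "(?z - (- (x \<bullet> y) *\<^sub>R c i)) \<bullet> c j = 0"
      using three_cases[of j i] by (auto simp: inner_diff_left inner_add_left P_sym' V_c[OF y] c_inner)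
  next
    fix j w assume w: "w \<in> V j"
    define l where "l = (if j = i then i + 1 else if j = i + 1 then i + 2 else i + 1)"
    have l: "l \<noteq> i" "l \<noteq> j" unfolding l_def using three_cases[of j i] by auto
    have "(c l \<diamondop> ?z) \<bullet> w = - (?z \<bullet> w)" using h[OF l(1)] by (simp add: inner_diff_left V_inner_c'[OF w])
    then show "(?z - (- (x \<bullet> y) *\<^sub>R c i)) \<bullet> w = 0"
      using l by (simp add: inner_diff_left inner_add_left P_sym V_c[OF w] V_inner_c'[OF w])
  qed
  then show ?thesis by (simp add: eq_neg_iff_add_eq_0)
qed

lemma V_cross: assumes x: "x \<in> V i" and y: "y \<in> V j" and "i \<noteq> j" "l \<noteq> i" "l \<noteq> j" shows "x \<diamondop> y \<in> V l"
proof (rule V_I)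
  have o: "x \<bullet> y = 0" by (rule V_orth[OF x y]) fact
  show "(x \<diamondop> y) \<bullet> c m = 0" for m by (simp add: P_sym' V_c[OF y] o)
  have "(1/2) *\<^sub>R (x \<diamondop> y) + c l \<diamondop> (x \<diamondop> y) + (1/2) *\<^sub>R (x \<diamondop> y) = 0"
    using P_polar[of "c l" x y] V_inner_c[OF x] V_inner_c[OF y] assms(4,5)
    by (simp add: V_inner_c'[OF x] V_inner_c'[OF y] o V_c[OF x] V_c[OF y] P_bil P_comm[of y x] P_comm[of _ "c l"])
  then show "c l \<diamondop> (x \<diamondop> y) = - (x \<diamondop> y)" unfolding half_sum by (simp add: eq_neg_iff_add_eq_0 add.commute)
qed

text \<open>By symmetry of the product, multiplication by a unit vector of one Peirce space is
  \<open>sqrt 3 / 2\<close> times an isometry between the other two. This is the source of the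
  composition algebra.\<close>

lemma V_double: assumes x: "x \<in> V i" and y: "y \<in> V j" and "i \<noteq> j"
  shows "x \<diamondop> (x \<diamondop> y) = (3/4 * (x \<bullet> x)) *\<^sub>R y"
proof -
  have "- (1/2 * (x \<bullet> x)) *\<^sub>R y + 2 *\<^sub>R (x \<diamondop> (x \<diamondop> y)) = (x \<bullet> x) *\<^sub>R y"
    using P_square[of x y] V_orth[OF x y] assms(3) by (simp add: V_sq[OF x x] P_bil V_c[OF y] P_comm[of "x \<diamondop> y" x])
  moreover have "b = (3/4 * r) *\<^sub>R a" if "- (1/2 * r) *\<^sub>R a + 2 *\<^sub>R b = r *\<^sub>R a" for a b :: 'e and r
  proof -
    have "b = (1/2) *\<^sub>R ((- (1/2 * r) *\<^sub>R a + 2 *\<^sub>R b) + (1/2 * r) *\<^sub>R a)" by simp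
    also have "\<dots> = (3/4 * r) *\<^sub>R a" unfolding that by (rule euclidean_eqI) (simp add: inner_add_left)
    finally show ?thesis .
  qed
  ultimately show ?thesis by blast
qed

text \<open>The trace of the projection is the dimension of \<open>V i\<close>. Multiplications are
  traceless by assumption, so only the identity and the plane contribute.\<close>

lemma trace_pr: assumes tr: "\<And>x. (\<Sum>b\<in>Basis. (x \<diamondop> b) \<bullet> b) = 0"
  shows "(\<Sum>b\<in>Basis. pr i b \<bullet> b) = (real DIM('e) - 2) / 3"
proof -
  have "csum b \<bullet> b = (\<Sum>j\<in>UNIV. (2/3) * ((b \<bullet> c j) * (c j \<bullet> b)))" for b
    by (simp add: csum_def inner_sum_left sum_distrib_left)
  then have "(\<Sum>b\<in>Basis. csum b \<bullet> b) = (\<Sum>j\<in>UNIV. \<Sum>b\<in>Basis. (2/3) * ((b \<bullet> c j) * (c j \<bullet> b)))"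
    by (simp only: sum.swap[of _ UNIV])
  then have 1: "(\<Sum>b\<in>Basis. csum b \<bullet> b) = 2"
    unfolding sum_distrib_left[symmetric] inner_Basis_sum by simp
  have "(c i \<diamondop> csum b) \<bullet> b = (\<Sum>j\<in>UNIV. (2/3) * ((b \<bullet> c j) * ((c i \<diamondop> c j) \<bullet> b)))" for b
    by (simp add: csum_def P_bil P.sum_right inner_sum_left sum_distrib_left)
  then have "(\<Sum>b\<in>Basis. (c i \<diamondop> csum b) \<bullet> b) = (\<Sum>j\<in>UNIV. \<Sum>b\<in>Basis. (2/3) * ((b \<bullet> c j) * ((c i \<diamondop> c j) \<bullet> b)))"
    by (simp only: sum.swap[of _ UNIV])
  then have 2: "(\<Sum>b\<in>Basis. (c i \<diamondop> csum b) \<bullet> b) = 0"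
    unfolding sum_distrib_left[symmetric] inner_Basis_sum sum_3_from[of _ i] using c_inner[of "i + 1"] by (simp add: c_prod c_inner)
  have "(\<Sum>b\<in>Basis. pr i b \<bullet> b) = (1/3) * (real DIM('e) - (\<Sum>b\<in>Basis. csum b \<bullet> b)
      - 2 * ((\<Sum>b\<in>Basis. (c i \<diamondop> b) \<bullet> b) - (\<Sum>b\<in>Basis. (c i \<diamondop> csum b) \<bullet> b)))"
    by (simp add: pr_def P_bil inner_diff_left sum_subtractf sum_distrib_left[symmetric] sum_divide_distrib[symmetric])
  then show ?thesis by (simp add: 1 2 tr)
qed

text \<open>If the projection to \<open>V i\<close> equalled the sum over \<open>U\<close>,
  comparing traces would give \<open>card U\<close> as its dimension. The new vector comes from a
  formula with a fixed \<open>b\<close>, so the same formula still works when the product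
  varies.\<close>

lemma V_extend:
  assumes tr: "\<And>x. (\<Sum>b\<in>Basis. (x \<diamondop> b) \<bullet> b) = 0" and "finite U" "U \<subseteq> V i"
    and ne: "real (card U) \<noteq> (real DIM('e) - 2) / 3" and u1: "\<And>u. u \<in> U \<Longrightarrow> u \<bullet> u = 1"
  obtains b where "pr i b - (\<Sum>u\<in>U. (b \<bullet> u) *\<^sub>R u) \<noteq> 0"
proof -
  have "\<exists>b. pr i b - (\<Sum>u\<in>U. (b \<bullet> u) *\<^sub>R u) \<noteq> 0"
  proof (rule ccontr)
    assume "\<not> ?thesis"
    then have "(\<Sum>b\<in>Basis. pr i b \<bullet> b) = (\<Sum>b\<in>Basis. (\<Sum>u\<in>U. (b \<bullet> u) *\<^sub>R u) \<bullet> b)" by simp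
    also have "\<dots> = (\<Sum>b\<in>Basis. \<Sum>u\<in>U. (b \<bullet> u) * (u \<bullet> b))" by (simp add: inner_sum_left)
    also have "\<dots> = (\<Sum>u\<in>U. u \<bullet> u)" unfolding sum.swap[of _ U] inner_Basis_sum ..
    also have "\<dots> = real (card U)" using u1 by simp
    finally show False using trace_pr[OF tr] ne by simp
  qed
  then show ?thesis using that by blast
qed

end

text \<open>
  These axioms are what singles out \<open>k = 1\<close> and \<open>k = 4\<close>: the imaginary part of the centre is nonzero
  for the complex numbers, and the octonions are not associative. The last one says that a skew map
  is the sum of a left and a right multiplication.
\<close>

locale comp_alg = M: bounded_bilinear mul
  for mul :: "'k::euclidean_space \<Rightarrow> 'k \<Rightarrow> 'k" (infixl "\<star>" 70) +
  fixes one :: 'k and cnj :: "'k \<Rightarrow> 'k"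
  assumes assoc: "(x \<star> y) \<star> z = x \<star> (y \<star> z)"
    and one_left [simp]: "one \<star> x = x" and one_right [simp]: "x \<star> one = x"
    and one_norm [simp]: "one \<bullet> one = 1"
    and adj_left: "(x \<star> y) \<bullet> z = y \<bullet> (cnj x \<star> z)"
    and adj_right: "(x \<star> y) \<bullet> z = x \<bullet> (z \<star> cnj y)"
    and cnj_mul: "cnj x \<star> x = (x \<bullet> x) *\<^sub>R one"
    and cnj_imag: "p \<bullet> one = 0 \<Longrightarrow> cnj p = - p"
    and center: "p \<bullet> one = 0 \<Longrightarrow> (\<And>x. p \<star> x = x \<star> p) \<Longrightarrow> p = 0"
    and skew_split: "linear N \<Longrightarrow> (\<And>x. N x \<bullet> x = 0) \<Longrightarrow>
      N x = ((1 / real DIM('k)) *\<^sub>R (\<Sum>b\<in>Basis. N b \<star> cnj b)) \<star> x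
          + x \<star> ((1 / real DIM('k)) *\<^sub>R (\<Sum>b\<in>Basis. cnj b \<star> N b))"
begin

text \<open>The two multipliers of \<open>skew_split\<close> as explicit averages over the basis; in
  this form they visibly depend linearly on the skew map.\<close>

definition lpart :: "('k \<Rightarrow> 'k) \<Rightarrow> 'k" where
  "lpart N = (1 / real DIM('k)) *\<^sub>R (\<Sum>b\<in>Basis. N b \<star> cnj b)"

definition rpart :: "('k \<Rightarrow> 'k) \<Rightarrow> 'k" where
  "rpart N = (1 / real DIM('k)) *\<^sub>R (\<Sum>b\<in>Basis. cnj b \<star> N b)"

lemmas M_bil = M.add_left M.add_right M.diff_left M.diff_right M.minus_left M.minus_right
  M.scaleR_left M.scaleR_right M.zero_left M.zero_right

lemma cnj_cnj [simp]: "cnj (cnj x) = x"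
proof -
  have "cnj (cnj x) \<bullet> z = x \<bullet> z" for z
    using adj_left[of "cnj x" one z] adj_left[of x z one] adj_right[of x z one] adj_right[of one one]
    by (metis adj_left inner_commute one_right)
  then show ?thesis by (metis inner_commute euclidean_eqI)
qed

lemma Re_cnj: "(x \<star> y) \<bullet> one = cnj x \<bullet> y"
  using adj_left[of x y one] by (simp add: inner_commute)

lemma Re_comm: "(x \<star> y) \<bullet> one = (y \<star> x) \<bullet> one"
  by (metis Re_cnj adj_right inner_commute one_left)

lemma Re_cyc: "(x \<star> y \<star> z) \<bullet> one = (y \<star> z \<star> x) \<bullet> one"
  by (metis assoc Re_comm)

lemma mul_cancel: assumes "w \<star> y = 0" "w \<noteq> 0" shows "y = 0"
proof -
  have "(w \<bullet> w) *\<^sub>R y = (cnj w \<star> w) \<star> y" by (simp only: cnj_mul M.scaleR_left one_left)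
  also have "\<dots> = 0" unfolding assoc assms(1) by (rule M.zero_right)
  finally show ?thesis using assms(2) by simp
qed

text \<open>Taking \<open>x = one\<close> gives \<open>q = - p\<close>, and then \<open>p\<close> is
  central.\<close>

lemma two_sided_zero:
  assumes "p \<bullet> one = 0" "\<And>x. p \<star> x + x \<star> q = 0" shows "p = 0" "q = 0"
proof -
  have q: "q = - p" using assms(2)[of one] by (simp add: eq_neg_iff_add_eq_0 add.commute)
  have "p \<star> x = x \<star> p" for x using assms(2)[of x] unfolding q by (simp add: M_bil)
  then show "p = 0" using center assms(1) by blast
  then show "q = 0" using q by simp
qed

lemma lpart_imag: assumes "\<And>x. N x \<bullet> x = 0" shows "lpart N \<bullet> one = 0"
proof -
  have "(N b \<star> cnj b) \<bullet> one = 0" for b using adj_right[of "N b" "cnj b" one] assms by simp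
  then show ?thesis by (simp add: lpart_def inner_sum_left)
qed

lemma rpart_imag: assumes "\<And>x. N x \<bullet> x = 0" shows "rpart N \<bullet> one = 0"
proof -
  have "(cnj b \<star> N b) \<bullet> one = 0" for b using adj_left[of "cnj b" "N b" one] assms by simp
  then show ?thesis by (simp add: rpart_def inner_sum_left)
qed

lemma skew_lr: "linear N \<Longrightarrow> (\<And>x. N x \<bullet> x = 0) \<Longrightarrow> N x = lpart N \<star> x + x \<star> rpart N"
  unfolding lpart_def rpart_def by (rule skew_split)

lemma lpart_linear: "(\<And>x. linear (\<lambda>w. N w x)) \<Longrightarrow> linear (\<lambda>w. lpart (N w))"
  unfolding lpart_def
  by (intro linear_compose_scale_right linear_compose_sum ballI linearI)
    (simp_all add: linear_add[of "\<lambda>w. N w _"] linear_scale[of "\<lambda>w. N w _"] M_bil)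

lemma rpart_linear: "(\<And>x. linear (\<lambda>w. N w x)) \<Longrightarrow> linear (\<lambda>w. rpart (N w))"
  unfolding rpart_def
  by (intro linear_compose_scale_right linear_compose_sum ballI linearI)
    (simp_all add: linear_add[of "\<lambda>w. N w _"] linear_scale[of "\<lambda>w. N w _"] M_bil)

lemma imag_skew: "p \<bullet> one = 0 \<Longrightarrow> (p \<star> x) \<bullet> x = 0" "p \<bullet> one = 0 \<Longrightarrow> (x \<star> p) \<bullet> x = 0"
  using adj_left[of p x x] adj_right[of x p x] by (auto simp: cnj_imag M_bil inner_commute)

end

text \<open>Each \<open>\<iota> i\<close> places the coordinate algebra in one off-diagonal
  position. Prescribing the cyclic trilinear form by the real part of \<open>x y z\<close> is enough
  to recover all products; \<open>sqrt 3 / 2\<close> is the similarity factor found in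
  \<open>V_double\<close>.\<close>

locale herm3 = comp_alg mul one cnj + peirce P c
  for mul :: "'k::euclidean_space \<Rightarrow> 'k \<Rightarrow> 'k" (infixl "\<star>" 70) and one cnj
    and P :: "'e::euclidean_space \<Rightarrow> 'e \<Rightarrow> 'e" (infixl "\<diamondop>" 70) and c +
  fixes \<iota> :: "3 \<Rightarrow> 'k \<Rightarrow> 'e"
  assumes \<iota>_linear: "linear (\<iota> i)"
    and \<iota>_iso [simp]: "\<iota> i x \<bullet> \<iota> i y = x \<bullet> y"
    and \<iota>_V: "\<iota> i x \<in> V i"
    and triple: "(\<iota> i x \<diamondop> \<iota> (i + 1) y) \<bullet> \<iota> (i + 2) z = (sqrt 3 / 2) * ((x \<star> y \<star> z) \<bullet> one)"
    and complete: "(\<And>i. v \<bullet> c i = 0) \<Longrightarrow> (\<And>i x. v \<bullet> \<iota> i x = 0) \<Longrightarrow> v = 0"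
begin

lemmas peirce = V_c(1)[OF \<iota>_V] and peirce_comm = V_c(2)[OF \<iota>_V]
  and \<iota>_orth = V_orth[OF \<iota>_V \<iota>_V] and csum_mult_\<iota> = csum_mult[OF \<iota>_V]
  and \<iota>_c [simp] = V_inner_c[OF \<iota>_V] V_inner_c'[OF \<iota>_V]

lemma \<iota>_sq: "\<iota> i x \<diamondop> \<iota> i y = - (x \<bullet> y) *\<^sub>R c i"
  using V_sq[OF \<iota>_V \<iota>_V] by simp

lemma peirce_simps [simp]: "c i \<diamondop> \<iota> i x = - \<iota> i x" "c i \<diamondop> \<iota> (i + 1) x = (1/2) *\<^sub>R \<iota> (i + 1) x"
  "c i \<diamondop> \<iota> (i + 2) x = (1/2) *\<^sub>R \<iota> (i + 2) x"
  "c (i + 1) \<diamondop> \<iota> i x = (1/2) *\<^sub>R \<iota> i x" "c (i + 2) \<diamondop> \<iota> i x = (1/2) *\<^sub>R \<iota> i x"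
  by (simp_all add: peirce)

lemma \<iota>_orth' [simp]: "\<iota> i x \<bullet> \<iota> (i + 1) y = 0" "\<iota> i x \<bullet> \<iota> (i + 2) y = 0"
  "\<iota> (i + 1) x \<bullet> \<iota> i y = 0" "\<iota> (i + 2) x \<bullet> \<iota> i y = 0"
  "\<iota> (i + 1) x \<bullet> \<iota> (i + 2) y = 0" "\<iota> (i + 2) x \<bullet> \<iota> (i + 1) y = 0"
  by (simp_all add: \<iota>_orth)

lemma vec_eqI: assumes "\<And>i. v \<bullet> c i = w \<bullet> c i" "\<And>i x. v \<bullet> \<iota> i x = w \<bullet> \<iota> i x" shows "v = w"
  using complete[of "v - w"] assms by (simp add: inner_diff_left)

definition \<pi> :: "3 \<Rightarrow> 'e \<Rightarrow> 'k" where "\<pi> i = adjoint (\<iota> i)"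

lemma \<pi>_inner: "\<pi> i v \<bullet> x = v \<bullet> \<iota> i x"
  unfolding \<pi>_def using adjoint_works[OF \<iota>_linear] by (simp add: inner_commute)

lemma \<pi>_inner': "x \<bullet> \<pi> i v = v \<bullet> \<iota> i x" by (metis \<pi>_inner inner_commute)

lemma \<pi>_linear: "linear (\<pi> i)" unfolding \<pi>_def by (rule adjoint_linear[OF \<iota>_linear])

lemma \<pi>_eqI: "(\<And>x. v \<bullet> \<iota> i x = y \<bullet> x) \<Longrightarrow> \<pi> i v = y"
  by (rule euclidean_eqI) (simp add: \<pi>_inner)

lemma \<pi>_\<iota>: "\<pi> i (\<iota> j x) = (if i = j then x else 0)"
  by (rule \<pi>_eqI) (auto simp: \<iota>_orth)

lemma \<pi>_c [simp]: "\<pi> i (c j) = 0"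
  by (rule \<pi>_eqI) simp

lemma decomp: "v = csum v + (\<Sum>i\<in>UNIV. \<iota> i (\<pi> i v))"
proof (rule vec_eqI)
  fix i
  have "v \<bullet> c (i + 2) = - (v \<bullet> c i) - v \<bullet> c (i + 1)" by (simp add: c2 inner_diff_right)
  then show "v \<bullet> c i = (csum v + (\<Sum>i\<in>UNIV. \<iota> i (\<pi> i v))) \<bullet> c i"
    unfolding csum_def sum_3_from[of _ i] by (simp add: inner_add_left c_inner diff_divide_distrib)
next
  fix i x
  show "v \<bullet> \<iota> i x = (csum v + (\<Sum>i\<in>UNIV. \<iota> i (\<pi> i v))) \<bullet> \<iota> i x"
    by (simp add: csum_def sum_3_from[of _ i] inner_add_left \<pi>_inner)
qed

lemma linear_eqI:
  assumes "linear f" "linear g" "\<And>i. f (c i) = g (c i)" "\<And>i x. f (\<iota> i x) = g (\<iota> i x)"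
  shows "f = g"
proof
  fix v
  have "f (csum v + (\<Sum>i\<in>UNIV. \<iota> i (\<pi> i v))) = g (csum v + (\<Sum>i\<in>UNIV. \<iota> i (\<pi> i v)))"
    unfolding csum_def
    by (simp add: linear_add[OF assms(1)] linear_add[OF assms(2)] linear_scale[OF assms(1)]
        linear_scale[OF assms(2)] linear_sum[OF assms(1)] linear_sum[OF assms(2)] assms(3,4))
  then show "f v = g v" using decomp[of v] by simp
qed

text \<open>The pairing with the third space is the real part of \<open>x y z\<close>, which equals
  \<open>cnj (x \<star> y) \<bullet> z\<close>; hence the conjugate.\<close>

lemma \<iota>_cross: "\<iota> i x \<diamondop> \<iota> (i + 1) y = (sqrt 3 / 2) *\<^sub>R \<iota> (i + 2) (cnj (x \<star> y))"
proof (rule vec_eqI)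
  fix j
  show "(\<iota> i x \<diamondop> \<iota> (i + 1) y) \<bullet> c j = ((sqrt 3 / 2) *\<^sub>R \<iota> (i + 2) (cnj (x \<star> y))) \<bullet> c j"
    using \<iota>_orth[of i "i + 1" x y] by (auto simp: P_sym' peirce_comm)
next
  fix j w
  consider "j = i" | "j = i + 1" | "j = i + 2" using three_cases by blast
  then show "(\<iota> i x \<diamondop> \<iota> (i + 1) y) \<bullet> \<iota> j w = ((sqrt 3 / 2) *\<^sub>R \<iota> (i + 2) (cnj (x \<star> y))) \<bullet> \<iota> j w"
  proof cases
    case 1
    then show ?thesis by (simp add: P_sym \<iota>_sq)
  next
    case 2
    then show ?thesis by (simp add: P_sym' \<iota>_sq)
  next
    case 3
    then show ?thesis by (simp add: triple Re_cnj)
  qed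
qed


section \<open>Product formulas and explicit derivations\<close>

lemma sum_3_shift: "(\<Sum>j\<in>UNIV. f (j + 1)) = (\<Sum>j\<in>UNIV. f j)" for f :: "3 \<Rightarrow> 'b::comm_monoid_add"
  by (rule sum.reindex_bij_witness[of _ "\<lambda>j. j + 2" "\<lambda>j. j + 1"]) auto

lemma csum_c [simp]: "csum (c i) = c i"
  using decomp[of "c i"] linear_0[OF \<iota>_linear] by simp

lemma csum_\<iota> [simp]: "csum (\<iota> i x) = 0"
  by (simp add: csum_def)

lemma \<iota>_cross2: "\<iota> (i + 2) x \<diamondop> \<iota> i y = (sqrt 3 / 2) *\<^sub>R \<iota> (i + 1) (cnj (x \<star> y))"
  using \<iota>_cross[of "i + 2" x y] by simp

lemma mult_\<iota>: "x \<diamondop> \<iota> i z = - (x \<bullet> c i) *\<^sub>R \<iota> i z - (\<pi> i x \<bullet> z) *\<^sub>R c i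
   + (sqrt 3 / 2) *\<^sub>R \<iota> (i + 2) (cnj (z \<star> \<pi> (i + 1) x)) + (sqrt 3 / 2) *\<^sub>R \<iota> (i + 1) (cnj (\<pi> (i + 2) x \<star> z))"
proof -
  have "x \<diamondop> \<iota> i z = csum x \<diamondop> \<iota> i z + (\<Sum>j\<in>UNIV. \<iota> j (\<pi> j x) \<diamondop> \<iota> i z)"
    by (subst decomp[of x]) (simp add: P_bil P.sum_left)
  then show ?thesis
    unfolding sum_3_from[of _ i] csum_mult_\<iota> \<iota>_sq \<iota>_cross2 P_comm[of "\<iota> (i + 1) _"] \<iota>_cross by simp
qed

lemma \<pi>_square: "\<pi> i (x \<diamondop> x) = - (2 * (x \<bullet> c i)) *\<^sub>R \<pi> i x + sqrt 3 *\<^sub>R cnj (\<pi> (i + 1) x \<star> \<pi> (i + 2) x)"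
proof (rule \<pi>_eqI)
  fix z
  let ?X = "\<lambda>j. \<pi> j x"
  have 1: "cnj (z \<star> ?X (i + 1)) \<bullet> ?X (i + 2) = cnj (?X (i + 1) \<star> ?X (i + 2)) \<bullet> z"
    unfolding Re_cnj[symmetric] by (rule Re_cyc)
  have 2: "cnj (?X (i + 2) \<star> z) \<bullet> ?X (i + 1) = cnj (?X (i + 1) \<star> ?X (i + 2)) \<bullet> z"
    unfolding Re_cnj[symmetric] by (rule Re_cyc[symmetric])
  have "(x \<diamondop> x) \<bullet> \<iota> i z = x \<bullet> (x \<diamondop> \<iota> i z)" by (rule P_sym)
  also have "\<dots> = - (2 * (x \<bullet> c i)) * (?X i \<bullet> z) + sqrt 3 * (cnj (?X (i + 1) \<star> ?X (i + 2)) \<bullet> z)"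
    unfolding mult_\<iota> by (simp add: inner_add_right inner_diff_right 1 2 inner_commute[of z] flip: \<pi>_inner')
  finally show "(x \<diamondop> x) \<bullet> \<iota> i z = (- (2 * (x \<bullet> c i)) *\<^sub>R \<pi> i x + sqrt 3 *\<^sub>R cnj (\<pi> (i + 1) x \<star> \<pi> (i + 2) x)) \<bullet> z"
    by (simp add: inner_add_left inner_diff_left)
qed

text \<open>The infinitesimal rotation mixing two diagonal positions. On \<open>c (i + 1)\<close>
  the inner derivation has the factor \<open>1/4 - 1/2 - 2 = - 9/4\<close>, which the constant
  inverts.\<close>

definition rot :: "3 \<Rightarrow> 'k \<Rightarrow> 'e \<Rightarrow> 'e" where
  "rot i a x = (- 4 / 9) *\<^sub>R inner_der (c (i + 1)) (\<iota> i a) x"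

lemma rot_ders: "rot i a \<in> ders"
  unfolding rot_def[abs_def] by (rule ders_scale[OF inner_der_in_ders])

lemma rot_linear: "linear (\<lambda>a. rot i a x)"
  unfolding rot_def inner_der_def
  by (rule linearI) (simp_all add: linear_add[OF \<iota>_linear] linear_scale[OF \<iota>_linear] P_bil inner_add_left
      scaleR_add_left scaleR_add_right scaleR_diff_right mult.commute mult.left_commute)

lemma rot_c [simp]: "rot i a (c i) = 0" "rot i a (c (i + 1)) = \<iota> i a" "rot i a (c (i + 2)) = - \<iota> i a"
proof -
  have e: "(1/4) *\<^sub>R v + v + v = (9/4) *\<^sub>R v" "(1/2) *\<^sub>R v + (1/2) *\<^sub>R v = v" for v :: 'e
    by (simp_all add: vec_eq_iff euclidean_eq_iff[of "_ + _"] inner_add_left flip: scaleR_add_left)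
  show "rot i a (c i) = 0" "rot i a (c (i + 1)) = \<iota> i a" "rot i a (c (i + 2)) = - \<iota> i a"
    using c_prod[of i] c_prod[of "i + 1"] c_inner[of i] c_inner[of "i + 1"]
    by (simp_all add: rot_def inner_der_def peirce_comm P_bil e flip: scaleR_add_left scaleR_minus_left scaleR_diff_left)
qed

text \<open>The derivation induced by the diagonal matrix with imaginary entries \<open>p 0\<close>, \<open>p 1\<close>, \<open>p 2\<close>.\<close>

definition mact :: "(3 \<Rightarrow> 'k) \<Rightarrow> 'e \<Rightarrow> 'e" where
  "mact p x = (\<Sum>i\<in>UNIV. \<iota> i (p i \<star> \<pi> i x - \<pi> i x \<star> p (i + 1)))"

lemma mact_c [simp]: "mact p (c i) = 0"
  by (simp add: mact_def M_bil linear_0[OF \<iota>_linear])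

lemma mact_\<iota>: "mact p (\<iota> i x) = \<iota> i (p i \<star> x - x \<star> p (i + 1))"
  unfolding mact_def sum_3_from[of _ i] by (simp add: \<pi>_\<iota> M_bil linear_0[OF \<iota>_linear])

lemma mact_linear: "linear (mact p)"
  unfolding mact_def
  by (rule linearI) (simp_all add: linear_add[OF \<pi>_linear] linear_scale[OF \<pi>_linear] linear_add[OF \<iota>_linear, symmetric]
       linear_scale[OF \<iota>_linear, symmetric] M_bil sum.distrib[symmetric] scaleR_sum_right algebra_simps)

lemma mact_linear2: assumes "\<And>i. linear (\<lambda>w. p w i)" shows "linear (\<lambda>w. mact (p w) x)"
  unfolding mact_def
  by (rule linearI) (simp_all add: linear_add[OF assms] linear_scale[OF assms] linear_add[OF \<iota>_linear, symmetric]
       linear_scale[OF \<iota>_linear, symmetric] M_bil sum.distrib[symmetric] scaleR_sum_right algebra_simps)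

text \<open>Imaginary multipliers act skewly, which also disposes of the quadratic terms. On the
  triple product the three positions contribute \<open>?t i - ?t (i + 1)\<close>, and the cyclic sum
  telescopes.\<close>

lemma mact_ders: assumes "\<And>i. p i \<bullet> one = 0" shows "mact p \<in> ders"
proof -
  have 1: "mact p x \<bullet> y = (\<Sum>i\<in>UNIV. (p i \<star> \<pi> i x - \<pi> i x \<star> p (i + 1)) \<bullet> \<pi> i y)" for x y
    by (simp add: mact_def inner_sum_left \<pi>_inner' inner_commute[of y])
  have 0: "mact p x \<bullet> x = 0" for x
    by (simp add: 1 inner_diff_left imag_skew assms)
  have "mact p x \<bullet> (x \<diamondop> x) = 0" for x
  proof -
    let ?X = "\<lambda>i. \<pi> i x"
    let ?t = "\<lambda>i. (p i \<star> ?X i \<star> (?X (i + 1) \<star> ?X (i + 2))) \<bullet> one"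
    have "(p i \<star> ?X i - ?X i \<star> p (i + 1)) \<bullet> \<pi> i (x \<diamondop> x) = sqrt 3 * (?t i - ?t (i + 1))" for i
    proof -
      have a: "cnj y \<bullet> z = (z \<star> y) \<bullet> one" for y z by (metis Re_cnj Re_comm)
      have "(?X i \<star> p (i + 1) \<star> (?X (i + 1) \<star> ?X (i + 2))) \<bullet> one = ?t (i + 1)"
        using Re_comm[of "?X i" "p (i + 1) \<star> ?X (i + 1) \<star> ?X (i + 2)"] by (simp add: assoc)
      then show ?thesis unfolding \<pi>_square
        by (simp add: inner_add_right inner_diff_left imag_skew assms inner_commute[of _ "cnj _"] a M_bil algebra_simps)
    qed
    then show ?thesis using sum_3_shift[of ?t] by (simp add: 1 sum_subtractf flip: sum_distrib_left)
  qed
  with 0 mact_linear show ?thesis by (simp add: ders_def)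
qed

text \<open>The Leibniz rule makes \<open>D (c i)\<close> an eigenvector of multiplication by
  \<open>c i\<close> with eigenvalue 1/2. That eigenvalue occurs neither on the plane, where it is 1
  or -1, nor on \<open>V i\<close>.\<close>

lemma ders_c: assumes "D \<in> ders"
  shows "D (c i) \<bullet> c j = 0" "D (c i) \<bullet> \<iota> i x = 0"
proof -
  have e: "D (c i) = 2 *\<^sub>R (c i \<diamondop> D (c i))"
    using ders_product[OF assms, of "c i" "c i"] by (simp add: P_comm[of "D (c i)"] scaleR_2)
  have h: "D (c i) \<bullet> w = 2 * (D (c i) \<bullet> (c i \<diamondop> w))" for w
    by (subst e) (simp add: P_sym)
  have 0: "D (c i) \<bullet> c i = 0" using h[of "c i"] by simp
  have "D (c i) \<bullet> c (i + 2) = - (D (c i) \<bullet> c (i + 1))" using 0 by (simp add: c2 inner_diff_right)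
  with h[of "c (i + 1)"] 0 have "D (c i) \<bullet> c (i + 1) = 0" "D (c i) \<bullet> c (i + 2) = 0" by (simp_all add: c_prod)
  then show "D (c i) \<bullet> c j = 0" using 0 three_cases[of j i] by auto
  show "D (c i) \<bullet> \<iota> i x = 0" using h[of "\<iota> i x"] by simp
qed


section \<open>Existence: reducing a tangent map to zero\<close>

lemma tangent_bil: assumes "tangent A"
  shows "A (x + y) z = A x z + A y z" "A x (y + z) = A x y + A x z" "A (r *\<^sub>R x) y = r *\<^sub>R A x y"
    "A x (r *\<^sub>R y) = r *\<^sub>R A x y" "A (- x) y = - A x y" "A x (- y) = - A x y" "A (x - y) z = A x z - A y z"
    "A x (y - z) = A x y - A x z" "A 0 y = 0" "A x 0 = 0"
  using assms unfolding tangent_def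
  by (auto simp: bilinear_ladd bilinear_radd bilinear_lmul bilinear_rmul bilinear_lneg bilinear_rneg
      bilinear_lsub bilinear_rsub bilinear_lzero bilinear_rzero)

lemma tangent_commute: "tangent A \<Longrightarrow> A x y = A y x" by (simp add: tangent_def)

lemma tangent_linear: assumes "tangent A" shows "linear (\<lambda>x. A x y)" "linear (\<lambda>y. A x y)"
  by (auto intro!: linearI simp: tangent_bil[OF assms])

text \<open>The same eigenvalue argument as in \<open>ders_c\<close>: the linearised cubic and
  quartic conditions combine to the eigenvalue 1/2 for \<open>A (c i) (c i)\<close>.\<close>

lemma tangent_c: assumes "tangent A"
  shows "A (c i) (c i) \<bullet> c j = 0" "A (c i) (c i) \<bullet> \<iota> i z = 0"
proof -
  have h: "A (c i) (c i) \<bullet> w = 2 * (A (c i) (c i) \<bullet> (c i \<diamondop> w))" for w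
    using tangent_Q1[OF assms, of "c i" w] tangent_C[OF assms, of "c i" "c i" w]
      tangent_commute[OF assms, of w "c i"] by simp
  have 0: "A (c i) (c i) \<bullet> c i = 0" using h[of "c i"] by simp
  have "A (c i) (c i) \<bullet> c (i + 2) = - (A (c i) (c i) \<bullet> c (i + 1))" using 0 by (simp add: c2 inner_diff_right)
  with h[of "c (i + 1)"] 0 have "A (c i) (c i) \<bullet> c (i + 1) = 0" "A (c i) (c i) \<bullet> c (i + 2) = 0" by (simp_all add: c_prod)
  then show "A (c i) (c i) \<bullet> c j = 0" using 0 three_cases[of j i] by auto
  show "A (c i) (c i) \<bullet> \<iota> i z = 0" using h[of "\<iota> i z"] by simp
qed

lemma tangent_reduce_idempotents: assumes "tangent A"
  obtains G where "ders_valued G" "\<And>i j. A (c i) (c j) - sympart G (c i) (c j) = 0"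
proof -
  \<comment> \<open>On \<open>c i\<close>, \<open>c (i + 1)\<close>, \<open>c (i + 2)\<close> the
    functionals \<beta> and \<gamma> take the values -1, 1, 0 and -1, 0, 1. Thus \<open>g i\<close>
    has the wanted values at \<open>c (i + 1)\<close> and \<open>c (i + 2)\<close>; its value at
    \<open>c i\<close> is harmless because \<open>rot i\<close> annihilates
    \<open>c i\<close>.\<close>
  define \<beta> where "\<beta> i x = (2/3) * (x \<bullet> c (i + 1) - x \<bullet> c i)" for i x
  define \<gamma> where "\<gamma> i x = (2/3) * (x \<bullet> c (i + 2) - x \<bullet> c i)" for i x
  define g where "g i x = \<beta> i x *\<^sub>R \<pi> i (A (c (i + 1)) (c (i + 1))) - \<gamma> i x *\<^sub>R \<pi> i (A (c (i + 2)) (c (i + 2)))" for i x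
  define G where "G x y = (\<Sum>i\<in>UNIV. rot i (g i x) y)" for x y
  have gl: "linear (g i)" for i
    unfolding g_def \<beta>_def \<gamma>_def by (rule linearI) (simp_all add: inner_add_left algebra_simps)
  have dG: "ders_valued G"
  proof (rule ders_valuedI)
    show "linear (\<lambda>x. G x y)" for y
      unfolding G_def using linear_compose[OF gl rot_linear, unfolded o_def] by (intro linear_compose_sum ballI)
    show "G x \<in> ders" for x unfolding G_def[abs_def] by (intro ders_sum rot_ders)
  qed
  let ?A = "\<lambda>x y. A x y - sympart G x y"
  have t: "tangent ?A" by (rule tangent_diff[OF assms dG])
  have d: "?A (c i) (c i) = 0" for i
  proof -
    have "sympart G (c i) (c i) = G (c i) (c i)" by (simp add: sympart_def flip: scaleR_2)
    also have "\<dots> = rot (i + 1) (g (i + 1) (c i)) (c i) + rot (i + 2) (g (i + 2) (c i)) (c i)"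
      unfolding G_def sum_3_from[of _ i] by simp
    also have "\<dots> = - \<iota> (i + 1) (g (i + 1) (c i)) + \<iota> (i + 2) (g (i + 2) (c i))"
      using rot_c(3)[of "i + 1"] rot_c(2)[of "i + 2"] by simp
    also have "\<dots> = \<iota> (i + 1) (\<pi> (i + 1) (A (c i) (c i))) + \<iota> (i + 2) (\<pi> (i + 2) (A (c i) (c i)))"
      by (simp add: g_def \<beta>_def \<gamma>_def c_inner linear_neg[OF \<iota>_linear])
    also have "\<dots> = A (c i) (c i)"
    proof -
      have "csum (A (c i) (c i)) = 0" by (simp add: csum_def tangent_c[OF assms])
      moreover have "\<pi> i (A (c i) (c i)) = 0" by (rule \<pi>_eqI) (simp add: tangent_c[OF assms])
      ultimately show ?thesis using decomp[of "A (c i) (c i)"] unfolding sum_3_from[of _ i] by (simp add: linear_0[OF \<iota>_linear])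
    qed
    finally show ?thesis by simp
  qed
  have "?A (c i) (c j) = 0" for i j
  proof -
    \<comment> \<open>Two idempotents span the plane, so the vanishing of the square at the third
      one kills the mixed value.\<close>
    have "?A (c i) (c (i + 1)) = 0" for i
    proof -
      have "?A (- c i - c (i + 1)) (- c i - c (i + 1)) = 0" using d[of "i + 2"] unfolding c2 .
      then have "?A (c i) (c i) + ?A (c (i + 1)) (c (i + 1)) + (?A (c i) (c (i + 1)) + ?A (c (i + 1)) (c i)) = 0"
        using tangent_bil[OF t] by (simp add: algebra_simps)
      then show ?thesis unfolding d tangent_commute[OF t, of "c (i + 1)" "c i"] by (simp flip: scaleR_2)
    qed
    note 1 = this
    have "?A (c i) (c (i + 2)) = 0" using 1[of "i + 2"] tangent_commute[OF t, of "c (i + 2)" "c i"] by simp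
    then show ?thesis using three_cases[of j i] 1 d by blast
  qed
  then show ?thesis using that dG by blast
qed

text \<open>Of the component of \<open>A (c j)\<close> in \<open>V j\<close> only a skew map of
  \<open>V j\<close> itself survives. Rotations cannot remove that map; imaginary diagonal matrices
  will.\<close>

lemma tangent_cw: assumes t: "tangent A" and z: "\<And>i j. A (c i) (c j) = 0"
  shows "A (c i) (\<iota> j x) \<bullet> c l = 0" and "\<pi> j (A (c j) (\<iota> i x)) \<bullet> y = (if i = j then - (\<pi> j (A (c j) (\<iota> i y)) \<bullet> x) else 0)"
proof -
  have z': "A (c i) (c i) = 0" for i using z .
  have cz: "A (c i) w \<bullet> c i = 0" for w i
    using tangent_C[OF t, of "c i" "c i" w] tangent_commute[OF t, of w "c i"] by (simp add: z')
  have ca: "A (c i) w \<bullet> c j = - (A (c j) w \<bullet> c i)" for w i j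
    using tangent_C[OF t, of "c i" "c j" w] tangent_commute[OF t, of w "c i"] by (simp add: z)
  have c1: "A (c i) w \<bullet> c (i + 1) = 0" for w i
  proof -
    have "2 * (A (c i) w \<bullet> c (i + 2)) + A (c (i + 1)) w \<bullet> c i = 0"
      using tangent_Q[OF t, of "c i" w "c i" "c (i + 1)"] tangent_commute[OF t, of w] by (simp add: z c_prod)
    moreover have "A (c i) w \<bullet> c (i + 2) = - (A (c i) w \<bullet> c (i + 1))" using cz[of i w] by (simp add: c2 inner_diff_right)
    ultimately show ?thesis using ca[of i w "i + 1"] by simp
  qed
  show "A (c i) (\<iota> j x) \<bullet> c l = 0"
    using three_cases[of l i] cz[of i] c1[of i] c1[of "i + 2" "\<iota> j x"] ca[of i "\<iota> j x" "i + 2"] by auto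
  have s: "A (\<iota> i x) (\<iota> j y) \<bullet> c l = - (A (c l) (\<iota> i x) \<bullet> \<iota> j y) - A (c l) (\<iota> j y) \<bullet> \<iota> i x" for i j x y l
    using tangent_C[OF t, of "c l" "\<iota> i x" "\<iota> j y"] tangent_commute[OF t, of "\<iota> j y" "c l"] by simp
  have q: "2 * (A (c j) (\<iota> i x) \<bullet> (c j \<diamondop> \<iota> j y)) + 2 * (A (c j) (\<iota> j y) \<bullet> (c j \<diamondop> \<iota> i x))
     = A (c j) (\<iota> i x) \<bullet> \<iota> j y + A (c j) (\<iota> j y) \<bullet> \<iota> i x" for i j x y
    using tangent_Q[OF t, of "c j" "c j" "\<iota> i x" "\<iota> j y"] by (simp add: z s del: peirce_simps)
  show "\<pi> j (A (c j) (\<iota> i x)) \<bullet> y = (if i = j then - (\<pi> j (A (c j) (\<iota> i y)) \<bullet> x) else 0)"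
    using q[of j i x y] by (auto simp: \<pi>_inner peirce simp del: peirce_simps)
qed

lemma ders_valued_mact:
  assumes "\<And>i. linear (p i)" "\<And>i x. p i x \<bullet> one = 0"
  shows "ders_valued (\<lambda>x. mact (\<lambda>i. p i x))"
  by (rule ders_valuedI) (auto intro!: mact_linear2 mact_ders assms)

text \<open>Imaginary diagonal matrices annihilate the idempotents, so subtracting them leaves the
  previous normalisation intact.\<close>

lemma tangent_diagonal_zero: assumes t: "tangent A" and z: "\<And>i j. A (c i) (c j) = 0"
  obtains G where "ders_valued G" "\<And>i j. A (c i) (c j) - sympart G (c i) (c j) = 0"
    "\<And>i x. \<pi> i (A (c i) (\<iota> i x) - sympart G (c i) (\<iota> i x)) = 0"
proof -
  \<comment> \<open>The values of \<beta> and \<gamma> on \<open>c i\<close>,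
    \<open>c (i + 1)\<close>, \<open>c (i + 2)\<close> are 1, -1, 0 and 0, -1, 1. They are chosen so
    that in the direction \<open>c i\<close> the entries \<open>i\<close> and \<open>i + 1\<close>
    are the left and right multipliers of \<open>N i\<close>. The factor 2 makes up for the half in
    \<open>sympart\<close>, only one order of the arguments contributing.\<close>
  define \<beta> where "\<beta> i x = (2/3) * (x \<bullet> c i - x \<bullet> c (i + 1))" for i x
  define \<gamma> where "\<gamma> i x = (2/3) * (x \<bullet> c (i + 2) - x \<bullet> c (i + 1))" for i x
  define N where "N i x = \<pi> i (A (c i) (\<iota> i x))" for i x
  define p where "p i x = (2 * \<beta> i x) *\<^sub>R lpart (N i) - (2 * \<gamma> i x) *\<^sub>R rpart (N (i + 2))" for i x
  let ?G = "\<lambda>x. mact (\<lambda>i. p i x)"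
  have N: "linear (N i)" "N i x \<bullet> x = 0" for i x
  proof -
    show "linear (N i)" unfolding N_def
      using linear_compose[OF \<iota>_linear linear_compose[OF tangent_linear(2)[OF t] \<pi>_linear]] by (simp add: o_def)
    show "N i x \<bullet> x = 0" using tangent_cw(2)[OF t z, of i i x x] by (simp add: N_def)
  qed
  have pl: "linear (p i)" for i
    unfolding p_def \<beta>_def \<gamma>_def by (rule linearI) (simp_all add: inner_add_left algebra_simps)
  have dG: "ders_valued ?G"
  proof (rule ders_valued_mact[OF pl])
    show "p i x \<bullet> one = 0" for i x
      using lpart_imag[OF N(2)] rpart_imag[OF N(2)] by (simp add: p_def inner_diff_left)
  qed
  have 1: "sympart ?G (c i) (c j) = 0" for i j by (simp add: sympart_def)
  have p\<iota>: "p j (\<iota> i x) = 0" for i j x by (simp add: p_def \<beta>_def \<gamma>_def)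
  have m0: "mact (\<lambda>i. 0) x = 0" for x by (simp add: mact_def M_bil linear_0[OF \<iota>_linear])
  have "\<pi> i (A (c i) (\<iota> i x) - sympart ?G (c i) (\<iota> i x)) = 0" for i x
  proof -
    have pi: "p i (c i) = 2 *\<^sub>R lpart (N i)" "p (i + 1) (c i) = - 2 *\<^sub>R rpart (N i)"
      by (simp_all add: p_def \<beta>_def \<gamma>_def c_inner)
    have "mact (\<lambda>j. p j (c i)) (\<iota> i x) = \<iota> i (2 *\<^sub>R (lpart (N i) \<star> x + x \<star> rpart (N i)))"
      by (simp add: mact_\<iota> pi M_bil scaleR_add_right)
    then have "sympart ?G (c i) (\<iota> i x) = \<iota> i (lpart (N i) \<star> x + x \<star> rpart (N i))"
      unfolding sympart_def p\<iota> m0 by (simp add: linear_scale[OF \<iota>_linear])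
    also have "\<dots> = \<iota> i (N i x)" by (simp only: skew_lr[OF N, symmetric])
    finally show ?thesis unfolding N_def by (simp add: linear_diff[OF \<pi>_linear] \<pi>_\<iota>)
  qed
  with 1 z dG show ?thesis using that[of ?G] by simp
qed

lemma tangent_reduce_mixed: assumes t: "tangent A" and z: "\<And>i j. A (c i) (c j) = 0"
    and n: "\<And>i x. \<pi> i (A (c i) (\<iota> i x)) = 0"
  obtains G where "ders_valued G" "\<And>i x. A (c i) x - sympart G (c i) x = 0"
proof -
  \<comment> \<open>By hypothesis \<open>A (c i)\<close> has no component in \<open>V i\<close>, and
    the idempotents sum to zero, so the components of \<open>A (c (i + 1))\<close> and
    \<open>A (c (i + 2))\<close> in \<open>V i\<close> are opposite. This is the sign pattern of
    \<open>rot i\<close>; the 2 compensates for \<open>sympart\<close>.\<close>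
  define g where "g i x = 2 *\<^sub>R \<pi> i (A (c (i + 1)) (x - csum x))" for i x
  define G where "G x y = (\<Sum>i\<in>UNIV. rot i (g i x) y)" for x y
  have gl: "linear (g i)" for i
  proof -
    have "linear (\<lambda>x. \<pi> i (A (c (i + 1)) (x - csum x)))"
      using linear_compose[OF linear_compose_sub[OF linear_ident csum_linear] linear_compose[OF tangent_linear(2)[OF t] \<pi>_linear]]
      by (simp add: o_def)
    then show ?thesis unfolding g_def by (rule linear_compose_scale_right)
  qed
  have dG: "ders_valued G"
  proof (rule ders_valuedI)
    show "linear (\<lambda>x. G x y)" for y
      unfolding G_def using linear_compose[OF gl rot_linear, unfolded o_def] by (intro linear_compose_sum ballI)
    show "G x \<in> ders" for x unfolding G_def[abs_def] by (intro ders_sum rot_ders)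
  qed
  have gc: "g i (c j) = 0" for i j by (simp add: g_def tangent_bil[OF t] linear_0[OF \<pi>_linear])
  have r0: "rot i 0 x = 0" for i x using linear_0[OF rot_linear] .
  have G0: "G (c i) y = 0" for i y by (simp add: G_def gc r0)
  have n': "\<pi> i (A (c i) (\<iota> j x)) = 0" for i j x
  proof (cases "i = j")
    case False
    then show ?thesis using tangent_cw(2)[OF t z, of i j x] by (intro \<pi>_eqI) (simp flip: \<pi>_inner)
  qed (use n in simp)
  have w: "A (c i) (\<iota> l x) - sympart G (c i) (\<iota> l x) = 0" for i l x
  proof -
    let ?w = "\<iota> l x"
    have g\<iota>: "g j ?w = 2 *\<^sub>R \<pi> j (A (c (j + 1)) ?w)" for j by (simp add: g_def)
    have p2: "\<pi> (i + 1) (A (c (i + 2)) ?w) = - \<pi> (i + 1) (A (c i) ?w)"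
      using n'[of "i + 1" l x] by (simp add: c2 tangent_bil[OF t] linear_diff[OF \<pi>_linear] linear_neg[OF \<pi>_linear])
    have "sympart G (c i) ?w = (1/2) *\<^sub>R G ?w (c i)" by (simp add: sympart_def G0)
    also have "\<dots> = (1/2) *\<^sub>R (rot (i + 1) (g (i + 1) ?w) (c i) + rot (i + 2) (g (i + 2) ?w) (c i))"
      unfolding G_def sum_3_from[of _ i] by simp
    also have "\<dots> = \<iota> (i + 1) (\<pi> (i + 1) (A (c i) ?w)) + \<iota> (i + 2) (\<pi> (i + 2) (A (c i) ?w))"
      using rot_c(3)[of "i + 1"] rot_c(2)[of "i + 2"]
      by (simp add: g\<iota> p2 linear_scale[OF \<iota>_linear] linear_neg[OF \<iota>_linear] scaleR_add_right)
    also have "\<dots> = A (c i) ?w"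
    proof -
      have "csum (A (c i) ?w) = 0" by (simp add: csum_def tangent_cw(1)[OF t z])
      then show ?thesis using decomp[of "A (c i) ?w"] unfolding sum_3_from[of _ i] by (simp add: n' linear_0[OF \<iota>_linear])
    qed
    finally show ?thesis by simp
  qed
  have "(\<lambda>x. A (c i) x - sympart G (c i) x) = (\<lambda>x. 0)" for i
  proof (rule linear_eqI)
    show "linear (\<lambda>x. A (c i) x - sympart G (c i) x)" by (rule tangent_linear(2)[OF tangent_diff[OF t dG]])
    show "A (c i) (c j) - sympart G (c i) (c j) = 0" for j by (simp add: sympart_def G0 z)
  qed (auto simp: linear_zero w)
  then show ?thesis using that dG by meson
qed

text \<open>Inserting one idempotent into the quartic identity weights the cyclic terms by
  eigenvalues -1 and 1/2, and comparison with the cubic identity leaves few components: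
  \<open>A\<close> maps a pair from one space into that space, and a pair from two spaces into their
  sum, skewly in each.\<close>

lemma tangent_ww: assumes t: "tangent A" and z: "\<And>i x. A (c i) x = 0"
  shows "A u v \<bullet> c l = 0"
    and "j \<noteq> i \<Longrightarrow> A (\<iota> i x) (\<iota> i y) \<bullet> \<iota> j w = 0"
    and "A (\<iota> i x) (\<iota> (i + 1) y) \<bullet> \<iota> (i + 2) w = 0"
    and "i \<noteq> j \<Longrightarrow> A (\<iota> i x) (\<iota> j y) \<bullet> \<iota> j y = 0"
proof -
  have z': "A x (c i) = 0" for i x using z tangent_commute[OF t] by metis
  show a: "A u v \<bullet> c l = 0" for u v l using tangent_C[OF t, of u v "c l"] by (simp add: z z')
  have q: "A (\<iota> i x) (\<iota> j y) \<bullet> (c m \<diamondop> \<iota> l w) + A (\<iota> j y) (\<iota> l w) \<bullet> (c m \<diamondop> \<iota> i x)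
      + A (\<iota> l w) (\<iota> i x) \<bullet> (c m \<diamondop> \<iota> j y) = 0" for i j l m x y w
    using tangent_Q[OF t, of "c m" "\<iota> i x" "\<iota> j y" "\<iota> l w"] tangent_commute[OF t, of "\<iota> i x" "\<iota> l w"]
    by (simp add: z del: peirce_simps)
  have C: "A (\<iota> i x) (\<iota> j y) \<bullet> \<iota> l w + A (\<iota> j y) (\<iota> l w) \<bullet> \<iota> i x
      + A (\<iota> l w) (\<iota> i x) \<bullet> \<iota> j y = 0" for i j l x y w
    using tangent_C[OF t] .
  show o: "A (\<iota> i x) (\<iota> i y) \<bullet> \<iota> j w = 0" if "j \<noteq> i" for i j x y w
    using q[of i x i y j j w] C[of i x i y j w] that by (simp add: peirce del: peirce_simps)
  show "A (\<iota> i x) (\<iota> (i + 1) y) \<bullet> \<iota> (i + 2) w = 0"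
    using q[of i x "i + 1" y "i + 2" "i + 2" w] C[of i x "i + 1" y "i + 2" w] by (simp add: peirce del: peirce_simps)
  show "A (\<iota> i x) (\<iota> j y) \<bullet> \<iota> j y = 0" if "i \<noteq> j"
    using C[of j y j y i x] o[of i j y y x] tangent_commute[OF t, of "\<iota> i x" "\<iota> j y"] that by simp
qed

lemma tangent_linear_coord: assumes t: "tangent A" shows "linear (\<lambda>y. \<pi> j (A (\<iota> i x) (\<iota> l y)))" "linear (\<lambda>x. \<pi> j (A (\<iota> i x) (\<iota> l y)))"
  by (auto intro!: linearI simp: linear_add[OF \<iota>_linear] linear_scale[OF \<iota>_linear] linear_add[OF \<pi>_linear]
      linear_scale[OF \<pi>_linear] tangent_bil[OF t])

text \<open>The only step that uses that left and right multiplications exhaust the skew maps of the coordinate algebra.\<close>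

lemma tangent_reduce_offdiagonal: assumes t: "tangent A" and z: "\<And>i x. A (c i) x = 0"
  obtains G where "ders_valued G" "\<And>x y. A x y = sympart G x y"
proof -
  \<comment> \<open>The action of \<open>\<iota> i x\<close> on the other two spaces, doubled
    because \<open>sympart\<close> will halve it.\<close>
  define N2 where "N2 i x y = 2 *\<^sub>R \<pi> (i + 1) (A (\<iota> i x) (\<iota> (i + 1) y))" for i x y
  define N3 where "N3 i x y = 2 *\<^sub>R \<pi> (i + 2) (A (\<iota> i x) (\<iota> (i + 2) y))" for i x y
  have l: "linear (N2 i x)" "linear (N3 i x)" "linear (\<lambda>x. N2 i x y)" "linear (\<lambda>x. N3 i x y)" for i x y
    unfolding N2_def N3_def by (intro linear_compose_scale_right tangent_linear_coord[OF t])+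
  have s: "N2 i x y \<bullet> y = 0" "N3 i x y \<bullet> y = 0" for i x y
    using tangent_ww(4)[OF t z, of i "i + 1" x y] tangent_ww(4)[OF t z, of i "i + 2" x y]
    by (simp_all add: N2_def N3_def \<pi>_inner)
  \<comment> \<open>Entries \<open>i + 1\<close> and \<open>i + 2\<close> are read off from
    \<open>N2\<close>, and entry \<open>i\<close> from \<open>N3\<close>. Reproducing
    \<open>N3\<close> in full also requires entry \<open>i + 2\<close> to be
    \<open>lpart (N3 i x)\<close>, a second prescription that \<open>key\<close> shows to be
    consistent.\<close>
  define P where "P i x j = (if j = i then - rpart (N3 i x) else if j = i + 1 then lpart (N2 i x) else - rpart (N2 i x))" for i x j
  have Pi [simp]: "P i x i = - rpart (N3 i x)" "P i x (i + 1) = lpart (N2 i x)" "P i x (i + 2) = - rpart (N2 i x)" for i x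
    by (simp_all add: P_def)
  have P_lin: "linear (\<lambda>x. P i x j)" for i j
    using lpart_linear[of "N2 i"] rpart_linear[of "N2 i"] rpart_linear[of "N3 i"] l(3,4)[of i]
    by (cases "j = i"; cases "j = i + 1") (simp_all add: P_def linear_compose_neg)
  have P_imag: "P i x j \<bullet> one = 0" for i x j
    using lpart_imag[OF s(1)[of i x]] rpart_imag[OF s(1)[of i x]] rpart_imag[OF s(2)[of i x]] by (simp add: P_def)
  have A1: "A (\<iota> i x) (\<iota> (i + 1) y) = (1/2) *\<^sub>R (\<iota> (i + 1) (N2 i x y) + \<iota> i (N3 (i + 1) y x))" for i x y
  proof -
    have "csum (A (\<iota> i x) (\<iota> (i + 1) y)) = 0" using tangent_ww(1)[OF t z] by (simp add: csum_def)
    moreover have "\<pi> (i + 2) (A (\<iota> i x) (\<iota> (i + 1) y)) = 0"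
      by (rule \<pi>_eqI) (simp add: tangent_ww(3)[OF t z])
    ultimately show ?thesis
      using decomp[of "A (\<iota> i x) (\<iota> (i + 1) y)"] tangent_commute[OF t, of "\<iota> i x" "\<iota> (i + 1) y"]
      unfolding sum_3_from[of _ i] N2_def N3_def
      by (simp add: linear_0[OF \<iota>_linear] linear_scale[OF \<iota>_linear] scaleR_add_right add.commute[of "\<iota> i _"])
  qed
  have main: "N3 i x y = lpart (N3 i x) \<star> y + y \<star> rpart (N3 i x)" "N2 i x y = lpart (N2 i x) \<star> y + y \<star> rpart (N2 i x)" for i x y
    using skew_lr[OF l(2) s(2)] skew_lr[OF l(1) s(1)] by blast+
  \<comment> \<open>The quartic identity at \<open>x, x, y, v\<close> becomes \<open>q\<close>,
    valid for all \<open>y\<close>. At \<open>y = one\<close> it determines the component in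
    \<open>V i\<close>; the rest says that \<open>s\<close>, the discrepancy of the two
    prescriptions, commutes with every \<open>y\<close>. Being imaginary, it vanishes.\<close>
  have key: "lpart (N3 i x) = - rpart (N2 i x) \<and> \<pi> i (A (\<iota> i x) (\<iota> i x)) = - rpart (N3 i x) \<star> x - x \<star> lpart (N2 i x)" for i x
  proof -
    let ?a = "\<pi> i (A (\<iota> i x) (\<iota> i x))"
    let ?l2 = "lpart (N2 i x)" and ?r2 = "rpart (N2 i x)" and ?l3 = "lpart (N3 i x)" and ?r3 = "rpart (N3 i x)"
    have q: "(?a \<star> y + x \<star> (N2 i x y) + x \<star> y \<star> ?l3 + ?r3 \<star> (x \<star> y)) = 0" for y
    proof -
      have tr: "w \<bullet> (\<iota> (i + 1) y \<diamondop> \<iota> (i + 2) v) = (sqrt 3 / 2) * ((\<pi> i w \<star> y \<star> v) \<bullet> one)" for w y v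
        using \<iota>_cross[of "i + 1" y v] by (simp add: \<pi>_inner'[symmetric] assoc Re_cnj[of "\<pi> i w"] inner_commute[of "\<pi> i w"])
          (metis Re_cnj Re_comm)
      have tr2: "w \<bullet> (\<iota> i x \<diamondop> \<iota> (i + 2) v) = (sqrt 3 / 2) * ((x \<star> \<pi> (i + 1) w \<star> v) \<bullet> one)" for w v
        using \<iota>_cross2[of i v x] by (simp add: P_comm[of "\<iota> i x"] \<pi>_inner'[symmetric])
          (metis Re_cnj Re_cyc)
      have tr3: "w \<bullet> (\<iota> i x \<diamondop> \<iota> (i + 1) y) = (sqrt 3 / 2) * ((x \<star> y \<star> \<pi> (i + 2) w) \<bullet> one)" for w
        using \<iota>_cross[of i x y] by (simp add: \<pi>_inner'[symmetric] Re_cnj)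
      have "((?a \<star> y + x \<star> (N2 i x y) + x \<star> y \<star> ?l3 + ?r3 \<star> (x \<star> y)) \<star> v) \<bullet> one = 0" for v
      proof -
        let ?y = "\<iota> (i + 1) y" and ?v = "\<iota> (i + 2) v" and ?x = "\<iota> i x"
        have "A ?x ?x \<bullet> (?y \<diamondop> ?v) + 2 * (A ?x ?y \<bullet> (?x \<diamondop> ?v)) + 2 * (A ?x ?v \<bullet> (?x \<diamondop> ?y)) = 0"
          using tangent_Q[OF t, of ?x ?x ?y ?v] tangent_ww(1)[OF t z, of ?y ?v i] by (simp add: \<iota>_sq)
        then have "(sqrt 3 / 2) * ((?a \<star> y \<star> v) \<bullet> one + (x \<star> N2 i x y \<star> v) \<bullet> one + (x \<star> y \<star> N3 i x v) \<bullet> one) = 0"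
          unfolding tr tr2 tr3 by (simp add: N2_def N3_def M_bil algebra_simps)
        then have "(?a \<star> y \<star> v) \<bullet> one + (x \<star> N2 i x y \<star> v) \<bullet> one + (x \<star> y \<star> N3 i x v) \<bullet> one = 0"
          by simp
        moreover have "(x \<star> y \<star> (v \<star> ?r3)) \<bullet> one = (?r3 \<star> (x \<star> y) \<star> v) \<bullet> one"
          by (metis Re_comm assoc)
        ultimately show ?thesis unfolding main(1)[of i x v] by (simp add: M_bil assoc inner_add_left)
      qed
      from this[of "cnj (?a \<star> y + x \<star> (N2 i x y) + x \<star> y \<star> ?l3 + ?r3 \<star> (x \<star> y))"]
      show ?thesis by (simp add: Re_comm[of _ "cnj _"] cnj_mul)
    qed
    define s where "s = ?r2 + ?l3"
    have "?a + x \<star> ?l2 + x \<star> s + ?r3 \<star> x = 0"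
      using q[of one] unfolding main(2)[of i x one] s_def by (simp add: M_bil algebra_simps)
    then have a: "?a = - (x \<star> ?l2) - x \<star> s - ?r3 \<star> x"
      by (simp only: eq_diff_eq eq_neg_iff_add_eq_0 ac_simps)
    have xs: "x \<star> (y \<star> s - s \<star> y) = 0" for y
      using q[of y] unfolding main(2)[of i x y] a s_def by (simp add: M_bil assoc algebra_simps)
    have im: "s \<bullet> one = 0" using lpart_imag[OF s(2)[of i x]] rpart_imag[OF s(1)[of i x]] by (simp add: s_def inner_add_left)
    have "s = 0"
    proof (cases "x = 0")
      case True
      have "N2 i x = (\<lambda>y. 0)" "N3 i x = (\<lambda>y. 0)" using linear_0[OF l(3)] linear_0[OF l(4)] True by auto
      then show ?thesis by (simp add: s_def lpart_def rpart_def M_bil)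
    next
      case False
      then have "y \<star> s = s \<star> y" for y using mul_cancel[OF xs] by simp
      then show ?thesis using center[OF im] by metis
    qed
    then show ?thesis using a by (simp add: s_def eq_neg_iff_add_eq_0 add.commute M_bil)
  qed
  define G where "G x y = (\<Sum>i\<in>UNIV. mact (P i (\<pi> i x)) y)" for x y
  have dG: "ders_valued G"
  proof (rule ders_valuedI)
    show "linear (\<lambda>x. G x y)" for y unfolding G_def
      using linear_compose[OF \<pi>_linear P_lin] by (intro linear_compose_sum ballI mact_linear2) (simp add: o_def)
    show "G x \<in> ders" for x unfolding G_def[abs_def] by (intro ders_sum mact_ders P_imag)
  qed
  have P0: "P i 0 = (\<lambda>j. 0)" for i using linear_0[OF P_lin] by auto
  have m0: "mact (\<lambda>i. 0) x = 0" for x by (simp add: mact_def M_bil linear_0[OF \<iota>_linear])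
  have Gc: "G (c i) y = 0" "G y (c i) = 0" for i y by (simp_all add: G_def P0 m0)
  have G\<iota>: "G (\<iota> i x) y = mact (P i x) y" for i x y
    unfolding G_def sum_3_from[of _ i] by (simp add: \<pi>_\<iota> P0 m0)
  let ?A = "\<lambda>x y. A x y - sympart G x y"
  have t': "tangent ?A" by (rule tangent_diff[OF t dG])
  have z': "?A (c i) x = 0" for i x by (simp add: z sympart_def Gc)
  have d: "?A (\<iota> i x) (\<iota> i x) = 0" for i x
  proof -
    have "sympart G (\<iota> i x) (\<iota> i x) = mact (P i x) (\<iota> i x)" by (simp add: sympart_def G\<iota> flip: scaleR_2)
    also have "\<dots> = \<iota> i (\<pi> i (A (\<iota> i x) (\<iota> i x)))" using key[of i x] by (simp add: mact_\<iota> M_bil)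
    also have "\<dots> = A (\<iota> i x) (\<iota> i x)"
    proof -
      have "csum (A (\<iota> i x) (\<iota> i x)) = 0" using tangent_ww(1)[OF t z] by (simp add: csum_def)
      moreover have "\<pi> j (A (\<iota> i x) (\<iota> i x)) = 0" if "j \<noteq> i" for j
        by (rule \<pi>_eqI) (simp add: tangent_ww(2)[OF t z that])
      ultimately show ?thesis using decomp[of "A (\<iota> i x) (\<iota> i x)"] unfolding sum_3_from[of _ i]
        by (simp add: linear_0[OF \<iota>_linear])
    qed
    finally show ?thesis by simp
  qed
  have dd: "?A (\<iota> i x) (\<iota> i y) = 0" for i x y
  proof -
    have "?A (\<iota> i (x + y)) (\<iota> i (x + y)) = 0" by (rule d)
    then have "?A (\<iota> i x) (\<iota> i x) + ?A (\<iota> i y) (\<iota> i y) + (?A (\<iota> i x) (\<iota> i y) + ?A (\<iota> i y) (\<iota> i x)) = 0"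
      unfolding linear_add[OF \<iota>_linear] tangent_bil[OF t'] by (simp only: add_ac)
    then have "?A (\<iota> i x) (\<iota> i y) + ?A (\<iota> i y) (\<iota> i x) = 0" unfolding d by simp
    moreover have "?A (\<iota> i y) (\<iota> i x) = ?A (\<iota> i x) (\<iota> i y)" by (rule tangent_commute[OF t'])
    ultimately show ?thesis by (metis scaleR_2 scaleR_eq_0_iff zero_neq_numeral)
  qed
  have d1: "?A (\<iota> i x) (\<iota> (i + 1) y) = 0" for i x y
  proof -
    have "G (\<iota> i x) (\<iota> (i + 1) y) = \<iota> (i + 1) (N2 i x y)"
      by (simp add: G\<iota> mact_\<iota> main(2)[of i x y] M_bil)
    moreover have "G (\<iota> (i + 1) y) (\<iota> i x) = \<iota> i (N3 (i + 1) y x)"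
      using Pi(1)[of "i + 1" y] Pi(3)[of "i + 1" y] key[of "i + 1" y] by (simp add: G\<iota> mact_\<iota> main(1)[of "i + 1" y x] M_bil)
    ultimately show ?thesis by (simp add: A1 sympart_def)
  qed
  have "?A (\<iota> i x) (\<iota> j y) = 0" for i j x y
  proof -
    consider "j = i" | "j = i + 1" | "j = i + 2" using three_cases by blast
    then show ?thesis
    proof cases
      case 3
      then show ?thesis using d1[of j y x] tangent_commute[OF t', of "\<iota> i x" "\<iota> j y"] by simp
    qed (use dd d1 in blast)+
  qed
  then have "(\<lambda>y. ?A (\<iota> i x) y) = (\<lambda>y. 0)" for i x
    using tangent_commute[OF t', of "\<iota> i x"] z'
    by (intro linear_eqI tangent_linear(2)[OF t'] linear_zero) auto
  note i0 = this
  have "(\<lambda>x. ?A x y) = (\<lambda>x. 0)" for y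
  proof (rule linear_eqI[OF tangent_linear(1)[OF t'] linear_zero])
    show "?A (\<iota> i x) y = 0" for i x by (rule fun_cong[OF i0])
  qed (rule z')
  then have "A x y = sympart G x y" for x y by (metis eq_iff_diff_eq_0)
  then show ?thesis using that dG by blast
qed

theorem tangent_imp_ders: assumes t: "tangent A"
  obtains G where "ders_valued G" "\<And>x. A x x = G x x"
proof -
  obtain G1 where G1: "ders_valued G1" and z1: "\<And>i j. A (c i) (c j) - sympart G1 (c i) (c j) = 0"
    using tangent_reduce_idempotents[OF t] by blast
  note t1 = tangent_diff[OF t G1]
  obtain G2 where G2: "ders_valued G2"
    and z2: "\<And>i j. (A (c i) (c j) - sympart G1 (c i) (c j)) - sympart G2 (c i) (c j) = 0"
      "\<And>i x. \<pi> i ((A (c i) (\<iota> i x) - sympart G1 (c i) (\<iota> i x)) - sympart G2 (c i) (\<iota> i x)) = 0"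
    using tangent_diagonal_zero[OF t1 z1] by blast
  note t2 = tangent_diff[OF t1 G2]
  obtain G3 where G3: "ders_valued G3"
    and z3: "\<And>i x. ((A (c i) x - sympart G1 (c i) x) - sympart G2 (c i) x) - sympart G3 (c i) x = 0"
    using tangent_reduce_mixed[OF t2 z2] by blast
  note t3 = tangent_diff[OF t2 G3]
  obtain G4 where G4: "ders_valued G4"
    and z4: "\<And>x y. ((A x y - sympart G1 x y) - sympart G2 x y) - sympart G3 x y = sympart G4 x y"
    using tangent_reduce_offdiagonal[OF t3 z3] by blast
  have sp: "sympart G x x = G x x" for G x by (simp add: sympart_def flip: scaleR_2)
  have "A x x = G1 x x + G2 x x + (G3 x x + G4 x x)" for x
    using z4[of x x] unfolding sp by (simp add: algebra_simps)
  moreover have "ders_valued (\<lambda>x y. G1 x y + G2 x y + (G3 x y + G4 x y))"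
    by (intro ders_valued_add G1 G2 G3 G4)
  ultimately show ?thesis using that[of "\<lambda>x y. G1 x y + G2 x y + (G3 x y + G4 x y)"] by blast
qed


section \<open>Uniqueness: alternating derivation valued maps\<close>

lemma ders_fix_c: assumes D: "D \<in> ders" and z: "\<And>i. D (c i) = 0"
  shows "D (\<iota> i x) = \<iota> i (\<pi> i (D (\<iota> i x)))"
proof (rule vec_eqI)
  fix l show "D (\<iota> i x) \<bullet> c l = \<iota> i (\<pi> i (D (\<iota> i x))) \<bullet> c l"
    using ders_skew[OF D, of "\<iota> i x" "c l"] z by simp
next
  fix j y
  show "D (\<iota> i x) \<bullet> \<iota> j y = \<iota> i (\<pi> i (D (\<iota> i x))) \<bullet> \<iota> j y"
  proof (cases "j = i")
    case True
    then show ?thesis by (simp add: \<pi>_inner)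
  next
    case False
    \<comment> \<open>A derivation that kills the idempotents commutes with multiplication by them
      and so preserves their eigenspaces.\<close>
    have "c i \<diamondop> D (\<iota> i x) = - D (\<iota> i x)"
      using ders_product[OF D, of "c i" "\<iota> i x"] by (simp add: z P_bil linear_neg[OF ders_linear[OF D]])
    then have "(c i \<diamondop> D (\<iota> i x)) \<bullet> \<iota> j y = - (D (\<iota> i x) \<bullet> \<iota> j y)" by simp
    moreover have "(c i \<diamondop> D (\<iota> i x)) \<bullet> \<iota> j y = (1/2) * (D (\<iota> i x) \<bullet> \<iota> j y)"
      using False by (simp add: P_sym peirce del: peirce_simps)
    ultimately show ?thesis using False by (simp add: \<iota>_orth)
  qed
qed

lemma triple_inner: "(\<iota> i x \<diamondop> \<iota> (i + 1) y) \<bullet> w = (sqrt 3 / 2) * ((x \<star> y \<star> \<pi> (i + 2) w) \<bullet> one)"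
  using \<iota>_cross[of i x y] by (simp add: \<pi>_inner'[symmetric] inner_commute[of _ w] Re_cnj)

text \<open>When \<open>D\<close> kills the first factor, invariance of the triple product reads
  \<open>?N2 y \<star> v + y \<star> ?N3 v = 0\<close>. Setting one argument to the unit expresses
  both maps through the single element \<open>r\<close>.\<close>

lemma ders_fix_V: assumes D: "D \<in> ders" and z: "\<And>i. D (c i) = 0" "\<And>x. D (\<iota> i x) = 0"
  obtains r where "r \<bullet> one = 0" "\<And>y. D (\<iota> (i + 1) y) = - \<iota> (i + 1) (y \<star> r)" "\<And>y. D (\<iota> (i + 2) y) = \<iota> (i + 2) (r \<star> y)"
proof -
  let ?N2 = "\<lambda>y. \<pi> (i + 1) (D (\<iota> (i + 1) y))" and ?N3 = "\<lambda>y. \<pi> (i + 2) (D (\<iota> (i + 2) y))"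
  have N: "?N2 y \<star> v + y \<star> ?N3 v = 0" for y v
  proof -
    have "(x \<star> (?N2 y \<star> v + y \<star> ?N3 v)) \<bullet> one = 0" for x
    proof -
      have "D (\<iota> (i + 1) y) \<bullet> (\<iota> (i + 2) v \<diamondop> \<iota> i x) + D (\<iota> (i + 2) v) \<bullet> (\<iota> i x \<diamondop> \<iota> (i + 1) y) = 0"
        using ders_polar[OF D, of "\<iota> i x" "\<iota> (i + 1) y" "\<iota> (i + 2) v"] by (simp add: z)
      then have "(sqrt 3 / 2) * ((v \<star> x \<star> ?N2 y) \<bullet> one + (x \<star> y \<star> ?N3 v) \<bullet> one) = 0"
        using triple_inner[of "i + 2" v x "D (\<iota> (i + 1) y)"] triple_inner[of i x y "D (\<iota> (i + 2) v)"]
        by (simp add: inner_commute[of "D _"] distrib_left)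
      then show ?thesis using Re_cyc[of v x "?N2 y"] by (simp add: M_bil inner_add_left assoc)
    qed
    from this[of "cnj (?N2 y \<star> v + y \<star> ?N3 v)"] show ?thesis by (simp add: cnj_mul)
  qed
  define r where "r = ?N3 one"
  have 2: "?N2 y = - (y \<star> r)" for y using N[of y one] by (simp add: r_def eq_neg_iff_add_eq_0)
  have 3: "?N3 y = r \<star> y" for y using N[of one y] unfolding 2 by (simp add: M_bil)
  have "r \<bullet> one = 0" using D by (simp add: r_def \<pi>_inner ders_def)
  moreover have "D (\<iota> (i + 1) y) = - \<iota> (i + 1) (y \<star> r)" for y
    using ders_fix_c[OF D z(1), of "i + 1" y] 2[of y] by (simp add: linear_neg[OF \<iota>_linear])
  moreover have "D (\<iota> (i + 2) y) = \<iota> (i + 2) (r \<star> y)" for y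
    using ders_fix_c[OF D z(1), of "i + 2" y] 3[of y] by simp
  ultimately show ?thesis using that by blast
qed

theorem ders_alternating_zero: assumes G: "ders_valued G" and alt: "\<And>x. G x x = 0"
  shows "G x y = 0"
proof -
  have b: "bilinear G" and d: "\<And>x. G x \<in> ders" using G by (auto simp: ders_valued_def)
  have sk: "G x y = - G y x" for x y
    using alt[of "x + y"] unfolding bilinear_ladd[OF b] bilinear_radd[OF b] by (simp add: alt eq_neg_iff_add_eq_0 add.commute)
  \<comment> \<open>Skewness and alternation turn the pairing with \<open>w\<close> into the pairing
    of \<open>G w (c i)\<close> with \<open>c j\<close>, which \<open>ders_c\<close> makes zero. The
    same exchange of roles drives the later cases.\<close>
  have cc: "G (c i) (c j) = 0" for i j
  proof -
    have "G (c i) (c j) \<bullet> w = 0" for w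
      using ders_skew[OF d, of "c i" "c j" w] sk[of "c i" w] ders_c(1)[OF d, of w i j] by (simp add: inner_commute)
    then show ?thesis using inner_eq_zero_iff by blast
  qed
  have ci: "G (c i) (\<iota> i x) = 0" for i x
  proof -
    have "\<pi> i (G (c i) (\<iota> i x)) = 0"
      using sk[of "c i" "\<iota> i x"] ders_c(2)[OF d, of "\<iota> i x" i] by (intro \<pi>_eqI) simp
    then show ?thesis using ders_fix_c[OF d cc, of i i x] by (simp add: linear_0[OF \<iota>_linear])
  qed
  have "\<exists>r. r \<bullet> one = 0 \<and> (\<forall>y. G (c i) (\<iota> (i + 1) y) = - \<iota> (i + 1) (y \<star> r)) \<and> (\<forall>y. G (c i) (\<iota> (i + 2) y) = \<iota> (i + 2) (r \<star> y))" for i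
    using ders_fix_V[OF d cc ci, of i] by metis
  then obtain r where r: "\<And>i. r i \<bullet> one = 0" "\<And>i y. G (c i) (\<iota> (i + 1) y) = - \<iota> (i + 1) (y \<star> r i)"
    "\<And>i y. G (c i) (\<iota> (i + 2) y) = \<iota> (i + 2) (r i \<star> y)" by metis
  \<comment> \<open>The idempotents sum to zero; on \<open>V j\<close> this gives a relation between
    a left and a right multiplication, which the trivial imaginary centre cannot sustain.\<close>
  have "r (j + 1) = 0" for j
  proof (rule two_sided_zero(1))
    show "r (j + 1) \<star> y + y \<star> (- r (j + 2)) = 0" for y
    proof -
      have "G (c j) (\<iota> j y) + G (c (j + 1)) (\<iota> j y) + G (c (j + 2)) (\<iota> j y) = 0"
        using c_sum[of j] by (simp add: bilinear_lzero[OF b] flip: bilinear_ladd[OF b])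
      then have "\<iota> j (r (j + 1) \<star> y + y \<star> (- r (j + 2))) = 0"
        using r(3)[of "j + 1" y] r(2)[of "j + 2" y] ci[of j y]
        by (simp add: M_bil linear_diff[OF \<iota>_linear])
      then show ?thesis by (metis \<iota>_iso inner_eq_zero_iff)
    qed
  qed (rule r)
  then have r0: "r j = 0" for j by (metis three_index(2) add.commute three_index(1) three_index(3))
  have z: "G (c i) w = 0" for i w
  proof -
    have "G (c i) = (\<lambda>w. 0)"
    proof (rule linear_eqI)
      show "G (c i) (\<iota> j x) = 0" for j x
        using three_cases[of j i] ci r(2,3)[of i x] by (auto simp: r0 M_bil linear_0[OF \<iota>_linear])
    qed (auto simp: cc linear_zero ders_linear[OF d])
    then show ?thesis by simp
  qed
  have z': "G w (c i) = 0" for i w using sk[of w "c i"] z by simp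
  have ij: "G (\<iota> i x) (\<iota> j y) = 0" if "i \<noteq> j" for i j x y
  proof -
    have "\<pi> j (G (\<iota> i x) (\<iota> j y)) = - \<pi> j (\<iota> i (\<pi> i (G (\<iota> j y) (\<iota> i x))))"
      using sk[of "\<iota> i x" "\<iota> j y"] ders_fix_c[OF d z', of "\<iota> j y" i x] by (simp add: linear_neg[OF \<pi>_linear])
    also have "\<dots> = 0" using that by (simp add: \<pi>_\<iota>)
    finally show ?thesis using ders_fix_c[OF d z', of "\<iota> i x" j y] by (simp add: linear_0[OF \<iota>_linear])
  qed
  \<comment> \<open>The value lies in \<open>V i\<close> and \<open>G (\<iota> i x)\<close> already
    kills the other two spaces, so the invariant triple product pairs the value to zero with all
    their products.\<close>
  have ii: "G (\<iota> i x) (\<iota> i y) = 0" for i x y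
  proof -
    let ?a = "\<pi> i (G (\<iota> i x) (\<iota> i y))"
    have "G (\<iota> i x) (\<iota> i y) \<bullet> (\<iota> (i + 1) u \<diamondop> \<iota> (i + 2) v) = 0" for u v
      using ders_polar[OF d, of "\<iota> i x" "\<iota> i y" "\<iota> (i + 1) u" "\<iota> (i + 2) v"] by (simp add: ij)
    then have "(u \<star> v \<star> ?a) \<bullet> one = 0" for u v
      using triple_inner[of "i + 1" u v "G (\<iota> i x) (\<iota> i y)"] by (simp add: inner_commute)
    from this[of "cnj ?a" one] have "?a = 0" by (simp add: cnj_mul)
    then show ?thesis using ders_fix_c[OF d z', of "\<iota> i x" i y] by (simp add: linear_0[OF \<iota>_linear])
  qed
  have i0: "G (\<iota> i x) = (\<lambda>w. 0)" for i x
  proof (rule linear_eqI)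
    show "G (\<iota> i x) (\<iota> j y) = 0" for j y using ij ii by (cases "i = j") auto
  qed (auto simp: z' linear_zero ders_linear[OF d])
  have "(\<lambda>x. G x y) = (\<lambda>x. 0)"
    using b by (intro linear_eqI) (auto simp: z i0 linear_zero bilinear_def)
  then show ?thesis by (rule fun_cong)
qed

end

section \<open>Coordinates and model frames\<close>

interpretation real_alg: comp_alg "(*) :: real \<Rightarrow> real \<Rightarrow> real" 1 "\<lambda>x. x"
proof (rule comp_alg.intro[OF bounded_bilinear_mult], unfold_locales)
  fix N :: "real \<Rightarrow> real" and x :: real
  assume N: "linear N" and s: "\<And>x. N x \<bullet> x = 0"
  have "N x = 0" for x
    using s[of x] linear_0[OF N] by (cases "x = 0") auto
  then show "N x = (1 / real DIM(real)) *\<^sub>R (\<Sum>b\<in>Basis. N b * b) * x + x * ((1 / real DIM(real)) *\<^sub>R (\<Sum>b\<in>Basis. b * N b))"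
    by simp
qed (auto simp: algebra_simps)

type_synonym quat = "real \<times> real \<times> real \<times> real"

definition qmul :: "quat \<Rightarrow> quat \<Rightarrow> quat" where
  "qmul x y = (case x of (a, b, c, d) \<Rightarrow> case y of (a', b', c', d') \<Rightarrow>
     (a * a' - b * b' - c * c' - d * d', a * b' + b * a' + c * d' - d * c',
      a * c' - b * d' + c * a' + d * b', a * d' + b * c' - c * b' + d * a'))"

definition qone :: quat where "qone = (1, 0, 0, 0)"

definition qcnj :: "quat \<Rightarrow> quat" where "qcnj x = (case x of (a, b, c, d) \<Rightarrow> (a, - b, - c, - d))"

lemmas quat_defs = qmul_def qone_def qcnj_def

lemma Basis_quat: "(Basis :: quat set) = {(1, 0, 0, 0), (0, 1, 0, 0), (0, 0, 1, 0), (0, 0, 0, 1)}"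
  by (simp add: Basis_prod_def image_Un image_image zero_prod_def insert_commute)

lemma sum_Basis_quat: "(\<Sum>b\<in>(Basis :: quat set). f b)
    = f (1, 0, 0, 0) + f (0, 1, 0, 0) + f (0, 0, 1, 0) + f (0, 0, 0, 1)"
  by (simp add: Basis_quat add.assoc)

lemma quat_linear: assumes "linear f"
  shows "f (a, b, c, d) = a *\<^sub>R f (1, 0, 0, 0) + b *\<^sub>R f (0, 1, 0, 0) + c *\<^sub>R f (0, 0, 1, 0) + d *\<^sub>R f (0, 0, 0, (1::real))"
proof -
  have "(a, b, c, d) = a *\<^sub>R (1, 0, 0, 0) + b *\<^sub>R (0, 1, 0, 0) + c *\<^sub>R (0, 0, 1, 0) + d *\<^sub>R (0, 0, 0, (1::real))" by simp
  then show ?thesis by (metis linear_add[OF assms] linear_scale[OF assms])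
qed

lemma qmul_bilinear: "bounded_bilinear qmul"
  unfolding bilinear_conv_bounded_bilinear[symmetric] bilinear_def
  by (auto intro!: linearI simp: quat_defs algebra_simps)

interpretation quat_alg: comp_alg qmul qone qcnj
proof (rule comp_alg.intro[OF qmul_bilinear], unfold_locales)
  fix x y z :: quat
  show "qmul (qmul x y) z = qmul x (qmul y z)"
    by (cases x rule: prod_cases4; cases y rule: prod_cases4; cases z rule: prod_cases4) (simp add: quat_defs algebra_simps)
  show "qmul qone x = x" "qmul x qone = x" "qone \<bullet> qone = 1" "qmul (qcnj x) x = (x \<bullet> x) *\<^sub>R qone"
    by (cases x rule: prod_cases4; simp add: quat_defs)+
  show "qmul x y \<bullet> z = y \<bullet> qmul (qcnj x) z" "qmul x y \<bullet> z = x \<bullet> qmul z (qcnj y)"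
    by (cases x rule: prod_cases4; cases y rule: prod_cases4; cases z rule: prod_cases4; simp add: quat_defs algebra_simps)+
  show "x \<bullet> qone = 0 \<Longrightarrow> qcnj x = - x"
    by (cases x rule: prod_cases4) (simp add: quat_defs)
next
  fix p :: quat assume 0: "p \<bullet> qone = 0" and c: "\<And>x. qmul p x = qmul x p"
  show "p = 0" using 0 c[of "(0, 1, 0, 0)"] c[of "(0, 0, 1, 0)"]
    by (cases p rule: prod_cases4) (simp add: quat_defs zero_prod_def)
next
  fix N :: "quat \<Rightarrow> quat" and x :: quat
  assume N: "linear N" and s: "\<And>x. N x \<bullet> x = 0"
  have sk: "N x \<bullet> y = - (N y \<bullet> x)" for x y
    using s[of "x + y"] s[of x] s[of y] by (simp add: linear_add[OF N] inner_add_left inner_add_right)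
  obtain n00 n01 n02 n03 n10 n11 n12 n13 n20 n21 n22 n23 n30 n31 n32 n33 where
    n: "N (1, 0, 0, 0) = (n00, n01, n02, n03)" "N (0, 1, 0, 0) = (n10, n11, n12, n13)"
    "N (0, 0, 1, 0) = (n20, n21, n22, n23)" "N (0, 0, 0, 1) = (n30, n31, n32, n33)"
    by (metis prod_cases4)
  have e00: "n00 = 0" using s[of "(1, 0, 0, 0)"] by (simp add: n)
  have e11: "n11 = 0" using s[of "(0, 1, 0, 0)"] by (simp add: n)
  have e22: "n22 = 0" using s[of "(0, 0, 1, 0)"] by (simp add: n)
  have e33: "n33 = 0" using s[of "(0, 0, 0, 1)"] by (simp add: n)
  have e10: "n10 = - n01" using sk[of "(0, 1, 0, 0)" "(1, 0, 0, 0)"] by (simp add: n)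
  have e20: "n20 = - n02" using sk[of "(0, 0, 1, 0)" "(1, 0, 0, 0)"] by (simp add: n)
  have e30: "n30 = - n03" using sk[of "(0, 0, 0, 1)" "(1, 0, 0, 0)"] by (simp add: n)
  have e21: "n21 = - n12" using sk[of "(0, 0, 1, 0)" "(0, 1, 0, 0)"] by (simp add: n)
  have e31: "n31 = - n13" using sk[of "(0, 0, 0, 1)" "(0, 1, 0, 0)"] by (simp add: n)
  have e32: "n32 = - n23" using sk[of "(0, 0, 0, 1)" "(0, 0, 1, 0)"] by (simp add: n)
  note e = e00 e11 e22 e33 e10 e20 e30 e21 e31 e32
  \<comment> \<open>The self-dual and the anti-self-dual part of a skew 4 by 4 matrix: the splitting
    of so(4) into two copies of so(3).\<close>
  have "(1 / real DIM(quat)) *\<^sub>R (\<Sum>b\<in>Basis. qmul (N b) (qcnj b)) = (0, (n01 + n23)/2, (n02 - n13)/2, (n03 + n12)/2)"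
    "(1 / real DIM(quat)) *\<^sub>R (\<Sum>b\<in>Basis. qmul (qcnj b) (N b)) = (0, (n01 - n23)/2, (n02 + n13)/2, (n03 - n12)/2)"
    unfolding sum_Basis_quat n by (simp_all add: e quat_defs)
  moreover obtain a b c d where x: "x = (a, b, c, d)" by (cases x rule: prod_cases4)
  moreover have "N x = a *\<^sub>R (n00, n01, n02, n03) + b *\<^sub>R (n10, n11, n12, n13) + c *\<^sub>R (n20, n21, n22, n23) + d *\<^sub>R (n30, n31, n32, n33)"
    unfolding x n[symmetric] by (rule quat_linear[OF N])
  ultimately show "N x = qmul ((1 / real DIM(quat)) *\<^sub>R (\<Sum>b\<in>Basis. qmul (N b) (qcnj b))) x
      + qmul x ((1 / real DIM(quat)) *\<^sub>R (\<Sum>b\<in>Basis. qmul (qcnj b) (N b)))"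
    by (simp only: e) (simp add: quat_defs field_simps)
qed

section \<open>A composition algebra on a Peirce space\<close>

lemma three_numerals [simp]: "(3 :: 3) = 0" "(1 :: 3) + 2 = 0" "(2 :: 3) + 1 = 0" "(2 :: 3) + 2 = 1" "(1 :: 3) + 1 = 2"
  by simp_all

lemma three_distinct [simp]: "(0 :: 3) \<noteq> 2" "(1 :: 3) \<noteq> 2" "(1 :: 3) \<noteq> 0" "(2 :: 3) \<noteq> 0" "(2 :: 3) \<noteq> 1"
  using three_index(5-10)[of "0 :: 3"] by simp_all

lemma all_3: "(\<forall>i::3. Q i) \<longleftrightarrow> Q 0 \<and> Q 1 \<and> Q 2"
  by (metis exhaust_3 three_numerals(1))

text \<open>One unit vector in each of two Peirce spaces is enough to identify all three
  isometrically; \<open>p\<close> then becomes the unit of an algebra on \<open>V 0\<close>.\<close>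

locale peirce_seed = peirce P c
  for P :: "'e::euclidean_space \<Rightarrow> 'e \<Rightarrow> 'e" (infixl "\<diamondop>" 70) and c +
  fixes p w :: 'e
  assumes p_V: "p \<in> V 0" and w_V: "w \<in> V 1" and p_norm: "p \<bullet> p = 1" and w_norm: "w \<bullet> w = 1"
begin

text \<open>Rescaled so that multiplication by a unit vector of one Peirce space is an isometry
  between the other two.\<close>

definition B :: "'e \<Rightarrow> 'e \<Rightarrow> 'e" where "B x y = (2 / sqrt 3) *\<^sub>R (x \<diamondop> y)"

lemma B_V: "x \<in> V i \<Longrightarrow> y \<in> V j \<Longrightarrow> i \<noteq> j \<Longrightarrow> l \<noteq> i \<Longrightarrow> l \<noteq> j \<Longrightarrow> B x y \<in> V l"
  unfolding B_def by (intro subspace_scale[OF V_subspace] V_cross)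

lemma B_comm: "B x y = B y x" by (simp add: B_def P_comm[of x y])

lemma B_sym: "B x y \<bullet> z = y \<bullet> B x z" by (simp add: B_def P_sym)

lemma B_cyc: "B x y \<bullet> z = B y z \<bullet> x" by (simp add: B_def P_cyc[of x y z])

lemma B_bil: "B (x + y) z = B x z + B y z" "B x (y + z) = B x y + B x z" "B (r *\<^sub>R x) y = r *\<^sub>R B x y"
  "B x (r *\<^sub>R y) = r *\<^sub>R B x y" "B (- x) y = - B x y" "B x (- y) = - B x y"
  by (simp_all add: B_def P_bil scaleR_add_right)

lemma B_B: "x \<in> V i \<Longrightarrow> y \<in> V j \<Longrightarrow> i \<noteq> j \<Longrightarrow> B x (B x y) = (x \<bullet> x) *\<^sub>R y"
  by (simp add: B_def P_bil V_double)

lemma B_iso: "x \<in> V i \<Longrightarrow> y \<in> V j \<Longrightarrow> i \<noteq> j \<Longrightarrow> B x y \<bullet> B x z = (x \<bullet> x) * (y \<bullet> z)"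
  using B_B[of x i y j] B_sym[of x "B x y" z] by (simp add: inner_commute)

text \<open>\<rho> and \<sigma> identify \<open>V 0\<close> with \<open>V 2\<close> and
  \<open>V 1\<close>. Transporting the product of \<open>V 2\<close> and \<open>V 1\<close> back
  along them is the isotope construction that makes a norm-multiplicative product unital, with unit
  \<open>p\<close>.\<close>

definition \<rho> :: "'e \<Rightarrow> 'e" where "\<rho> x = B x w"
definition \<sigma> :: "'e \<Rightarrow> 'e" where "\<sigma> y = B (B p w) y"
definition m :: "'e \<Rightarrow> 'e \<Rightarrow> 'e" where "m x y = B (\<rho> x) (\<sigma> y)"

lemma pw_V: "B p w \<in> V 2" by (rule B_V[OF p_V w_V]) simp_all

lemma pw_norm: "B p w \<bullet> B p w = 1" by (simp add: B_iso[OF p_V w_V] p_norm w_norm)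

lemma \<rho>_V: "x \<in> V 0 \<Longrightarrow> \<rho> x \<in> V 2" unfolding \<rho>_def by (rule B_V[where i = 0, OF _ w_V]) simp_all
lemma \<sigma>_V: "x \<in> V 0 \<Longrightarrow> \<sigma> x \<in> V 1" unfolding \<sigma>_def by (rule B_V[where j = 0, OF pw_V]) simp_all
lemma m_V: "x \<in> V 0 \<Longrightarrow> y \<in> V 0 \<Longrightarrow> m x y \<in> V 0" unfolding m_def by (rule B_V[OF \<rho>_V \<sigma>_V]) simp_all

lemma \<rho>_iso: "x \<in> V 0 \<Longrightarrow> \<rho> x \<bullet> \<rho> y = x \<bullet> y"
  unfolding \<rho>_def B_comm[of _ w] by (simp add: B_iso[OF w_V] w_norm)

lemma \<sigma>_iso: "x \<in> V 0 \<Longrightarrow> \<sigma> x \<bullet> \<sigma> y = x \<bullet> y"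
  unfolding \<sigma>_def by (simp add: B_iso[OF pw_V] pw_norm)

lemma \<rho>_p: "\<rho> p = B p w" by (simp add: \<rho>_def)

lemma \<sigma>_p: "\<sigma> p = w"
  unfolding \<sigma>_def by (subst B_comm) (simp add: B_B[OF p_V w_V] p_norm)

lemma m_left: "y \<in> V 0 \<Longrightarrow> m p y = y"
  unfolding m_def \<sigma>_def \<rho>_p by (simp add: B_B[OF pw_V] pw_norm)

lemma m_right: "x \<in> V 0 \<Longrightarrow> m x p = x"
  unfolding m_def \<sigma>_p unfolding \<rho>_def B_comm[of _ w] by (simp add: B_B[OF w_V] w_norm)

lemma m_bil: "m (x + y) z = m x z + m y z" "m x (y + z) = m x y + m x z" "m (r *\<^sub>R x) y = r *\<^sub>R m x y"
  "m x (r *\<^sub>R y) = r *\<^sub>R m x y" "m (- x) y = - m x y" "m x (- y) = - m x y"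
  by (simp_all add: m_def \<rho>_def \<sigma>_def B_bil)

lemma m_iso_right: assumes "x \<in> V 0" "y \<in> V 0" "z \<in> V 0" shows "m x y \<bullet> m x z = (x \<bullet> x) * (y \<bullet> z)"
  unfolding m_def by (simp add: B_iso[OF \<rho>_V \<sigma>_V] \<rho>_iso \<sigma>_iso assms)

lemma m_iso_left: assumes "x \<in> V 0" "y \<in> V 0" "z \<in> V 0" shows "m x z \<bullet> m y z = (z \<bullet> z) * (x \<bullet> y)"
  unfolding m_def B_comm[of _ "\<sigma> z"] by (simp add: B_iso[OF \<sigma>_V \<rho>_V] \<rho>_iso \<sigma>_iso assms)

lemma m_polar: assumes V: "x \<in> V 0" "x' \<in> V 0" "y \<in> V 0" "y' \<in> V 0"
  shows "m x y \<bullet> m x' y' + m x y' \<bullet> m x' y = 2 * (x \<bullet> x') * (y \<bullet> y')"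
proof -
  have "y + y' \<in> V 0" using V subspace_add[OF V_subspace] by blast
  from m_iso_left[OF V(1,2) this] m_iso_left[OF V(1,2,3)] m_iso_left[OF V(1,2,4)]
  show ?thesis by (simp add: m_bil inner_add_left inner_add_right inner_commute[of y' y] algebra_simps)
qed

lemma m_skew_left: assumes V: "x \<in> V 0" "y \<in> V 0" "z \<in> V 0" and "x \<bullet> p = 0" shows "m x y \<bullet> z = - (y \<bullet> m x z)"
  using m_polar[OF V(1) p_V V(2,3)] assms(4) by (simp add: m_left V inner_commute)

lemma m_skew_right: assumes V: "x \<in> V 0" "y \<in> V 0" "z \<in> V 0" and "x \<bullet> p = 0" shows "m y x \<bullet> z = - (y \<bullet> m z x)"
  using m_polar[OF V(2,3) V(1) p_V] assms(4) by (simp add: m_right V inner_commute)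

lemma V0_eqI: assumes "x \<in> V 0" "y \<in> V 0" "\<And>z. z \<in> V 0 \<Longrightarrow> x \<bullet> z = y \<bullet> z" shows "x = y"
proof -
  have "x - y \<in> V 0" using assms subspace_diff[OF V_subspace] by blast
  from assms(3)[OF this] have "(x - y) \<bullet> (x - y) = 0" by (simp only: inner_diff_left diff_self)
  then show ?thesis by simp
qed

text \<open>As in Hurwitz's theorem: multiplication by an imaginary element is skew and multiplies
  norms, so its square is a negative scalar.\<close>

lemma m_alt_left: assumes V: "x \<in> V 0" "y \<in> V 0" and "x \<bullet> p = 0" shows "m x (m x y) = - (x \<bullet> x) *\<^sub>R y"
proof (rule V0_eqI)
  fix z assume z: "z \<in> V 0"
  show "m x (m x y) \<bullet> z = (- (x \<bullet> x) *\<^sub>R y) \<bullet> z"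
    using m_skew_left[OF V(1) m_V[OF V] z assms(3)] m_iso_right[OF V z] by simp
qed (auto intro!: m_V V subspace_neg[OF V_subspace] subspace_scale[OF V_subspace])

lemma m_alt_right: assumes V: "x \<in> V 0" "y \<in> V 0" and "x \<bullet> p = 0" shows "m (m y x) x = - (x \<bullet> x) *\<^sub>R y"
proof (rule V0_eqI)
  fix z assume z: "z \<in> V 0"
  show "m (m y x) x \<bullet> z = (- (x \<bullet> x) *\<^sub>R y) \<bullet> z"
    using m_skew_right[OF V(1) m_V[OF V(2,1)] z assms(3)] m_iso_left[OF V(2) z V(1)] by simp
qed (auto intro!: m_V V subspace_neg[OF V_subspace] subspace_scale[OF V_subspace])

lemma m_anti: assumes V: "x \<in> V 0" "y \<in> V 0" and "x \<bullet> p = 0" "y \<bullet> p = 0" "x \<bullet> y = 0" shows "m x y = - m y x"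
proof -
  have V': "x + y \<in> V 0" using V subspace_add[OF V_subspace] by blast
  have sq: "m x x = - (x \<bullet> x) *\<^sub>R p" if "x \<in> V 0" "x \<bullet> p = 0" for x
    using m_alt_left[OF that(1) p_V that(2)] by (simp add: m_right that)
  show ?thesis using sq[OF V'] sq[OF V(1) assms(3)] sq[OF V(2) assms(4)] assms(5)
    by (simp add: m_bil inner_add_left inner_add_right inner_commute[of y x] assms(3,4) algebra_simps eq_neg_iff_add_eq_0)
qed

text \<open>The composition algebra \<open>m\<close> on \<open>V 0\<close> supplies coordinates on all three spaces at once.\<close>

lemma herm3_if_multiplicative:
  fixes \<iota>0 :: "'k::euclidean_space \<Rightarrow> 'e" and mul one and cnj :: "'k \<Rightarrow> 'k"
  assumes K: "comp_alg mul one cnj" and lc: "linear cnj"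
    and l: "linear \<iota>0" and iso: "\<And>x y. \<iota>0 x \<bullet> \<iota>0 y = x \<bullet> y" and V0: "\<And>x. \<iota>0 x \<in> V 0"
    and mult: "\<And>x y. \<iota>0 (mul x y) = m (\<iota>0 x) (\<iota>0 y)"
    and complete: "\<And>v. (\<And>i. v \<bullet> c i = 0) \<Longrightarrow> (\<And>x. v \<bullet> \<iota>0 x = 0) \<Longrightarrow> (\<And>x. v \<bullet> \<sigma> (\<iota>0 x) = 0)
       \<Longrightarrow> (\<And>x. v \<bullet> \<rho> (\<iota>0 x) = 0) \<Longrightarrow> v = 0"
  shows "herm3 mul one cnj P c (\<lambda>i x. if i = 0 then \<iota>0 x else if i = 1 then \<sigma> (\<iota>0 (cnj x)) else \<rho> (\<iota>0 (cnj x)))"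
    (is "herm3 mul one cnj P c ?\<iota>")
proof -
  interpret K: comp_alg mul one cnj by (rule K)
  have ciso: "cnj x \<bullet> cnj y = x \<bullet> y" for x y
    by (metis K.adj_right K.Re_cnj K.Re_comm K.cnj_cnj K.one_left inner_commute)
  \<comment> \<open>In \<open>m\<close> the third coordinate is the left factor, so the pairing
    produces \<open>cnj z \<star> cnj y\<close>, the conjugate of \<open>y \<star> z\<close>. The
    conjugates in the last two coordinates are there to undo this reversal.\<close>
  have t0: "(\<iota>0 x \<diamondop> \<sigma> (\<iota>0 (cnj y))) \<bullet> \<rho> (\<iota>0 (cnj z)) = (sqrt 3 / 2) * (mul (mul x y) z \<bullet> one)" for x y z
  proof -
    have "B (\<iota>0 x) (\<sigma> (\<iota>0 (cnj y))) \<bullet> \<rho> (\<iota>0 (cnj z)) = \<iota>0 (mul (cnj z) (cnj y)) \<bullet> \<iota>0 x"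
      unfolding mult m_def by (metis B_cyc B_comm)
    also have "\<dots> = mul (mul x y) z \<bullet> one"
      unfolding iso K.adj_left[of "cnj z"] by (metis K.Re_cnj K.Re_comm K.cnj_cnj K.assoc)
    finally show ?thesis by (simp add: B_def field_simps)
  qed
  show ?thesis
  proof (rule herm3.intro[OF K peirce_axioms herm3_axioms.intro])
    show "linear (?\<iota> i)" for i
    proof -
      have "linear (\<lambda>x. \<sigma> (\<iota>0 (cnj x)))" "linear (\<lambda>x. \<rho> (\<iota>0 (cnj x)))"
        unfolding \<sigma>_def \<rho>_def by (rule linearI; simp add: linear_add[OF l] linear_scale[OF l] linear_add[OF lc] linear_scale[OF lc] B_bil)+
      with l show ?thesis by (cases "i = 0"; cases "i = 1") simp_all
    qed
    show "?\<iota> i x \<bullet> ?\<iota> i y = x \<bullet> y" for i x y by (simp add: iso \<sigma>_iso \<rho>_iso V0 ciso)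
    show "?\<iota> i x \<in> V i" for i x
    proof -
      have "\<forall>i. ?\<iota> i x \<in> V i" unfolding all_3 by (simp add: V0 \<sigma>_V \<rho>_V)
      then show ?thesis by blast
    qed
    show "(?\<iota> i x \<diamondop> ?\<iota> (i + 1) y) \<bullet> ?\<iota> (i + 2) z = sqrt 3 / 2 * (mul (mul x y) z \<bullet> one)" for i x y z
    proof -
      have "\<forall>i. (?\<iota> i x \<diamondop> ?\<iota> (i + 1) y) \<bullet> ?\<iota> (i + 2) z = sqrt 3 / 2 * (mul (mul x y) z \<bullet> one)"
        unfolding all_3
        using t0[of x y z] t0[of z x y] t0[of y z x] K.Re_cyc[of z x y] K.Re_cyc[of y z x]
          P_cyc[of "\<iota>0 z" "\<sigma> (\<iota>0 (cnj x))" "\<rho> (\<iota>0 (cnj y))"]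
          P_cyc[of "\<rho> (\<iota>0 (cnj x))" "\<iota>0 y" "\<sigma> (\<iota>0 (cnj z))"] by simp
      then show ?thesis by blast
    qed
    fix v assume a: "\<And>i. v \<bullet> c i = 0" and b: "\<And>i x. v \<bullet> ?\<iota> i x = 0"
    show "v = 0"
    proof (rule complete)
      show "v \<bullet> \<iota>0 x = 0" for x using b[of 0 x] by simp
      show "v \<bullet> \<sigma> (\<iota>0 x) = 0" for x using b[of 1 "cnj x"] by simp
      show "v \<bullet> \<rho> (\<iota>0 x) = 0" for x using b[of 2 "cnj x"] by simp
    qed (rule a)
  qed
qed

end

section \<open>Octonion products and the determinant as a polynomial\<close>

lemma oct_apply: "oct [a0, a1, a2, a3, a4, a5, a6, a7] r =
  (if r = 0 then a0 else if r = 1 then a1 else if r = 2 then a2 else if r = 3 then a3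
   else if r = 4 then a4 else if r = 5 then a5 else if r = 6 then a6 else if r = 7 then a7 else 0)"
  unfolding oct_def by (auto simp: less_Suc_eq nth_Cons' numeral_eq_Suc)

lemma oct_eqI:
  assumes "\<And>r. r > 7 \<Longrightarrow> x r = 0" "x 0 = a0" "x 1 = a1" "x 2 = a2" "x 3 = a3" "x 4 = a4" "x 5 = a5" "x 6 = a6" "x 7 = a7"
  shows "x = oct [a0, a1, a2, a3, a4, a5, a6, a7]"
proof
  fix r :: nat
  consider "r = 0" | "r = 1" | "r = 2" | "r = 3" | "r = 4" | "r = 5" | "r = 6" | "r = 7" | "r > 7" by linarith
  then show "x r = oct [a0, a1, a2, a3, a4, a5, a6, a7] r"
    by cases (use assms in \<open>simp_all add: oct_apply\<close>)
qed

lemma oct_sc_out: "i \<le> 7 \<Longrightarrow> j \<le> 7 \<Longrightarrow> r > 7 \<Longrightarrow> oct_sc i j r = 0"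
  by (auto simp: oct_sc_def oct_pos_def oct_triples_def)

lemma sum_atMost_7: "(\<Sum>i\<le>7. f i) = f 0 + f 1 + f 2 + f 3 + f 4 + f 5 + f 6 + f (7::nat)" for f :: "nat \<Rightarrow> real"
  by (simp add: numeral_eq_Suc add_ac)

text \<open>Only products of quaternions, spanned by \<open>e\<^sub>0, e\<^sub>1, e\<^sub>2, e\<^sub>4\<close>, are needed.\<close>

lemma oct_mult_quat: "oct [a0, a1, a2, 0, a4, 0, 0, 0] \<odot> oct [b0, b1, b2, 0, b4, 0, 0, 0] =
  oct [a0 * b0 - a1 * b1 - a2 * b2 - a4 * b4, a0 * b1 + a1 * b0 + a2 * b4 - a4 * b2,
    a0 * b2 - a1 * b4 + a2 * b0 + a4 * b1, 0, a0 * b4 + a1 * b2 - a2 * b1 + a4 * b0, 0, 0, 0]"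
proof (rule oct_eqI)
  show "r > 7 \<Longrightarrow> (oct [a0, a1, a2, 0, a4, 0, 0, 0] \<odot> oct [b0, b1, b2, 0, b4, 0, 0, 0]) r = 0" for r
    by (simp add: oct_mult_def oct_sc_out)
qed (simp_all add: oct_mult_def sum_atMost_7 oct_apply oct_sc_def oct_pos_def oct_triples_def)

lemma oct_cnj_oct: "oct_cnj (oct [a0, a1, a2, a3, a4, a5, a6, a7]) = oct [a0, - a1, - a2, - a3, - a4, - a5, - a6, - a7]"
  by (rule oct_eqI) (simp_all add: oct_cnj_def oct_apply)

lemma oct_scale_oct: "oct_scale s (oct [a0, a1, a2, a3, a4, a5, a6, a7])
    = oct [s * a0, s * a1, s * a2, s * a3, s * a4, s * a5, s * a6, s * a7]"
  by (rule oct_eqI) (simp_all add: oct_scale_def oct_apply)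

text \<open>Half the determinant of the model matrix, multiplied out over the quaternions. Cutting
  off the indices beyond \<open>dim_n k\<close> lets one formula serve both cases; for
  \<open>k = 1\<close> five coordinates survive.\<close>

definition model_cubic :: "nat \<Rightarrow> (nat \<Rightarrow> real) \<Rightarrow> real" where
  "model_cubic k x0 = (let x = (\<lambda>I. if I \<le> dim_n k then x0 I else 0) in
     - ((x 5)^3) + 3 * (x 4)^2 * x 5 + 3 * x 5 * ((x 3)^2 + (x 8)^2 + (x 13)^2 + (x 14)^2)
     - (3/2) * (x 5 + sqrt 3 * x 4) * ((x 2)^2 + (x 7)^2 + (x 11)^2 + (x 12)^2)
     - (3/2) * (x 5 - sqrt 3 * x 4) * ((x 1)^2 + (x 6)^2 + (x 9)^2 + (x 10)^2)
     + 3 * sqrt 3 * ( x 2 * (x 3 * x 1 - x 8 * x 6 - x 13 * x 9 - x 14 * x 10)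
        + x 7 * (x 3 * x 6 + x 8 * x 1 + x 13 * x 10 - x 14 * x 9)
        + x 11 * (x 3 * x 9 - x 8 * x 10 + x 13 * x 1 + x 14 * x 6)
        + x 12 * (x 3 * x 10 + x 8 * x 9 - x 13 * x 6 + x 14 * x 1)))"

lemma det1_model: assumes "k \<in> {1, 4}"
  shows "oct_scale (1/2) (det1 (model_matrix k x0)) = oct_of_real (model_cubic k x0)"
proof -
  define x where "x = (\<lambda>I. if I \<in> {1..dim_n k} then x0 I else 0)"
  have z: "x I = 0" if "I > 14" for I using that assms by (auto simp: x_def dim_n_def)
  have s3: "sqrt 3 * sqrt 3 = 3" "sqrt 3 * (sqrt 3 * a) = 3 * a" for a by (simp_all flip: mult.assoc)
  let ?X1 = "oct [x 1, x 6, x 9, 0, x 10, 0, 0, 0]" and ?X2 = "oct [x 2, x 7, x 11, 0, x 12, 0, 0, 0]"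
    and ?X3 = "oct [x 3, x 8, x 13, 0, x 14, 0, 0, 0]"
  have a: "model_matrix k x0 1 1 = oct_of_real (x 5 - sqrt 3 * x 4)" "model_matrix k x0 1 2 = oct_scale (sqrt 3) ?X3"
    "model_matrix k x0 1 3 = oct_scale (sqrt 3) ?X2" "model_matrix k x0 2 1 = oct_scale (sqrt 3) (oct_cnj ?X3)"
    "model_matrix k x0 2 2 = oct_of_real (x 5 + sqrt 3 * x 4)" "model_matrix k x0 2 3 = oct_scale (sqrt 3) ?X1"
    "model_matrix k x0 3 1 = oct_scale (sqrt 3) (oct_cnj ?X2)" "model_matrix k x0 3 2 = oct_scale (sqrt 3) (oct_cnj ?X1)"
    "model_matrix k x0 3 3 = oct_of_real (- 2 * x 5)"
    unfolding model_matrix_def Let_def x_def[symmetric] by (simp_all add: z)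
  have m: "model_cubic k x0 = - ((x 5)^3) + 3 * (x 4)^2 * x 5 + 3 * x 5 * ((x 3)^2 + (x 8)^2 + (x 13)^2 + (x 14)^2)
     - (3/2) * (x 5 + sqrt 3 * x 4) * ((x 2)^2 + (x 7)^2 + (x 11)^2 + (x 12)^2)
     - (3/2) * (x 5 - sqrt 3 * x 4) * ((x 1)^2 + (x 6)^2 + (x 9)^2 + (x 10)^2)
     + 3 * sqrt 3 * ( x 2 * (x 3 * x 1 - x 8 * x 6 - x 13 * x 9 - x 14 * x 10)
        + x 7 * (x 3 * x 6 + x 8 * x 1 + x 13 * x 10 - x 14 * x 9)
        + x 11 * (x 3 * x 9 - x 8 * x 10 + x 13 * x 1 + x 14 * x 6)
        + x 12 * (x 3 * x 10 + x 8 * x 9 - x 13 * x 6 + x 14 * x 1))"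
    unfolding model_cubic_def Let_def x_def by simp
  show ?thesis
    unfolding det1_def a oct_cnj_oct oct_scale_oct minus_zero mult_zero_right oct_mult_quat m
    by (rule oct_eqI; simp add: oct_scale_def oct_apply; simp add: algebra_simps power2_eq_square power3_eq_cube s3)
qed

section \<open>The cubic form in coordinates\<close>

lemma orthonormal_complete:
  fixes b :: "nat \<Rightarrow> 'e::euclidean_space"
  assumes o: "\<And>I J. I \<in> {1..DIM('e)} \<Longrightarrow> J \<in> {1..DIM('e)} \<Longrightarrow> b I \<bullet> b J = (if I = J then 1 else 0)"
    and v: "\<And>I. I \<in> {1..DIM('e)} \<Longrightarrow> v \<bullet> b I = 0"
  shows "v = 0"
proof -
  let ?N = "{1..DIM('e)}"
  have inj: "inj_on b ?N" by (intro inj_onI) (metis o zero_neq_one)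
  have "pairwise orthogonal (b ` ?N)" using o by (auto simp: pairwise_def orthogonal_def)
  moreover have "0 \<notin> b ` ?N" using o by (metis imageE inner_zero_left zero_neq_one)
  ultimately have "independent (b ` ?N)" by (rule pairwise_orthogonal_independent)
  moreover have "card (b ` ?N) = dim (UNIV :: 'e set)" using card_image[OF inj] by simp
  ultimately have "UNIV \<subseteq> span (b ` ?N)" using card_eq_dim[of "b ` ?N" UNIV] by auto
  then have "v \<in> span (b ` ?N)" by blast
  moreover have "orthogonal v x" if "x \<in> b ` ?N" for x using that v by (auto simp: orthogonal_def)
  ultimately have "orthogonal v v" using orthogonal_to_span by blast
  then show ?thesis by (simp add: orthogonal_def)
qed

lemma orthonormal_expand:
  fixes b :: "nat \<Rightarrow> 'e::euclidean_space"
  assumes o: "\<And>I J. I \<in> {1..DIM('e)} \<Longrightarrow> J \<in> {1..DIM('e)} \<Longrightarrow> b I \<bullet> b J = (if I = J then 1 else 0)"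
  shows "(\<Sum>I=1..DIM('e). (v \<bullet> b I) *\<^sub>R b I) = v"
proof -
  have "v - (\<Sum>I=1..DIM('e). (v \<bullet> b I) *\<^sub>R b I) = 0"
  proof (rule orthonormal_complete[OF o])
    fix J assume J: "J \<in> {1..DIM('e)}"
    have "(\<Sum>I=1..DIM('e). (v \<bullet> b I) *\<^sub>R b I) \<bullet> b J = (\<Sum>I=1..DIM('e). if I = J then v \<bullet> b J else 0)"
      unfolding inner_sum_left by (rule sum.cong) (use o J in auto)
    then show "(v - (\<Sum>I=1..DIM('e). (v \<bullet> b I) *\<^sub>R b I)) \<bullet> b J = 0" using J by (simp add: inner_diff_left)
  qed auto
  then show ?thesis by simp
qed

lemma four_eq [simp]: "(4 :: 3) = 1"
  using three_numerals(4) by simp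

context herm3 begin

text \<open>The expansion of a hermitian 3 by 3 determinant: the diagonal cubic, each off-diagonal
  norm times the opposite diagonal entry, here \<open>2 * (x \<bullet> c i)\<close>, and the triple
  product.\<close>

lemma cubic_decomp: "(x \<diamondop> x) \<bullet> x = (csum x \<diamondop> csum x) \<bullet> csum x - 3 * (\<Sum>i\<in>UNIV. (x \<bullet> c i) * (\<pi> i x \<bullet> \<pi> i x))
   + 3 * sqrt 3 * ((\<pi> 0 x \<star> \<pi> 1 x \<star> \<pi> 2 x) \<bullet> one)"
proof -
  let ?v = "csum x" and ?r = "(\<pi> 0 x \<star> \<pi> 1 x \<star> \<pi> 2 x) \<bullet> one"
  have cy: "cnj (\<pi> (i + 1) x \<star> \<pi> (i + 2) x) \<bullet> \<pi> i x = ?r" for i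
  proof -
    have "\<forall>i. cnj (\<pi> (i + 1) x \<star> \<pi> (i + 2) x) \<bullet> \<pi> i x = ?r"
      unfolding all_3 Re_cnj[symmetric]
      using Re_cyc[of "\<pi> 0 x" "\<pi> 1 x" "\<pi> 2 x"] Re_cyc[of "\<pi> 1 x" "\<pi> 2 x" "\<pi> 0 x"] by simp
    then show ?thesis ..
  qed
  have "(\<Sum>i\<in>UNIV. \<iota> i (\<pi> i x)) \<bullet> (x \<diamondop> x) = (\<Sum>i\<in>UNIV. \<pi> i (x \<diamondop> x) \<bullet> \<pi> i x)"
    unfolding inner_sum_left by (simp only: inner_commute[of "\<iota> _ _"] \<pi>_inner)
  also have "\<dots> = - 2 * (\<Sum>i\<in>UNIV. (x \<bullet> c i) * (\<pi> i x \<bullet> \<pi> i x)) + 3 * sqrt 3 * ?r"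
    unfolding \<pi>_square inner_add_left inner_scaleR_left cy sum.distrib by (simp add: sum_distrib_left mult.assoc sum_negf)
  finally have 1: "(\<Sum>i\<in>UNIV. \<iota> i (\<pi> i x)) \<bullet> (x \<diamondop> x) = - 2 * (\<Sum>i\<in>UNIV. (x \<bullet> c i) * (\<pi> i x \<bullet> \<pi> i x)) + 3 * sqrt 3 * ?r" .
  have vx: "?v \<diamondop> x = ?v \<diamondop> ?v - (\<Sum>i\<in>UNIV. (x \<bullet> c i) *\<^sub>R \<iota> i (\<pi> i x))"
    by (subst (2) decomp[of x]) (simp add: P_bil P.sum_right csum_mult_\<iota> sum_negf)
  have vi: "?v \<bullet> \<iota> i z = 0" for i z by (simp add: csum_def inner_sum_left)
  have vvi: "(?v \<diamondop> ?v) \<bullet> \<iota> i z = 0" for i z by (simp add: P_sym csum_mult_\<iota> vi)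
  have "?v \<bullet> (x \<diamondop> x) = x \<bullet> (?v \<diamondop> x)" using P_sym[of x ?v x] P_comm[of x ?v] inner_commute[of x "?v \<diamondop> x"] by simp
  also have "\<dots> = x \<bullet> (?v \<diamondop> ?v) - (\<Sum>i\<in>UNIV. (x \<bullet> c i) * (\<pi> i x \<bullet> \<pi> i x))"
    unfolding vx by (simp add: inner_diff_right inner_sum_right \<pi>_inner')
  also have "x \<bullet> (?v \<diamondop> ?v) = ?v \<bullet> (?v \<diamondop> ?v)"
    by (subst decomp[of x]) (simp add: inner_add_left inner_sum_left inner_commute[of "\<iota> _ _"] vvi)
  finally have 2: "?v \<bullet> (x \<diamondop> x) = ?v \<bullet> (?v \<diamondop> ?v) - (\<Sum>i\<in>UNIV. (x \<bullet> c i) * (\<pi> i x \<bullet> \<pi> i x))" .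
  have "(x \<diamondop> x) \<bullet> x = ?v \<bullet> (x \<diamondop> x) + (\<Sum>i\<in>UNIV. \<iota> i (\<pi> i x)) \<bullet> (x \<diamondop> x)"
    by (subst (3) decomp[of x]) (simp add: inner_add_right inner_commute)
  then show ?thesis unfolding 1 2 by (simp add: inner_commute)
qed

text \<open>The plane is parametrised by the orthonormal pair \<open>c 2\<close> and
  \<open>(1 / sqrt 3) *\<^sub>R (c 1 - c 0)\<close>, matching the diagonal directions of the model
  matrix. On it the cubic form is the real part of the cube of the complex number with parts
  \<open>a\<close> and \<open>d\<close>.\<close>

lemma frame_cubic:
  assumes x: "x = a *\<^sub>R c 2 + d *\<^sub>R ((1 / sqrt 3) *\<^sub>R (c 1 - c 0)) + \<iota> 0 X + \<iota> 1 Y + \<iota> 2 Z"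
  shows "(x \<diamondop> x) \<bullet> x = a^3 - 3 * a * d^2 + (3/2) * (a + sqrt 3 * d) * (X \<bullet> X) + (3/2) * (a - sqrt 3 * d) * (Y \<bullet> Y)
     - 3 * a * (Z \<bullet> Z) + 3 * sqrt 3 * ((X \<star> Y \<star> Z) \<bullet> one)"
proof -
  let ?f = "(1 / sqrt 3) *\<^sub>R (c 1 - c 0)"
  have ip: "c 0 \<bullet> c 1 = - 1/2" "c 1 \<bullet> c 0 = - 1/2" "c 0 \<bullet> c 2 = - 1/2" "c 2 \<bullet> c 0 = - 1/2" "c 1 \<bullet> c 2 = - 1/2" "c 2 \<bullet> c 1 = - 1/2"
    using c_inner[of 0] c_inner[of 1] by simp_all
  have pd: "c 0 \<diamondop> c 1 = c 2" "c 1 \<diamondop> c 0 = c 2" "c 2 \<diamondop> c 0 = c 1" "c 0 \<diamondop> c 2 = c 1" "c 2 \<diamondop> c 1 = c 0" "c 1 \<diamondop> c 2 = c 0"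
    using c_prod[of 0] c_prod[of 1] by simp_all
  have cs: "csum x = a *\<^sub>R c 2 + d *\<^sub>R ?f"
    unfolding x by (simp add: linear_add[OF csum_linear] linear_scale[OF csum_linear] linear_diff[OF csum_linear])
  have p: "\<pi> 0 x = X" "\<pi> 1 x = Y" "\<pi> 2 x = Z"
    unfolding x by (simp_all add: linear_add[OF \<pi>_linear] linear_scale[OF \<pi>_linear] linear_diff[OF \<pi>_linear] \<pi>_\<iota>)
  have s: "sqrt 3 * sqrt 3 = 3" by simp
  have xc: "x \<bullet> c 2 = a" "x \<bullet> c 0 = - a/2 - (sqrt 3 / 2) * d" "x \<bullet> c 1 = - a/2 + (sqrt 3 / 2) * d"
    unfolding x by (simp_all add: inner_add_left inner_diff_left ip field_simps)
  have f: "?f \<diamondop> ?f = - c 2" "c 2 \<diamondop> ?f = - ?f" "?f \<bullet> ?f = 1" "c 2 \<bullet> ?f = 0"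
  proof -
    have "c 1 + c 0 = - c 2" using c_sum[of 0] by (simp add: eq_neg_iff_add_eq_0 add_ac)
    then have "(c 1 - c 0) \<diamondop> (c 1 - c 0) = - 3 *\<^sub>R c 2"
      by (simp add: P_bil pd) (simp add: scaleR_conv_of_real euclidean_eq_iff[where 'a = 'e] inner_add_left inner_diff_left algebra_simps)
    then show "?f \<diamondop> ?f = - c 2" by (simp only: P.scaleR_left P.scaleR_right) simp
    show "c 2 \<diamondop> ?f = - ?f" by (simp add: P_bil pd flip: scaleR_minus_right)
    show "?f \<bullet> ?f = 1" "c 2 \<bullet> ?f = 0" by (simp_all add: inner_diff_left inner_diff_right ip s)
  qed
  have cc: "(csum x \<diamondop> csum x) \<bullet> csum x = a^3 - 3 * a * d^2"
  proof -
    have "(u \<diamondop> u) \<bullet> u = a^3 - 3 * a * d^2" if "u = a *\<^sub>R c 2 + d *\<^sub>R g" "g \<diamondop> g = - c 2" "c 2 \<diamondop> g = - g" "g \<bullet> g = 1" "c 2 \<bullet> g = 0" for u g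
      unfolding that(1) by (simp add: P_bil that(2-) P_comm[of g "c 2"] inner_add_left inner_add_right inner_commute[of g "c 2"]
          power2_eq_square power3_eq_cube algebra_simps)
    from this[OF cs f] show ?thesis .
  qed
  show ?thesis
    unfolding cubic_decomp[of x] cc sum_3_from[of _ 0]
    by (simp add: p xc algebra_simps)
qed

end

section \<open>Explicit adapted frames\<close>

lemma sum_1_14: "(\<Sum>I=1..14. f I) = f 1 + f 2 + f 3 + f 4 + f 5 + f 6 + f 7 + f 8 + f 9 + f 10 + f 11 + f 12 + f 13 + f (14 :: nat)"
  for f :: "nat \<Rightarrow> 'b::real_vector"
  by (simp add: eval_nat_numeral)

lemma sum_1_5: "(\<Sum>I=1..5. f I) = f 1 + f 2 + f 3 + f 4 + f (5 :: nat)"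
  for f :: "nat \<Rightarrow> 'b::real_vector"
  by (simp add: eval_nat_numeral)

context peirce_seed begin

text \<open>The order is that of the coordinates of the model matrix, shifted by one since lists
  start at 0. The fifth vector is \<open>- c 2\<close> because that coordinate enters with diagonal
  (1, 1, -2). The signs of the \<rho>-vectors come from the conjugated coordinate on
  \<open>V 2\<close>.\<close>

definition frame :: "'e \<Rightarrow> 'e \<Rightarrow> nat \<Rightarrow> 'e" where
  "frame p1 p2 I = [p, w, B p w, (1 / sqrt 3) *\<^sub>R (c 1 - c 0), - c 2, p1, \<sigma> p1, - \<rho> p1, p2, m p1 p2,
     \<sigma> p2, \<sigma> (m p1 p2), - \<rho> p2, - \<rho> (m p1 p2)] ! (I - 1)"

lemma frame_simps: "frame p1 p2 1 = p" "frame p1 p2 2 = w" "frame p1 p2 3 = B p w"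
  "frame p1 p2 4 = (1 / sqrt 3) *\<^sub>R (c 1 - c 0)" "frame p1 p2 5 = - c 2" "frame p1 p2 6 = p1" "frame p1 p2 7 = \<sigma> p1"
  "frame p1 p2 8 = - \<rho> p1" "frame p1 p2 9 = p2" "frame p1 p2 10 = m p1 p2" "frame p1 p2 11 = \<sigma> p2"
  "frame p1 p2 12 = \<sigma> (m p1 p2)" "frame p1 p2 13 = - \<rho> p2" "frame p1 p2 14 = - \<rho> (m p1 p2)"
  by (simp_all add: frame_def)

lemma cc_inner: "c 0 \<bullet> c 1 = - 1/2" "c 1 \<bullet> c 0 = - 1/2" "c 0 \<bullet> c 2 = - 1/2" "c 2 \<bullet> c 0 = - 1/2" "c 1 \<bullet> c 2 = - 1/2" "c 2 \<bullet> c 1 = - 1/2"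
  using c_inner[of 0] c_inner[of 1] by simp_all

lemma frame_real: assumes n: "DIM('e) = 5"
  shows frame_real_orthonormal: "\<And>I J. I \<in> {1..5} \<Longrightarrow> J \<in> {1..5} \<Longrightarrow> frame p1 p2 I \<bullet> frame p1 p2 J = (if I = J then 1 else 0)"
    and frame_real_herm: "\<exists>\<iota>. herm3 (*) (1::real) (\<lambda>x. x) P c \<iota>"
    and frame_real_cubic: "let y = (\<Sum>I=1..5. x I *\<^sub>R frame p1 p2 I) in (y \<diamondop> y) \<bullet> y = model_cubic 1 x"
proof -
  let ?f = "(1 / sqrt 3) *\<^sub>R (c 1 - c 0)"
  have o: "p \<bullet> w = 0" "p \<bullet> B p w = 0" "w \<bullet> B p w = 0" "p \<bullet> c i = 0" "w \<bullet> c i = 0" "B p w \<bullet> c i = 0" for i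
    using V_orth[OF p_V w_V] V_orth[OF p_V pw_V] V_orth[OF w_V pw_V] V_inner_c[OF p_V] V_inner_c[OF w_V] V_inner_c[OF pw_V]
    by simp_all
  have o': "w \<bullet> p = 0" "B p w \<bullet> p = 0" "B p w \<bullet> w = 0" "c i \<bullet> p = 0" "c i \<bullet> w = 0" "c i \<bullet> B p w = 0" for i
    using o by (simp_all add: inner_commute)
  have ff: "?f \<bullet> ?f = 1" "?f \<bullet> c 2 = 0" "c 2 \<bullet> ?f = 0" by (simp_all add: inner_diff_left inner_diff_right cc_inner)
  show on: "frame p1 p2 I \<bullet> frame p1 p2 J = (if I = J then 1 else 0)" if "I \<in> {1..5}" "J \<in> {1..5}" for I J
  proof -
    have "I = 1 \<or> I = 2 \<or> I = 3 \<or> I = 4 \<or> I = 5" "J = 1 \<or> J = 2 \<or> J = 3 \<or> J = 4 \<or> J = 5" using that by auto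
    then show ?thesis
      using ff by (elim disjE) (simp_all add: frame_simps[simplified] o o' inner_diff_left inner_diff_right p_norm w_norm pw_norm cc_inner)
  qed
  define \<iota>0 where "\<iota>0 r = r *\<^sub>R p" for r :: real
  have H: "herm3 (*) (1::real) (\<lambda>x. x) P c (\<lambda>i x. if i = 0 then \<iota>0 x else if i = 1 then \<sigma> (\<iota>0 x) else \<rho> (\<iota>0 x))"
  proof (rule herm3_if_multiplicative)
    show "\<iota>0 (x * y) = m (\<iota>0 x) (\<iota>0 y)" for x y by (simp add: \<iota>0_def m_bil m_left[OF p_V])
    show "\<iota>0 x \<in> V 0" for x unfolding \<iota>0_def by (rule subspace_scale[OF V_subspace p_V])
    fix v assume a: "\<And>i. v \<bullet> c i = 0" "\<And>x. v \<bullet> \<iota>0 x = 0" "\<And>x. v \<bullet> \<sigma> (\<iota>0 x) = 0" "\<And>x. v \<bullet> \<rho> (\<iota>0 x) = 0"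
    show "v = 0"
    proof (rule orthonormal_complete[of "frame p1 p2"])
      fix I assume "I \<in> {1..DIM('e)}"
      then have "I = 1 \<or> I = 2 \<or> I = 3 \<or> I = 4 \<or> I = 5" using n by auto
      then show "v \<bullet> frame p1 p2 I = 0"
        using a(1) a(2-4)[of 1] by (elim disjE) (simp_all add: frame_simps[simplified] \<iota>0_def \<sigma>_p \<rho>_p inner_diff_right)
    qed (simp add: on n)
  qed (auto simp: \<iota>0_def p_norm real_alg.comp_alg_axioms linear_ident intro!: linearI scaleR_add_left)
  then show "\<exists>\<iota>. herm3 (*) (1::real) (\<lambda>x. x) P c \<iota>" by blast
  interpret H: herm3 "(*)" "1::real" "\<lambda>x. x" P c "\<lambda>i x. if i = 0 then \<iota>0 x else if i = 1 then \<sigma> (\<iota>0 x) else \<rho> (\<iota>0 x)" by (rule H)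
  let ?y = "\<Sum>I=1..5. x I *\<^sub>R frame p1 p2 I"
  have s: "\<sigma> (r *\<^sub>R p) = r *\<^sub>R w" "\<rho> (r *\<^sub>R p) = r *\<^sub>R B p w" for r
    using \<sigma>_p \<rho>_p by (simp_all add: \<sigma>_def \<rho>_def B_bil)
  have "?y = (- x 5) *\<^sub>R c 2 + x 4 *\<^sub>R ?f + (if (0::3) = 0 then \<iota>0 (x 1) else if (0::3) = 1 then \<sigma> (\<iota>0 (x 1)) else \<rho> (\<iota>0 (x 1)))
    + (if (1::3) = 0 then \<iota>0 (x 2) else if (1::3) = 1 then \<sigma> (\<iota>0 (x 2)) else \<rho> (\<iota>0 (x 2)))
    + (if (2::3) = 0 then \<iota>0 (x 3) else if (2::3) = 1 then \<sigma> (\<iota>0 (x 3)) else \<rho> (\<iota>0 (x 3)))"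
    unfolding sum_1_5 frame_simps by (simp add: s \<iota>0_def)
  from H.frame_cubic[OF this] show "let y = (\<Sum>I=1..5. x I *\<^sub>R frame p1 p2 I) in (y \<diamondop> y) \<bullet> y = model_cubic 1 x"
    unfolding Let_def by (simp add: model_cubic_def dim_n_def power2_eq_square power3_eq_cube algebra_simps)
qed

end

context peirce_seed begin

lemma \<sigma>_linear: "\<sigma> (x + y) = \<sigma> x + \<sigma> y" "\<sigma> (r *\<^sub>R x) = r *\<^sub>R \<sigma> x" "\<sigma> (- x) = - \<sigma> x" "\<sigma> (x - y) = \<sigma> x - \<sigma> y"
  by (simp_all add: \<sigma>_def B_def P_bil scaleR_add_right scaleR_diff_right)

lemma \<rho>_linear: "\<rho> (x + y) = \<rho> x + \<rho> y" "\<rho> (r *\<^sub>R x) = r *\<^sub>R \<rho> x" "\<rho> (- x) = - \<rho> x" "\<rho> (x - y) = \<rho> x - \<rho> y"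
  by (simp_all add: \<rho>_def B_def P_bil scaleR_add_right scaleR_diff_right)

text \<open>Hurwitz: \<open>p\<close>, two further orthonormal vectors and their product multiply like the quaternion units.\<close>

lemma quat_table:
  assumes V: "p1 \<in> V 0" "p2 \<in> V 0" and o: "p1 \<bullet> p1 = 1" "p2 \<bullet> p2 = 1" "p1 \<bullet> p = 0" "p2 \<bullet> p = 0" "p1 \<bullet> p2 = 0"
  defines "p3 \<equiv> m p1 p2"
  shows "p3 \<in> V 0" "p3 \<bullet> p3 = 1" "p3 \<bullet> p = 0" "p3 \<bullet> p1 = 0" "p3 \<bullet> p2 = 0"
    "m p1 p1 = - p" "m p2 p2 = - p" "m p3 p3 = - p" "m p1 p2 = p3" "m p2 p1 = - p3"
    "m p1 p3 = - p2" "m p3 p1 = p2" "m p2 p3 = p1" "m p3 p2 = - p1"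
proof -
  show V3: "p3 \<in> V 0" unfolding p3_def by (rule m_V[OF V])
  show n3: "p3 \<bullet> p3 = 1" unfolding p3_def using m_iso_right[OF V V(2)] o by simp
  show o3: "p3 \<bullet> p = 0" unfolding p3_def using m_skew_left[OF V p_V o(3)] m_right[OF V(1)] o(5) by (simp add: inner_commute)
  show o31: "p3 \<bullet> p1 = 0" unfolding p3_def using m_iso_right[OF V(1,2) p_V] m_right[OF V(1)] o by simp
  show o32: "p3 \<bullet> p2 = 0" unfolding p3_def using m_iso_left[OF V(1) p_V V(2)] m_left[OF V(2)] o by simp
  have sq: "m x x = - p" if "x \<in> V 0" "x \<bullet> x = 1" "x \<bullet> p = 0" for x
    using m_alt_left[OF that(1) p_V that(3)] by (simp add: m_right that)
  show "m p1 p1 = - p" "m p2 p2 = - p" "m p3 p3 = - p" using sq V V3 o n3 o3 by auto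
  show "m p1 p2 = p3" by (simp add: p3_def)
  show "m p2 p1 = - p3" unfolding p3_def using m_anti[OF V(2,1) o(4,3)] o(5) by (simp add: inner_commute)
  show 13: "m p1 p3 = - p2" unfolding p3_def using m_alt_left[OF V o(3)] o by simp
  show 32: "m p3 p2 = - p1" unfolding p3_def using m_alt_right[OF V(2,1) o(4)] o by simp
  show "m p3 p1 = p2" using m_anti[OF V3 V(1) o3 o(3) o31] 13 by simp
  show "m p2 p3 = p1" using m_anti[OF V(2) V3 o(4) o3] o32 32 by (simp add: inner_commute)
qed

lemma frame_quat:
  assumes n: "DIM('e) = 14"
    and V: "p1 \<in> V 0" "p2 \<in> V 0" and o: "p1 \<bullet> p1 = 1" "p2 \<bullet> p2 = 1" "p1 \<bullet> p = 0" "p2 \<bullet> p = 0" "p1 \<bullet> p2 = 0"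
  shows frame_quat_orthonormal: "\<And>I J. I \<in> {1..14} \<Longrightarrow> J \<in> {1..14} \<Longrightarrow> frame p1 p2 I \<bullet> frame p1 p2 J = (if I = J then 1 else 0)"
    and frame_quat_herm: "\<exists>\<iota>. herm3 qmul qone qcnj P c \<iota>"
    and frame_quat_cubic: "let y = (\<Sum>I=1..14. x I *\<^sub>R frame p1 p2 I) in (y \<diamondop> y) \<bullet> y = model_cubic 4 x"
proof -
  let ?f = "(1 / sqrt 3) *\<^sub>R (c 1 - c 0)"
  let ?p3 = "m p1 p2"
  note t = quat_table[OF V o]
  have ff: "?f \<bullet> ?f = 1" "?f \<bullet> c 2 = 0" by (simp_all add: inner_diff_left inner_diff_right cc_inner)
  have B1: "B p w = \<rho> p" by (simp add: \<rho>_p)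
  define q where "q r = (if r = 0 then p else if r = 1 then p1 else if r = 2 then p2 else ?p3)" for r :: nat
  have qV: "q r \<in> V 0" for r using p_V V t(1) by (simp add: q_def)
  have qo: "q r \<bullet> q s = (if r = s then 1 else 0)" if "r < 4" "s < 4" for r s
  proof -
    have "r = 0 \<or> r = 1 \<or> r = 2 \<or> r = 3" "s = 0 \<or> s = 1 \<or> s = 2 \<or> s = 3" using that by auto
    then show ?thesis using t(2-5) o p_norm by (elim disjE) (simp_all add: q_def inner_commute)
  qed
  \<comment> \<open>Each frame vector is a sign times a vector addressed by a block (three Peirce
    spaces and two directions of the plane) and a unit. Orthonormality of all pairs then reduces to
    injectivity of the address and one statement about blocks.\<close>
  define sel :: "nat \<Rightarrow> nat \<times> nat \<times> real" where
    "sel I = [(0, 0, 1), (1, 0, 1), (2, 0, 1), (3, 0, 1), (4, 0, -1), (0, 1, 1), (1, 1, 1), (2, 1, -1), (0, 2, 1), (0, 3, 1),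
       (1, 2, 1), (1, 3, 1), (2, 2, -1), (2, 3, -1)] ! (I - 1)" for I
  define vec where "vec k r = (if k = 0 then q r else if k = 1 then \<sigma> (q r) else if k = 2 then \<rho> (q r) else if k = 3 then ?f else c 2)" for k r :: nat
  have Icases: "I = 1 \<or> I = 2 \<or> I = 3 \<or> I = 4 \<or> I = 5 \<or> I = 6 \<or> I = 7 \<or> I = 8 \<or> I = 9 \<or> I = 10 \<or> I = 11 \<or> I = 12 \<or> I = 13 \<or> I = 14"
    if "I \<in> {1..14}" for I :: nat using that unfolding atLeastAtMost_iff by presburger
  have fr: "frame p1 p2 I = snd (snd (sel I)) *\<^sub>R vec (fst (sel I)) (fst (snd (sel I)))
     \<and> fst (snd (sel I)) < 4 \<and> fst (sel I) < 5 \<and> snd (snd (sel I)) * snd (snd (sel I)) = 1 \<and> (fst (sel I) \<ge> 3 \<longrightarrow> fst (snd (sel I)) = 0)"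
    if "I \<in> {1..14}" for I
    using Icases[OF that] by (elim disjE) (simp_all add: frame_def sel_def vec_def q_def B1 \<sigma>_p)
  have sel_eq: "fst (sel I) = fst (sel J) \<Longrightarrow> fst (snd (sel I)) = fst (snd (sel J)) \<Longrightarrow> I = J"
    if "I \<in> {1..14}" "J \<in> {1..14}" for I J
    using Icases[OF that(1)] Icases[OF that(2)] by (elim disjE; simp add: sel_def)
  have vo: "vec k r \<bullet> vec l s = (if k = l \<and> r = s then 1 else 0)"
    if "r < 4" "s < 4" "k < 5" "l < 5" "k \<ge> 3 \<longrightarrow> r = 0" "l \<ge> 3 \<longrightarrow> s = 0" for k l r s
  proof -
    have z: "q r \<bullet> \<sigma> (q s) = 0" "q r \<bullet> \<rho> (q s) = 0" "\<sigma> (q r) \<bullet> \<rho> (q s) = 0"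
      "q r \<bullet> c i = 0" "\<sigma> (q r) \<bullet> c i = 0" "\<rho> (q r) \<bullet> c i = 0" for r s i
      using V_orth[OF qV \<sigma>_V[OF qV]] V_orth[OF qV \<rho>_V[OF qV]] V_orth[OF \<sigma>_V[OF qV] \<rho>_V[OF qV]]
        V_inner_c[OF qV] V_inner_c[OF \<sigma>_V[OF qV]] V_inner_c[OF \<rho>_V[OF qV]] by simp_all
    have z': "\<sigma> (q s) \<bullet> q r = 0" "\<rho> (q s) \<bullet> q r = 0" "\<rho> (q s) \<bullet> \<sigma> (q r) = 0"
      "c i \<bullet> q r = 0" "c i \<bullet> \<sigma> (q r) = 0" "c i \<bullet> \<rho> (q r) = 0" for r s i
      using z by (simp_all add: inner_commute)
    have k: "k = 0 \<or> k = 1 \<or> k = 2 \<or> k = 3 \<or> k = 4" "l = 0 \<or> l = 1 \<or> l = 2 \<or> l = 3 \<or> l = 4" using that(3,4) by auto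
    show ?thesis using k that ff
      by (elim disjE) (simp_all add: vec_def qo \<sigma>_iso[OF qV] \<rho>_iso[OF qV] z z' inner_diff_left inner_diff_right cc_inner)
  qed
  show on: "frame p1 p2 I \<bullet> frame p1 p2 J = (if I = J then 1 else 0)" if "I \<in> {1..14}" "J \<in> {1..14}" for I J
    using fr[OF that(1)] fr[OF that(2)] vo[of "fst (snd (sel I))" "fst (snd (sel J))" "fst (sel I)" "fst (sel J)"] sel_eq[OF that]
    by auto
  define \<iota>0 :: "quat \<Rightarrow> 'e" where "\<iota>0 x = (case x of (a, b, c, d) \<Rightarrow> a *\<^sub>R p + b *\<^sub>R p1 + c *\<^sub>R p2 + d *\<^sub>R ?p3)" for x
  have \<iota>0: "\<iota>0 (a, b, c, d) = a *\<^sub>R p + b *\<^sub>R p1 + c *\<^sub>R p2 + d *\<^sub>R ?p3" for a b c d by (simp add: \<iota>0_def)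
  let ?\<iota> = "\<lambda>i x. if i = (0::3) then \<iota>0 x else if i = 1 then \<sigma> (\<iota>0 (qcnj x)) else \<rho> (\<iota>0 (qcnj x))"
  have H: "herm3 qmul qone qcnj P c ?\<iota>"
  proof (rule herm3_if_multiplicative)
    show "linear \<iota>0" by (rule linearI) (auto simp: \<iota>0 algebra_simps)
    show "linear qcnj" by (rule linearI) (auto simp: qcnj_def)
    fix x y :: quat
    obtain x0 x1 x2 x3 y0 y1 y2 y3 where xy: "x = (x0, x1, x2, x3)" "y = (y0, y1, y2, y3)" by (metis prod_cases4)
    show "\<iota>0 x \<bullet> \<iota>0 y = x \<bullet> y"
      unfolding xy \<iota>0 using t(2-5) o p_norm
      by (simp add: inner_add_left inner_add_right inner_commute[of p p1] inner_commute[of p p2] inner_commute[of p2 p1]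
          inner_commute[of p ?p3] inner_commute[of p1 ?p3] inner_commute[of p2 ?p3])
    show "\<iota>0 (qmul x y) = m (\<iota>0 x) (\<iota>0 y)"
      unfolding xy \<iota>0 qmul_def prod.case m_bil
      by (simp add: t(6-8,10-14) m_left[OF p_V] m_left[OF V(1)] m_left[OF V(2)] m_left[OF t(1)]
         m_right[OF V(1)] m_right[OF V(2)] m_right[OF t(1)] algebra_simps)
    show "\<iota>0 x \<in> V 0" unfolding xy \<iota>0
      by (intro subspace_add[OF V_subspace] subspace_scale[OF V_subspace] p_V V t(1))
  next
    fix v assume a: "\<And>i. v \<bullet> c i = 0" "\<And>x. v \<bullet> \<iota>0 x = 0" "\<And>x. v \<bullet> \<sigma> (\<iota>0 x) = 0" "\<And>x. v \<bullet> \<rho> (\<iota>0 x) = 0"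
    have u: "\<iota>0 (1, 0, 0, 0) = p" "\<iota>0 (0, 1, 0, 0) = p1" "\<iota>0 (0, 0, 1, 0) = p2" "\<iota>0 (0, 0, 0, 1) = ?p3" by (simp_all add: \<iota>0)
    note a2 = a(2)[of "(1, 0, 0, 0)"] a(2)[of "(0, 1, 0, 0)"] a(2)[of "(0, 0, 1, 0)"] a(2)[of "(0, 0, 0, 1)"]
      a(3)[of "(1, 0, 0, 0)"] a(3)[of "(0, 1, 0, 0)"] a(3)[of "(0, 0, 1, 0)"] a(3)[of "(0, 0, 0, 1)"]
      a(4)[of "(1, 0, 0, 0)"] a(4)[of "(0, 1, 0, 0)"] a(4)[of "(0, 0, 1, 0)"] a(4)[of "(0, 0, 0, 1)"]
    show "v = 0"
    proof (rule orthonormal_complete[of "frame p1 p2"])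
      fix I assume "I \<in> {1..DIM('e)}"
      then have "I \<in> {1..14}" using n by simp
      from Icases[OF this] show "v \<bullet> frame p1 p2 I = 0"
        using a2[unfolded u] a(1) by (elim disjE) (simp_all add: frame_def \<sigma>_p \<rho>_p inner_diff_right)
    qed (simp add: on n)
  qed (rule quat_alg.comp_alg_axioms)
  then show "\<exists>\<iota>. herm3 qmul qone qcnj P c \<iota>" by blast
  interpret H: herm3 qmul qone qcnj P c ?\<iota> by (rule H)
  let ?y = "\<Sum>I=1..14. x I *\<^sub>R frame p1 p2 I"
  \<comment> \<open>The second matrix entry stands above the diagonal in the corner, against the
    cyclic order, so its conjugate is the coordinate \<open>?Y\<close>.\<close>
  let ?X = "(x 1, x 6, x 9, x 10)" and ?Y = "(x 2, - x 7, - x 11, - x 12)" and ?Z = "(x 3, x 8, x 13, x 14)"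
  have "?y = (- x 5) *\<^sub>R c 2 + x 4 *\<^sub>R ?f + ?\<iota> 0 ?X + ?\<iota> 1 ?Y + ?\<iota> 2 ?Z"
    unfolding sum_1_14 frame_simps by (simp add: \<iota>0 qcnj_def \<sigma>_linear \<rho>_linear \<sigma>_p \<rho>_p)
  from H.frame_cubic[OF this] show "let y = (\<Sum>I=1..14. x I *\<^sub>R frame p1 p2 I) in (y \<diamondop> y) \<bullet> y = model_cubic 4 x"
    unfolding Let_def by (simp add: model_cubic_def dim_n_def qmul_def qone_def power2_eq_square power3_eq_cube algebra_simps)
qed

end

section \<open>Smooth functions\<close>

text \<open>A derivative at a point sees only nearby values, so on an open set agreement passes to
  derivatives of every order.\<close>

lemma Ck_on_cong:
  assumes "open S" "\<And>x. x \<in> S \<Longrightarrow> f x = g x" "Ck_on m S f" shows "Ck_on m S g"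
  using assms(2,3)
proof (induction m arbitrary: f g)
  case 0
  then show ?case using continuous_on_cong[of S S f g] by simp
next
  case (Suc m)
  have d: "(g has_derivative frechet_derivative f (at x)) (at x)" if "x \<in> S" for x
  proof (rule has_derivative_transform_within_open)
    show "(f has_derivative frechet_derivative f (at x)) (at x)"
      using Suc.prems(2) that by (simp add: frechet_derivative_works[symmetric])
  qed (use assms(1) that Suc.prems(1) in auto)
  have "frechet_derivative g (at x) = frechet_derivative f (at x)" if "x \<in> S" for x
    using frechet_derivative_at[OF d[OF that]] by simp
  then have "Ck_on m S (\<lambda>x. frechet_derivative g (at x) v)" for v
    using Suc.IH[of "\<lambda>x. frechet_derivative f (at x) v" "\<lambda>x. frechet_derivative g (at x) v"] Suc.prems(2) by simp
  moreover have "g differentiable (at x)" if "x \<in> S" for x using d[OF that] by (auto simp: differentiable_def)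
  ultimately show ?case by simp
qed

text \<open>Replaces the chosen \<open>frechet_derivative\<close> by any explicit derivative, which
  is the form most closure properties need.\<close>

lemma Ck_on_SucI:
  assumes "open S" "\<And>x. x \<in> S \<Longrightarrow> (f has_derivative f' x) (at x)" "\<And>v. Ck_on m S (\<lambda>x. f' x v)"
  shows "Ck_on (Suc m) S f"
proof -
  have "frechet_derivative f (at x) = f' x" if "x \<in> S" for x
    using frechet_derivative_at[OF assms(2)[OF that]] by simp
  then have "Ck_on m S (\<lambda>x. frechet_derivative f (at x) v)" for v
    using Ck_on_cong[OF assms(1) _ assms(3)[of v], of "\<lambda>x. frechet_derivative f (at x) v"] by simp
  moreover have "f differentiable (at x)" if "x \<in> S" for x using assms(2)[OF that] by (auto simp: differentiable_def)
  ultimately show ?thesis by simp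
qed

lemma Ck_on_SucD: "Ck_on (Suc m) S f \<Longrightarrow> x \<in> S \<Longrightarrow> (f has_derivative frechet_derivative f (at x)) (at x)"
  by (simp add: frechet_derivative_works[symmetric])

lemma Ck_on_continuous: "Ck_on m S f \<Longrightarrow> continuous_on S f"
  by (cases m) (auto intro!: continuous_at_imp_continuous_on differentiable_imp_continuous_within)

lemma Ck_on_lower: "Ck_on (Suc m) S f \<Longrightarrow> Ck_on m S f"
proof (induction m arbitrary: f)
  case 0
  then show ?case using Ck_on_continuous[OF 0] by simp
next
  case (Suc m)
  then show ?case by (auto simp del: Ck_on.simps(1))
qed

lemma Ck_on_subset: "Ck_on m S f \<Longrightarrow> T \<subseteq> S \<Longrightarrow> Ck_on m T f"
  by (induction m arbitrary: f) (auto intro: continuous_on_subset)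

lemma Ck_on_Un: "open S \<Longrightarrow> open T \<Longrightarrow> Ck_on m S f \<Longrightarrow> Ck_on m T f \<Longrightarrow> Ck_on m (S \<union> T) f"
  by (induction m arbitrary: f) (auto intro: continuous_on_open_Un)

lemma Ck_on_const: "Ck_on m S (\<lambda>x. c)"
  by (induction m arbitrary: c) auto

lemma Ck_on_add: "open S \<Longrightarrow> Ck_on m S f \<Longrightarrow> Ck_on m S g \<Longrightarrow> Ck_on m S (\<lambda>x. f x + g x)"
proof (induction m arbitrary: f g)
  case 0
  then show ?case by (simp add: continuous_on_add)
next
  case (Suc m)
  show ?case
  proof (rule Ck_on_SucI[OF Suc.prems(1)])
    show "((\<lambda>x. f x + g x) has_derivative (\<lambda>v. frechet_derivative f (at x) v + frechet_derivative g (at x) v)) (at x)"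
      if "x \<in> S" for x
      using Ck_on_SucD[OF Suc.prems(2) that] Ck_on_SucD[OF Suc.prems(3) that] by (rule has_derivative_add)
    show "Ck_on m S (\<lambda>x. frechet_derivative f (at x) v + frechet_derivative g (at x) v)" for v
      by (rule Suc.IH[OF Suc.prems(1)]) (use Suc.prems(2,3) in simp_all)
  qed
qed

lemma Ck_on_bilinear:
  assumes B: "bounded_bilinear B" and S: "open S"
  shows "Ck_on m S f \<Longrightarrow> Ck_on m S g \<Longrightarrow> Ck_on m S (\<lambda>x. B (f x) (g x))"
proof (induction m arbitrary: f g)
  case 0
  then show ?case by (simp add: bounded_bilinear.continuous_on[OF B])
next
  case (Suc m)
  show ?case
  proof (rule Ck_on_SucI[OF S])
    show "((\<lambda>x. B (f x) (g x)) has_derivative (\<lambda>v. B (f x) (frechet_derivative g (at x) v) + B (frechet_derivative f (at x) v) (g x))) (at x)"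
      if "x \<in> S" for x
      using bounded_bilinear.FDERIV[OF B Ck_on_SucD[OF Suc.prems(1) that] Ck_on_SucD[OF Suc.prems(2) that]] .
    fix v
    have d: "Ck_on m S (\<lambda>x. frechet_derivative f (at x) v)" "Ck_on m S (\<lambda>x. frechet_derivative g (at x) v)"
      using Suc.prems by simp_all
    show "Ck_on m S (\<lambda>x. B (f x) (frechet_derivative g (at x) v) + B (frechet_derivative f (at x) v) (g x))"
      by (rule Ck_on_add[OF S Suc.IH[OF Ck_on_lower[OF Suc.prems(1)] d(2)] Suc.IH[OF d(1) Ck_on_lower[OF Suc.prems(2)]]])
  qed
qed

lemma Ck_on_linear:
  assumes L: "bounded_linear L" and S: "open S"
  shows "Ck_on m S f \<Longrightarrow> Ck_on m S (\<lambda>x. L (f x))"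
proof (induction m arbitrary: f)
  case 0
  then show ?case by (simp add: bounded_linear.continuous_on[OF L])
next
  case (Suc m)
  show ?case
  proof (rule Ck_on_SucI[OF S])
    show "((\<lambda>x. L (f x)) has_derivative (\<lambda>v. L (frechet_derivative f (at x) v))) (at x)" if "x \<in> S" for x
      using bounded_linear.has_derivative[OF L Ck_on_SucD[OF Suc.prems that]] .
  qed (use Suc in simp)
qed

lemma Ck_on_ident: "open S \<Longrightarrow> Ck_on m S (\<lambda>x. x)"
  by (cases m) (auto intro!: Ck_on_SucI[where f' = "\<lambda>x v. v"] Ck_on_const continuous_on_id)

lemma Ck_on_sum: "open S \<Longrightarrow> (\<And>i. i \<in> I \<Longrightarrow> Ck_on m S (f i)) \<Longrightarrow> Ck_on m S (\<lambda>x. \<Sum>i\<in>I. f i x)"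
  by (induction I rule: infinite_finite_induct) (auto intro: Ck_on_const Ck_on_add)

lemma Ck_on_compose:
  fixes f :: "'a::euclidean_space \<Rightarrow> 'b::euclidean_space" and g :: "'b \<Rightarrow> 'c::real_normed_vector"
  assumes S: "open S" and T: "open T" and sub: "f ` S \<subseteq> T"
  shows "Ck_on m S f \<Longrightarrow> Ck_on m T g \<Longrightarrow> Ck_on m S (\<lambda>x. g (f x))"
proof (induction m arbitrary: g)
  case 0
  then show ?case using continuous_on_compose2[of T g S f] sub by simp
next
  case (Suc m)
  let ?f = "\<lambda>x. frechet_derivative f (at x)" and ?g = "\<lambda>y. frechet_derivative g (at y)"
  show ?case
  proof (rule Ck_on_SucI[OF S])
    fix x assume x: "x \<in> S"
    then have fx: "f x \<in> T" using sub by blast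
    have "((g \<circ> f) has_derivative (?g (f x) \<circ> ?f x)) (at x)"
      using diff_chain_at[OF Ck_on_SucD[OF Suc.prems(1) x] Ck_on_SucD[OF Suc.prems(2) fx]] .
    \<comment> \<open>The direction \<open>?f x v\<close> moves with \<open>x\<close>. Expanding it
      in the basis leaves derivatives of \<open>g\<close> in fixed directions, to which the
      induction hypothesis applies.\<close>
    moreover have "?g (f x) \<circ> ?f x = (\<lambda>v. \<Sum>b\<in>Basis. (?f x v \<bullet> b) *\<^sub>R ?g (f x) b)"
    proof
      fix v
      have l: "linear (?g (f x))" using has_derivative_linear[OF Ck_on_SucD[OF Suc.prems(2) fx]] .
      have "?g (f x) (?f x v) = ?g (f x) (\<Sum>b\<in>Basis. (?f x v \<bullet> b) *\<^sub>R b)" by (simp add: euclidean_representation)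
      then show "(?g (f x) \<circ> ?f x) v = (\<Sum>b\<in>Basis. (?f x v \<bullet> b) *\<^sub>R ?g (f x) b)"
        by (simp add: linear_sum[OF l] linear_scale[OF l])
    qed
    ultimately show "((\<lambda>x. g (f x)) has_derivative (\<lambda>v. \<Sum>b\<in>Basis. (?f x v \<bullet> b) *\<^sub>R ?g (f x) b)) (at x)"
      by (simp add: o_def)
  next
    fix v
    have "Ck_on m S (\<lambda>x. ?g (f x) b)" for b
      using Suc.IH[of "\<lambda>y. ?g y b"] Suc.prems Ck_on_lower[OF Suc.prems(1)] by simp
    moreover have "Ck_on m S (\<lambda>x. ?f x v \<bullet> b)" for b
      using Suc.prems(1) by (intro Ck_on_linear[OF bounded_linear_inner_left S]) simp
    ultimately show "Ck_on m S (\<lambda>x. \<Sum>b\<in>Basis. (?f x v \<bullet> b) *\<^sub>R ?g (f x) b)"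
      by (intro Ck_on_sum S Ck_on_bilinear[OF bounded_bilinear_scaleR S])
  qed
qed

lemma smooth_on_cong: "open S \<Longrightarrow> (\<And>x. x \<in> S \<Longrightarrow> f x = g x) \<Longrightarrow> smooth_on S f \<Longrightarrow> smooth_on S g"
  unfolding smooth_on_def using Ck_on_cong by blast

lemma smooth_on_subset: "smooth_on S f \<Longrightarrow> T \<subseteq> S \<Longrightarrow> smooth_on T f"
  unfolding smooth_on_def using Ck_on_subset by blast

lemma smooth_on_Un: "open S \<Longrightarrow> open T \<Longrightarrow> smooth_on S f \<Longrightarrow> smooth_on T f \<Longrightarrow> smooth_on (S \<union> T) f"
  unfolding smooth_on_def using Ck_on_Un by blast

lemma smooth_on_const: "smooth_on S (\<lambda>x. c)"
  unfolding smooth_on_def using Ck_on_const by blast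

lemma smooth_on_ident: "open S \<Longrightarrow> smooth_on S (\<lambda>x. x)"
  unfolding smooth_on_def using Ck_on_ident by blast

lemma smooth_on_add: "open S \<Longrightarrow> smooth_on S f \<Longrightarrow> smooth_on S g \<Longrightarrow> smooth_on S (\<lambda>x. f x + g x)"
  unfolding smooth_on_def using Ck_on_add by blast

lemma smooth_on_sum:
  assumes "open S" "\<And>i. i \<in> I \<Longrightarrow> smooth_on S (f i)" shows "smooth_on S (\<lambda>x. \<Sum>i\<in>I. f i x)"
  unfolding smooth_on_def
proof
  show "Ck_on m S (\<lambda>x. \<Sum>i\<in>I. f i x)" for m
    by (rule Ck_on_sum[OF assms(1)]) (use assms(2) in \<open>simp add: smooth_on_def\<close>)
qed

lemma smooth_on_bilinear: "bounded_bilinear B \<Longrightarrow> open S \<Longrightarrow> smooth_on S f \<Longrightarrow> smooth_on S g \<Longrightarrow> smooth_on S (\<lambda>x. B (f x) (g x))"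
  unfolding smooth_on_def using Ck_on_bilinear by blast

lemmas smooth_on_scaleR = smooth_on_bilinear[OF bounded_bilinear_scaleR]
  and smooth_on_inner = smooth_on_bilinear[OF bounded_bilinear_inner]

lemma smooth_on_mult:
  "open S \<Longrightarrow> smooth_on S f \<Longrightarrow> smooth_on S g \<Longrightarrow> smooth_on S (\<lambda>x. f x * g x)"
  for f g :: "'e::euclidean_space \<Rightarrow> real"
  by (rule smooth_on_bilinear[OF bounded_bilinear_mult])

lemma smooth_on_linear: "bounded_linear L \<Longrightarrow> open S \<Longrightarrow> smooth_on S f \<Longrightarrow> smooth_on S (\<lambda>x. L (f x))"
  unfolding smooth_on_def using Ck_on_linear by blast

lemma smooth_on_minus: "open S \<Longrightarrow> smooth_on S f \<Longrightarrow> smooth_on S (\<lambda>x. - f x)"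
  by (rule smooth_on_linear[OF bounded_linear_minus[OF bounded_linear_ident]])

lemma smooth_on_diff: assumes "open S" "smooth_on S f" "smooth_on S g" shows "smooth_on S (\<lambda>x. f x - g x)"
  unfolding diff_conv_add_uminus
  by (rule smooth_on_add[OF assms(1,2) smooth_on_minus[OF assms(1,3)]])

lemma smooth_on_compose:
  fixes f :: "'a::euclidean_space \<Rightarrow> 'b::euclidean_space" and g :: "'b \<Rightarrow> 'c::real_normed_vector"
  assumes "open S" "open T" "f ` S \<subseteq> T" "smooth_on S f" "smooth_on T g"
  shows "smooth_on S (\<lambda>x. g (f x))"
  using assms unfolding smooth_on_def by (auto intro: Ck_on_compose)

lemma smooth_on_frechet: "smooth_on S f \<Longrightarrow> smooth_on S (\<lambda>x. frechet_derivative f (at x) v)"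
  unfolding smooth_on_def using Ck_on.simps(2) by blast

lemma smooth_on_has_derivative: "smooth_on S f \<Longrightarrow> x \<in> S \<Longrightarrow> (f has_derivative frechet_derivative f (at x)) (at x)"
  unfolding smooth_on_def using Ck_on_SucD by blast

lemma smooth_on_continuous: "smooth_on S f \<Longrightarrow> continuous_on S f"
  unfolding smooth_on_def using Ck_on_continuous by blast

section \<open>Smoothness of elementary functions\<close>

lemma Ck_on_real_SucI:
  fixes f :: "real \<Rightarrow> 'b::real_normed_vector"
  assumes "open S" "\<And>x. x \<in> S \<Longrightarrow> (f has_vector_derivative f' x) (at x)" "Ck_on m S f'"
  shows "Ck_on (Suc m) S f"
  using assms(2) unfolding has_vector_derivative_def
  by (intro Ck_on_SucI[OF assms(1)]) (auto intro!: Ck_on_bilinear[OF bounded_bilinear_scaleR assms(1)] Ck_on_const assms(3))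

text \<open>The derivative is built from the function itself, so the order of smoothness rises by
  induction; \<open>sqrt\<close> and the pair \<open>sin\<close>, \<open>cos\<close> are treated
  alike.\<close>

lemma smooth_inverse: "smooth_on {x::real. x \<noteq> 0} inverse"
proof -
  have o: "open {x::real. x \<noteq> 0}" by (simp add: open_Collect_neq continuous_on_id continuous_on_const)
  have "Ck_on m {x::real. x \<noteq> 0} inverse" for m
  proof (induction m)
    case 0
    show ?case by (auto intro: continuous_on_inverse continuous_on_id)
  next
    case (Suc m)
    show ?case
    proof (rule Ck_on_real_SucI[OF o])
      show "(inverse has_vector_derivative - 1 * (inverse x * inverse x)) (at x)" if "x \<in> {x::real. x \<noteq> 0}" for x
        using that DERIV_inverse[of x UNIV]
        by (simp add: has_real_derivative_iff_has_vector_derivative power2_eq_square numeral_2_eq_2)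
      show "Ck_on m {x::real. x \<noteq> 0} (\<lambda>x. - 1 * (inverse x * inverse x))"
        by (intro Ck_on_bilinear[OF bounded_bilinear_mult o] Ck_on_const Suc)
    qed
  qed
  then show ?thesis by (simp add: smooth_on_def)
qed

lemma smooth_on_inverse:
  fixes f :: "'e::euclidean_space \<Rightarrow> real"
  assumes "open S" "smooth_on S f" "\<And>x. x \<in> S \<Longrightarrow> f x \<noteq> 0" shows "smooth_on S (\<lambda>x. inverse (f x))"
  using assms by (intro smooth_on_compose[OF _ _ _ _ smooth_inverse])
    (auto simp: open_Collect_neq continuous_on_id continuous_on_const)

lemma smooth_on_divide:
  fixes f :: "'e::euclidean_space \<Rightarrow> real"
  assumes "open S" "smooth_on S f" "smooth_on S g" "\<And>x. x \<in> S \<Longrightarrow> g x \<noteq> 0" shows "smooth_on S (\<lambda>x. f x / g x)"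
  using smooth_on_mult[OF assms(1,2) smooth_on_inverse[OF assms(1,3,4)]] by (simp add: divide_inverse)

lemma Ck_on_inverse_real:
  fixes f :: "real \<Rightarrow> real"
  assumes "open S" "Ck_on m S f" "\<And>x. x \<in> S \<Longrightarrow> f x \<noteq> 0" shows "Ck_on m S (\<lambda>x. inverse (f x))"
  by (rule Ck_on_compose[OF assms(1) _ _ assms(2), where T = "{x. x \<noteq> 0}"])
    (use assms smooth_inverse in \<open>auto simp: smooth_on_def open_Collect_neq continuous_on_id continuous_on_const\<close>)

lemma smooth_sqrt: "smooth_on {0<..} sqrt"
proof -
  have "Ck_on m {0<..} sqrt" for m
  proof (induction m)
    case 0
    show ?case by (auto intro: continuous_on_real_sqrt continuous_on_id)
  next
    case (Suc m)
    show ?case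
    proof (rule Ck_on_real_SucI)
      show "(sqrt has_vector_derivative (1/2) * inverse (sqrt x)) (at x)" if "x \<in> {0<..}" for x
        using DERIV_real_sqrt[of x] that by (simp add: has_real_derivative_iff_has_vector_derivative[symmetric])
      show "Ck_on m {0<..} (\<lambda>x. (1/2) * inverse (sqrt x))"
      proof (rule Ck_on_bilinear[OF bounded_bilinear_mult _ Ck_on_const])
        show "Ck_on m {0<..} (\<lambda>x. inverse (sqrt x))" by (rule Ck_on_inverse_real[OF _ Suc]) simp_all
      qed simp
    qed auto
  qed
  then show ?thesis by (simp add: smooth_on_def)
qed

lemma smooth_on_sqrt:
  fixes f :: "'e::euclidean_space \<Rightarrow> real"
  assumes "open S" "smooth_on S f" "\<And>x. x \<in> S \<Longrightarrow> f x > 0" shows "smooth_on S (\<lambda>x. sqrt (f x))"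
  using assms by (intro smooth_on_compose[OF _ _ _ _ smooth_sqrt]) auto

lemma smooth_sin_cos: "smooth_on UNIV (sin :: real \<Rightarrow> real)" "smooth_on UNIV (cos :: real \<Rightarrow> real)"
proof -
  have "Ck_on m UNIV (sin :: real \<Rightarrow> real) \<and> Ck_on m UNIV (cos :: real \<Rightarrow> real)" for m
  proof (induction m)
    case 0
    show ?case by (auto intro: continuous_on_sin continuous_on_cos continuous_on_id)
  next
    case (Suc m)
    have "Ck_on (Suc m) UNIV (sin :: real \<Rightarrow> real)"
      using Suc by (intro Ck_on_real_SucI[where f' = cos])
        (auto simp: has_real_derivative_iff_has_vector_derivative[symmetric] intro!: DERIV_sin)
    moreover have "Ck_on (Suc m) UNIV (cos :: real \<Rightarrow> real)"
    proof (rule Ck_on_real_SucI)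
      show "(cos has_vector_derivative - 1 * sin x) (at x)" for x :: real
        using DERIV_cos[of x] by (simp add: has_real_derivative_iff_has_vector_derivative)
      show "Ck_on m UNIV (\<lambda>x::real. - 1 * sin x)"
        using Suc by (intro Ck_on_bilinear[OF bounded_bilinear_mult] Ck_on_const) auto
    qed auto
    ultimately show ?case ..
  qed
  then show "smooth_on UNIV (sin :: real \<Rightarrow> real)" "smooth_on UNIV (cos :: real \<Rightarrow> real)" by (simp_all add: smooth_on_def)
qed

lemma smooth_arccos: "smooth_on {-1<..<1} arccos"
proof -
  have sm: "smooth_on {-1<..<1} (\<lambda>x::real. - 1 * inverse (sqrt (1 - x * x)))"
  proof (intro smooth_on_mult smooth_on_inverse smooth_on_sqrt smooth_on_diff smooth_on_const smooth_on_ident)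
    fix x :: real assume "x \<in> {-1<..<1}"
    then have "x * x < 1" by (simp add: abs_square_less_1 flip: power2_eq_square) (simp add: abs_less_iff)
    then show "1 - x * x > 0" "sqrt (1 - x * x) \<noteq> 0" by auto
  qed auto
  have "Ck_on m {-1<..<1} arccos" for m
  proof (cases m)
    case 0
    then show ?thesis by (auto intro!: continuous_on_arccos continuous_on_id)
  next
    case (Suc m')
    show ?thesis unfolding Suc
    proof (rule Ck_on_real_SucI)
      show "(arccos has_vector_derivative - 1 * inverse (sqrt (1 - x * x))) (at x)" if "x \<in> {-1<..<1}" for x
        using that DERIV_arccos[of x] by (simp add: has_real_derivative_iff_has_vector_derivative power2_eq_square)
      show "Ck_on m' {-1<..<1} (\<lambda>x::real. - 1 * inverse (sqrt (1 - x * x)))" using sm by (simp add: smooth_on_def)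
    qed auto
  qed
  then show ?thesis by (simp add: smooth_on_def)
qed

text \<open>The functions \<open>exp (- 1 / t) / t ^ j\<close>, extended by 0, are closed under differentiation.\<close>

definition flat :: "nat \<Rightarrow> real \<Rightarrow> real" where
  "flat j t = (if t > 0 then exp (- 1 / t) / t ^ j else 0)"

lemma flat_tendsto: "(flat j \<longlongrightarrow> 0) (at 0)"
proof -
  have "((\<lambda>t. inverse t ^ j / exp (inverse t)) \<longlongrightarrow> (0::real)) (at_right 0)"
    by (rule filterlim_compose[OF tendsto_power_div_exp_0 filterlim_inverse_at_top_right])
  then have "(flat j \<longlongrightarrow> 0) (at_right 0)"
    by (rule filterlim_mono_eventually) (auto simp: flat_def eventually_at_filter exp_minus field_simps)
  moreover have "(flat j \<longlongrightarrow> 0) (at_left 0)"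
    by (rule tendsto_eventually) (auto simp: flat_def eventually_at_filter)
  ultimately show ?thesis by (simp add: filterlim_split_at)
qed

lemma flat_deriv: "(flat j has_real_derivative flat (j + 2) t - real j * flat (j + 1) t) (at t)"
proof -
  consider "t > 0" | "t < 0" | "t = 0" by linarith
  then show ?thesis
  proof cases
    case 1
    have "((\<lambda>t. exp (- 1 / t) / t ^ j) has_real_derivative flat (j + 2) t - real j * flat (j + 1) t) (at t)"
      using 1 by (auto intro!: derivative_eq_intros simp: flat_def field_simps power2_eq_square)
        (cases j; simp add: field_simps power_add)
    then show ?thesis
      by (rule DERIV_cong_ev[THEN iffD1, rotated -1]) (use 1 eventually_nhds_in_open[of "{0<..}" t] in \<open>auto simp: flat_def elim: eventually_mono\<close>)
  next
    case 2
    have "((\<lambda>t. 0) has_real_derivative flat (j + 2) t - real j * flat (j + 1) t) (at t)"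
      using 2 by (simp add: flat_def)
    then show ?thesis
      by (rule DERIV_cong_ev[THEN iffD1, rotated -1]) (use 2 eventually_nhds_in_open[of "{..<0}" t] in \<open>auto simp: flat_def elim: eventually_mono\<close>)
  next
    case 3
    have "(flat j has_real_derivative 0) (at 0)"
      unfolding has_field_derivative_iff
    \<comment> \<open>The difference quotient of \<open>flat j\<close> at 0 is
      \<open>flat (j + 1)\<close>, whose limit is already known.\<close>
    proof (rule Lim_transform_eventually[OF flat_tendsto[of "j + 1"]])
      show "\<forall>\<^sub>F t in at 0. flat (j + 1) t = (flat j t - flat j 0) / (t - 0)"
        by (auto simp: eventually_at_filter flat_def)
    qed
    then show ?thesis using 3 by (simp add: flat_def)
  qed
qed

lemma smooth_flat: "smooth_on UNIV (flat j)"
proof -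
  have "Ck_on m UNIV (flat j)" for m
  proof (induction m arbitrary: j)
    case 0
    show ?case using DERIV_isCont[OF flat_deriv] by (simp add: continuous_on_eq_continuous_at)
  next
    case (Suc m)
    show ?case
    proof (rule Ck_on_real_SucI)
      show "(flat j has_vector_derivative flat (j + 2) t + (- real j) * flat (j + 1) t) (at t)" for t
        using flat_deriv[of j t] by (simp add: has_real_derivative_iff_has_vector_derivative)
      show "Ck_on m UNIV (\<lambda>t. flat (j + 2) t + (- real j) * flat (j + 1) t)"
        by (intro Ck_on_add Ck_on_bilinear[OF bounded_bilinear_mult] Ck_on_const Suc) auto
    qed auto
  qed
  then show ?thesis by (simp add: smooth_on_def)
qed

lemma smooth_bump:
  fixes a :: "'e::euclidean_space"
  assumes "r > 0"
  obtains \<beta> :: "'e \<Rightarrow> real" where "smooth_on UNIV \<beta>" "\<beta> a = 1" "\<And>x. x \<notin> cball a r \<Longrightarrow> \<beta> x = 0"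
proof
  let ?\<beta> = "\<lambda>x. (1 / flat 0 (r * r)) * flat 0 (r * r - (x - a) \<bullet> (x - a))"
  have "smooth_on UNIV (\<lambda>x. flat 0 (r * r - (x - a) \<bullet> (x - a)))"
    by (rule smooth_on_compose[OF _ _ _ _ smooth_flat])
      (auto intro!: smooth_on_diff smooth_on_inner smooth_on_const smooth_on_ident)
  then show "smooth_on UNIV ?\<beta>" by (intro smooth_on_mult smooth_on_const) auto
  show "?\<beta> a = 1" using assms by (simp add: flat_def)
  show "?\<beta> x = 0" if "x \<notin> cball a r" for x
  proof -
    have "r * r < norm (x - a) * norm (x - a)"
      using that assms by (intro mult_strict_mono) (auto simp: dist_norm norm_minus_commute)
    then show ?thesis by (simp add: flat_def dot_square_norm power2_eq_square)
  qed
qed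

section \<open>Smooth adapted frames\<close>

definition smooth_prod :: "'e::euclidean_space set \<Rightarrow> ('e \<Rightarrow> 'e \<Rightarrow> 'e \<Rightarrow> 'e) \<Rightarrow> bool" where
  "smooth_prod S P \<longleftrightarrow> (\<forall>x x'. smooth_on S (\<lambda>y. P y x x')) \<and> (\<forall>y\<in>S. cartan_product (P y))"

lemma smooth_prod_subset: "smooth_prod S P \<Longrightarrow> T \<subseteq> S \<Longrightarrow> smooth_prod T P"
  unfolding smooth_prod_def using smooth_on_subset by blast

text \<open>Smoothness is only assumed for fixed arguments; expanding moving arguments in the basis
  reduces to that case.\<close>

lemma smooth_prod_app:
  assumes "smooth_prod S P" "open S" "smooth_on S f" "smooth_on S h"
  shows "smooth_on S (\<lambda>y. P y (f y) (h y))"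
proof (rule smooth_on_cong[OF assms(2)])
  show "smooth_on S (\<lambda>y. \<Sum>b\<in>Basis. \<Sum>b'\<in>Basis. (f y \<bullet> b) *\<^sub>R (h y \<bullet> b') *\<^sub>R P y b b')"
    using assms by (intro smooth_on_sum smooth_on_scaleR smooth_on_inner smooth_on_const) (auto simp: smooth_prod_def)
  fix y assume "y \<in> S"
  then interpret cartan_product "P y" using assms(1) by (simp add: smooth_prod_def)
  have "P y (f y) (h y) = P y (\<Sum>b\<in>Basis. (f y \<bullet> b) *\<^sub>R b) (\<Sum>b'\<in>Basis. (h y \<bullet> b') *\<^sub>R b')"
    by (simp add: euclidean_representation)
  then show "(\<Sum>b\<in>Basis. \<Sum>b'\<in>Basis. (f y \<bullet> b) *\<^sub>R (h y \<bullet> b') *\<^sub>R P y b b') = P y (f y) (h y)"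
    unfolding P.sum_left P.sum_right P.scaleR_left P.scaleR_right scaleR_sum_right
    by (subst sum.swap) (simp add: mult.commute)
qed

lemma smooth_normalize:
  fixes v :: "'e::euclidean_space \<Rightarrow> 'e"
  assumes "open T" "smooth_on T v" "y0 \<in> T" "v y0 \<noteq> 0"
  obtains T' where "open T'" "y0 \<in> T'" "T' \<subseteq> T" "\<And>y. y \<in> T' \<Longrightarrow> v y \<noteq> 0"
    "smooth_on T' (\<lambda>y. (1 / sqrt (v y \<bullet> v y)) *\<^sub>R v y)"
proof
  let ?T = "T \<inter> v -` (- {0})"
  show o: "open ?T" using smooth_on_continuous[OF assms(2)] assms(1) by (intro continuous_open_preimage) auto
  show "y0 \<in> ?T" "?T \<subseteq> T" using assms by auto
  have v: "smooth_on ?T v" using smooth_on_subset[OF assms(2)] by blast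
  show "smooth_on ?T (\<lambda>y. (1 / sqrt (v y \<bullet> v y)) *\<^sub>R v y)"
    by (intro smooth_on_scaleR[OF o] smooth_on_divide[OF o] smooth_on_sqrt[OF o] smooth_on_inner[OF o] smooth_on_const v)
      auto
qed auto

lemma unit_normalize: "v \<noteq> 0 \<Longrightarrow> ((1 / sqrt (v \<bullet> v)) *\<^sub>R v) \<bullet> ((1 / sqrt (v \<bullet> v)) *\<^sub>R v) = 1"
  for v :: "'a::real_inner"
  by (simp add: real_inner_class.norm_eq_sqrt_inner[symmetric] dot_square_norm power2_eq_square)

section \<open>Idempotents obtained from one unit vector\<close>

context cartan_product begin

text \<open>The cubic form is odd, and the unit sphere is connected. The value 0 is wanted because
  it is interior to the interval where \<open>arccos\<close> is smooth, so the same vector stays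
  usable for nearby products.\<close>

lemma exists_isotropic: assumes "DIM('e) \<ge> 2" obtains x where "x \<bullet> x = 1" "(x \<diamondop> x) \<bullet> x = 0"
proof -
  let ?t = "\<lambda>x. (x \<diamondop> x) \<bullet> x"
  have "continuous_on (sphere 0 1) ?t"
    by (intro continuous_on_inner P.continuous_on continuous_on_id)
  then have c: "connected (?t ` sphere 0 1)" using connected_sphere[OF assms] by (rule connected_continuous_image)
  obtain u :: 'e where "u \<in> Basis" using nonempty_Basis by blast
  then have u: "u \<in> sphere 0 1" "- u \<in> sphere 0 1" by auto
  have "?t (- u) = - ?t u" by (simp add: P_bil)
  moreover have "?t u \<in> ?t ` sphere 0 1" "?t (- u) \<in> ?t ` sphere 0 1" using u by blast+
  ultimately have "0 \<in> ?t ` sphere 0 1"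
    using connectedD_interval[OF c, of "?t u" "?t (- u)" 0] connectedD_interval[OF c, of "?t (- u)" "?t u" 0] by linarith
  then obtain x where "x \<in> sphere 0 1" "?t x = 0" by auto
  then show ?thesis using that[of x] by (simp add: dot_square_norm)
qed

text \<open>The three idempotents lie in the plane spanned by \<open>x\<close> and \<open>x \<diamondop> x\<close>; with \<open>a = cos \<phi>\<close> the
  hypothesis on the cubic form is the triple angle formula \<open>cos 3\<phi> = 4 cos\<^sup>3 \<phi> - 3 cos \<phi>\<close>.\<close>

definition idem :: "'e \<Rightarrow> real \<Rightarrow> 'e" where
  "idem x a = (1 / (4 * a^2 - 1)) *\<^sub>R ((2 * a) *\<^sub>R x + x \<diamondop> x)"

definition idem_perp :: "'e \<Rightarrow> real \<Rightarrow> 'e" where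
  "idem_perp x a = (1 / sqrt (1 - a^2)) *\<^sub>R (x - a *\<^sub>R idem x a)"

definition idems :: "'e \<Rightarrow> real \<Rightarrow> 3 \<Rightarrow> 'e" where
  "idems x a i = (if i = 2 then idem x a else if i = 1 then (- 1/2) *\<^sub>R idem x a + (sqrt 3 / 2) *\<^sub>R idem_perp x a
     else (- 1/2) *\<^sub>R idem x a - (sqrt 3 / 2) *\<^sub>R idem_perp x a)"

text \<open>Identify the plane with the complex numbers so that \<open>idem x a\<close> is 1 and
  \<open>idem_perp x a\<close> is the imaginary unit. The product then squares to the conjugate of
  \<open>z^2\<close>, the cubic form is the real part of \<open>z^3\<close>, and the unit
  idempotents are the cube roots of unity. If \<open>x\<close> is the unit number at angle \<phi>,
  then \<open>2 cos \<phi>\<close> times \<open>x\<close> plus the conjugate of its square is the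
  real number \<open>4 cos^2 \<phi> - 1\<close>, which explains \<open>idem\<close>. The bounds on
  \<open>a\<close> keep both denominators nonzero.\<close>

lemma peirce_idems:
  assumes x: "x \<bullet> x = 1" and t: "(x \<diamondop> x) \<bullet> x = 4 * a^3 - 3 * a" and a: "1/2 < a" "a < 1"
  shows "peirce (\<diamondop>) (idems x a)"
proof -
  let ?s = "x \<diamondop> x" and ?e = "idem x a" and ?f = "idem_perp x a"
  define d where "d = 4 * a^2 - 1"
  have d: "d \<noteq> 0" using a power_strict_mono[of "1/2" a 2] by (simp add: d_def power2_eq_square)
  have b: "1 - a^2 > 0" using a by (simp add: power_less_one_iff)
  have xs: "?s \<diamondop> x = x" "x \<diamondop> ?s = x" using P_cube[of x] x by (simp_all add: P_comm[of x ?s])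
  have ss: "?s \<diamondop> ?s = (2 * (4 * a^3 - 3 * a)) *\<^sub>R x - ?s"
  proof -
    have "?s \<diamondop> ?s + 2 *\<^sub>R ?s = ?s + (2 * (4 * a^3 - 3 * a)) *\<^sub>R x"
      using P_square[of x ?s] t xs x by (simp add: inner_commute)
    then show ?thesis by (simp add: scaleR_2 algebra_simps)
  qed
  have sn: "?s \<bullet> ?s = 1" using P_sym[of x x ?s] xs x by simp
  have e: "d *\<^sub>R ?e = (2 * a) *\<^sub>R x + ?s" using d by (simp add: idem_def d_def)
  have s_e: "?s = d *\<^sub>R ?e - (2 * a) *\<^sub>R x" unfolding e by simp
  have ee: "?e \<diamondop> ?e = ?e"
  proof -
    have "(d * d) *\<^sub>R (?e \<diamondop> ?e) = (d *\<^sub>R ?e) \<diamondop> (d *\<^sub>R ?e)" by (simp add: P_bil)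
    also have "\<dots> = d *\<^sub>R ((2 * a) *\<^sub>R x + ?s)"
      unfolding e by (simp add: P_bil xs ss) (rule euclidean_eqI;
        simp add: inner_add_left inner_diff_left d_def power2_eq_square power3_eq_cube algebra_simps)
    also have "\<dots> = (d * d) *\<^sub>R ?e" unfolding e[symmetric] by simp
    finally show ?thesis using d by simp
  qed
  have en: "?e \<bullet> ?e = 1"
  proof -
    have "(d * d) * (?e \<bullet> ?e) = (d *\<^sub>R ?e) \<bullet> (d *\<^sub>R ?e)" by simp
    also have "\<dots> = 4 * a^2 + 4 * a * (?s \<bullet> x) + 1" unfolding e
      by (simp add: inner_add_left inner_add_right sn x inner_commute[of x ?s] power2_eq_square algebra_simps)
    also have "\<dots> = d * d" unfolding t by (simp add: d_def power2_eq_square power3_eq_cube algebra_simps)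
    finally show ?thesis using d by simp
  qed
  have ex: "?e \<bullet> x = a"
  proof -
    have "d * (?e \<bullet> x) = (d *\<^sub>R ?e) \<bullet> x" by simp
    also have "\<dots> = d * a" unfolding e using t
      by (simp add: inner_add_left x d_def power2_eq_square power3_eq_cube algebra_simps)
    finally show ?thesis using d by simp
  qed
  have ex2: "?e \<diamondop> x = (2 * a) *\<^sub>R ?e - x"
  proof -
    have "d *\<^sub>R (?e \<diamondop> x) = (d *\<^sub>R ?e) \<diamondop> x" by (simp add: P_bil)
    also have "\<dots> = (2 * a) *\<^sub>R (d *\<^sub>R ?e - (2 * a) *\<^sub>R x) + x" unfolding e by (simp add: P_bil xs)
    also have "\<dots> = d *\<^sub>R ((2 * a) *\<^sub>R ?e - x)"
      by (rule euclidean_eqI) (simp add: inner_add_left inner_diff_left d_def power2_eq_square algebra_simps)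
    finally show ?thesis using d by simp
  qed
  define r where "r = sqrt (1 - a^2)"
  have r: "r \<noteq> 0" "r * r = 1 - a^2" using b by (simp_all add: r_def)
  have f: "r *\<^sub>R ?f = x - a *\<^sub>R ?e" using r by (simp add: idem_perp_def r_def)
  have ef: "?e \<diamondop> ?f = - ?f"
  proof -
    have "r *\<^sub>R (?e \<diamondop> ?f) = ?e \<diamondop> (x - a *\<^sub>R ?e)" by (simp add: P_bil flip: f)
    also have "\<dots> = - (x - a *\<^sub>R ?e)" by (simp add: P_bil ee ex2) (rule euclidean_eqI; simp add: inner_diff_left)
    also have "\<dots> = r *\<^sub>R (- ?f)" by (simp add: f)
    finally show ?thesis using r by (simp only: scaleR_cancel_left) simp
  qed
  have ff: "?f \<diamondop> ?f = - ?e"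
  proof -
    have "(r * r) *\<^sub>R (?f \<diamondop> ?f) = (r *\<^sub>R ?f) \<diamondop> (r *\<^sub>R ?f)" by (simp add: P_bil)
    also have "\<dots> = (a * a - 1) *\<^sub>R ?e"
      unfolding f by (simp add: P_bil ee ex2 P_comm[of x ?e]) (subst s_e, rule euclidean_eqI,
        simp add: inner_diff_left inner_add_left d_def power2_eq_square algebra_simps)
    also have "\<dots> = (r * r) *\<^sub>R (- ?e)" unfolding r(2) by (simp add: power2_eq_square flip: scaleR_minus_left)
    finally show ?thesis using r(1) by (simp only: scaleR_cancel_left mult_eq_0_iff) simp
  qed
  have fn: "?f \<bullet> ?f = 1"
  proof -
    have "(r * r) * (?f \<bullet> ?f) = (r *\<^sub>R ?f) \<bullet> (r *\<^sub>R ?f)" by simp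
    also have "\<dots> = r * r" unfolding f r(2)
      by (simp add: inner_diff_left inner_diff_right x en ex inner_commute[of x ?e] power2_eq_square)
    finally show ?thesis using r(1) by (simp only: mult_cancel_left2 mult_eq_0_iff) simp
  qed
  have efi: "?e \<bullet> ?f = 0"
  proof -
    have "r * (?e \<bullet> ?f) = ?e \<bullet> (r *\<^sub>R ?f)" by simp
    then show ?thesis unfolding f using r by (simp add: inner_diff_right en ex)
  qed
  have g: "((- 1/2) *\<^sub>R ?e + q *\<^sub>R ?f) \<diamondop> ((- 1/2) *\<^sub>R ?e + q *\<^sub>R ?f) = (- 1/2) *\<^sub>R ?e + q *\<^sub>R ?f"
    "((- 1/2) *\<^sub>R ?e + q *\<^sub>R ?f) \<bullet> ((- 1/2) *\<^sub>R ?e + q *\<^sub>R ?f) = 1" if "q * q = 3/4" for q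
  proof -
    have "((- 1/2) *\<^sub>R ?e + q *\<^sub>R ?f) \<diamondop> ((- 1/2) *\<^sub>R ?e + q *\<^sub>R ?f) = (1/4) *\<^sub>R ?e + q *\<^sub>R ?f - (q * q) *\<^sub>R ?e"
      by (simp add: P_bil ee ef ff P_comm[of ?f ?e]) (rule euclidean_eqI; simp add: inner_diff_left inner_add_left algebra_simps)
    then show "((- 1/2) *\<^sub>R ?e + q *\<^sub>R ?f) \<diamondop> ((- 1/2) *\<^sub>R ?e + q *\<^sub>R ?f) = (- 1/2) *\<^sub>R ?e + q *\<^sub>R ?f"
      unfolding that by (simp) (rule euclidean_eqI; simp add: inner_diff_left inner_add_left)
    show "((- 1/2) *\<^sub>R ?e + q *\<^sub>R ?f) \<bullet> ((- 1/2) *\<^sub>R ?e + q *\<^sub>R ?f) = 1"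
      using that by (simp add: inner_add_left inner_add_right inner_diff_left inner_diff_right en fn efi inner_commute[of ?f ?e])
  qed
  have s3: "sqrt 3 / 2 * (sqrt 3 / 2) = 3/4" "- sqrt 3 / 2 * (- sqrt 3 / 2) = 3/4" by simp_all
  note g1 = g[OF s3(1)] and g2 = g[OF s3(2)]
  have i0: "idems x a 0 = (- 1/2) *\<^sub>R ?e + (- sqrt 3 / 2) *\<^sub>R ?f" and i1: "idems x a 1 = (- 1/2) *\<^sub>R ?e + (sqrt 3 / 2) *\<^sub>R ?f"
    and i2: "idems x a 2 = ?e" by (simp_all add: idems_def)
  have 1: "\<forall>i. idems x a i \<diamondop> idems x a i = idems x a i" unfolding all_3 i0 i1 i2 using g1(1) g2(1) ee by blast
  have 2: "\<forall>i. idems x a i \<bullet> idems x a i = 1" unfolding all_3 i0 i1 i2 using g1(2) g2(2) en by blast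
  have 3: "\<forall>i. idems x a i + idems x a (i + 1) + idems x a (i + 2) = 0"
    unfolding all_3 by (simp add: i0 i1 i2 algebra_simps flip: scaleR_add_left)
  show ?thesis
    by (rule peirce.intro[OF cartan_product_axioms peirce_axioms.intro]) (use 1 2 3 in blast)+
qed

end

text \<open>\<open>V_extend\<close> at the single point \<open>y0\<close> provides \<open>b\<close>.
  Projecting the same \<open>b\<close> at nearby points and subtracting its components along the
  vectors already chosen gives a smooth field that is nonzero near \<open>y0\<close> and can be
  normalised.\<close>

lemma smooth_frame_step:
  fixes P :: "'e::euclidean_space \<Rightarrow> 'e \<Rightarrow> 'e \<Rightarrow> 'e" and u :: "nat \<Rightarrow> 'e \<Rightarrow> 'e"
  assumes S: "open S" "y0 \<in> S" and P: "smooth_prod S P" and tr: "\<And>x. (\<Sum>b\<in>Basis. P y0 x b \<bullet> b) = 0"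
    and c: "\<And>i. smooth_on S (\<lambda>y. c y i)" and p: "\<And>y. y \<in> S \<Longrightarrow> peirce (P y) (c y)"
    and u: "\<And>l. l < m \<Longrightarrow> smooth_on S (u l)"
    and uV: "\<And>y l. y \<in> S \<Longrightarrow> l < m \<Longrightarrow> u l y \<in> peirce.V (P y) (c y) i"
    and uo: "\<And>y l l'. y \<in> S \<Longrightarrow> l < m \<Longrightarrow> l' < m \<Longrightarrow> u l y \<bullet> u l' y = (if l = l' then 1 else 0)"
    and m: "real m \<noteq> (real DIM('e) - 2) / 3"
  obtains T v where "open T" "y0 \<in> T" "T \<subseteq> S" "smooth_on T v"
    "\<And>y. y \<in> T \<Longrightarrow> v y \<in> peirce.V (P y) (c y) i" "\<And>y. y \<in> T \<Longrightarrow> v y \<bullet> v y = (1::real)"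
    "\<And>y l. y \<in> T \<Longrightarrow> l < m \<Longrightarrow> v y \<bullet> u l y = 0"
proof -
  interpret p0: peirce "P y0" "c y0" by (rule p[OF S(2)])
  let ?U = "(\<lambda>l. u l y0) ` {..<m}"
  have inj: "inj_on (\<lambda>l. u l y0) {..<m}"
    by (intro inj_onI) (metis S(2) lessThan_iff uo zero_neq_one)
  have ne: "real (card ?U) \<noteq> (real DIM('e) - 2) / 3" using m card_image[OF inj] by simp
  have U: "finite ?U" "?U \<subseteq> p0.V i" "\<And>u. u \<in> ?U \<Longrightarrow> u \<bullet> u = 1" using uV[OF S(2)] uo[OF S(2)] by auto
  obtain b where b: "peirce.pr (P y0) (c y0) i b - (\<Sum>u\<in>?U. (b \<bullet> u) *\<^sub>R u) \<noteq> 0"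
    using p0.V_extend[OF tr U(1,2) ne U(3)] by blast
  define w where "w y = peirce.pr (P y) (c y) i b - (\<Sum>l<m. (b \<bullet> u l y) *\<^sub>R u l y)" for y
  have csm: "smooth_on S (\<lambda>y. (2/3) *\<^sub>R (\<Sum>i\<in>UNIV. (b \<bullet> c y i) *\<^sub>R c y i))"
    by (intro smooth_on_scaleR[OF S(1)] smooth_on_sum[OF S(1)] smooth_on_inner[OF S(1)] smooth_on_const c)
  have "smooth_on S (\<lambda>y. (1/3) *\<^sub>R ((b - (2/3) *\<^sub>R (\<Sum>i\<in>UNIV. (b \<bullet> c y i) *\<^sub>R c y i))
      - 2 *\<^sub>R P y (c y i) (b - (2/3) *\<^sub>R (\<Sum>i\<in>UNIV. (b \<bullet> c y i) *\<^sub>R c y i)))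
      - (\<Sum>l<m. (b \<bullet> u l y) *\<^sub>R u l y))"
    by (intro smooth_on_scaleR[OF S(1)] smooth_on_diff[OF S(1)] smooth_prod_app[OF P S(1)] smooth_on_sum[OF S(1)]
        smooth_on_inner[OF S(1)] smooth_on_const csm c u) simp_all
  then have "smooth_on S w"
    by (rule smooth_on_cong[OF S(1), rotated]) (simp add: w_def peirce.pr_def[OF p] peirce.csum_def[OF p])
  moreover have "w y0 \<noteq> 0" using b sum.reindex[OF inj, of "\<lambda>u. (b \<bullet> u) *\<^sub>R u"] by (simp add: w_def)
  ultimately obtain T where T: "open T" "y0 \<in> T" "T \<subseteq> S" "\<And>y. y \<in> T \<Longrightarrow> w y \<noteq> 0"
    "smooth_on T (\<lambda>y. (1 / sqrt (w y \<bullet> w y)) *\<^sub>R w y)"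
    using smooth_normalize[OF S(1) _ S(2)] by metis
  have wV: "w y \<in> peirce.V (P y) (c y) i" if "y \<in> S" for y
  proof -
    interpret p: peirce "P y" "c y" by (rule p[OF that])
    show ?thesis unfolding w_def
      using uV[OF that] by (intro subspace_diff[OF p.V_subspace] p.pr_in_V subspace_sum[OF p.V_subspace] subspace_scale[OF p.V_subspace]) simp
  qed
  have wo: "w y \<bullet> u l y = 0" if "y \<in> S" "l < m" for y l
  proof -
    interpret p: peirce "P y" "c y" by (rule p[OF that(1)])
    have "(\<Sum>l'<m. (b \<bullet> u l' y) *\<^sub>R u l' y) \<bullet> u l y = (\<Sum>l'<m. if l' = l then b \<bullet> u l y else 0)"
      unfolding inner_sum_left using uo[OF that(1) _ that(2)] by (intro sum.cong) auto
    then show ?thesis using that by (simp add: w_def inner_diff_left p.pr_adjoint[OF uV[OF that]])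
  qed
  show ?thesis
  proof (rule that[OF T(1-3,5)])
    fix y assume y: "y \<in> T"
    then have yS: "y \<in> S" using T(3) by blast
    show "(1 / sqrt (w y \<bullet> w y)) *\<^sub>R w y \<in> peirce.V (P y) (c y) i"
      using subspace_scale[OF peirce.V_subspace[OF p[OF yS]] wV[OF yS]] .
    show "((1 / sqrt (w y \<bullet> w y)) *\<^sub>R w y) \<bullet> ((1 / sqrt (w y \<bullet> w y)) *\<^sub>R w y) = 1"
      by (rule unit_normalize[OF T(4)[OF y]])
    show "((1 / sqrt (w y \<bullet> w y)) *\<^sub>R w y) \<bullet> u l y = 0" if "l < m" for l
      using wo[OF yS that] by simp
  qed
qed

definition adapted_frame :: "nat \<Rightarrow> ('e::euclidean_space \<Rightarrow> 'e \<Rightarrow> 'e) \<Rightarrow> (nat \<Rightarrow> 'e) \<Rightarrow> bool" where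
  "adapted_frame k P b \<longleftrightarrow> (\<forall>I\<in>{1..dim_n k}. \<forall>J\<in>{1..dim_n k}. b I \<bullet> b J = (if I = J then 1 else 0)) \<and>
     (\<forall>x. let y = (\<Sum>I=1..dim_n k. x I *\<^sub>R b I) in P y y \<bullet> y = model_cubic k x)"

text \<open>A fixed \<open>x\<close> has cubic value 0 at \<open>y0\<close> and hence a value
  strictly between -1 and 1 nearby. A third of its \<open>arccos\<close> lies strictly between 0 and
  \<open>pi / 3\<close>, which puts the cosine strictly between 1/2 and 1.\<close>

lemma smooth_idems:
  fixes P :: "'e::euclidean_space \<Rightarrow> 'e \<Rightarrow> 'e \<Rightarrow> 'e"
  assumes S: "open S" "y0 \<in> S" and P: "smooth_prod S P" and D: "DIM('e) \<ge> 2"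
  obtains T c where "open T" "y0 \<in> T" "T \<subseteq> S" "\<And>i. smooth_on T (\<lambda>y. c y i)" "\<And>y. y \<in> T \<Longrightarrow> peirce (P y) (c y)"
proof -
  have cp: "cartan_product (P y)" if "y \<in> S" for y using P that by (simp add: smooth_prod_def)
  obtain x where x: "x \<bullet> x = 1" "P y0 x x \<bullet> x = 0"
    using cartan_product.exists_isotropic[OF cp[OF S(2)] D] by blast
  define t where "t y = P y x x \<bullet> x" for y
  have t: "smooth_on S t" unfolding t_def
    using P by (intro smooth_on_inner[OF S(1)] smooth_on_const) (simp add: smooth_prod_def)
  define T where "T = S \<inter> t -` {-1<..<1}"
  have T: "open T" "y0 \<in> T" "T \<subseteq> S"
    using smooth_on_continuous[OF t] S x by (auto simp: T_def t_def intro!: continuous_open_preimage)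
  have tT: "smooth_on T t" by (rule smooth_on_subset[OF t T(3)])
  define a where "a y = cos (arccos (t y) / 3)" for y
  have a: "smooth_on T a"
  proof -
    have "smooth_on T (\<lambda>y. arccos (t y))"
      by (rule smooth_on_compose[OF T(1) _ _ tT smooth_arccos]) (auto simp: T_def)
    then have 3: "smooth_on T (\<lambda>y. arccos (t y) / 3)"
      by (intro smooth_on_divide[OF T(1)] smooth_on_const) simp_all
    show ?thesis unfolding a_def by (rule smooth_on_compose[OF T(1) open_UNIV _ 3 smooth_sin_cos(2)]) simp
  qed
  have ab: "1/2 < a y" "a y < 1" "t y = 4 * a y ^ 3 - 3 * a y" if "y \<in> T" for y
  proof -
    have ty: "- 1 < t y" "t y < 1" using that by (auto simp: T_def)
    have r: "0 < arccos (t y)" "arccos (t y) < pi" using arccos_lt_bounded[OF ty] by auto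
    have "cos (pi / 3) < cos (arccos (t y) / 3)" using r by (intro cos_monotone_0_pi) auto
    then show "1/2 < a y" by (simp add: a_def cos_60)
    have "cos (arccos (t y) / 3) < cos 0" using r by (intro cos_monotone_0_pi) auto
    then show "a y < 1" by (simp add: a_def)
    have "t y = cos (3 * (arccos (t y) / 3))" using ty by simp
    also have "\<dots> = 4 * a y ^ 3 - 3 * a y" unfolding a_def by (rule cos_treble_cos)
    finally show "t y = 4 * a y ^ 3 - 3 * a y" .
  qed
  have d: "4 * (a y)^2 - 1 \<noteq> 0" "0 < 1 - (a y)^2" if "y \<in> T" for y
    using ab[OF that] power_strict_mono[of "1/2" "a y" 2] by (auto simp: power2_eq_square power_less_one_iff abs_square_less_1[unfolded power2_eq_square])
  define e where "e y = (1 / (4 * (a y)^2 - 1)) *\<^sub>R ((2 * a y) *\<^sub>R x + P y x x)" for y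
  define f where "f y = (1 / sqrt (1 - (a y)^2)) *\<^sub>R (x - a y *\<^sub>R e y)" for y
  have Px: "smooth_on T (\<lambda>y. P y x x)" using P smooth_on_subset[OF _ T(3)] unfolding smooth_prod_def by blast
  have a2: "smooth_on T (\<lambda>y. (a y)^2)" unfolding power2_eq_square by (rule smooth_on_mult[OF T(1) a a])
  have e: "smooth_on T e" unfolding e_def
    using d by (intro smooth_on_scaleR[OF T(1)] smooth_on_divide[OF T(1)] smooth_on_diff[OF T(1)] smooth_on_mult[OF T(1)]
        smooth_on_add[OF T(1)] smooth_on_const a a2 Px) simp
  have f: "smooth_on T f" unfolding f_def
    using d by (intro smooth_on_scaleR[OF T(1)] smooth_on_divide[OF T(1)] smooth_on_sqrt[OF T(1)] smooth_on_diff[OF T(1)]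
        smooth_on_const a a2 e) (simp_all add: less_imp_neq[symmetric])
  define c :: "'e \<Rightarrow> 3 \<Rightarrow> 'e" where "c y i = (if i = 2 then e y else if i = 1 then (- 1/2) *\<^sub>R e y + (sqrt 3 / 2) *\<^sub>R f y
     else (- 1/2) *\<^sub>R e y - (sqrt 3 / 2) *\<^sub>R f y)" for y i
  have "smooth_on T (\<lambda>y. c y i)" for i
  proof -
    have "smooth_on T (\<lambda>y. (- 1/2) *\<^sub>R e y + (sqrt 3 / 2) *\<^sub>R f y)" "smooth_on T (\<lambda>y. (- 1/2) *\<^sub>R e y - (sqrt 3 / 2) *\<^sub>R f y)"
      by (intro smooth_on_add[OF T(1)] smooth_on_diff[OF T(1)] smooth_on_scaleR[OF T(1)] smooth_on_const e f)+
    then show ?thesis using e by (cases "i = 2"; cases "i = 1") (simp_all add: c_def)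
  qed
  moreover have "peirce (P y) (c y)" if "y \<in> T" for y
  proof -
    have yS: "y \<in> S" using that T by blast
    have "c y = cartan_product.idems (P y) x (a y)"
      by (rule ext) (simp add: c_def cartan_product.idems_def[OF cp[OF yS]] cartan_product.idem_def[OF cp[OF yS]]
          cartan_product.idem_perp_def[OF cp[OF yS]] e_def f_def)
    then show ?thesis
      using cartan_product.peirce_idems[OF cp[OF yS] x(1)] ab[OF that] by (simp add: t_def)
  qed
  ultimately show ?thesis using that T by blast
qed


definition hermitian :: "nat \<Rightarrow> ('e::euclidean_space \<Rightarrow> 'e \<Rightarrow> 'e) \<Rightarrow> bool" where
  "hermitian k P \<longleftrightarrow> (k = 1 \<and> (\<exists>c \<iota>. herm3 (*) (1::real) (\<lambda>x. x) P c \<iota>)) \<or> (k = 4 \<and> (\<exists>c \<iota>. herm3 qmul qone qcnj P c \<iota>))"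

theorem smooth_adapted_frame:
  fixes P :: "'e::euclidean_space \<Rightarrow> 'e \<Rightarrow> 'e \<Rightarrow> 'e"
  assumes k: "k \<in> {1, 4}" and D: "DIM('e) = dim_n k" and S: "open S" "y0 \<in> S" and P: "smooth_prod S P"
    and tr: "\<And>x. (\<Sum>b\<in>Basis. P y0 x b \<bullet> b) = 0"
  obtains T b where "open T" "y0 \<in> T" "T \<subseteq> S" "\<And>I. I \<in> {1..dim_n k} \<Longrightarrow> smooth_on T (b I)"
    "\<And>y. y \<in> T \<Longrightarrow> adapted_frame k (P y) (\<lambda>I. b I y)" "\<And>y. y \<in> T \<Longrightarrow> hermitian k (P y)"
proof -
  have D2: "DIM('e) \<ge> 2" and Dk: "(real DIM('e) - 2) / 3 = real k" using k D by (auto simp: dim_n_def)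
  obtain T1 c where T1: "open T1" "y0 \<in> T1" "T1 \<subseteq> S" and c: "\<And>i. smooth_on T1 (\<lambda>y. c y i)" "\<And>y. y \<in> T1 \<Longrightarrow> peirce (P y) (c y)"
    using smooth_idems[OF S P D2] by metis
  obtain T2 p where T2: "open T2" "y0 \<in> T2" "T2 \<subseteq> T1" and p: "smooth_on T2 p"
    "\<And>y. y \<in> T2 \<Longrightarrow> p y \<in> peirce.V (P y) (c y) 0" "\<And>y. y \<in> T2 \<Longrightarrow> p y \<bullet> p y = 1"
    by (rule smooth_frame_step[OF T1(1,2) smooth_prod_subset[OF P T1(3)] tr c, of 0 "\<lambda>l y. 0" 0]) (use k in \<open>auto simp: Dk\<close>)
  note sub2 = order.trans[OF T2(3) T1(3)]
  have c2: "\<And>i. smooth_on T2 (\<lambda>y. c y i)" "\<And>y. y \<in> T2 \<Longrightarrow> peirce (P y) (c y)"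
    using smooth_on_subset[OF c(1) T2(3)] c(2) T2(3) by blast+
  obtain T3 w where T3: "open T3" "y0 \<in> T3" "T3 \<subseteq> T2" and w: "smooth_on T3 w"
    "\<And>y. y \<in> T3 \<Longrightarrow> w y \<in> peirce.V (P y) (c y) 1" "\<And>y. y \<in> T3 \<Longrightarrow> w y \<bullet> w y = 1"
    by (rule smooth_frame_step[OF T2(1,2) smooth_prod_subset[OF P sub2] tr c2, of 0 "\<lambda>l y. 0" 1]) (use k in \<open>auto simp: Dk\<close>)
  note sub3 = order.trans[OF T3(3) sub2]
  have c3: "\<And>i. smooth_on T3 (\<lambda>y. c y i)" "\<And>y. y \<in> T3 \<Longrightarrow> peirce (P y) (c y)"
    using smooth_on_subset[OF c2(1) T3(3)] c2(2) T3(3) by blast+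
  have p3: "smooth_on T3 p" "\<And>y. y \<in> T3 \<Longrightarrow> p y \<in> peirce.V (P y) (c y) 0" "\<And>y. y \<in> T3 \<Longrightarrow> p y \<bullet> p y = 1"
    using smooth_on_subset[OF p(1) T3(3)] p(2,3) T3(3) by blast+
  \<comment> \<open>For \<open>k = 4\<close> the space \<open>V 0\<close> is four-dimensional and
    holds two more orthonormal vectors orthogonal to \<open>p\<close>. For \<open>k = 1\<close> the
    zero function is a placeholder, since the first five frame vectors do not contain them.\<close>
  have "\<exists>T p1 p2. open T \<and> y0 \<in> T \<and> T \<subseteq> T3 \<and> smooth_on T p1 \<and> smooth_on T p2 \<and> (k = 4 \<longrightarrow> (\<forall>y\<in>T.
     p1 y \<in> peirce.V (P y) (c y) 0 \<and> p2 y \<in> peirce.V (P y) (c y) 0 \<and> p1 y \<bullet> p1 y = 1 \<and> p2 y \<bullet> p2 y = 1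
     \<and> p1 y \<bullet> p y = 0 \<and> p2 y \<bullet> p y = 0 \<and> p1 y \<bullet> p2 y = 0))"
  proof (cases "k = 4")
    case False
    then show ?thesis using T3 by (intro exI[of _ T3] exI[of _ "\<lambda>y. 0"]) (simp add: smooth_on_const)
  next
    case True
    obtain T4 p1 where T4: "open T4" "y0 \<in> T4" "T4 \<subseteq> T3" and p1: "smooth_on T4 p1"
      "\<And>y. y \<in> T4 \<Longrightarrow> p1 y \<in> peirce.V (P y) (c y) 0" "\<And>y. y \<in> T4 \<Longrightarrow> p1 y \<bullet> p1 y = 1" "\<And>y. y \<in> T4 \<Longrightarrow> p1 y \<bullet> p y = 0"
      by (rule smooth_frame_step[OF T3(1,2) smooth_prod_subset[OF P sub3] tr c3, of 1 "\<lambda>l. p" 0]) (use True p3 in \<open>auto simp: Dk\<close>)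
    note sub4 = order.trans[OF T4(3) sub3]
    have c4: "\<And>i. smooth_on T4 (\<lambda>y. c y i)" "\<And>y. y \<in> T4 \<Longrightarrow> peirce (P y) (c y)"
      using smooth_on_subset[OF c3(1) T4(3)] c3(2) T4(3) by blast+
    have p4: "smooth_on T4 p" "\<And>y. y \<in> T4 \<Longrightarrow> p y \<in> peirce.V (P y) (c y) 0" "\<And>y. y \<in> T4 \<Longrightarrow> p y \<bullet> p y = 1"
      using smooth_on_subset[OF p3(1) T4(3)] p3(2,3) T4(3) by blast+
    let ?u = "\<lambda>l::nat. if l = 0 then p else p1"
    have u1: "smooth_on T4 (?u l)" for l using p1 p4 by simp
    have u2: "?u l y \<in> peirce.V (P y) (c y) 0" if "y \<in> T4" for l y using p1(2) p4(2) that by simp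
    have u3: "?u l y \<bullet> ?u l' y = (if l = l' then 1 else 0)" if "y \<in> T4" "l < 2" "l' < 2" for l l' y
    proof -
      have "l = 0 \<or> l = 1" "l' = 0 \<or> l' = 1" using that by auto
      then show ?thesis using p1(3,4)[OF that(1)] p4(3)[OF that(1)] by (auto simp: inner_commute)
    qed
    have u4: "real 2 \<noteq> (real DIM('e) - 2) / 3" using True by (simp add: Dk)
    obtain T5 p2 where T5: "open T5" "y0 \<in> T5" "T5 \<subseteq> T4" and p2: "smooth_on T5 p2"
      "\<And>y. y \<in> T5 \<Longrightarrow> p2 y \<in> peirce.V (P y) (c y) 0" "\<And>y. y \<in> T5 \<Longrightarrow> p2 y \<bullet> p2 y = 1"
      "\<And>y l. y \<in> T5 \<Longrightarrow> l < 2 \<Longrightarrow> p2 y \<bullet> ?u l y = 0"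
      using smooth_frame_step[OF T4(1,2) smooth_prod_subset[OF P sub4] tr c4 u1 u2 u3 u4] by blast
    have "p1 y \<bullet> p2 y = 0 \<and> p2 y \<bullet> p y = 0" if "y \<in> T5" for y
      using p2(4)[OF that, of 0] p2(4)[OF that, of 1] by (simp add: inner_commute)
    then show ?thesis
      using T5 T4 p1 p2(1-3) smooth_on_subset[OF p1(1) T5(3)]
      by (intro exI[of _ T5] exI[of _ p1] exI[of _ p2]) auto
  qed
  then obtain T p1 p2 where T: "open T" "y0 \<in> T" "T \<subseteq> T3" and pp: "smooth_on T p1" "smooth_on T p2"
    and p4: "k = 4 \<Longrightarrow> y \<in> T \<Longrightarrow> p1 y \<in> peirce.V (P y) (c y) 0 \<and> p2 y \<in> peirce.V (P y) (c y) 0 \<and> p1 y \<bullet> p1 y = 1 \<and> p2 y \<bullet> p2 y = 1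
     \<and> p1 y \<bullet> p y = 0 \<and> p2 y \<bullet> p y = 0 \<and> p1 y \<bullet> p2 y = 0" for y by blast
  have seed: "peirce_seed (P y) (c y) (p y) (w y)" if "y \<in> T" for y
    using that T(3) c3(2) p3(2,3) w(2,3) by (intro peirce_seed.intro peirce_seed_axioms.intro) blast+
  have sm: "smooth_on T p" "smooth_on T w" "\<And>i. smooth_on T (\<lambda>y. c y i)"
    using smooth_on_subset[OF _ T(3)] p3(1) w(1) c3(1) by blast+
  note PT = smooth_prod_subset[OF P order.trans[OF T(3) sub3]]
  define B where "B f g y = (2 / sqrt 3) *\<^sub>R P y (f y) (g y)" for f g y
  have B: "smooth_on T (B f g)" if "smooth_on T f" "smooth_on T g" for f g
    unfolding B_def by (intro smooth_on_scaleR[OF T(1)] smooth_on_const smooth_prod_app[OF PT T(1)] that)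
  let ?s = "\<lambda>f. B (B p w) f" and ?r = "\<lambda>f. B f w"
  let ?m = "B (?r p1) (?s p2)"
  \<comment> \<open>The list in \<open>frame\<close> with its entries read as functions of the
    point; \<open>?s\<close>, \<open>?r\<close> and \<open>?m\<close> are the pointwise \<sigma>,
    \<rho> and \<open>m\<close>.\<close>
  define fs where "fs = [p, w, B p w, \<lambda>y. (1 / sqrt 3) *\<^sub>R (c y 1 - c y 0), \<lambda>y. - c y 2, p1, ?s p1, \<lambda>y. - ?r p1 y, p2, ?m,
     ?s p2, ?s ?m, \<lambda>y. - ?r p2 y, \<lambda>y. - ?r ?m y]"
  have fs: "smooth_on T f" if "f \<in> set fs" for f
    using that unfolding fs_def
    by (auto intro!: B sm pp smooth_on_scaleR[OF T(1)] smooth_on_const smooth_on_diff[OF T(1)] smooth_on_minus[OF T(1)])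
  define b where "b I = fs ! (I - 1)" for I
  have b: "smooth_on T (b I)" if "I \<in> {1..14}" for I
    unfolding b_def by (rule fs, rule nth_mem) (use that in \<open>auto simp: fs_def\<close>)
  have bf: "b I y = peirce_seed.frame (P y) (c y) (p y) (w y) (p1 y) (p2 y) I" if "y \<in> T" "I \<in> {1..14}" for I y
  proof -
    interpret s: peirce_seed "P y" "c y" "p y" "w y" by (rule seed[OF that(1)])
    have "I - 1 < length fs" using that(2) by (auto simp: fs_def)
    then have "b I y = map (\<lambda>f. f y) fs ! (I - 1)" by (simp add: b_def)
    also have "map (\<lambda>f. f y) fs = [p y, w y, s.B (p y) (w y), (1 / sqrt 3) *\<^sub>R (c y 1 - c y 0), - c y 2, p1 y, s.\<sigma> (p1 y), - s.\<rho> (p1 y),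
       p2 y, s.m (p1 y) (p2 y), s.\<sigma> (p2 y), s.\<sigma> (s.m (p1 y) (p2 y)), - s.\<rho> (p2 y), - s.\<rho> (s.m (p1 y) (p2 y))]"
      by (simp add: fs_def s.m_def s.\<sigma>_def s.\<rho>_def s.B_def B_def)
    finally show ?thesis unfolding s.frame_def .
  qed
  have n14: "I \<in> {1..14}" if "I \<in> {1..dim_n k}" for I using that k by (auto simp: dim_n_def)
  show ?thesis
  proof (rule that[OF T(1,2)])
    show "T \<subseteq> S" using T(3) sub3 by blast
    show "smooth_on T (b I)" if "I \<in> {1..dim_n k}" for I by (rule b[OF n14[OF that]])
    fix y assume y: "y \<in> T"
    interpret s: peirce_seed "P y" "c y" "p y" "w y" by (rule seed[OF y])
    note bI = bf[OF y n14]
    have sb: "(\<Sum>I=1..dim_n k. x I *\<^sub>R b I y) = (\<Sum>I=1..dim_n k. x I *\<^sub>R s.frame (p1 y) (p2 y) I)" for x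
      by (intro sum.cong refl) (simp add: bI)
    show "adapted_frame k (P y) (\<lambda>I. b I y)"
      unfolding adapted_frame_def sb
    proof (intro conjI ballI allI)
      fix I J assume IJ: "I \<in> {1..dim_n k}" "J \<in> {1..dim_n k}"
      have "k = 1 \<or> k = 4" using k by auto
      then show "b I y \<bullet> b J y = (if I = J then 1 else 0)"
      proof
        assume "k = 1"
        then show ?thesis using s.frame_real_orthonormal[of I J "p1 y" "p2 y"] IJ D by (simp add: bI dim_n_def)
      next
        assume "k = 4"
        then show ?thesis using s.frame_quat_orthonormal[of "p1 y" "p2 y" I J] p4[OF _ y] IJ D by (simp add: bI dim_n_def)
      qed
    next
      fix x
      have "k = 1 \<or> k = 4" using k by auto
      then show "let ya = \<Sum>I=1..dim_n k. x I *\<^sub>R s.frame (p1 y) (p2 y) I in P y ya ya \<bullet> ya = model_cubic k x"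
      proof
        assume "k = 1"
        then show ?thesis using s.frame_real_cubic[of x "p1 y" "p2 y"] D by (simp add: dim_n_def)
      next
        assume "k = 4"
        then show ?thesis using s.frame_quat_cubic[of "p1 y" "p2 y" x] p4[OF _ y] D by (simp add: dim_n_def)
      qed
    qed
    have "k = 1 \<or> k = 4" using k by auto
    then show "hermitian k (P y)"
    proof
      assume "k = 1"
      then show ?thesis using s.frame_real_herm D by (auto simp: hermitian_def dim_n_def)
    next
      assume "k = 4"
      then show ?thesis using s.frame_quat_herm[of "p1 y" "p2 y"] p4[OF _ y] D by (auto simp: hermitian_def dim_n_def)
    qed
  qed
qed

section \<open>The Lie algebra as a stabilizer\<close>

text \<open>Reindexing by a finite type of \<open>n\<close> elements gives access to the theory of
  \<open>det\<close>, in particular for orthogonal matrices.\<close>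

lemma det_matrix_eq_det:
  fixes h :: "nat \<Rightarrow> 'n::finite"
  assumes h: "bij_betw h {1..n} UNIV"
  shows "det_matrix n a = det (\<chi> i j. a (inv_into {1..n} h i) (inv_into {1..n} h j))"
proof -
  let ?N = "{1..n}" and ?g = "inv_into {1..n} h"
  have inj: "inj_on h ?N" using h by (simp add: bij_betw_def)
  have g: "bij_betw ?g UNIV ?N" by (rule bij_betw_inv_into[OF h])
  have gh: "?g (h x) = x" if "x \<in> ?N" for x using inj that by simp
  have hg: "h (?g x) = x" for x using h by (simp add: bij_betw_inv_into_right)
  have bij: "bij_betw (map_permutation ?N h) {p. p permutes ?N} {p. p permutes UNIV}"
  proof (rule bij_betw_byWitness[of _ "map_permutation UNIV ?g"])
    show "\<forall>p\<in>{p. p permutes ?N}. map_permutation UNIV ?g (map_permutation ?N h p) = p"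
      using map_permutation_compose_inv[OF h] gh by auto
    show "\<forall>p\<in>{p. p permutes UNIV}. map_permutation ?N h (map_permutation UNIV ?g p) = p"
      using map_permutation_compose_inv[OF g] hg by auto
    show "map_permutation ?N h ` {p. p permutes ?N} \<subseteq> {p. p permutes UNIV}"
      using map_permutation_permutes[OF h] by auto
    show "map_permutation UNIV ?g ` {p. p permutes UNIV} \<subseteq> {p. p permutes ?N}"
      using map_permutation_permutes[OF g] by auto
  qed
  have "of_int (sign (map_permutation ?N h p)) * (\<Prod>i\<in>UNIV. a (?g i) (?g (map_permutation ?N h p i)))
      = of_int (sign p) * (\<Prod>I\<in>?N. a I (p I))" if p: "p permutes ?N" for p
  proof -
    have "(\<Prod>i\<in>UNIV. a (?g i) (?g (map_permutation ?N h p i))) = (\<Prod>I\<in>?N. a (?g (h I)) (?g (map_permutation ?N h p (h I))))"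
      using prod.reindex_bij_betw[OF h, of "\<lambda>i. a (?g i) (?g (map_permutation ?N h p i))"] by simp
    also have "\<dots> = (\<Prod>I\<in>?N. a I (p I))"
    proof (rule prod.cong[OF refl])
      fix I assume I: "I \<in> ?N"
      then have "p I \<in> ?N" using p permutes_in_image by metis
      then show "a (?g (h I)) (?g (map_permutation ?N h p (h I))) = a I (p I)"
        using I by (simp only: map_permutation_apply[OF inj] gh)
    qed
    finally show ?thesis unfolding sign_map_permutation[OF inj p finite_atLeastAtMost] by simp
  qed
  then show ?thesis
    unfolding det_matrix_def det_def sum.reindex_bij_betw[OF bij, symmetric] by simp
qed

text \<open>The two sizes are treated separately because each is realised by its own index type,
  \<open>5\<close> or \<open>14\<close>.\<close>

lemma det_matrix_orthogonal:
  assumes k: "n = 5 \<or> n = 14"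
    and o: "\<And>I J. I \<in> {1..n} \<Longrightarrow> J \<in> {1..n} \<Longrightarrow> (\<Sum>K=1..n. a K I * a K J) = (if I = J then 1 else 0)"
  shows "det_matrix n a = 1 \<or> det_matrix n a = - 1"
proof -
  have *: "det_matrix n a = 1 \<or> det_matrix n a = - 1" if h: "bij_betw h {1..n} (UNIV :: 'n::finite set)" for h
  proof -
    let ?g = "inv_into {1..n} h"
    let ?A = "\<chi> i j. a (?g i) (?g j) :: real^'n^'n"
    have g: "?g i \<in> {1..n}" for i using bij_betw_inv_into[OF h] by (auto simp: bij_betw_def)
    have ginj: "?g i = ?g j \<longleftrightarrow> i = j" for i j using bij_betw_inv_into[OF h] by (auto simp: bij_betw_def inj_on_def)
    have "transpose ?A ** ?A = mat 1"
    proof -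
      have "(\<Sum>l\<in>UNIV. a (?g l) (?g i) * a (?g l) (?g j)) = (if i = j then 1 else 0)" for i j
        using o[OF g g, of i j] sum.reindex_bij_betw[OF bij_betw_inv_into[OF h], of "\<lambda>K. a K (?g i) * a K (?g j)"] ginj by simp
      then show ?thesis by (simp add: matrix_matrix_mult_def transpose_def mat_def vec_eq_iff)
    qed
    then have "orthogonal_matrix ?A" by (simp add: orthogonal_matrix)
    then show ?thesis unfolding det_matrix_eq_det[OF h] by (rule det_orthogonal_matrix)
  qed
  from k show ?thesis
  proof
    assume "n = 5"
    then obtain h where "bij_betw h {1..n} (UNIV :: 5 set)" using finite_same_card_bij[of "{1..n}" "UNIV :: 5 set"] by auto
    then show ?thesis by (rule *)
  next
    assume "n = 14"
    then obtain h where "bij_betw h {1..n} (UNIV :: 14 set)" using finite_same_card_bij[of "{1..n}" "UNIV :: 14 set"] by auto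
    then show ?thesis by (rule *)
  qed
qed

section \<open>The matrix exponential\<close>

primrec mpow :: "nat \<Rightarrow> (nat \<Rightarrow> nat \<Rightarrow> real) \<Rightarrow> nat \<Rightarrow> nat \<Rightarrow> nat \<Rightarrow> real" where
  "mpow n B 0 = id_matrix n"
| "mpow n B (Suc m) = (\<lambda>I J. \<Sum>K=1..n. B I K * mpow n B m K J)"

definition mexp :: "nat \<Rightarrow> (nat \<Rightarrow> nat \<Rightarrow> real) \<Rightarrow> real \<Rightarrow> nat \<Rightarrow> nat \<Rightarrow> real" where
  "mexp n B t I J = (\<Sum>m. mpow n B m I J / fact m * t ^ m)"

lemma mpow_bound: obtains C where "\<And>m I J. I \<in> {1..n} \<Longrightarrow> \<bar>mpow n B m I J\<bar> \<le> C ^ m"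
proof
  define b where "b = (\<Sum>I=1..n. \<Sum>K=1..n. \<bar>B I K\<bar>)"
  show "\<bar>mpow n B m I J\<bar> \<le> b ^ m" if "I \<in> {1..n}" for m I J
    using that
  proof (induction m arbitrary: I)
    case 0
    then show ?case by (simp add: id_matrix_def)
  next
    case (Suc m)
    have "\<bar>mpow n B (Suc m) I J\<bar> \<le> (\<Sum>K=1..n. \<bar>B I K * mpow n B m K J\<bar>)" by simp
    also have "\<dots> \<le> (\<Sum>K=1..n. \<bar>B I K\<bar> * b ^ m)"
      using Suc.IH by (intro sum_mono) (simp add: abs_mult mult_left_mono)
    also have "\<dots> = (\<Sum>K=1..n. \<bar>B I K\<bar>) * b ^ m" by (simp add: sum_distrib_right)
    also have "\<dots> \<le> b * b ^ m"
    proof (rule mult_right_mono)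
      show "(\<Sum>K=1..n. \<bar>B I K\<bar>) \<le> b" unfolding b_def
        using Suc.prems by (intro member_le_sum[of I "{1..n}" "\<lambda>I. \<Sum>K=1..n. \<bar>B I K\<bar>"] sum_nonneg) auto
      show "0 \<le> b ^ m" unfolding b_def by (intro zero_le_power sum_nonneg) auto
    qed
    finally show ?case by simp
  qed
qed

text \<open>The entries of the powers grow at most geometrically, so the scalar exponential series
  dominates.\<close>

lemma mexp_summable: assumes "I \<in> {1..n}" shows "summable (\<lambda>m. mpow n B m I J / fact m * t ^ m)"
proof -
  obtain C where C: "\<And>m I J. I \<in> {1..n} \<Longrightarrow> \<bar>mpow n B m I J\<bar> \<le> C ^ m"
    using mpow_bound[of n B] by blast
  show ?thesis
  proof (rule summable_comparison_test')
    show "summable (\<lambda>m. inverse (fact m) * (C * \<bar>t\<bar>) ^ m)" by (rule summable_exp)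
    show "norm (mpow n B m I J / fact m * t ^ m) \<le> inverse (fact m) * (C * \<bar>t\<bar>) ^ m" for m
      using mult_right_mono[OF C[OF assms, of m J], of "\<bar>t\<bar> ^ m / fact m"]
      by (simp add: abs_mult power_mult_distrib power_abs divide_inverse mult_ac)
  qed
qed

lemma mexp_deriv: assumes "I \<in> {1..n}"
  shows "((\<lambda>t. mexp n B t I J) has_real_derivative (\<Sum>K=1..n. B I K * mexp n B t K J)) (at t)"
proof -
  let ?c = "\<lambda>m. mpow n B m I J / fact m"
  have "diffs ?c m = mpow n B (Suc m) I J / fact m" for m
    by (simp add: diffs_def fact_Suc del: mpow.simps of_nat_Suc)
  then have d: "diffs ?c m * t ^ m = (\<Sum>K=1..n. B I K * (mpow n B m K J / fact m * t ^ m))" for m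
    by (simp add: sum_divide_distrib sum_distrib_right mult.assoc)
  have "((\<lambda>t. \<Sum>m. ?c m * t ^ m) has_real_derivative (\<Sum>m. diffs ?c m * t ^ m)) (at t)"
    by (rule termdiffs_strong_converges_everywhere) (rule mexp_summable[OF assms])
  also have "(\<Sum>m. diffs ?c m * t ^ m) = (\<Sum>K=1..n. \<Sum>m. B I K * (mpow n B m K J / fact m * t ^ m))"
    unfolding d by (rule suminf_sum) (rule summable_mult, rule mexp_summable)
  also have "\<dots> = (\<Sum>K=1..n. B I K * mexp n B t K J)"
    unfolding mexp_def by (rule sum.cong[OF refl], rule suminf_mult, rule mexp_summable)
  finally show ?thesis by (simp add: mexp_def)
qed

lemma mexp_0: "mexp n B 0 = id_matrix n"
  unfolding mexp_def using powser_zero[of "\<lambda>m. mpow n B m _ _ / fact m"] by (simp add: fun_eq_iff)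

lemma mexp_matrices: assumes "B \<in> matrices n" shows "mexp n B t \<in> matrices n"
proof -
  have "mpow n B m I J = 0" if "\<not> {I, J} \<subseteq> {1..n}" for m I J
    using that
  proof (induction m arbitrary: I)
    case 0
    then show ?case by (auto simp: id_matrix_def)
  next
    case (Suc m)
    show ?case
    proof (cases "I \<in> {1..n}")
      case True
      then show ?thesis using Suc by simp
    next
      case False
      then have "B I K = 0" for K using assms unfolding matrices_def by blast
      then show ?thesis by simp
    qed
  qed
  then show ?thesis by (simp add: matrices_def mexp_def)
qed

text \<open>The equations of \<open>H_group\<close> linearised at the identity: orthogonality
  becomes skewness, and invariance of the tensor becomes the Leibniz condition. The determinant adds
  no linear equation.\<close>

definition stab_algebra :: "nat \<Rightarrow> (nat \<Rightarrow> nat \<Rightarrow> nat \<Rightarrow> real) \<Rightarrow> (nat \<Rightarrow> nat \<Rightarrow> real) set" where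
  "stab_algebra n Y = {B \<in> matrices n. (\<forall>I J. B I J = - B J I) \<and>
     (\<forall>I\<in>{1..n}. \<forall>J\<in>{1..n}. \<forall>K\<in>{1..n}. (\<Sum>P=1..n. Y P J K * B P I + Y I P K * B P J + Y I J P * B P K) = 0)}"

lemma DERIV_zero_const: "(\<And>t::real. (f has_real_derivative 0) (at t)) \<Longrightarrow> f t = f (0::real)"
  using DERIV_isconst_all by blast

lemma mexp_orthogonal:
  assumes "\<And>I J. B I J = - B J I" and IJ: "I \<in> {1..n}" "J \<in> {1..n}"
  shows "(\<Sum>K=1..n. mexp n B t K I * mexp n B t K J) = (if I = J then 1 else 0)"
proof -
  let ?E = "mexp n B" and ?f = "\<lambda>t. \<Sum>K=1..n. mexp n B t K I * mexp n B t K J"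
  have "(?f has_real_derivative 0) (at t)" for t
  proof -
    have "(?f has_real_derivative (\<Sum>K=1..n. (\<Sum>L=1..n. B K L * ?E t L I) * ?E t K J + (\<Sum>L=1..n. B K L * ?E t L J) * ?E t K I)) (at t)"
      by (intro DERIV_sum DERIV_mult mexp_deriv) auto
    moreover have "(\<Sum>K=1..n. (\<Sum>L=1..n. B K L * ?E t L I) * ?E t K J) = - (\<Sum>K=1..n. (\<Sum>L=1..n. B K L * ?E t L J) * ?E t K I)"
    proof -
      have "(\<Sum>K=1..n. (\<Sum>L=1..n. B K L * ?E t L I) * ?E t K J) = (\<Sum>L=1..n. \<Sum>K=1..n. B K L * ?E t L I * ?E t K J)"
        unfolding sum_distrib_right by (rule sum.swap)
      also have "\<dots> = (\<Sum>L=1..n. \<Sum>K=1..n. - (B L K * ?E t K J * ?E t L I))"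
        by (intro sum.cong refl) (subst assms(1), simp)
      also have "\<dots> = - (\<Sum>K=1..n. (\<Sum>L=1..n. B K L * ?E t L J) * ?E t K I)"
        by (simp add: sum_negf sum_distrib_right)
      finally show ?thesis .
    qed
    ultimately show ?thesis by (simp add: sum.distrib)
  qed
  then have "?f t = ?f 0" by (rule DERIV_zero_const)
  also have "\<dots> = (\<Sum>K=1..n. if K = I then (if I = J then 1 else 0) else 0)"
    unfolding mexp_0 by (intro sum.cong) (auto simp: id_matrix_def)
  also have "\<dots> = (if I = J then 1 else 0)" using IJ by simp
  finally show ?thesis .
qed

lemma sum4_swap:
  fixes g :: "nat \<Rightarrow> nat \<Rightarrow> nat \<Rightarrow> nat \<Rightarrow> real"
  shows "(\<Sum>P\<in>A. \<Sum>Q\<in>A. \<Sum>R\<in>A. \<Sum>L\<in>A. g P Q R L) = (\<Sum>P\<in>A. \<Sum>Q\<in>A. \<Sum>R\<in>A. \<Sum>L\<in>A. g L Q R P)"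
    and "(\<Sum>P\<in>A. \<Sum>Q\<in>A. \<Sum>R\<in>A. \<Sum>L\<in>A. g P Q R L) = (\<Sum>P\<in>A. \<Sum>Q\<in>A. \<Sum>R\<in>A. \<Sum>L\<in>A. g P L R Q)"
    and "(\<Sum>P\<in>A. \<Sum>Q\<in>A. \<Sum>R\<in>A. \<Sum>L\<in>A. g P Q R L) = (\<Sum>P\<in>A. \<Sum>Q\<in>A. \<Sum>R\<in>A. \<Sum>L\<in>A. g P Q L R)"
proof -
  have *: "(\<Sum>P\<in>A. \<Sum>Q\<in>A. \<Sum>R\<in>A. \<Sum>L\<in>A. h P Q R L) = (\<Sum>(P, Q, R, L)\<in>A \<times> A \<times> A \<times> A. h P Q R L)" for h :: "nat \<Rightarrow> nat \<Rightarrow> nat \<Rightarrow> nat \<Rightarrow> real"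
    by (simp add: sum.cartesian_product)
  show "(\<Sum>P\<in>A. \<Sum>Q\<in>A. \<Sum>R\<in>A. \<Sum>L\<in>A. g P Q R L) = (\<Sum>P\<in>A. \<Sum>Q\<in>A. \<Sum>R\<in>A. \<Sum>L\<in>A. g L Q R P)"
    unfolding * by (rule sum.reindex_bij_witness[of _ "\<lambda>(P, Q, R, L). (L, Q, R, P)" "\<lambda>(P, Q, R, L). (L, Q, R, P)"]) auto
  show "(\<Sum>P\<in>A. \<Sum>Q\<in>A. \<Sum>R\<in>A. \<Sum>L\<in>A. g P Q R L) = (\<Sum>P\<in>A. \<Sum>Q\<in>A. \<Sum>R\<in>A. \<Sum>L\<in>A. g P L R Q)"
    unfolding * by (rule sum.reindex_bij_witness[of _ "\<lambda>(P, Q, R, L). (P, L, R, Q)" "\<lambda>(P, Q, R, L). (P, L, R, Q)"]) auto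
  show "(\<Sum>P\<in>A. \<Sum>Q\<in>A. \<Sum>R\<in>A. \<Sum>L\<in>A. g P Q R L) = (\<Sum>P\<in>A. \<Sum>Q\<in>A. \<Sum>R\<in>A. \<Sum>L\<in>A. g P Q L R)"
    unfolding * by (rule sum.reindex_bij_witness[of _ "\<lambda>(P, Q, R, L). (P, Q, L, R)" "\<lambda>(P, Q, R, L). (P, Q, L, R)"]) auto
qed

text \<open>The index equation contracted with three arbitrary vectors, that is, the derivative of
  the trilinear form along \<open>B\<close>.\<close>

lemma stab_algebra_invariant:
  assumes B: "B \<in> stab_algebra n Y"
  shows "(\<Sum>P=1..n. \<Sum>Q=1..n. \<Sum>R=1..n. Y P Q R * (\<Sum>L=1..n. B P L * x L) * y Q * z R)
     + (\<Sum>P=1..n. \<Sum>Q=1..n. \<Sum>R=1..n. Y P Q R * x P * (\<Sum>L=1..n. B Q L * y L) * z R)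
     + (\<Sum>P=1..n. \<Sum>Q=1..n. \<Sum>R=1..n. Y P Q R * x P * y Q * (\<Sum>L=1..n. B R L * z L)) = 0"
    (is "?a + ?b + ?c = 0")
proof -
  have "?a = (\<Sum>P=1..n. \<Sum>Q=1..n. \<Sum>R=1..n. \<Sum>L=1..n. Y P Q R * (B P L * x L) * y Q * z R)"
    by (simp only: sum_distrib_left sum_distrib_right)
  also have "\<dots> = (\<Sum>P=1..n. \<Sum>Q=1..n. \<Sum>R=1..n. \<Sum>L=1..n. Y L Q R * (B L P * x P) * y Q * z R)"
    by (rule sum4_swap(1))
  finally have a: "?a = \<dots>" .
  have "?b = (\<Sum>P=1..n. \<Sum>Q=1..n. \<Sum>R=1..n. \<Sum>L=1..n. Y P Q R * x P * (B Q L * y L) * z R)"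
    by (simp only: sum_distrib_left sum_distrib_right)
  also have "\<dots> = (\<Sum>P=1..n. \<Sum>Q=1..n. \<Sum>R=1..n. \<Sum>L=1..n. Y P L R * x P * (B L Q * y Q) * z R)"
    by (rule sum4_swap(2))
  finally have b: "?b = \<dots>" .
  have "?c = (\<Sum>P=1..n. \<Sum>Q=1..n. \<Sum>R=1..n. \<Sum>L=1..n. Y P Q R * x P * y Q * (B R L * z L))"
    by (simp only: sum_distrib_left sum_distrib_right)
  also have "\<dots> = (\<Sum>P=1..n. \<Sum>Q=1..n. \<Sum>R=1..n. \<Sum>L=1..n. Y P Q L * x P * y Q * (B L R * z R))"
    by (rule sum4_swap(3))
  finally have c: "?c = \<dots>" .
  have "?a + ?b + ?c = (\<Sum>P=1..n. \<Sum>Q=1..n. \<Sum>R=1..n. (\<Sum>L=1..n. Y L Q R * B L P + Y P L R * B L Q + Y P Q L * B L R) * (x P * y Q * z R))"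
    unfolding a b c
  proof (simp only: sum.distrib[symmetric], intro sum.cong refl)
    fix P Q R
    have "(\<Sum>L=1..n. Y L Q R * (B L P * x P) * y Q * z R) = (\<Sum>L=1..n. Y L Q R * B L P) * (x P * y Q * z R)"
      "(\<Sum>L=1..n. Y P L R * x P * (B L Q * y Q) * z R) = (\<Sum>L=1..n. Y P L R * B L Q) * (x P * y Q * z R)"
      "(\<Sum>L=1..n. Y P Q L * x P * y Q * (B L R * z R)) = (\<Sum>L=1..n. Y P Q L * B L R) * (x P * y Q * z R)"
      unfolding sum_distrib_right by (simp_all only: mult_ac)
    then show "(\<Sum>L=1..n. Y L Q R * (B L P * x P) * y Q * z R + Y P L R * x P * (B L Q * y Q) * z R + Y P Q L * x P * y Q * (B L R * z R))
      = (\<Sum>L=1..n. Y L Q R * B L P + Y P L R * B L Q + Y P Q L * B L R) * (x P * y Q * z R)"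
      by (simp only: sum.distrib distrib_right)
  qed
  also have "\<dots> = 0"
  proof (intro sum.neutral ballI)
    fix P Q R assume "P \<in> {1..n}" "Q \<in> {1..n}" "R \<in> {1..n}"
    then have "(\<Sum>L=1..n. Y L Q R * B L P + Y P L R * B L Q + Y P Q L * B L R) = 0"
      using B unfolding stab_algebra_def by blast
    then show "(\<Sum>L=1..n. Y L Q R * B L P + Y P L R * B L Q + Y P Q L * B L R) * (x P * y Q * z R) = 0" by simp
  qed
  finally show ?thesis .
qed

lemma id_matrix_sum: fixes f :: "nat \<Rightarrow> real"
  assumes "I \<in> {1..n}" shows "(\<Sum>P=1..n. f P * id_matrix n P I) = f I"
proof -
  have "(\<Sum>P=1..n. f P * id_matrix n P I) = (\<Sum>P=1..n. if P = I then f I else 0)"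
    by (rule sum.cong) (auto simp: id_matrix_def)
  then show ?thesis using assms by simp
qed

text \<open>By \<open>stab_algebra_invariant\<close>, applied to columns of the exponential, the
  transformed tensor has derivative zero along the curve, so it keeps its initial value.\<close>

lemma mexp_tensor:
  assumes B: "B \<in> stab_algebra n Y" and IJK: "I \<in> {1..n}" "J \<in> {1..n}" "K \<in> {1..n}"
  shows "(\<Sum>P=1..n. \<Sum>Q=1..n. \<Sum>R=1..n. Y P Q R * mexp n B t P I * mexp n B t Q J * mexp n B t R K) = Y I J K"
proof -
  let ?E = "mexp n B" and ?f = "\<lambda>t. \<Sum>P=1..n. \<Sum>Q=1..n. \<Sum>R=1..n. Y P Q R * mexp n B t P I * mexp n B t Q J * mexp n B t R K"
  have "(?f has_real_derivative 0) (at t)" for t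
  proof -
    have "(?f has_real_derivative (\<Sum>P=1..n. \<Sum>Q=1..n. \<Sum>R=1..n. ((Y P Q R * (\<Sum>L=1..n. B P L * ?E t L I)) * ?E t Q J
       + (\<Sum>L=1..n. B Q L * ?E t L J) * (Y P Q R * ?E t P I)) * ?E t R K
       + (\<Sum>L=1..n. B R L * ?E t L K) * (Y P Q R * ?E t P I * ?E t Q J))) (at t)"
      by (intro DERIV_sum DERIV_mult DERIV_cmult mexp_deriv) auto
    also have "(\<Sum>P=1..n. \<Sum>Q=1..n. \<Sum>R=1..n. ((Y P Q R * (\<Sum>L=1..n. B P L * ?E t L I)) * ?E t Q J
       + (\<Sum>L=1..n. B Q L * ?E t L J) * (Y P Q R * ?E t P I)) * ?E t R K
       + (\<Sum>L=1..n. B R L * ?E t L K) * (Y P Q R * ?E t P I * ?E t Q J)) = 0"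
      using stab_algebra_invariant[OF B, of "\<lambda>L. ?E t L I" "\<lambda>L. ?E t L J" "\<lambda>L. ?E t L K"]
      by (simp only: sum.distrib distrib_right distrib_left mult_ac)
    finally show ?thesis .
  qed
  then have "?f t = ?f 0" by (rule DERIV_zero_const)
  also have "\<dots> = Y I J K" unfolding mexp_0 id_matrix_sum[OF IJK(3)] id_matrix_sum[OF IJK(2)] id_matrix_sum[OF IJK(1)] ..
  finally show ?thesis .
qed

text \<open>Differentiate the defining equations of the group at time 0, where the curve is the
  identity.\<close>

lemma h_algebra_subset: "h_algebra k \<subseteq> stab_algebra (dim_n k) (model_tensor k)"
proof
  fix B assume "B \<in> h_algebra k"
  define n where "n = dim_n k"
  let ?Y = "model_tensor k"
  obtain a where a: "\<And>t::real. a t \<in> H_group k" "a 0 = id_matrix n" "\<And>I J. ((\<lambda>t. a t I J) has_real_derivative B I J) (at 0)"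
    using \<open>B \<in> h_algebra k\<close> unfolding h_algebra_def lie_algebra_def n_def by blast
  have o: "(\<Sum>K=1..n. a t K I * a t K J) = (if I = J then 1 else 0)" if "I \<in> {1..n}" "J \<in> {1..n}" for t I J
    using a(1)[of t] that unfolding H_group_def SO_group_def n_def by blast
  have u: "D = 0" if "((\<lambda>t. c) has_real_derivative D) (at 0)" for c D :: real
    using DERIV_unique[OF that DERIV_const] .
  have out: "B I J = 0" if "\<not> {I, J} \<subseteq> {1..n}" for I J
  proof -
    have "(\<lambda>t. a t I J) = (\<lambda>t. 0)"
      using a(1) that unfolding H_group_def SO_group_def matrices_def n_def by blast
    then show ?thesis using a(3)[of I J] u by simp
  qed
  have skew: "B I J = - B J I" for I J
  proof (cases "{I, J} \<subseteq> {1..n}")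
    case True
    then have IJ: "I \<in> {1..n}" "J \<in> {1..n}" by auto
    have "((\<lambda>t. \<Sum>K=1..n. a t K I * a t K J) has_real_derivative (\<Sum>K=1..n. B K I * a 0 K J + B K J * a 0 K I)) (at 0)"
      by (intro DERIV_sum DERIV_mult a(3))
    then have "(\<Sum>K=1..n. B K I * a 0 K J + B K J * a 0 K I) = 0" unfolding o[OF IJ] by (rule u)
    then show ?thesis unfolding sum.distrib a(2) id_matrix_sum[OF IJ(1)] id_matrix_sum[OF IJ(2)] by simp
  next
    case False
    then show ?thesis using out[of I J] out[of J I] by (simp add: insert_commute)
  qed
  have "(\<Sum>P=1..n. ?Y P J K * B P I + ?Y I P K * B P J + ?Y I J P * B P K) = 0"
    if IJK: "I \<in> {1..n}" "J \<in> {1..n}" "K \<in> {1..n}" for I J K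
  proof -
    have c: "(\<lambda>t. \<Sum>P=1..n. \<Sum>Q=1..n. \<Sum>R=1..n. ?Y P Q R * a t P I * a t Q J * a t R K) = (\<lambda>t. ?Y I J K)"
      using a(1) IJK unfolding H_group_def n_def by blast
    have "((\<lambda>t. \<Sum>P=1..n. \<Sum>Q=1..n. \<Sum>R=1..n. ?Y P Q R * a t P I * a t Q J * a t R K) has_real_derivative
       (\<Sum>P=1..n. \<Sum>Q=1..n. \<Sum>R=1..n. ((?Y P Q R * B P I) * a 0 Q J + B Q J * (?Y P Q R * a 0 P I)) * a 0 R K
          + B R K * (?Y P Q R * a 0 P I * a 0 Q J))) (at 0)"
      by (intro DERIV_sum DERIV_mult DERIV_cmult a(3))
    then have "(\<Sum>P=1..n. \<Sum>Q=1..n. \<Sum>R=1..n. ((?Y P Q R * B P I) * a 0 Q J + B Q J * (?Y P Q R * a 0 P I)) * a 0 R K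
          + B R K * (?Y P Q R * a 0 P I * a 0 Q J)) = 0" unfolding c by (rule u)
    then have "(\<Sum>P=1..n. \<Sum>Q=1..n. \<Sum>R=1..n. ?Y P Q R * B P I * id_matrix n Q J * id_matrix n R K)
       + (\<Sum>P=1..n. \<Sum>Q=1..n. \<Sum>R=1..n. ?Y P Q R * B Q J * id_matrix n P I * id_matrix n R K)
       + (\<Sum>P=1..n. \<Sum>Q=1..n. \<Sum>R=1..n. ?Y P Q R * B R K * id_matrix n P I * id_matrix n Q J) = 0"
      unfolding a(2) by (simp only: sum.distrib distrib_right distrib_left mult_ac)
    moreover have "(\<Sum>P=1..n. \<Sum>Q=1..n. \<Sum>R=1..n. ?Y P Q R * B P I * id_matrix n Q J * id_matrix n R K) = (\<Sum>P=1..n. ?Y P J K * B P I)"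
      unfolding id_matrix_sum[OF IJK(3)] id_matrix_sum[OF IJK(2)] ..
    moreover have "(\<Sum>P=1..n. \<Sum>Q=1..n. \<Sum>R=1..n. ?Y P Q R * B Q J * id_matrix n P I * id_matrix n R K) = (\<Sum>P=1..n. ?Y I P K * B P J)"
      unfolding id_matrix_sum[OF IJK(3)] sum_distrib_right[symmetric] id_matrix_sum[OF IJK(1)] ..
    moreover have "(\<Sum>P=1..n. \<Sum>Q=1..n. \<Sum>R=1..n. ?Y P Q R * B R K * id_matrix n P I * id_matrix n Q J) = (\<Sum>P=1..n. ?Y I J P * B P K)"
      unfolding sum_distrib_right[symmetric] id_matrix_sum[OF IJK(2)] id_matrix_sum[OF IJK(1)] ..
    ultimately show ?thesis by (simp only: sum.distrib)
  qed
  then show "B \<in> stab_algebra (dim_n k) (model_tensor k)"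
    using skew out unfolding stab_algebra_def matrices_def n_def[symmetric] by blast
qed

theorem h_algebra_eq: assumes "k \<in> {1, 4}" shows "h_algebra k = stab_algebra (dim_n k) (model_tensor k)"
proof
  show "h_algebra k \<subseteq> stab_algebra (dim_n k) (model_tensor k)" by (rule h_algebra_subset)
  show "stab_algebra (dim_n k) (model_tensor k) \<subseteq> h_algebra k"
  proof
    fix B assume B: "B \<in> stab_algebra (dim_n k) (model_tensor k)"
    define n where "n = dim_n k"
    have n: "n = 5 \<or> n = 14" using assms by (auto simp: n_def dim_n_def)
    have mat: "B \<in> matrices n" and skew: "\<And>I J. B I J = - B J I" using B unfolding stab_algebra_def n_def by blast+
    let ?E = "mexp n B"
    have o: "I \<in> {1..n} \<Longrightarrow> J \<in> {1..n} \<Longrightarrow> (\<Sum>K=1..n. ?E t K I * ?E t K J) = (if I = J then 1 else 0)" for I J t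
      by (rule mexp_orthogonal[OF skew])
    have d: "((\<lambda>t. ?E t I J) has_real_derivative (\<Sum>K=1..n. B I K * ?E t K J)) (at t)" for I J t
    proof (cases "I \<in> {1..n}")
      case True
      then show ?thesis by (rule mexp_deriv)
    next
      case False
      then have "(\<lambda>t. ?E t I J) = (\<lambda>t. 0)" "\<And>K. B I K = 0"
        using mexp_matrices[OF mat] mat unfolding matrices_def by blast+
      then show ?thesis by simp
    qed
    \<comment> \<open>Orthogonality leaves only the values 1 and -1; continuity of the determinant
      along the curve from the identity excludes -1.\<close>
    have det: "det_matrix n (?E t) = 1" for t
    proof -
      let ?d = "\<lambda>t. det_matrix n (?E t)"
      have pm: "?d t = 1 \<or> ?d t = - 1" for t by (rule det_matrix_orthogonal[OF n o])
      have "continuous_on UNIV ?d" unfolding det_matrix_def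
        using DERIV_isCont[OF d] by (intro continuous_on_sum continuous_on_mult continuous_on_const continuous_on_prod)
          (simp add: continuous_on_eq_continuous_at)
      then have c: "connected (range ?d)" by (rule connected_continuous_image) (rule connected_UNIV)
      have 0: "?d 0 = 1"
      proof -
        have "(\<Prod>I=1..n. id_matrix n I (p I)) = (if p = id then 1 else 0)" if p: "p permutes {1..n}" for p
        proof (cases "p = id")
          case False
          then obtain I where "I \<in> {1..n}" "p I \<noteq> I" using p by (metis eq_id_iff permutes_not_in)
          then show ?thesis using False by (auto intro!: prod_zero simp: id_matrix_def)
        qed (simp add: id_matrix_def)
        then have "?d 0 = (\<Sum>p | p permutes {1..n}. of_int (sign p) * (if p = id then 1 else 0))"
          unfolding det_matrix_def mexp_0 by (intro sum.cong) auto
        also have "\<dots> = (\<Sum>p | p permutes {1..n}. if p = id then 1 else 0)"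
          by (intro sum.cong) (auto simp: sign_id)
        also have "\<dots> = 1" using finite_permutations[of "{1..n}"] by (simp add: permutes_id)
        finally show ?thesis .
      qed
      show ?thesis
      proof (rule ccontr)
        assume "?d t \<noteq> 1"
        then have "?d t = - 1" using pm by blast
        then have "- 1 \<in> range ?d" "1 \<in> range ?d" using 0 by (metis rangeI)+
        then have "0 \<in> range ?d" using connectedD_interval[OF c, of "- 1" 1 0] by simp
        then obtain t' where "?d t' = 0" by auto
        then show False using pm[of t'] by auto
      qed
    qed
    have "?E t \<in> H_group k" for t
      unfolding H_group_def SO_group_def mem_Collect_eq n_def[symmetric]
      using mexp_matrices[OF mat] o det mexp_tensor[OF B] unfolding n_def by blast
    moreover have "((\<lambda>t. ?E t I J) has_real_derivative B I J) (at 0)" for I J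
    proof -
      have "(\<Sum>K=1..n. B I K * ?E 0 K J) = B I J"
      proof (cases "J \<in> {1..n}")
        case True
        then show ?thesis unfolding mexp_0 by (rule id_matrix_sum)
      next
        case False
        then have "B I J = 0" "\<And>K. id_matrix n K J = 0" using mat unfolding matrices_def by (blast, auto simp: id_matrix_def)
        then show ?thesis by (simp add: mexp_0)
      qed
      then show ?thesis using d[of I J 0] by simp
    qed
    ultimately show "B \<in> h_algebra k"
      unfolding h_algebra_def lie_algebra_def mem_Collect_eq n_def[symmetric] using mexp_0 by (intro exI[of _ ?E]) blast
  qed
qed

section \<open>The decomposition at a point\<close>

definition cubic_form3 :: "nat \<Rightarrow> (nat \<Rightarrow> nat \<Rightarrow> nat \<Rightarrow> real) \<Rightarrow> (nat \<Rightarrow> real) \<Rightarrow> (nat \<Rightarrow> real) \<Rightarrow> (nat \<Rightarrow> real) \<Rightarrow> real" where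
  "cubic_form3 n Y x y z = (\<Sum>I=1..n. \<Sum>J=1..n. \<Sum>K=1..n. Y I J K * x I * y J * z K)"

text \<open>Polarisation of a cubic form. It gives the uniqueness half of the definite description
  \<open>model_tensor\<close>.\<close>

lemma symmetric_tensor_eq_0:
  assumes s: "\<And>I J K. Y I J K = Y J I K \<and> Y I J K = Y I K J"
    and z: "\<And>x. cubic_form3 n Y x x x = 0" and N: "I \<in> {1..n}" "J \<in> {1..n}" "K \<in> {1..n}"
  shows "Y I J K = 0"
proof -
  let ?T = "cubic_form3 n Y"
  have add: "?T (\<lambda>I. x I + y I) u v = ?T x u v + ?T y u v" "?T u (\<lambda>I. x I + y I) v = ?T u x v + ?T u y v"
    "?T u v (\<lambda>I. x I + y I) = ?T u v x + ?T u v y" for x y u v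
    by (simp_all add: cubic_form3_def algebra_simps sum.distrib)
  have neg: "?T (\<lambda>I. - x I) u v = - ?T x u v" "?T u (\<lambda>I. - x I) v = - ?T u x v" "?T u v (\<lambda>I. - x I) = - ?T u v x" for x u v
    by (simp_all add: cubic_form3_def sum_negf)
  have s1: "?T x y u = ?T y x u" for x y u
  proof -
    have "Y J I K * x J * y I * u K = Y I J K * y I * x J * u K" for I J K using s[of I J K] by simp
    then have "(\<Sum>I=1..n. \<Sum>J=1..n. \<Sum>K=1..n. Y J I K * x J * y I * u K) = ?T y x u"
      unfolding cubic_form3_def by (intro sum.cong refl)
    then show ?thesis unfolding cubic_form3_def by (subst sum.swap)
  qed
  have s2: "?T x y u = ?T x u y" for x y u
  proof -
    have "Y I K J * x I * y K * u J = Y I J K * x I * u J * y K" for I J K using s[of I J K] by simp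
    then have "(\<Sum>I=1..n. \<Sum>J=1..n. \<Sum>K=1..n. Y I K J * x I * y K * u J) = ?T x u y"
      unfolding cubic_form3_def by (intro sum.cong refl)
    moreover have "?T x y u = (\<Sum>I=1..n. \<Sum>J=1..n. \<Sum>K=1..n. Y I K J * x I * y K * u J)"
      unfolding cubic_form3_def by (intro sum.cong refl sum.swap)
    ultimately show ?thesis by simp
  qed
  have xxy: "?T x x y = 0" for x y
  proof -
    have "?T (\<lambda>I. x I + y I) (\<lambda>I. x I + y I) (\<lambda>I. x I + y I) = 0"
      "?T (\<lambda>I. x I + - y I) (\<lambda>I. x I + - y I) (\<lambda>I. x I + - y I) = 0" by (rule z)+
    then show ?thesis
      unfolding add neg z s1[of y x] s2[of x y x] using s2[of y x y] s1[of x y y] s2[of x y y] s1[of y x y] by linarith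
  qed
  have xyu: "?T x y u = 0" for x y u
    using xxy[of "\<lambda>I. x I + y I" u] s1[of y x u] unfolding add xxy by simp
  have "?T (\<lambda>P. id_matrix n P I) (\<lambda>P. id_matrix n P J) (\<lambda>P. id_matrix n P K) = Y I J K"
    unfolding cubic_form3_def id_matrix_sum[OF N(3)] id_matrix_sum[OF N(2)] id_matrix_sum[OF N(1)] ..
  then show ?thesis using xyu by simp
qed

lemma cubic_form3_vec:
  fixes P :: "'e::euclidean_space \<Rightarrow> 'e \<Rightarrow> 'e"
  assumes "bounded_bilinear P" and Y: "\<And>I J K. I \<in> {1..n} \<Longrightarrow> J \<in> {1..n} \<Longrightarrow> K \<in> {1..n} \<Longrightarrow> Y I J K = P (b I) (b J) \<bullet> b K"
  shows "cubic_form3 n Y x y z = P (\<Sum>I=1..n. x I *\<^sub>R b I) (\<Sum>I=1..n. y I *\<^sub>R b I) \<bullet> (\<Sum>I=1..n. z I *\<^sub>R b I)"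
proof -
  interpret P: bounded_bilinear P by fact
  have "cubic_form3 n Y x y z = (\<Sum>I=1..n. \<Sum>J=1..n. \<Sum>K=1..n. (P (b I) (b J) \<bullet> b K) * x I * y J * z K)"
    unfolding cubic_form3_def by (intro sum.cong refl) (simp add: Y)
  also have "\<dots> = (\<Sum>I=1..n. \<Sum>J=1..n. P (x I *\<^sub>R b I) (y J *\<^sub>R b J) \<bullet> (\<Sum>K=1..n. z K *\<^sub>R b K))"
    by (simp add: inner_sum_right P.scaleR_left P.scaleR_right mult_ac)
  finally show ?thesis by (simp only: P.sum_left P.sum_right inner_sum_left)
     (subst sum.swap, simp)
qed

text \<open>The existence half comes from the frame itself: the components of the product in an
  adapted frame are symmetric and have the prescribed cubic form.\<close>

lemma model_tensor_eq:
  fixes P :: "'e::euclidean_space \<Rightarrow> 'e \<Rightarrow> 'e"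
  assumes k: "k \<in> {1, 4}" and P: "cartan_product P" and b: "adapted_frame k P b"
  shows "model_tensor k = (\<lambda>I J K. if {I, J, K} \<subseteq> {1..dim_n k} then P (b I) (b J) \<bullet> b K else 0)"
proof -
  interpret cartan_product P by fact
  let ?N = "{1..dim_n k}"
  let ?Y = "\<lambda>I J K. if {I, J, K} \<subseteq> ?N then P (b I) (b J) \<bullet> b K else 0"
  let ?Q = "\<lambda>Y. (\<forall>I J K. Y I J K = Y J I K \<and> Y I J K = Y I K J) \<and>
     (\<forall>I J K. \<not> {I, J, K} \<subseteq> ?N \<longrightarrow> Y I J K = 0) \<and>
     (\<forall>x. oct_of_real (\<Sum>I=1..dim_n k. \<Sum>J=1..dim_n k. \<Sum>K=1..dim_n k. Y I J K * x I * x J * x K)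
        = oct_scale (1/2) (det1 (model_matrix k x)))"
  have cub: "cubic_form3 (dim_n k) ?Y x x x = model_cubic k x" for x
    using cubic_form3_vec[OF P.bounded_bilinear_axioms, of "dim_n k" ?Y b x x x] b
    by (simp add: adapted_frame_def Let_def)
  have sym: "?Y I J K = ?Y J I K \<and> ?Y I J K = ?Y I K J" for I J K
    using P_comm[of "b I" "b J"] P_cyc[of "b I" "b J" "b K"] P_comm[of "b J" "b K"] P_cyc[of "b I" "b K" "b J"] P_cyc[of "b K" "b J" "b I"]
    by (simp add: insert_commute)
  have Q: "?Q ?Y"
    using sym cub by (auto simp: det1_model[OF k] cubic_form3_def)
  show ?thesis unfolding model_tensor_def
  proof (rule the_equality[where P = ?Q], rule Q)
    fix Z assume Z: "?Q Z"
    have "cubic_form3 (dim_n k) Z x x x = model_cubic k x" for x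
    proof -
      have "oct_of_real (cubic_form3 (dim_n k) Z x x x) = oct_of_real (model_cubic k x)"
        using Z unfolding cubic_form3_def det1_model[OF k] by blast
      then have "oct_of_real (cubic_form3 (dim_n k) Z x x x) 0 = oct_of_real (model_cubic k x) 0" by simp
      then show ?thesis by (simp add: oct_apply)
    qed
    then have "cubic_form3 (dim_n k) (\<lambda>I J K. Z I J K - ?Y I J K) x x x = 0" for x :: "nat \<Rightarrow> real"
      using cub[of x] by (simp add: cubic_form3_def left_diff_distrib sum_subtractf)
    note c0 = this
    have Zs: "Z I J K = Z J I K" "Z I J K = Z I K J" for I J K using Z by blast+
    have ds: "Z I J K - ?Y I J K = Z J I K - ?Y J I K \<and> Z I J K - ?Y I J K = Z I K J - ?Y I K J" for I J K
      by (intro conjI arg_cong2[of _ _ _ _ minus]) (use sym[of I J K] Zs[of I J K] in blast)+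
    have eq: "Z I J K - ?Y I J K = 0" if "I \<in> ?N" "J \<in> ?N" "K \<in> ?N" for I J K
      by (rule symmetric_tensor_eq_0[of "\<lambda>I J K. Z I J K - ?Y I J K", OF ds c0 that])
    show "Z = ?Y"
    proof (intro ext)
      fix I J K show "Z I J K = ?Y I J K"
        using eq[of I J K] Z by (cases "{I, J, K} \<subseteq> ?N") auto
    qed
  qed
qed

locale model_point = cartan_product P
  for P :: "'e::euclidean_space \<Rightarrow> 'e \<Rightarrow> 'e" (infixl "\<diamondop>" 70) +
  fixes k :: nat and \<epsilon> :: "nat \<Rightarrow> 'e"
  assumes k: "k \<in> {1, 4}" and n: "DIM('e) = dim_n k"
    and \<epsilon>: "I \<in> {1..dim_n k} \<Longrightarrow> J \<in> {1..dim_n k} \<Longrightarrow> \<epsilon> I \<bullet> \<epsilon> J = (if I = J then 1 else 0)"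
    and model: "I \<in> {1..dim_n k} \<Longrightarrow> J \<in> {1..dim_n k} \<Longrightarrow> K \<in> {1..dim_n k} \<Longrightarrow> model_tensor k I J K = (\<epsilon> I \<diamondop> \<epsilon> J) \<bullet> \<epsilon> K"
    and herm: "hermitian k P"
begin

abbreviation "N \<equiv> {1..dim_n k}"

lemma expand: "(\<Sum>I\<in>N. (v \<bullet> \<epsilon> I) *\<^sub>R \<epsilon> I) = v"
  using orthonormal_expand[of \<epsilon> v] \<epsilon> n by simp

lemma parseval: "(\<Sum>I\<in>N. (v \<bullet> \<epsilon> I) * (w \<bullet> \<epsilon> I)) = v \<bullet> w"
  by (subst expand[of w, symmetric]) (simp add: inner_sum_right mult.commute)

lemma coord_eqI: "(\<And>I. I \<in> N \<Longrightarrow> v \<bullet> \<epsilon> I = w \<bullet> \<epsilon> I) \<Longrightarrow> v = w"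
  using expand[of v] expand[of w] by (metis (no_types, lifting) sum.cong)

lemma tangent_ders: assumes "tangent A" obtains G where "ders_valued G" "\<And>x. A x x = G x x"
  using herm unfolding hermitian_def
proof (elim disjE conjE exE)
  fix c \<iota> assume "herm3 (*) (1::real) (\<lambda>x. x) P c \<iota>"
  then interpret H: herm3 "(*)" "1::real" "\<lambda>x. x" P c \<iota> .
  show thesis using H.tangent_imp_ders[OF assms] that by blast
next
  fix c \<iota> assume "herm3 qmul qone qcnj P c \<iota>"
  then interpret H: herm3 qmul qone qcnj P c \<iota> .
  show thesis using H.tangent_imp_ders[OF assms] that by blast
qed

lemma alternating_zero: assumes "ders_valued G" "\<And>x. G x x = 0" shows "G x y = 0"
  using herm unfolding hermitian_def
proof (elim disjE conjE exE)
  fix c \<iota> assume "herm3 (*) (1::real) (\<lambda>x. x) P c \<iota>"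
  then interpret H: herm3 "(*)" "1::real" "\<lambda>x. x" P c \<iota> .
  show ?thesis by (rule H.ders_alternating_zero[OF assms])
next
  fix c \<iota> assume "herm3 qmul qone qcnj P c \<iota>"
  then interpret H: herm3 qmul qone qcnj P c \<iota> .
  show ?thesis by (rule H.ders_alternating_zero[OF assms])
qed

definition op :: "(nat \<Rightarrow> nat \<Rightarrow> real) \<Rightarrow> 'e \<Rightarrow> 'e" where
  "op B y = (\<Sum>I\<in>N. (\<Sum>J\<in>N. B I J * (y \<bullet> \<epsilon> J)) *\<^sub>R \<epsilon> I)"

lemma op_linear: "linear (op B)"
  by (rule linearI) (simp_all add: op_def inner_add_left algebra_simps sum.distrib sum_distrib_left scaleR_sum_right)

lemma inner_comb: "I \<in> N \<Longrightarrow> (\<Sum>J\<in>N. f J *\<^sub>R \<epsilon> J) \<bullet> \<epsilon> I = f I"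
proof -
  assume I: "I \<in> N"
  have "(\<Sum>J\<in>N. f J *\<^sub>R \<epsilon> J) \<bullet> \<epsilon> I = (\<Sum>J\<in>N. if J = I then f I else 0)"
    unfolding inner_sum_left by (rule sum.cong) (use I in \<open>auto simp: \<epsilon>\<close>)
  then show ?thesis using I by simp
qed

lemma op_coord: "I \<in> N \<Longrightarrow> op B y \<bullet> \<epsilon> I = (\<Sum>J\<in>N. B I J * (y \<bullet> \<epsilon> J))"
  unfolding op_def by (rule inner_comb)

lemma op_entry: assumes "I \<in> N" "J \<in> N" shows "op B (\<epsilon> J) \<bullet> \<epsilon> I = B I J"
proof -
  have "op B (\<epsilon> J) \<bullet> \<epsilon> I = (\<Sum>L\<in>N. if L = J then B I J else 0)"
    unfolding op_coord[OF assms(1)] by (rule sum.cong) (use assms in \<open>auto simp: \<epsilon>\<close>)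
  then show ?thesis using assms by simp
qed

lemma cubic_vec: "cubic_form3 (dim_n k) (model_tensor k) (\<lambda>I. x \<bullet> \<epsilon> I) (\<lambda>I. y \<bullet> \<epsilon> I) (\<lambda>I. z \<bullet> \<epsilon> I) = (x \<diamondop> y) \<bullet> z"
  using cubic_form3_vec[where n = "dim_n k" and Y = "model_tensor k" and b = \<epsilon>, OF P.bounded_bilinear_axioms model, where x = "\<lambda>I. x \<bullet> \<epsilon> I" and y = "\<lambda>I. y \<bullet> \<epsilon> I" and z = "\<lambda>I. z \<bullet> \<epsilon> I"]
  unfolding expand .

lemma skew_op: assumes "\<And>I J. I \<in> N \<Longrightarrow> J \<in> N \<Longrightarrow> B I J = - B J I" shows "op B x \<bullet> x = 0"
proof -
  have "op B x \<bullet> x = (\<Sum>I\<in>N. \<Sum>J\<in>N. B I J * (x \<bullet> \<epsilon> J) * (x \<bullet> \<epsilon> I))"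
    unfolding parseval[of "op B x" x, symmetric] by (simp add: op_coord sum_distrib_right)
  also have "\<dots> = (\<Sum>J\<in>N. \<Sum>I\<in>N. - B J I * (x \<bullet> \<epsilon> J) * (x \<bullet> \<epsilon> I))"
    by (subst sum.swap, intro sum.cong refl) (use assms in metis)
  also have "\<dots> = - (\<Sum>J\<in>N. \<Sum>I\<in>N. B J I * (x \<bullet> \<epsilon> I) * (x \<bullet> \<epsilon> J))"
    by (simp add: sum_negf mult_ac)
  also have "(\<Sum>J\<in>N. \<Sum>I\<in>N. B J I * (x \<bullet> \<epsilon> I) * (x \<bullet> \<epsilon> J)) = op B x \<bullet> x"
    unfolding parseval[of "op B x" x, symmetric] by (simp add: op_coord sum_distrib_right)
  finally show ?thesis by simp
qed

lemma h_algebra_op: assumes "B \<in> h_algebra k" shows "op B \<in> ders"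
proof -
  have B: "B \<in> stab_algebra (dim_n k) (model_tensor k)" using assms h_algebra_eq[OF k] by simp
  have sk: "B I J = - B J I" for I J using B unfolding stab_algebra_def by blast
  have "op B x \<bullet> (x \<diamondop> x) = 0" for x
  proof -
    have o: "cubic_form3 (dim_n k) (model_tensor k) (\<lambda>I. \<Sum>L=1..dim_n k. B I L * (x \<bullet> \<epsilon> L)) f g
        = cubic_form3 (dim_n k) (model_tensor k) (\<lambda>I. op B x \<bullet> \<epsilon> I) f g"
      "cubic_form3 (dim_n k) (model_tensor k) f (\<lambda>I. \<Sum>L=1..dim_n k. B I L * (x \<bullet> \<epsilon> L)) g
        = cubic_form3 (dim_n k) (model_tensor k) f (\<lambda>I. op B x \<bullet> \<epsilon> I) g"
      "cubic_form3 (dim_n k) (model_tensor k) f g (\<lambda>I. \<Sum>L=1..dim_n k. B I L * (x \<bullet> \<epsilon> L))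
        = cubic_form3 (dim_n k) (model_tensor k) f g (\<lambda>I. op B x \<bullet> \<epsilon> I)" for f g
      unfolding cubic_form3_def by (intro sum.cong refl, simp add: op_coord)+
    have "(op B x \<diamondop> x) \<bullet> x + (x \<diamondop> op B x) \<bullet> x + (x \<diamondop> x) \<bullet> op B x = 0"
      unfolding cubic_vec[symmetric] o[symmetric] unfolding cubic_form3_def by (rule stab_algebra_invariant[OF B])
    then show ?thesis using P_cyc[of "op B x" x x] P_comm[of x "op B x"] by (simp add: inner_commute)
  qed
  moreover have "op B x \<bullet> x = 0" for x using skew_op sk by blast
  ultimately show ?thesis by (simp add: ders_def op_linear)
qed

lemma ders_h_algebra: assumes D: "D \<in> ders"
  shows "(\<lambda>I J. if {I, J} \<subseteq> N then D (\<epsilon> J) \<bullet> \<epsilon> I else 0) \<in> h_algebra k" (is "?B \<in> _")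
proof -
  have sk: "D (\<epsilon> J) \<bullet> \<epsilon> I = - (D (\<epsilon> I) \<bullet> \<epsilon> J)" for I J
    using ders_skew[OF D, of "\<epsilon> J" "\<epsilon> I"] by (simp add: inner_commute)
  have "(\<Sum>P=1..dim_n k. model_tensor k P J K * ?B P I + model_tensor k I P K * ?B P J + model_tensor k I J P * ?B P K) = 0"
    if IJK: "I \<in> N" "J \<in> N" "K \<in> N" for I J K
  proof -
    have "(\<Sum>P=1..dim_n k. model_tensor k P J K * ?B P I + model_tensor k I P K * ?B P J + model_tensor k I J P * ?B P K)
      = (\<Sum>P=1..dim_n k. (D (\<epsilon> I) \<bullet> \<epsilon> P) * ((\<epsilon> J \<diamondop> \<epsilon> K) \<bullet> \<epsilon> P) + (D (\<epsilon> J) \<bullet> \<epsilon> P) * ((\<epsilon> K \<diamondop> \<epsilon> I) \<bullet> \<epsilon> P)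
          + (D (\<epsilon> K) \<bullet> \<epsilon> P) * ((\<epsilon> I \<diamondop> \<epsilon> J) \<bullet> \<epsilon> P))"
    proof (rule sum.cong[OF refl])
      fix P assume P: "P \<in> N"
      have "model_tensor k P J K = (\<epsilon> J \<diamondop> \<epsilon> K) \<bullet> \<epsilon> P" "model_tensor k I P K = (\<epsilon> K \<diamondop> \<epsilon> I) \<bullet> \<epsilon> P"
        "model_tensor k I J P = (\<epsilon> I \<diamondop> \<epsilon> J) \<bullet> \<epsilon> P"
        using model IJK P P_cyc[of "\<epsilon> P" "\<epsilon> J" "\<epsilon> K"] P_cyc[of "\<epsilon> K" "\<epsilon> I" "\<epsilon> P"] by simp_all
      then show "model_tensor k P J K * ?B P I + model_tensor k I P K * ?B P J + model_tensor k I J P * ?B P K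
        = (D (\<epsilon> I) \<bullet> \<epsilon> P) * ((\<epsilon> J \<diamondop> \<epsilon> K) \<bullet> \<epsilon> P) + (D (\<epsilon> J) \<bullet> \<epsilon> P) * ((\<epsilon> K \<diamondop> \<epsilon> I) \<bullet> \<epsilon> P)
          + (D (\<epsilon> K) \<bullet> \<epsilon> P) * ((\<epsilon> I \<diamondop> \<epsilon> J) \<bullet> \<epsilon> P)" using IJK P by simp
    qed
    also have "\<dots> = 0" unfolding sum.distrib parseval using ders_polar[OF D, of "\<epsilon> I" "\<epsilon> J" "\<epsilon> K"] by simp
    finally show ?thesis .
  qed
  moreover have "?B I J = - ?B J I" for I J using sk[of J I] by auto
  moreover have "?B \<in> matrices (dim_n k)" by (simp add: matrices_def)
  ultimately have "?B \<in> stab_algebra (dim_n k) (model_tensor k)" unfolding stab_algebra_def by blast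
  then show ?thesis using h_algebra_eq[OF k] by simp
qed

text \<open>The first vector is contracted with the last index, the direction of differentiation, so
  \<open>op3 \<Gamma> x\<close> is the connection matrix in the direction \<open>x\<close>.\<close>

definition op3 :: "(nat \<Rightarrow> nat \<Rightarrow> nat \<Rightarrow> real) \<Rightarrow> 'e \<Rightarrow> 'e \<Rightarrow> 'e" where
  "op3 \<Gamma> x y = (\<Sum>K\<in>N. (x \<bullet> \<epsilon> K) *\<^sub>R op (\<lambda>I J. \<Gamma> I J K) y)"

lemma op3_bilinear: "bilinear (op3 \<Gamma>)"
  unfolding bilinear_def op3_def
  by (auto intro!: linear_compose_sum linear_compose_scale_right op_linear linearI simp: inner_add_left algebra_simps sum.distrib scaleR_sum_right)

lemma op3_entry: assumes "I \<in> N" "J \<in> N" "K \<in> N" shows "op3 \<Gamma> (\<epsilon> K) (\<epsilon> J) \<bullet> \<epsilon> I = \<Gamma> I J K"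
proof -
  have "op3 \<Gamma> (\<epsilon> K) (\<epsilon> J) \<bullet> \<epsilon> I = (\<Sum>L\<in>N. if L = K then \<Gamma> I J K else 0)"
    unfolding op3_def inner_sum_left by (rule sum.cong) (use assms in \<open>auto simp: \<epsilon> op_entry\<close>)
  then show ?thesis using assms by simp
qed

lemma op3_add: "op3 (\<lambda>I J K. \<Gamma> I J K + s * \<Delta> I J K) x y = op3 \<Gamma> x y + s *\<^sub>R op3 \<Delta> x y"
  by (simp add: op3_def op_def algebra_simps sum.distrib sum_distrib_left scaleR_sum_right)

lemma h_tensor_op3: assumes "F \<in> h_tensor_Rn k" shows "ders_valued (op3 F)"
proof (rule ders_valuedI)
  show "linear (\<lambda>x. op3 F x y)" for y using op3_bilinear by (simp add: bilinear_def)
  show "op3 F x \<in> ders" for x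
    unfolding op3_def[abs_def] using assms
    by (intro ders_sum ders_scale h_algebra_op) (simp add: h_tensor_Rn_def)
qed

lemma three_forms_op3: assumes "T \<in> three_forms (dim_n k)" shows "op3 T x x = 0"
proof (rule coord_eqI)
  fix I assume I: "I \<in> N"
  have sk: "T I J K = - T I K J" for J K using assms unfolding three_forms_def by blast
  have "op3 T x x \<bullet> \<epsilon> I = (\<Sum>K\<in>N. \<Sum>J\<in>N. T I J K * (x \<bullet> \<epsilon> J) * (x \<bullet> \<epsilon> K))"
    unfolding op3_def inner_sum_left by (simp add: op_coord[OF I] sum_distrib_left sum_distrib_right mult_ac)
  moreover have "(\<Sum>K\<in>N. \<Sum>J\<in>N. T I J K * (x \<bullet> \<epsilon> J) * (x \<bullet> \<epsilon> K)) = - (\<Sum>K\<in>N. \<Sum>J\<in>N. T I J K * (x \<bullet> \<epsilon> J) * (x \<bullet> \<epsilon> K))"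
  proof -
    have "(\<Sum>K\<in>N. \<Sum>J\<in>N. T I J K * (x \<bullet> \<epsilon> J) * (x \<bullet> \<epsilon> K)) = (\<Sum>J\<in>N. \<Sum>K\<in>N. - (T I K J * (x \<bullet> \<epsilon> K) * (x \<bullet> \<epsilon> J)))"
      by (subst sum.swap, intro sum.cong refl) (subst sk, simp)
    then show ?thesis by (simp only: sum_negf)
  qed
  ultimately show "op3 T x x \<bullet> \<epsilon> I = 0 \<bullet> \<epsilon> I" by simp
qed

theorem decomposition_iff:
  assumes out: "\<And>I J K. \<not> {I, J, K} \<subseteq> N \<Longrightarrow> \<Gamma> I J K = 0"
    and skew: "\<And>I J K. I \<in> N \<Longrightarrow> J \<in> N \<Longrightarrow> K \<in> N \<Longrightarrow> \<Gamma> I J K = - \<Gamma> J I K"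
  shows "(\<exists>!D. fst D \<in> h_tensor_Rn k \<and> snd D \<in> three_forms (dim_n k) \<and>
           (\<forall>I J K. \<Gamma> I J K = fst D I J K + 1/2 * snd D I J K)) \<longleftrightarrow> (\<forall>x. op3 \<Gamma> x x \<bullet> (x \<diamondop> x) = 0)"
    (is "?L \<longleftrightarrow> ?R")
proof
  assume ?L
  then obtain F T where F: "F \<in> h_tensor_Rn k" and T: "T \<in> three_forms (dim_n k)" and e: "\<And>I J K. \<Gamma> I J K = F I J K + 1/2 * T I J K"
    by (auto simp: Ex1_def)
  have "op3 \<Gamma> x x = op3 F x x" for x
  proof -
    have "\<Gamma> = (\<lambda>I J K. F I J K + 1/2 * T I J K)" using e by blast
    then show ?thesis using op3_add[of F "1/2" T x x] three_forms_op3[OF T, of x] by simp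
  qed
  then show ?R using h_tensor_op3[OF F] by (auto simp: ders_valued_def ders_def)
next
  assume R: ?R
  have sk: "op3 \<Gamma> x y \<bullet> y = 0" for x y
    unfolding op3_def inner_sum_left using skew_op[OF skew] by (intro sum.neutral) simp
  \<comment> \<open>Passing to the symmetric part loses nothing: \<open>tangent\<close> asks for a
    symmetric map, and only the values at equal arguments enter.\<close>
  define A where "A = sympart (op3 \<Gamma>)"
  have Axx: "A x x = op3 \<Gamma> x x" for x by (simp add: A_def sympart_def flip: scaleR_2)
  have "bilinear A"
    using op3_bilinear[of \<Gamma>] unfolding A_def bilinear_def sympart_def
    by (auto intro!: linear_compose_scale_right linear_compose_add)
  moreover have "A x y = A y x" for x y by (simp add: A_def sympart_def add.commute)
  ultimately have "tangent A" using R sk by (simp add: tangent_def Axx)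
  then obtain G where G: "ders_valued G" and AG: "\<And>x. A x x = G x x" by (rule tangent_ders) blast
  have Gd: "G x \<in> ders" and Gb: "bilinear G" for x using G by (auto simp: ders_valued_def)
  define F where "F I J K = (if {I, J, K} \<subseteq> N then G (\<epsilon> K) (\<epsilon> J) \<bullet> \<epsilon> I else 0)" for I J K
  define T where "T I J K = 2 * (\<Gamma> I J K - F I J K)" for I J K
  have FF: "F \<in> h_tensor_Rn k"
  proof -
    have "(\<lambda>I J. F I J K) \<in> h_algebra k" if "K \<in> N" for K
    proof -
      have "(\<lambda>I J. F I J K) = (\<lambda>I J. if {I, J} \<subseteq> N then G (\<epsilon> K) (\<epsilon> J) \<bullet> \<epsilon> I else 0)"
        using that by (auto simp: F_def fun_eq_iff)
      then show ?thesis using ders_h_algebra[OF Gd] by simp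
    qed
    then show ?thesis by (auto simp: h_tensor_Rn_def F_def)
  qed
  have Fsk: "F I J K = - F J I K" for I J K
    using ders_skew[OF Gd, of "\<epsilon> K" "\<epsilon> J" "\<epsilon> I"] by (auto simp: F_def inner_commute)
  \<comment> \<open>Polarisation of the vanishing of \<Gamma> - \<open>G\<close> on equal
    arguments.\<close>
  have alt: "op3 \<Gamma> x y - G x y = - (op3 \<Gamma> y x - G y x)" for x y
  proof -
    have z: "op3 \<Gamma> u u - G u u = 0" for u using AG[of u] Axx[of u] by simp
    have "(op3 \<Gamma> x x - G x x) + (op3 \<Gamma> y y - G y y) + ((op3 \<Gamma> x y - G x y) + (op3 \<Gamma> y x - G y x)) = 0"
      using z[of "x + y"] unfolding bilinear_ladd[OF Gb] bilinear_radd[OF Gb] bilinear_ladd[OF op3_bilinear] bilinear_radd[OF op3_bilinear]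
      by (simp add: algebra_simps)
    then have "(op3 \<Gamma> x y - G x y) + (op3 \<Gamma> y x - G y x) = 0" unfolding z by simp
    then show ?thesis by (simp only: eq_neg_iff_add_eq_0)
  qed
  \<comment> \<open>Skew in the first two indices because \<Gamma> and \<open>F\<close> are; skew in
    the last two by \<open>alt\<close>.\<close>
  have TT: "T \<in> three_forms (dim_n k)"
  proof -
    have "T I J K = - T J I K" for I J K
      using skew[of I J K] Fsk[of I J K] out[of I J K] out[of J I K]
      by (cases "{I, J, K} \<subseteq> N") (auto simp: T_def insert_commute)
    moreover have "T I J K = - T I K J" for I J K
    proof (cases "{I, J, K} \<subseteq> N")
      case True
      then have IJK: "I \<in> N" "J \<in> N" "K \<in> N" by auto
      have "(op3 \<Gamma> (\<epsilon> K) (\<epsilon> J) - G (\<epsilon> K) (\<epsilon> J)) \<bullet> \<epsilon> I = - ((op3 \<Gamma> (\<epsilon> J) (\<epsilon> K) - G (\<epsilon> J) (\<epsilon> K)) \<bullet> \<epsilon> I)"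
        by (subst alt) (simp only: inner_minus_left)
      then show ?thesis using IJK by (simp add: T_def F_def inner_diff_left op3_entry)
    next
      case False
      then have "\<not> {I, K, J} \<subseteq> N" by blast
      then show ?thesis using out[of I J K] out[of I K J] False by (simp only: T_def F_def if_False) simp
    qed
    moreover have "T I J K = 0" if "\<not> {I, J, K} \<subseteq> N" for I J K using out[OF that] that by (simp only: T_def F_def if_False) simp
    ultimately show ?thesis unfolding three_forms_def by blast
  qed
  show ?L
  proof (rule ex1I[of _ "(F, T)"])
    show "fst (F, T) \<in> h_tensor_Rn k \<and> snd (F, T) \<in> three_forms (dim_n k) \<and>
           (\<forall>I J K. \<Gamma> I J K = fst (F, T) I J K + 1/2 * snd (F, T) I J K)"
      using FF TT by (simp add: T_def field_simps)
    fix D assume D: "fst D \<in> h_tensor_Rn k \<and> snd D \<in> three_forms (dim_n k) \<and>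
           (\<forall>I J K. \<Gamma> I J K = fst D I J K + 1/2 * snd D I J K)"
    define F' T' where "F' = fst D" and "T' = snd D"
    have F': "F' \<in> h_tensor_Rn k" and T': "T' \<in> three_forms (dim_n k)" and e: "\<And>I J K. \<Gamma> I J K = F' I J K + 1/2 * T' I J K"
      using D by (auto simp: F'_def T'_def)
    \<comment> \<open>Two decompositions have derivation parts whose difference is again derivation
      valued, and it vanishes on equal arguments because three-forms do.\<close>
    let ?G = "\<lambda>x y. op3 F x y + (-1) *\<^sub>R op3 F' x y"
    have "ders_valued (\<lambda>x y. (-1) *\<^sub>R op3 F' x y)"
      using h_tensor_op3[OF F'] unfolding ders_valued_def bilinear_def
      by (intro conjI allI linear_compose_scale_right ders_scale) blast+
    then have dG: "ders_valued ?G" by (rule ders_valued_add[OF h_tensor_op3[OF FF]])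
    have "?G x x = 0" for x
    proof -
      have e1: "\<Gamma> = (\<lambda>I J K. F' I J K + 1/2 * T' I J K)" using e by blast
      have e2: "\<Gamma> = (\<lambda>I J K. F I J K + 1/2 * T I J K)" by (simp add: T_def fun_eq_iff field_simps)
      have "op3 \<Gamma> x x = op3 F' x x" using op3_add[of F' "1/2" T' x x] three_forms_op3[OF T', of x] e1 by simp
      moreover have "op3 \<Gamma> x x = op3 F x x" using op3_add[of F "1/2" T x x] three_forms_op3[OF TT, of x] e2 by simp
      ultimately show ?thesis by simp
    qed
    then have "?G x y = 0" for x y by (rule alternating_zero[OF dG])
    then have eq: "op3 F x y = op3 F' x y" for x y by simp
    have "F' I J K = F I J K" for I J K
    proof (cases "{I, J, K} \<subseteq> N")
      case True
      then show ?thesis using op3_entry[of I J K F] op3_entry[of I J K F'] eq by simp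
    next
      case False
      have "F' I J K = 0" "F I J K = 0" using False F' FF unfolding h_tensor_Rn_def by blast+
      then show ?thesis by simp
    qed
    then have FFF: "F' = F" by (simp add: fun_eq_iff)
    moreover have "T' = T" using e by (auto simp: fun_eq_iff FFF T_def)
    ultimately show "D = (F, T)" by (simp add: F'_def T'_def prod_eq_iff)
  qed
qed

end

section \<open>Manifolds with an \<open>H\<^sub>k\<close> structure\<close>

lemma chart_open: "is_chart X c \<Longrightarrow> open (snd c ` fst c)" by (simp add: is_chart_def)

lemma chart_inj: assumes "is_chart X c" shows "inj_on (snd c) (fst c)"
proof -
  have "homeomorphic_map (subtopology X (fst c)) (top_of_set (snd c ` fst c)) (snd c)" "openin X (fst c)"
    using assms by (auto simp: is_chart_def)
  then have "inj_on (snd c) (topspace (subtopology X (fst c)))" by (metis homeomorphic_imp_injective_map)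
  then show ?thesis using \<open>openin X (fst c)\<close> by (simp add: openin_subset inf_absorb2)
qed

lemma chart_inv_left: "is_chart X c \<Longrightarrow> p \<in> fst c \<Longrightarrow> chart_inv c (snd c p) = p"
  by (simp add: chart_inv_def chart_inj)

lemma chart_inv_right: "y \<in> snd c ` U \<Longrightarrow> U \<subseteq> fst c \<Longrightarrow> snd c (chart_inv c y) = y"
  unfolding chart_inv_def by (meson f_inv_into_f image_mono subsetD)

lemma chart_inv_in: assumes "is_chart X c" "y \<in> snd c ` U" "U \<subseteq> fst c" shows "chart_inv c y \<in> U"
  using assms chart_inv_left[OF assms(1)] by auto

lemma chart_image_open: assumes c: "is_chart X c" and U: "openin X U" shows "open (snd c ` (U \<inter> fst c))"
proof -
  have h: "homeomorphic_map (subtopology X (fst c)) (top_of_set (snd c ` fst c)) (snd c)" and o: "openin X (fst c)"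
    using c by (auto simp: is_chart_def)
  have "openin (subtopology X (fst c)) (U \<inter> fst c)" using U by (auto simp: openin_subtopology)
  moreover have "U \<inter> fst c \<subseteq> topspace (subtopology X (fst c))" using openin_subset[OF o] by auto
  ultimately have "openin (top_of_set (snd c ` fst c)) (snd c ` (U \<inter> fst c))"
    using homeomorphic_map_openness[OF h] by blast
  then show ?thesis using chart_open[OF c] openin_open_trans by blast
qed

lemma chart_preimage_open: assumes c: "is_chart X c" and T: "open T" shows "openin X {p \<in> fst c. snd c p \<in> T}"
proof -
  have h: "homeomorphic_map (subtopology X (fst c)) (top_of_set (snd c ` fst c)) (snd c)" and o: "openin X (fst c)"
    using c by (auto simp: is_chart_def)
  have "continuous_map (subtopology X (fst c)) (top_of_set (snd c ` fst c)) (snd c)" by (rule homeomorphic_imp_continuous_map[OF h])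
  moreover have "openin (top_of_set (snd c ` fst c)) (snd c ` fst c \<inter> T)" using T by (rule openin_open_Int)
  ultimately have "openin (subtopology X (fst c)) {p \<in> topspace (subtopology X (fst c)). snd c p \<in> snd c ` fst c \<inter> T}"
    by (rule openin_continuous_map_preimage)
  moreover have "{p \<in> topspace (subtopology X (fst c)). snd c p \<in> snd c ` fst c \<inter> T} = {p \<in> fst c. snd c p \<in> T}"
    using openin_subset[OF o] by auto
  ultimately show ?thesis using openin_trans_full[OF _ o] by simp
qed

locale atlas =
  fixes X :: "'a topology" and A :: "('a, 'e::euclidean_space) chart set"
  assumes mfd: "smooth_manifold X A"
begin

lemma chart: "c \<in> A \<Longrightarrow> is_chart X c" using mfd by (simp add: smooth_manifold_def)

lemma chart_openin: "c \<in> A \<Longrightarrow> openin X (fst c)" using chart by (simp add: is_chart_def)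

lemma topspace_charts: "p \<in> topspace X \<longleftrightarrow> (\<exists>c\<in>A. p \<in> fst c)" using mfd by (auto simp: smooth_manifold_def)

abbreviation trans :: "('a, 'e) chart \<Rightarrow> ('a, 'e) chart \<Rightarrow> 'e \<Rightarrow> 'e" where
  "trans c c' \<equiv> snd c' \<circ> chart_inv c"

lemma trans_smooth: "c \<in> A \<Longrightarrow> c' \<in> A \<Longrightarrow> smooth_on (snd c ` (fst c \<inter> fst c')) (trans c c')"
  using mfd by (simp add: smooth_manifold_def)

lemma overlap_open: "c \<in> A \<Longrightarrow> c' \<in> A \<Longrightarrow> open (snd c ` (fst c \<inter> fst c'))"
  using chart_image_open[OF chart chart_openin, of c c'] by (simp add: Int_commute)

lemma tmap_deriv: assumes "c \<in> A" "c' \<in> A" "p \<in> fst c" "p \<in> fst c'"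
  shows "(trans c c' has_derivative tmap c c' p) (at (snd c p))"
  unfolding tmap_def by (rule smooth_on_has_derivative[OF trans_smooth]) (use assms in auto)

lemma tmap_linear: "c \<in> A \<Longrightarrow> c' \<in> A \<Longrightarrow> p \<in> fst c \<Longrightarrow> p \<in> fst c' \<Longrightarrow> linear (tmap c c' p)"
  using has_derivative_linear[OF tmap_deriv] .

lemma tmap_chain:
  assumes c: "c \<in> A" "c' \<in> A" "c'' \<in> A" and p: "p \<in> fst c" "p \<in> fst c'" "p \<in> fst c''"
  shows "tmap c' c'' p (tmap c c' p x) = tmap c c'' p x"
proof -
  have e: "trans c c' (snd c p) = snd c' p" using chart_inv_left[OF chart[OF c(1)] p(1)] by simp
  have "(trans c' c'' \<circ> trans c c' has_derivative tmap c' c'' p \<circ> tmap c c' p) (at (snd c p))"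
    by (rule diff_chain_at[OF tmap_deriv[OF c(1,2) p(1,2)]]) (use tmap_deriv[OF c(2,3) p(2,3)] e in simp)
  moreover have "(trans c' c'' \<circ> trans c c' has_derivative tmap c c'' p) (at (snd c p))"
  proof (rule has_derivative_transform_within_open[OF tmap_deriv[OF c(1,3) p(1,3)]])
    show "open (snd c ` (fst c \<inter> fst c'))" by (rule overlap_open[OF c(1,2)])
    show "snd c p \<in> snd c ` (fst c \<inter> fst c')" using p by blast
    fix y assume y: "y \<in> snd c ` (fst c \<inter> fst c')"
    have "chart_inv c y \<in> fst c'" using chart_inv_in[OF chart[OF c(1)] y] by blast
    then show "trans c c'' y = (trans c' c'' \<circ> trans c c') y" using chart_inv_left[OF chart[OF c(2)]] by simp
  qed
  ultimately show ?thesis using has_derivative_unique by (metis comp_apply)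
qed

lemma tmap_id: assumes "c \<in> A" "p \<in> fst c" shows "tmap c c p x = x"
proof -
  have "((\<lambda>y. y) has_derivative tmap c c p) (at (snd c p))"
  proof (rule has_derivative_transform_within_open[OF tmap_deriv[OF assms(1,1,2,2)]])
    show "open (snd c ` fst c)" by (rule chart_open[OF chart[OF assms(1)]])
    show "snd c p \<in> snd c ` fst c" using assms by blast
    show "trans c c y = y" if "y \<in> snd c ` fst c" for y using chart_inv_right[OF that] by simp
  qed
  then show ?thesis using has_derivative_unique[OF _ has_derivative_ident] by metis
qed

end

section \<open>Smooth evaluation of tensors and smooth orthonormal frames\<close>

lemma linear_sum_Basis: "linear f \<Longrightarrow> f x = (\<Sum>b\<in>Basis. (x \<bullet> b) *\<^sub>R f b)" for f :: "'e::euclidean_space \<Rightarrow> 'b::real_vector"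
  by (subst euclidean_representation[of x, symmetric]) (simp only: linear_sum linear_scale)

lemma smooth_bilinear_app:
  fixes G :: "'e::euclidean_space \<Rightarrow> 'e \<Rightarrow> 'e \<Rightarrow> real" and \<tau> :: "'e \<Rightarrow> 'e"
  assumes S: "open S" "open S'" "\<tau> ` S' \<subseteq> S" and G: "\<And>x x'. smooth_on S (\<lambda>y. G y x x')" and b: "\<And>y. y \<in> S \<Longrightarrow> bilinear (G y)"
    and s: "smooth_on S' \<tau>" "smooth_on S' f" "smooth_on S' h"
  shows "smooth_on S' (\<lambda>y. G (\<tau> y) (f y) (h y))"
proof (rule smooth_on_cong[OF S(2)])
  have "smooth_on S' (\<lambda>y. G (\<tau> y) b b')" for b b'
    by (rule smooth_on_compose[OF S(2,1,3) s(1) G])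
  then show "smooth_on S' (\<lambda>y. \<Sum>b\<in>Basis. \<Sum>b'\<in>Basis. (f y \<bullet> b) * ((h y \<bullet> b') * G (\<tau> y) b b'))"
    by (intro smooth_on_sum[OF S(2)] smooth_on_mult[OF S(2)] smooth_on_inner[OF S(2)] smooth_on_const s)
  fix y assume "y \<in> S'"
  then have b: "bilinear (G (\<tau> y))" using S(3) b by blast
  show "(\<Sum>b\<in>Basis. \<Sum>b'\<in>Basis. (f y \<bullet> b) * ((h y \<bullet> b') * G (\<tau> y) b b')) = G (\<tau> y) (f y) (h y)"
  proof -
    have 1: "linear (\<lambda>x. G (\<tau> y) x (h y))" and 2: "linear (G (\<tau> y) x)" for x using b by (simp_all add: bilinear_def)
    have "G (\<tau> y) (f y) (h y) = (\<Sum>b\<in>Basis. (f y \<bullet> b) *\<^sub>R G (\<tau> y) b (h y))" by (rule linear_sum_Basis[OF 1])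
    also have "\<dots> = (\<Sum>b\<in>Basis. (f y \<bullet> b) *\<^sub>R (\<Sum>b'\<in>Basis. (h y \<bullet> b') *\<^sub>R G (\<tau> y) b b'))"
      by (intro sum.cong refl arg_cong2[of _ _ _ _ scaleR] linear_sum_Basis[OF 2])
    finally show ?thesis by (simp add: sum_distrib_left)
  qed
qed

lemma smooth_trilinear_app:
  fixes Y :: "'e::euclidean_space \<Rightarrow> 'e \<Rightarrow> 'e \<Rightarrow> 'e \<Rightarrow> real"
  assumes S: "open S" and Y: "\<And>x x' x''. smooth_on S (\<lambda>y. Y y x x' x'')"
    and l: "\<And>y x x'. y \<in> S \<Longrightarrow> linear (\<lambda>z. Y y z x x') \<and> linear (\<lambda>z. Y y x z x') \<and> linear (\<lambda>z. Y y x x' z)"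
    and s: "smooth_on S f" "smooth_on S h" "smooth_on S k"
  shows "smooth_on S (\<lambda>y. Y y (f y) (h y) (k y))"
proof (rule smooth_on_cong[OF S])
  have "smooth_on S (\<lambda>y. Y y b (h y) (k y))" for b
    by (rule smooth_bilinear_app[OF S S, where \<tau> = "\<lambda>y. y" and G = "\<lambda>y. Y y b"])
      (use Y l s smooth_on_ident[OF S] in \<open>auto simp: bilinear_def\<close>)
  then show "smooth_on S (\<lambda>y. \<Sum>b\<in>Basis. (f y \<bullet> b) * Y y b (h y) (k y))"
    by (intro smooth_on_sum[OF S] smooth_on_mult[OF S] smooth_on_inner[OF S] smooth_on_const s)
  show "(\<Sum>b\<in>Basis. (f y \<bullet> b) * Y y b (h y) (k y)) = Y y (f y) (h y) (k y)" if "y \<in> S" for y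
    using linear_sum_Basis[of "\<lambda>x. Y y x (h y) (k y)" "f y"] l[OF that] by simp
qed

text \<open>Gram-Schmidt with respect to a varying inner product, starting from a constant basis.
  The span clause of the induction keeps the next vector from vanishing at any point, so one frame
  serves all of \<open>S\<close>.\<close>

lemma smooth_gram_schmidt:
  fixes G :: "'e::euclidean_space \<Rightarrow> 'e \<Rightarrow> 'e \<Rightarrow> real" and \<epsilon> :: "nat \<Rightarrow> 'e"
  assumes S: "open S" and G: "\<And>x x'. smooth_on S (\<lambda>y. G y x x')" and b: "\<And>y. y \<in> S \<Longrightarrow> bilinear (G y)"
    and sym: "\<And>y x x'. y \<in> S \<Longrightarrow> G y x x' = G y x' x" and pos: "\<And>y x. y \<in> S \<Longrightarrow> x \<noteq> 0 \<Longrightarrow> G y x x > 0"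
    and \<epsilon>: "\<And>I J. I \<in> {1..n} \<Longrightarrow> J \<in> {1..n} \<Longrightarrow> \<epsilon> I \<bullet> \<epsilon> J = (if I = J then 1 else 0)"
  shows "\<exists>E. \<forall>I\<in>{1..n}. smooth_on S (E I) \<and> (\<forall>J\<in>{1..n}. \<forall>y\<in>S. G y (E I y) (E J y) = (if I = J then 1 else 0))"
proof -
  have "\<exists>E. \<forall>I\<in>{1..m}. smooth_on S (E I) \<and> (\<forall>y\<in>S. E I y \<in> span (\<epsilon> ` {1..m}))
     \<and> (\<forall>J\<in>{1..m}. \<forall>y\<in>S. G y (E I y) (E J y) = (if I = J then 1 else 0))" if "m \<le> n" for m
    using that
  proof (induction m)
    case 0
    then show ?case by simp
  next
    case (Suc m)
    then obtain E where E: "\<And>I. I \<in> {1..m} \<Longrightarrow> smooth_on S (E I)" "\<And>I y. I \<in> {1..m} \<Longrightarrow> y \<in> S \<Longrightarrow> E I y \<in> span (\<epsilon> ` {1..m})"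
      and Eo: "\<And>I J y. I \<in> {1..m} \<Longrightarrow> J \<in> {1..m} \<Longrightarrow> y \<in> S \<Longrightarrow> G y (E I y) (E J y) = (if I = J then 1 else 0)"
      by (metis Suc_leD)
    let ?e = "\<epsilon> (Suc m)"
    define u where "u y = ?e - (\<Sum>I=1..m. G y ?e (E I y) *\<^sub>R E I y)" for y
    have us: "smooth_on S u"
      unfolding u_def
    proof (rule smooth_on_diff[OF S smooth_on_const smooth_on_sum[OF S smooth_on_scaleR[OF S]]])
      fix I assume I: "I \<in> {1..m}"
      show "smooth_on S (E I)" by (rule E(1)[OF I])
      show "smooth_on S (\<lambda>y. G y ?e (E I y))"
        by (rule smooth_bilinear_app[OF S S _ G b smooth_on_ident[OF S] smooth_on_const E(1)[OF I]]) simp_all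
    qed
    have sp: "(\<Sum>I=1..m. G y ?e (E I y) *\<^sub>R E I y) \<in> span (\<epsilon> ` {1..m})" if "y \<in> S" for y
      using E(2)[OF _ that] by (intro span_sum span_scale)
    have u0: "u y \<noteq> 0" if "y \<in> S" for y
    proof
      assume "u y = 0"
      then have "?e \<in> span (\<epsilon> ` {1..m})" using sp[OF that] by (simp add: u_def)
      moreover have "orthogonal ?e x" if "x \<in> \<epsilon> ` {1..m}" for x
        using that \<epsilon>[of "Suc m"] Suc.prems by (auto simp: orthogonal_def)
      ultimately have "orthogonal ?e ?e" using orthogonal_to_span by blast
      then show False using \<epsilon>[of "Suc m" "Suc m"] Suc.prems by (simp add: orthogonal_def)
    qed
    have uE: "G y (u y) (E J y) = 0" if y: "y \<in> S" and J: "J \<in> {1..m}" for y J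
    proof -
      have l: "linear (\<lambda>x. G y x (E J y))" using b[OF y] by (simp add: bilinear_def)
      have "G y (\<Sum>I=1..m. G y ?e (E I y) *\<^sub>R E I y) (E J y) = (\<Sum>I=1..m. if I = J then G y ?e (E J y) else 0)"
        unfolding linear_sum[OF l] by (rule sum.cong) (use Eo[OF _ J y] in \<open>auto simp: linear_scale[OF l]\<close>)
      then show ?thesis using J by (simp add: u_def linear_diff[OF l])
    qed
    define F where "F I y = (if I = Suc m then (1 / sqrt (G y (u y) (u y))) *\<^sub>R u y else E I y)" for I y
    have Gu: "smooth_on S (\<lambda>y. G y (u y) (u y))"
      by (rule smooth_bilinear_app[OF S S, where \<tau> = "\<lambda>y. y" and G = G]) (use us G b smooth_on_ident[OF S] in auto)
    have gp: "G y (u y) (u y) > 0" if "y \<in> S" for y using pos[OF that u0[OF that]] .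
    have Fs: "smooth_on S (F (Suc m))"
      unfolding F_def using gp
      by (simp, intro smooth_on_scaleR[OF S] smooth_on_divide[OF S] smooth_on_sqrt[OF S] smooth_on_const Gu us)
        (auto simp: less_imp_neq[symmetric])
    have Fe: "F I = E I" if "I \<in> {1..m}" for I using that by (auto simp: F_def fun_eq_iff)
    have Fsp: "F I y \<in> span (\<epsilon> ` {1..Suc m})" if "I \<in> {1..Suc m}" "y \<in> S" for I y
    proof (cases "I = Suc m")
      case True
      have "span (\<epsilon> ` {1..m}) \<subseteq> span (\<epsilon> ` {1..Suc m})" by (rule span_mono) auto
      moreover have "?e \<in> span (\<epsilon> ` {1..Suc m})" by (rule span_base) auto
      ultimately have "u y \<in> span (\<epsilon> ` {1..Suc m})" unfolding u_def using sp[OF that(2)] by (meson span_diff subsetD)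
      then show ?thesis using True by (simp add: F_def span_scale)
    next
      case False
      then have "I \<in> {1..m}" using that by auto
      moreover have "span (\<epsilon> ` {1..m}) \<subseteq> span (\<epsilon> ` {1..Suc m})" by (rule span_mono) auto
      ultimately show ?thesis using E(2)[of I y] that Fe by auto
    qed
    have Fo: "G y (F I y) (F J y) = (if I = J then 1 else 0)" if "I \<in> {1..Suc m}" "J \<in> {1..Suc m}" and y: "y \<in> S" for I J y
    proof -
      note bl = bilinear_lmul[OF b[OF y]] bilinear_rmul[OF b[OF y]]
      have 1: "G y (F (Suc m) y) (F (Suc m) y) = 1" using gp[OF y] by (simp add: F_def bl)
      have 2: "G y (F (Suc m) y) (F J y) = 0" "G y (F J y) (F (Suc m) y) = 0" if "J \<in> {1..m}" for J
        using uE[OF y that] sym[OF y, of "E J y" "u y"] that by (auto simp: F_def bl)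
      have "I = Suc m \<or> I \<in> {1..m}" "J = Suc m \<or> J \<in> {1..m}" using that by auto
      then show ?thesis using 1 2 Eo[OF _ _ y] Fe by (elim disjE) auto
    qed
    have "smooth_on S (F I)" if "I \<in> {1..Suc m}" for I
      using that Fs E(1) Fe by (cases "I = Suc m") auto
    then show ?case using Fsp Fo by (intro exI[of _ F]) blast
  qed
  then show ?thesis by (meson order_refl)
qed

lemma linear_eq_0_frame:
  fixes \<epsilon> :: "nat \<Rightarrow> 'e::euclidean_space"
  assumes "linear f" "\<And>x. (\<Sum>I=1..n. (x \<bullet> \<epsilon> I) *\<^sub>R \<epsilon> I) = x" "\<And>I. I \<in> {1..n} \<Longrightarrow> f (\<epsilon> I) = 0"
  shows "f x = 0"
proof -
  have "f x = (\<Sum>I=1..n. (x \<bullet> \<epsilon> I) *\<^sub>R f (\<epsilon> I))"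
    by (subst assms(2)[of x, symmetric]) (simp only: linear_sum[OF assms(1)] linear_scale[OF assms(1)])
  then show ?thesis using assms(3) by simp
qed

text \<open>The product on the model space with structure constants \<open>y\<close> in the basis
  \<epsilon>; it is used with the components of the tensor in an orthonormal frame of the
  metric.\<close>

definition frame_product :: "nat \<Rightarrow> (nat \<Rightarrow> 'e::euclidean_space) \<Rightarrow> (nat \<Rightarrow> nat \<Rightarrow> nat \<Rightarrow> real) \<Rightarrow> 'e \<Rightarrow> 'e \<Rightarrow> 'e" where
  "frame_product n \<epsilon> y x x' = (\<Sum>K=1..n. (\<Sum>I=1..n. \<Sum>J=1..n. y I J K * (x \<bullet> \<epsilon> I) * (x' \<bullet> \<epsilon> J)) *\<^sub>R \<epsilon> K)"

lemma linear_coef: "linear (\<lambda>x. (a * (x \<bullet> u) * (z \<bullet> v)) *\<^sub>R w)" "linear (\<lambda>x. (a * (z \<bullet> v) * (x \<bullet> u)) *\<^sub>R w)"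
  for u v w :: "'e::euclidean_space"
  by (simp_all add: linear_iff inner_add_left distrib_left distrib_right scaleR_add_left mult_ac)

text \<open>The index conditions are multilinear, so each passes from basis vectors to all vectors
  one argument at a time.\<close>

lemma
  fixes \<epsilon> :: "nat \<Rightarrow> 'e::euclidean_space"
  assumes bij: "bij_betw \<epsilon> {1..n} Basis"
    and sym: "\<And>I J K. I \<in> {1..n} \<Longrightarrow> J \<in> {1..n} \<Longrightarrow> K \<in> {1..n} \<Longrightarrow> y I J K = y J I K \<and> y I J K = y I K J"
    and tr: "\<And>I. I \<in> {1..n} \<Longrightarrow> (\<Sum>J=1..n. y I J J) = 0"
    and q: "\<And>J K L M. J \<in> {1..n} \<Longrightarrow> K \<in> {1..n} \<Longrightarrow> L \<in> {1..n} \<Longrightarrow> M \<in> {1..n} \<Longrightarrow>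
       (\<Sum>I=1..n. y J K I * y L M I + y L J I * y K M I + y K L I * y J M I)
       = (if J = K then 1 else 0) * (if L = M then 1 else 0) + (if L = J then 1 else 0) * (if K = M then 1 else 0)
         + (if K = L then 1 else 0) * (if J = M then 1 else 0)"
  shows frame_product_entry: "\<And>I J K. I \<in> {1..n} \<Longrightarrow> J \<in> {1..n} \<Longrightarrow> K \<in> {1..n} \<Longrightarrow> frame_product n \<epsilon> y (\<epsilon> I) (\<epsilon> J) \<bullet> \<epsilon> K = y I J K"
    and frame_product_cartan: "cartan_product (frame_product n \<epsilon> y)"
    and frame_product_trace: "(\<Sum>b\<in>Basis. frame_product n \<epsilon> y x b \<bullet> b) = 0"
proof -
  let ?N = "{1..n}" and ?P = "frame_product n \<epsilon> y"
  have \<epsilon>: "\<epsilon> I \<bullet> \<epsilon> J = (if I = J then 1 else 0)" if "I \<in> ?N" "J \<in> ?N" for I J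
    using inner_Basis[OF bij_betwE[OF bij, rule_format, OF that(1)] bij_betwE[OF bij, rule_format, OF that(2)]]
      inj_on_eq_iff[OF bij_betw_imp_inj_on[OF bij] that] by simp
  have ex: "(\<Sum>I=1..n. (x \<bullet> \<epsilon> I) *\<^sub>R \<epsilon> I) = x" for x
    using sum.reindex_bij_betw[OF bij, of "\<lambda>b. (x \<bullet> b) *\<^sub>R b"] by (simp add: euclidean_representation)
  have bl: "bilinear ?P"
  proof -
    have "linear (\<lambda>x. ?P x z)" "linear (\<lambda>x. ?P z x)" for z
      unfolding frame_product_def scaleR_sum_left
      by (intro linear_compose_sum ballI linear_coef)+
    then show ?thesis unfolding bilinear_def by simp
  qed
  interpret P: bounded_bilinear ?P using bl by (simp add: bilinear_conv_bounded_bilinear)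
  have delta: "(\<Sum>I=1..n. f I * (\<epsilon> J \<bullet> \<epsilon> I)) = f J" if "J \<in> ?N" for f J
  proof -
    have "(\<Sum>I=1..n. f I * (\<epsilon> J \<bullet> \<epsilon> I)) = (\<Sum>I=1..n. if I = J then f J else 0)"
      by (rule sum.cong) (use that in \<open>auto simp: \<epsilon>\<close>)
    then show ?thesis using that by simp
  qed
  have comb: "(\<Sum>K=1..n. f K *\<^sub>R \<epsilon> K) \<bullet> \<epsilon> L = f L" if "L \<in> ?N" for f L
    unfolding inner_sum_left inner_scaleR_left delta[OF that, of f, symmetric]
    by (intro sum.cong refl arg_cong2[of _ _ _ _ "(*)"] inner_commute)
  show entry: "?P (\<epsilon> I) (\<epsilon> J) \<bullet> \<epsilon> K = y I J K" if "I \<in> ?N" "J \<in> ?N" "K \<in> ?N" for I J K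
    unfolding frame_product_def comb[OF that(3)] delta[OF that(2)]
    using delta[OF that(1), of "\<lambda>I. y I J K"] by (simp add: delta[OF that(2)])
  have lin: "linear (\<lambda>x. ?P x z)" "linear (\<lambda>x. ?P z x)" for z using bl by (auto simp: bilinear_def)
  have li: "linear (\<lambda>x. F x \<bullet> w)" "linear (\<lambda>x. w \<bullet> F x)" if "linear F" for F :: "'e \<Rightarrow> 'e" and w
    using that by (auto intro!: linearI simp: linear_add linear_scale inner_add_left inner_add_right)
  have ext0: "v = 0" if "\<And>K. K \<in> ?N \<Longrightarrow> v \<bullet> \<epsilon> K = 0" for v :: 'e
    using ex[of v] that by simp
  have comm: "?P x z = ?P z x" for x z
  proof -
    have e: "?P (\<epsilon> I) (\<epsilon> J) - ?P (\<epsilon> J) (\<epsilon> I) = 0" if "I \<in> ?N" "J \<in> ?N" for I J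
      by (rule ext0) (use that sym in \<open>simp add: inner_diff_left entry\<close>)
    have e2: "?P x (\<epsilon> J) - ?P (\<epsilon> J) x = 0" if "J \<in> ?N" for J x
      by (rule linear_eq_0_frame[of "\<lambda>x. ?P x (\<epsilon> J) - ?P (\<epsilon> J) x", OF _ ex e[OF _ that]]) (intro linear_compose_sub lin)
    have "?P x z - ?P z x = 0"
      by (rule linear_eq_0_frame[of "\<lambda>z. ?P x z - ?P z x", OF _ ex e2]) (intro linear_compose_sub lin)
    then show ?thesis by simp
  qed
  have psym: "?P x z \<bullet> w = z \<bullet> ?P x w" for x z w
  proof -
    have e: "?P (\<epsilon> I) (\<epsilon> J) \<bullet> \<epsilon> K - \<epsilon> J \<bullet> ?P (\<epsilon> I) (\<epsilon> K) = 0" if "I \<in> ?N" "J \<in> ?N" "K \<in> ?N" for I J K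
      using entry[OF that] entry[OF that(1,3,2)] sym[OF that] by (simp add: inner_commute)
    have e1: "?P x (\<epsilon> J) \<bullet> \<epsilon> K - \<epsilon> J \<bullet> ?P x (\<epsilon> K) = 0" if "J \<in> ?N" "K \<in> ?N" for J K x
      by (rule linear_eq_0_frame[of "\<lambda>x. ?P x (\<epsilon> J) \<bullet> \<epsilon> K - \<epsilon> J \<bullet> ?P x (\<epsilon> K)", OF _ ex e[OF _ that]]) (intro linear_compose_sub li lin)
    have e2: "?P x z \<bullet> \<epsilon> K - z \<bullet> ?P x (\<epsilon> K) = 0" if "K \<in> ?N" for K x z
      by (rule linear_eq_0_frame[of "\<lambda>z. ?P x z \<bullet> \<epsilon> K - z \<bullet> ?P x (\<epsilon> K)", OF _ ex e1[OF _ that]])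
        (intro linear_compose_sub li lin linearI; simp add: inner_add_left)
    have "?P x z \<bullet> w - z \<bullet> ?P x w = 0"
      by (rule linear_eq_0_frame[of "\<lambda>w. ?P x z \<bullet> w - z \<bullet> ?P x w", OF _ ex e2])
        (intro linear_compose_sub li lin linearI; simp add: inner_add_right)
    then show ?thesis by simp
  qed
  have parseval: "(\<Sum>I=1..n. (v \<bullet> \<epsilon> I) * (w \<bullet> \<epsilon> I)) = v \<bullet> w" for v w
    by (subst ex[of w, symmetric]) (simp add: inner_sum_right mult.commute)
  define R where "R a b d e = ?P a b \<bullet> ?P d e + ?P d a \<bullet> ?P b e + ?P b d \<bullet> ?P a e
     - ((a \<bullet> b) * (d \<bullet> e) + (d \<bullet> a) * (b \<bullet> e) + (b \<bullet> d) * (a \<bullet> e))" for a b d e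
  have Rlin: "linear (\<lambda>x. R x b d e)" "linear (\<lambda>x. R a x d e)" "linear (\<lambda>x. R a b x e)" "linear (\<lambda>x. R a b d x)" for a b d e
    unfolding R_def by (rule linearI; simp add: P.add_left P.add_right P.scaleR_left P.scaleR_right inner_add_left inner_add_right algebra_simps)+
  have R0: "R (\<epsilon> J) (\<epsilon> K) (\<epsilon> L) (\<epsilon> M) = 0" if "J \<in> ?N" "K \<in> ?N" "L \<in> ?N" "M \<in> ?N" for J K L M
  proof -
    have "?P (\<epsilon> J) (\<epsilon> K) \<bullet> ?P (\<epsilon> L) (\<epsilon> M) = (\<Sum>I=1..n. y J K I * y L M I)" if "J \<in> ?N" "K \<in> ?N" "L \<in> ?N" "M \<in> ?N" for J K L M
      unfolding parseval[of "?P (\<epsilon> J) (\<epsilon> K)" "?P (\<epsilon> L) (\<epsilon> M)", symmetric] by (rule sum.cong) (use that in \<open>simp_all add: entry\<close>)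
    then show ?thesis unfolding R_def using q[OF that] that by (simp add: sum.distrib \<epsilon>)
  qed
  have R1: "R x (\<epsilon> K) (\<epsilon> L) (\<epsilon> M) = 0" if "K \<in> ?N" "L \<in> ?N" "M \<in> ?N" for x K L M
    by (rule linear_eq_0_frame[OF Rlin(1) ex R0[OF _ that]])
  have R2: "R x z (\<epsilon> L) (\<epsilon> M) = 0" if "L \<in> ?N" "M \<in> ?N" for x z L M
    by (rule linear_eq_0_frame[OF Rlin(2) ex R1[OF _ that]])
  have R3: "R x z w (\<epsilon> M) = 0" if "M \<in> ?N" for x z w M
    by (rule linear_eq_0_frame[OF Rlin(3) ex R2[OF _ that]])
  have R4: "R x z w v = 0" for x z w v
    by (rule linear_eq_0_frame[OF Rlin(4) ex R3])
  \<comment> \<open>\<open>R\<close> is the defect of condition (iii); with three equal arguments it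
    is three times the defect of the cube identity paired with \<open>b\<close>.\<close>
  have cube: "?P (?P x x) x = (x \<bullet> x) *\<^sub>R x" for x
  proof (rule euclidean_eqI)
    fix b
    have "?P (?P x x) x \<bullet> b = ?P x x \<bullet> ?P x b" using psym[of x "?P x x" b] comm[of "?P x x" x] by simp
    then show "?P (?P x x) x \<bullet> b = ((x \<bullet> x) *\<^sub>R x) \<bullet> b" using R4[of x x x b] by (simp add: R_def)
  qed
  show "cartan_product ?P"
    by (rule cartan_product.intro[OF P.bounded_bilinear_axioms cartan_product_axioms.intro]) (use comm psym cube in blast)+
  have t: "(\<Sum>J=1..n. ?P x (\<epsilon> J) \<bullet> \<epsilon> J) = 0"
  proof (rule linear_eq_0_frame[of "\<lambda>x. \<Sum>J=1..n. ?P x (\<epsilon> J) \<bullet> \<epsilon> J", OF _ ex])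
    show "linear (\<lambda>x. \<Sum>J=1..n. ?P x (\<epsilon> J) \<bullet> \<epsilon> J)" by (intro linear_compose_sum ballI li lin)
    show "(\<Sum>J=1..n. ?P (\<epsilon> I) (\<epsilon> J) \<bullet> \<epsilon> J) = 0" if "I \<in> ?N" for I
      using tr[OF that] that by (simp add: entry)
  qed
  then show "(\<Sum>b\<in>Basis. ?P x b \<bullet> b) = 0" using sum.reindex_bij_betw[OF bij, of "\<lambda>b. ?P x b \<bullet> b"] by simp
qed

section \<open>Orthonormal and adapted frames on the manifold\<close>

locale hk_manifold = atlas X A
  for X :: "'a topology" and A :: "('a, 'e::euclidean_space) chart set" +
  fixes k :: nat and g :: "('a, 'e) chart \<Rightarrow> 'a \<Rightarrow> 'e \<Rightarrow> 'e \<Rightarrow> real"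
    and Y :: "('a, 'e) chart \<Rightarrow> 'a \<Rightarrow> 'e \<Rightarrow> 'e \<Rightarrow> 'e \<Rightarrow> real" and \<epsilon> :: "nat \<Rightarrow> 'e"
  assumes k: "k \<in> {1, 4}" and Hk: "Hk_structure k X A g Y" and bij: "bij_betw \<epsilon> {1..dim_n k} Basis"
begin

abbreviation "n \<equiv> dim_n k"

lemma dim: "DIM('e) = n" using Hk by (simp add: Hk_structure_def)

lemma \<epsilon>: "I \<in> {1..n} \<Longrightarrow> J \<in> {1..n} \<Longrightarrow> \<epsilon> I \<bullet> \<epsilon> J = (if I = J then 1 else 0)"
proof -
  assume that: "I \<in> {1..n}" "J \<in> {1..n}"
  show ?thesis
    using inner_Basis[OF bij_betwE[OF bij, rule_format, OF that(1)] bij_betwE[OF bij, rule_format, OF that(2)]]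
      inj_on_eq_iff[OF bij_betw_imp_inj_on[OF bij] that] by simp
qed

lemma expand: "(\<Sum>I=1..n. (v \<bullet> \<epsilon> I) *\<^sub>R \<epsilon> I) = v"
  using sum.reindex_bij_betw[OF bij, of "\<lambda>b. (v \<bullet> b) *\<^sub>R b"] by (simp add: euclidean_representation)

lemma comb: assumes "J \<in> {1..n}" shows "(\<Sum>I=1..n. f I *\<^sub>R \<epsilon> I) \<bullet> \<epsilon> J = f J"
proof -
  have "(\<Sum>I=1..n. f I *\<^sub>R \<epsilon> I) \<bullet> \<epsilon> J = (\<Sum>I=1..n. if I = J then f J else 0)"
    unfolding inner_sum_left by (rule sum.cong) (use assms \<epsilon> in auto)
  then show ?thesis using assms by simp
qed

lemma metric: "riemannian_metric A g" and tensor: "tensor3_field A Y" using Hk by (simp_all add: Hk_structure_def)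

lemma g_bilinear: "c \<in> A \<Longrightarrow> p \<in> fst c \<Longrightarrow> bilinear (g c p)"
  and g_sym: "c \<in> A \<Longrightarrow> p \<in> fst c \<Longrightarrow> g c p x y = g c p y x"
  and g_pos: "c \<in> A \<Longrightarrow> p \<in> fst c \<Longrightarrow> x \<noteq> 0 \<Longrightarrow> g c p x x > 0"
  and g_smooth: "c \<in> A \<Longrightarrow> smooth_on (snd c ` fst c) (\<lambda>z. g c (chart_inv c z) x y)"
  and g_trans: "c \<in> A \<Longrightarrow> c' \<in> A \<Longrightarrow> p \<in> fst c \<Longrightarrow> p \<in> fst c' \<Longrightarrow> g c p x y = g c' p (tmap c c' p x) (tmap c c' p y)"
  using metric unfolding riemannian_metric_def comp_def by blast+

lemma g_linear: "c \<in> A \<Longrightarrow> p \<in> fst c \<Longrightarrow> linear (\<lambda>x. g c p x y)" "c \<in> A \<Longrightarrow> p \<in> fst c \<Longrightarrow> linear (g c p x)"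
  using g_bilinear by (simp_all add: bilinear_def)

lemma Y_linear: "c \<in> A \<Longrightarrow> p \<in> fst c \<Longrightarrow> linear (\<lambda>z. Y c p z x y) \<and> linear (\<lambda>z. Y c p x z y) \<and> linear (\<lambda>z. Y c p x y z)"
  and Y_smooth: "c \<in> A \<Longrightarrow> smooth_on (snd c ` fst c) (\<lambda>w. Y c (chart_inv c w) x y z)"
  and Y_trans: "c \<in> A \<Longrightarrow> c' \<in> A \<Longrightarrow> p \<in> fst c \<Longrightarrow> p \<in> fst c' \<Longrightarrow>
    Y c p x y z = Y c' p (tmap c c' p x) (tmap c c' p y) (tmap c c' p z)"
  using tensor unfolding tensor3_field_def comp_def by blast+

lemma g_nondegenerate: assumes "c \<in> A" "p \<in> fst c" "\<And>z. g c p x z = g c p y z" shows "x = y"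
proof (rule ccontr)
  assume "x \<noteq> y"
  then have "g c p (x - y) (x - y) > 0" using g_pos[OF assms(1,2)] by simp
  moreover have "g c p (x - y) (x - y) = 0"
    using assms(3) by (simp add: linear_diff[OF g_linear(1)[OF assms(1,2)]])
  ultimately show False by simp
qed

definition frame_at :: "('a, 'e) chart \<Rightarrow> 'a \<Rightarrow> (nat \<Rightarrow> 'e) \<Rightarrow> bool" where
  "frame_at c p v \<longleftrightarrow> (\<forall>I\<in>{1..n}. \<forall>J\<in>{1..n}. g c p (v I) (v J) = (if I = J then 1 else 0))"

definition frame_comb :: "(nat \<Rightarrow> 'e) \<Rightarrow> 'e \<Rightarrow> 'e" where
  "frame_comb v z = (\<Sum>I=1..n. (z \<bullet> \<epsilon> I) *\<^sub>R v I)"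

lemma frame_comb_linear: "linear (frame_comb v)"
  by (rule linearI) (simp_all add: frame_comb_def inner_add_left scaleR_add_left sum.distrib scaleR_sum_right)

lemma frame_comb_coord:
  assumes c: "c \<in> A" "p \<in> fst c" and v: "frame_at c p v" and J: "J \<in> {1..n}"
  shows "g c p (frame_comb v z) (v J) = z \<bullet> \<epsilon> J"
proof -
  have "g c p (frame_comb v z) (v J) = (\<Sum>I=1..n. if I = J then z \<bullet> \<epsilon> J else 0)"
    unfolding frame_comb_def linear_sum[OF g_linear(1)[OF c]] linear_scale[OF g_linear(1)[OF c]]
    by (rule sum.cong) (use v J in \<open>auto simp: frame_at_def\<close>)
  then show ?thesis using J by simp
qed

text \<open>Orthonormality makes \<open>frame_comb v\<close> injective, and an injective
  endomorphism of the model space is surjective.\<close>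

lemma frame_expand:
  assumes c: "c \<in> A" "p \<in> fst c" and v: "frame_at c p v"
  shows "x = (\<Sum>I=1..n. g c p x (v I) *\<^sub>R v I)"
proof -
  have "inj (frame_comb v)"
  proof (rule linear_injective_0[OF frame_comb_linear, THEN iffD2], intro allI impI)
    fix z assume "frame_comb v z = 0"
    then have "z \<bullet> \<epsilon> J = 0" if "J \<in> {1..n}" for J
      using frame_comb_coord[OF c v that, of z] by (simp add: linear_0[OF g_linear(1)[OF c]])
    then show "z = 0" using expand[of z] by simp
  qed
  then have "surj (frame_comb v)" using linear_injective_imp_surjective[OF frame_comb_linear] by blast
  then obtain z where z: "x = frame_comb v z" by blast
  show ?thesis
    unfolding z frame_comb_def[of v z]
    by (rule sum.cong[OF refl]) (simp only: frame_comb_coord[OF c v] frame_comb_def[symmetric])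
qed

lemma frame_parseval:
  assumes c: "c \<in> A" "p \<in> fst c" and v: "frame_at c p v"
  shows "g c p x y = (\<Sum>I=1..n. g c p x (v I) * g c p y (v I))"
proof -
  have "g c p x y = g c p (\<Sum>I=1..n. g c p x (v I) *\<^sub>R v I) y"
    using frame_expand[OF c v, of x] by simp
  also have "\<dots> = (\<Sum>I=1..n. g c p x (v I) * g c p (v I) y)"
    unfolding linear_sum[OF g_linear(1)[OF c]] linear_scale[OF g_linear(1)[OF c]] by simp
  finally show ?thesis using g_sym[OF c] by simp
qed

lemma Y_frame:
  assumes c: "c \<in> A" "p \<in> fst c"
  shows "Y c p (\<Sum>I=1..n. x I *\<^sub>R v I) (\<Sum>I=1..n. y I *\<^sub>R v I) (\<Sum>I=1..n. z I *\<^sub>R v I)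
    = (\<Sum>I=1..n. \<Sum>J=1..n. \<Sum>K=1..n. Y c p (v I) (v J) (v K) * x I * y J * z K)"
proof -
  note Y_linear[OF c]
  then have l: "linear (\<lambda>z. Y c p z x y)" "linear (\<lambda>z. Y c p x z y)" "linear (\<lambda>z. Y c p x y z)" for x y by blast+
  show ?thesis
    unfolding linear_sum[OF l(1)] linear_scale[OF l(1)]
    unfolding linear_sum[OF l(2)] linear_scale[OF l(2)]
    unfolding linear_sum[OF l(3)] linear_scale[OF l(3)]
    by (simp add: sum_distrib_left mult_ac)
qed

lemma Y_expand:
  assumes c: "c \<in> A" "p \<in> fst c" and v: "frame_at c p v"
  shows "Y c p x y z = (\<Sum>I=1..n. \<Sum>J=1..n. \<Sum>K=1..n. Y c p (v I) (v J) (v K) * g c p x (v I) * g c p y (v J) * g c p z (v K))"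
proof -
  have "Y c p x y z = Y c p (\<Sum>I=1..n. g c p x (v I) *\<^sub>R v I) (\<Sum>I=1..n. g c p y (v I) *\<^sub>R v I) (\<Sum>I=1..n. g c p z (v I) *\<^sub>R v I)"
    using frame_expand[OF c v, of x] frame_expand[OF c v, of y] frame_expand[OF c v, of z] by simp
  then show ?thesis unfolding Y_frame[OF c] .
qed

text \<open>The map sending \<epsilon> to the frame \<open>v\<close> is an isometry from the model
  space to the tangent space. Pulling the tensor back along it replaces the metric by the standard
  inner product.\<close>

definition prod_at :: "('a, 'e) chart \<Rightarrow> 'a \<Rightarrow> (nat \<Rightarrow> 'e) \<Rightarrow> 'e \<Rightarrow> 'e \<Rightarrow> 'e" where
  "prod_at c p v = frame_product n \<epsilon> (\<lambda>I J K. Y c p (v I) (v J) (v K))"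

lemma
  assumes c: "c \<in> A" "p \<in> fst c" and v: "frame_at c p v"
  shows prod_at_entry: "\<And>I J K. I \<in> {1..n} \<Longrightarrow> J \<in> {1..n} \<Longrightarrow> K \<in> {1..n} \<Longrightarrow> prod_at c p v (\<epsilon> I) (\<epsilon> J) \<bullet> \<epsilon> K = Y c p (v I) (v J) (v K)"
    and prod_at_cartan: "cartan_product (prod_at c p v)"
    and prod_at_trace: "\<And>x. (\<Sum>b\<in>Basis. prod_at c p v x b \<bullet> b) = 0"
proof -
  let ?y = "\<lambda>I J K. Y c p (v I) (v J) (v K)" and ?N = "{1..n}" and ?h = "\<lambda>I J. g c p (v I) (v J)"
  have "(\<forall>I\<in>?N. \<forall>J\<in>?N. \<forall>K\<in>?N. ?y I J K = ?y J I K \<and> ?y I J K = ?y I K J) \<and>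
            (\<forall>I\<in>?N. (\<Sum>J\<in>?N. ?y I J J) = 0) \<and>
            (\<forall>J\<in>?N. \<forall>K\<in>?N. \<forall>L\<in>?N. \<forall>M\<in>?N.
               (\<Sum>I\<in>?N. ?y J K I * ?y L M I + ?y L J I * ?y K M I + ?y K L I * ?y J M I)
               = ?h J K * ?h L M + ?h L J * ?h K M + ?h K L * ?h J M)"
    using Hk c v unfolding Hk_structure_def Let_def frame_at_def by blast
  then have s: "\<And>I J K. I \<in> ?N \<Longrightarrow> J \<in> ?N \<Longrightarrow> K \<in> ?N \<Longrightarrow> ?y I J K = ?y J I K \<and> ?y I J K = ?y I K J"
    and t: "\<And>I. I \<in> ?N \<Longrightarrow> (\<Sum>J\<in>?N. ?y I J J) = 0"
    and q: "\<And>J K L M. J \<in> ?N \<Longrightarrow> K \<in> ?N \<Longrightarrow> L \<in> ?N \<Longrightarrow> M \<in> ?N \<Longrightarrow>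
               (\<Sum>I\<in>?N. ?y J K I * ?y L M I + ?y L J I * ?y K M I + ?y K L I * ?y J M I)
               = ?h J K * ?h L M + ?h L J * ?h K M + ?h K L * ?h J M" by blast+
  have q': "(\<Sum>I\<in>?N. ?y J K I * ?y L M I + ?y L J I * ?y K M I + ?y K L I * ?y J M I)
      = (if J = K then 1 else 0) * (if L = M then 1 else 0) + (if L = J then 1 else 0) * (if K = M then 1 else 0)
         + (if K = L then 1 else 0) * (if J = M then 1 else 0)"
    if "J \<in> ?N" "K \<in> ?N" "L \<in> ?N" "M \<in> ?N" for J K L M
    using q[OF that] v that unfolding frame_at_def by simp
  show "prod_at c p v (\<epsilon> I) (\<epsilon> J) \<bullet> \<epsilon> K = Y c p (v I) (v J) (v K)" if "I \<in> {1..n}" "J \<in> {1..n}" "K \<in> {1..n}" for I J K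
    unfolding prod_at_def by (rule frame_product_entry[OF bij s t q' that])
  show "cartan_product (prod_at c p v)"
    unfolding prod_at_def by (rule frame_product_cartan[OF bij s t q'])
  show "(\<Sum>b\<in>Basis. prod_at c p v x b \<bullet> b) = 0" for x
    unfolding prod_at_def by (rule frame_product_trace[OF bij s t q'])
qed

lemma smooth_frame:
  assumes c: "c \<in> A"
  obtains E where "\<And>I. I \<in> {1..n} \<Longrightarrow> smooth_on (snd c ` fst c) (E I)"
    "\<And>y. y \<in> snd c ` fst c \<Longrightarrow> frame_at c (chart_inv c y) (\<lambda>I. E I y)"
proof -
  let ?S = "snd c ` fst c"
  have i: "chart_inv c y \<in> fst c" if "y \<in> ?S" for y using chart_inv_in[OF chart[OF c] that] by blast
  have "\<exists>E. \<forall>I\<in>{1..n}. smooth_on ?S (E I) \<and> (\<forall>J\<in>{1..n}. \<forall>y\<in>?S. g c (chart_inv c y) (E I y) (E J y) = (if I = J then 1 else 0))"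
    by (rule smooth_gram_schmidt[OF chart_open[OF chart[OF c]] g_smooth[OF c] g_bilinear[OF c i] g_sym[OF c i] g_pos[OF c i] \<epsilon>])
  then obtain E where "\<forall>I\<in>{1..n}. smooth_on ?S (E I) \<and> (\<forall>J\<in>{1..n}. \<forall>y\<in>?S. g c (chart_inv c y) (E I y) (E J y) = (if I = J then 1 else 0))"
    by blast
  then show thesis by (intro that[of E]) (auto simp: frame_at_def)
qed

lemma exists_frame: assumes c: "c \<in> A" "p \<in> fst c" obtains v where "frame_at c p v"
proof -
  obtain E where "\<And>y. y \<in> snd c ` fst c \<Longrightarrow> frame_at c (chart_inv c y) (\<lambda>I. E I y)" using smooth_frame[OF c(1)] by metis
  then have "frame_at c (chart_inv c (snd c p)) (\<lambda>I. E I (snd c p))" using c(2) by blast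
  then show thesis using that chart_inv_left[OF chart[OF c(1)] c(2)] by simp
qed

lemma smooth_model_frame:
  assumes c: "c \<in> A" "p \<in> fst c"
  obtains T f where "open T" "snd c p \<in> T" "T \<subseteq> snd c ` fst c" "\<And>I. I \<in> {1..n} \<Longrightarrow> smooth_on T (f I)"
    "\<And>y. y \<in> T \<Longrightarrow> frame_at c (chart_inv c y) (\<lambda>I. f I y)"
    "\<And>y I J K. y \<in> T \<Longrightarrow> I \<in> {1..n} \<Longrightarrow> J \<in> {1..n} \<Longrightarrow> K \<in> {1..n} \<Longrightarrow> Y c (chart_inv c y) (f I y) (f J y) (f K y) = model_tensor k I J K"
proof -
  let ?S = "snd c ` fst c" and ?N = "{1..n}"
  have S: "open ?S" by (rule chart_open[OF chart[OF c(1)]])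
  have i: "chart_inv c y \<in> fst c" if "y \<in> ?S" for y using chart_inv_in[OF chart[OF c(1)] that] by blast
  obtain E where E: "\<And>I. I \<in> ?N \<Longrightarrow> smooth_on ?S (E I)" "\<And>y. y \<in> ?S \<Longrightarrow> frame_at c (chart_inv c y) (\<lambda>I. E I y)"
    using smooth_frame[OF c(1)] by metis
  define P where "P y = prod_at c (chart_inv c y) (\<lambda>I. E I y)" for y
  have "smooth_on ?S (\<lambda>y. P y x x')" for x x'
    unfolding P_def prod_at_def frame_product_def
  proof (intro smooth_on_sum[OF S] smooth_on_scaleR[OF S] smooth_on_mult[OF S] smooth_on_const)
    fix I J K assume "K \<in> ?N" "I \<in> ?N" "J \<in> ?N"
    then show "smooth_on ?S (\<lambda>y. Y c (chart_inv c y) (E I y) (E J y) (E K y))"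
      by (intro smooth_trilinear_app[OF S Y_smooth[OF c(1)] Y_linear[OF c(1) i]] E(1))
  qed
  then have sp: "smooth_prod ?S P"
    unfolding smooth_prod_def P_def using prod_at_cartan[OF c(1) i E(2)] by blast
  have y0: "snd c p \<in> ?S" using c(2) by blast
  have tr: "(\<Sum>b\<in>Basis. P (snd c p) x b \<bullet> b) = 0" for x unfolding P_def by (rule prod_at_trace[OF c(1) i[OF y0] E(2)[OF y0]])
  obtain T b where T: "open T" "snd c p \<in> T" "T \<subseteq> ?S" and b: "\<And>I. I \<in> ?N \<Longrightarrow> smooth_on T (b I)"
    "\<And>y. y \<in> T \<Longrightarrow> adapted_frame k (P y) (\<lambda>I. b I y)"
    using smooth_adapted_frame[OF k dim S y0 sp tr] by metis
  \<comment> \<open>The adapted frame \<open>b\<close> lives in the model space; the isometry given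
    by \<open>E\<close> returns it to the tangent space.\<close>
  define f where "f I y = (\<Sum>J=1..n. (b I y \<bullet> \<epsilon> J) *\<^sub>R E J y)" for I y
  show thesis
  proof (rule that[OF T])
    show "smooth_on T (f I)" if "I \<in> ?N" for I
      unfolding f_def using that
      by (intro smooth_on_sum[OF T(1)] smooth_on_scaleR[OF T(1)] smooth_on_inner[OF T(1)] smooth_on_const b(1)
          smooth_on_subset[OF E(1) T(3)])
    fix y assume y: "y \<in> T"
    then have yS: "y \<in> ?S" using T(3) by blast
    have gl: "g c (chart_inv c y) (f I y) (E J y) = b I y \<bullet> \<epsilon> J" if "J \<in> ?N" for I J
      using frame_comb_coord[OF c(1) i[OF yS] E(2)[OF yS] that, of "b I y"] by (simp add: frame_comb_def f_def)
    have par: "(\<Sum>L=1..n. (v \<bullet> \<epsilon> L) * (w \<bullet> \<epsilon> L)) = v \<bullet> w" for v w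
    proof -
      have "v \<bullet> w = v \<bullet> (\<Sum>L=1..n. (w \<bullet> \<epsilon> L) *\<^sub>R \<epsilon> L)" by (simp only: expand)
      then show ?thesis by (simp add: inner_sum_right mult.commute)
    qed
    have bo: "b I y \<bullet> b J y = (if I = J then 1 else 0)" if "I \<in> ?N" "J \<in> ?N" for I J
      using b(2)[OF y] that unfolding adapted_frame_def by blast
    show "frame_at c (chart_inv c y) (\<lambda>I. f I y)"
      unfolding frame_at_def
    proof (intro ballI)
      fix I J assume N: "I \<in> ?N" "J \<in> ?N"
      have "g c (chart_inv c y) (f I y) (f J y) = (\<Sum>L=1..n. (b I y \<bullet> \<epsilon> L) * (b J y \<bullet> \<epsilon> L))"
        by (rule HOL.trans[OF frame_parseval[OF c(1) i[OF yS] E(2)[OF yS]]]) (intro sum.cong refl arg_cong2[of _ _ _ _ "(*)"] gl)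
      also have "\<dots> = (if I = J then 1 else 0)" unfolding par by (rule bo[OF N])
      finally show "g c (chart_inv c y) (f I y) (f J y) = (if I = J then 1 else 0)" .
    qed
    fix I J K assume N: "I \<in> ?N" "J \<in> ?N" "K \<in> ?N"
    have cp: "cartan_product (P y)" unfolding P_def by (rule prod_at_cartan[OF c(1) i[OF yS] E(2)[OF yS]])
    then have bb: "bounded_bilinear (P y)" by (simp add: cartan_product_def)
    have "Y c (chart_inv c y) (f I y) (f J y) (f K y) = cubic_form3 n (\<lambda>I J K. Y c (chart_inv c y) (E I y) (E J y) (E K y))
        (\<lambda>L. b I y \<bullet> \<epsilon> L) (\<lambda>L. b J y \<bullet> \<epsilon> L) (\<lambda>L. b K y \<bullet> \<epsilon> L)"
      unfolding f_def Y_frame[OF c(1) i[OF yS]] cubic_form3_def ..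
    also have "\<dots> = P y (b I y) (b J y) \<bullet> b K y"
      by (subst cubic_form3_vec[OF bb, of n _ \<epsilon>]) (simp_all only: expand P_def prod_at_entry[OF c(1) i[OF yS] E(2)[OF yS]])
    also have "\<dots> = model_tensor k I J K"
      unfolding model_tensor_eq[OF k cp b(2)[OF y]] using N by simp
    finally show "Y c (chart_inv c y) (f I y) (f J y) (f K y) = model_tensor k I J K" .
  qed
qed

theorem exists_adapted_coframe:
  assumes p: "p \<in> topspace X"
  shows "\<exists>U \<theta>. p \<in> U \<and> adapted_coframe k X A g Y U \<theta>"
proof -
  obtain c where c: "c \<in> A" "p \<in> fst c" using p topspace_charts by blast
  obtain T f where T: "open T" "snd c p \<in> T" "T \<subseteq> snd c ` fst c" and f: "\<And>I. I \<in> {1..n} \<Longrightarrow> smooth_on T (f I)"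
    "\<And>y. y \<in> T \<Longrightarrow> frame_at c (chart_inv c y) (\<lambda>I. f I y)"
    "\<And>y I J K. y \<in> T \<Longrightarrow> I \<in> {1..n} \<Longrightarrow> J \<in> {1..n} \<Longrightarrow> K \<in> {1..n} \<Longrightarrow> Y c (chart_inv c y) (f I y) (f J y) (f K y) = model_tensor k I J K"
    using smooth_model_frame[OF c] by metis
  define U where "U = {q \<in> fst c. snd c q \<in> T}"
  \<comment> \<open>The metric dual of the frame in the chart \<open>c\<close>. In any other chart
    the vector is first carried over to \<open>c\<close>, so the transformation law reduces to the
    chain rule for \<open>tmap\<close>.\<close>
  define \<theta> where "\<theta> I c' q v = g c q (f I (snd c q)) (tmap c' c q v)" for I :: nat and c' q v
  have U: "q \<in> fst c" "snd c q \<in> T" if "q \<in> U" for q using that by (auto simp: U_def)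
  have ci: "chart_inv c (snd c q) = q" if "q \<in> U" for q using chart_inv_left[OF chart[OF c(1)] U(1)[OF that]] .
  have fr: "frame_at c q (\<lambda>I. f I (snd c q))" if "q \<in> U" for q using f(2)[OF U(2)[OF that]] ci[OF that] by simp
  have Uo: "openin X U" unfolding U_def by (rule chart_preimage_open[OF chart[OF c(1)] T(1)])
  have "covector_field_on A U (\<theta> I)" if I: "I \<in> {1..n}" for I
    unfolding covector_field_on_def
  proof (intro conjI ballI allI)
    fix c' q assume c': "c' \<in> A" and q: "q \<in> U \<inter> fst c'"
    have "linear (g c q (f I (snd c q)) \<circ> tmap c' c q)"
      by (rule linear_compose[OF tmap_linear g_linear(2)]) (use c c' q U in auto)
    then show "linear (\<theta> I c' q)" unfolding \<theta>_def comp_def .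
  next
    fix c' x assume c': "c' \<in> A"
    let ?S' = "snd c' ` (U \<inter> fst c')" and ?\<tau> = "trans c' c"
    have o: "open ?S'" by (rule chart_image_open[OF chart[OF c'] Uo])
    have sub: "?S' \<subseteq> snd c' ` (fst c' \<inter> fst c)" using U by blast
    have \<tau>s: "smooth_on ?S' ?\<tau>" by (rule smooth_on_subset[OF trans_smooth[OF c' c(1)] sub])
    have ci': "chart_inv c' y \<in> U \<inter> fst c'" if "y \<in> ?S'" for y using chart_inv_in[OF chart[OF c'] that] by blast
    have \<tau>T: "?\<tau> ` ?S' \<subseteq> T" using ci' U by fastforce
    have e: "chart_inv c (?\<tau> y) = chart_inv c' y" if "y \<in> ?S'" for y using ci[of "chart_inv c' y"] ci'[OF that] by simp
    have "smooth_on ?S' (\<lambda>y. g c (chart_inv c (?\<tau> y)) (f I (?\<tau> y)) (frechet_derivative ?\<tau> (at y) x))"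
    proof (rule smooth_bilinear_app[OF T(1) o \<tau>T])
      show "smooth_on T (\<lambda>y. g c (chart_inv c y) x x')" for x x' by (rule smooth_on_subset[OF g_smooth[OF c(1)] T(3)])
      show "bilinear (g c (chart_inv c y))" if "y \<in> T" for y
        by (rule g_bilinear[OF c(1)]) (use chart_inv_in[OF chart[OF c(1)], of y "fst c"] that T(3) in blast)
      show "smooth_on ?S' (\<lambda>y. f I (?\<tau> y))" by (rule smooth_on_compose[OF o T(1) \<tau>T \<tau>s f(1)[OF I]])
    qed (use \<tau>s smooth_on_frechet in blast)+
    moreover have "g c (chart_inv c (?\<tau> y)) (f I (?\<tau> y)) (frechet_derivative ?\<tau> (at y) x) = ((\<lambda>q. \<theta> I c' q x) \<circ> chart_inv c') y"
      if y: "y \<in> ?S'" for y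
    proof -
      have "snd c' (chart_inv c' y) = y" by (rule chart_inv_right[OF y]) blast
      then show ?thesis unfolding \<theta>_def tmap_def comp_def using e[OF y] by (simp add: comp_def)
    qed
    ultimately show "smooth_on ?S' ((\<lambda>q. \<theta> I c' q x) \<circ> chart_inv c')" by (rule smooth_on_cong[OF o, rotated])
  next
    fix c1 c2 q x assume "c1 \<in> A" "c2 \<in> A" "q \<in> U \<inter> fst c1 \<inter> fst c2"
    then show "\<theta> I c1 q x = \<theta> I c2 q (tmap c1 c2 q x)"
      unfolding \<theta>_def using tmap_chain[of c1 c2 c q x] c U by simp
  qed
  moreover have "g c' q x y = (\<Sum>I=1..n. \<theta> I c' q x * \<theta> I c' q y)" if c': "c' \<in> A" and q: "q \<in> U \<inter> fst c'" for c' q x y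
  proof -
    have qU: "q \<in> U" "q \<in> fst c'" using q by auto
    show ?thesis
      unfolding \<theta>_def g_trans[OF c' c(1) qU(2) U(1)[OF qU(1)]]
      by (rule HOL.trans[OF frame_parseval[OF c(1) U(1)[OF qU(1)] fr[OF qU(1)]]])
        (intro sum.cong refl arg_cong2[of _ _ _ _ "(*)"] g_sym[OF c(1) U(1)[OF qU(1)]])
  qed
  moreover have "Y c' q x y z = (\<Sum>I=1..n. \<Sum>J=1..n. \<Sum>K=1..n. model_tensor k I J K * \<theta> I c' q x * \<theta> J c' q y * \<theta> K c' q z)"
    if c': "c' \<in> A" and q: "q \<in> U \<inter> fst c'" for c' q x y z
  proof -
    have qU: "q \<in> U" "q \<in> fst c'" using q by auto
    note cU = c(1) U(1)[OF qU(1)]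
    have e: "\<theta> I c' q x = g c q (tmap c' c q x) (f I (snd c q))" for I x unfolding \<theta>_def by (rule g_sym[OF cU])
    show ?thesis
      unfolding e Y_trans[OF c' c(1) qU(2) U(1)[OF qU(1)]]
      by (rule HOL.trans[OF Y_expand[OF cU fr[OF qU(1)]]], intro sum.cong refl)
        (use f(3)[OF U(2)[OF qU(1)]] ci[OF qU(1)] in simp)
  qed
  ultimately have "adapted_coframe k X A g Y U \<theta>" unfolding adapted_coframe_def using Uo by blast
  then show ?thesis using c T by (intro exI[of _ U]) (auto simp: U_def)
qed

end

section \<open>Directional derivatives and extension of tangent vectors\<close>

context atlas begin

lemma dird_has_derivative:
  assumes "smooth_on W (h \<circ> chart_inv c)" "snd c p \<in> W"
  shows "((h \<circ> chart_inv c) has_derivative dird c h p) (at (snd c p))"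
  using smooth_on_has_derivative[OF assms] unfolding dird_def[abs_def] by simp

text \<open>Any function of the coordinates that represents \<open>h\<close> near \<open>p\<close>
  may be differentiated instead.\<close>

lemma dird_eqI:
  assumes c: "c \<in> A" and U: "openin X U" "p \<in> U" "p \<in> fst c" and e: "\<And>q. q \<in> U \<Longrightarrow> q \<in> fst c \<Longrightarrow> h' (snd c q) = h q"
    and D: "(h' has_derivative D) (at (snd c p))"
  shows "dird c h p x = D x"
proof -
  have "((h \<circ> chart_inv c) has_derivative D) (at (snd c p))"
  proof (rule has_derivative_transform_within_open[OF D])
    show "open (snd c ` (U \<inter> fst c))" by (rule chart_image_open[OF chart[OF c] U(1)])
    show "snd c p \<in> snd c ` (U \<inter> fst c)" using U by blast
    fix y assume y: "y \<in> snd c ` (U \<inter> fst c)"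
    have "chart_inv c y \<in> U \<inter> fst c" by (rule chart_inv_in[OF chart[OF c] y]) blast
    moreover have "snd c (chart_inv c y) = y" by (rule chart_inv_right[OF y]) blast
    ultimately show "h' y = (h \<circ> chart_inv c) y" using e[of "chart_inv c y"] by simp
  qed
  from frechet_derivative_at[OF this] show ?thesis by (simp add: dird_def)
qed

lemma dird_linear_dir: assumes "smooth_on W (h \<circ> chart_inv c)" "snd c p \<in> W" shows "linear (dird c h p)"
  using has_derivative_linear[OF dird_has_derivative[OF assms]] .

lemma dird_linear_param:
  assumes c: "c \<in> A" and U: "openin X U" "p \<in> U" "p \<in> fst c"
    and l: "\<And>q. q \<in> U \<Longrightarrow> q \<in> fst c \<Longrightarrow> linear (\<lambda>z. h z q)"
    and s: "\<And>z. smooth_on (snd c ` (U \<inter> fst c)) (h z \<circ> chart_inv c)"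
  shows "linear (\<lambda>z. dird c (h z) p x)"
proof -
  have pU: "snd c p \<in> snd c ` (U \<inter> fst c)" using U by blast
  note d = dird_has_derivative[OF s pU]
  note inv = chart_inv_left[OF chart[OF c]]
  show ?thesis
  proof (rule linearI)
    show "dird c (h (a + b)) p x = dird c (h a) p x + dird c (h b) p x" for a b
      by (rule dird_eqI[OF c U _ has_derivative_add[OF d d]]) (simp add: inv linear_add[OF l])
    show "dird c (h (r *\<^sub>R a)) p x = r *\<^sub>R dird c (h a) p x" for r a
      by (rule dird_eqI[OF c U _ has_derivative_scaleR_right[OF d]]) (simp add: inv linear_scale[OF l])
  qed
qed

lemma exists_vector_field:
  assumes c: "c \<in> A" and p: "p \<in> fst c"
  obtains v where "vector_field A v" "v c p = x"
proof -
  let ?S = "snd c ` fst c"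
  have S: "open ?S" by (rule chart_open[OF chart[OF c]])
  have "snd c p \<in> ?S" using p by blast
  then obtain r where r: "r > 0" "cball (snd c p) r \<subseteq> ?S" using S open_contains_cball by blast
  obtain \<beta> :: "'e \<Rightarrow> real" where \<beta>: "smooth_on UNIV \<beta>" "\<beta> (snd c p) = 1" "\<And>x. x \<notin> cball (snd c p) r \<Longrightarrow> \<beta> x = 0"
    using smooth_bump[OF r(1)] by metis
  \<comment> \<open>\<open>K\<close> contains the support of the field. It is the preimage of a
    closed ball, hence compact, and closed because the manifold is Hausdorff; the extension by zero
    is therefore smooth also in charts that leave the domain of \<open>c\<close>.\<close>
  define K where "K = {q \<in> fst c. snd c q \<in> cball (snd c p) r}"
  have h: "homeomorphic_map (subtopology X (fst c)) (top_of_set ?S) (snd c)" and o: "openin X (fst c)"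
    using chart[OF c] by (auto simp: is_chart_def)
  have "snd c ` K = cball (snd c p) r" using r(2) unfolding K_def by blast
  then have "compactin (top_of_set ?S) (snd c ` K)" using r(2) by (simp add: compactin_subtopology)
  moreover have "K \<subseteq> topspace (subtopology X (fst c))" using openin_subset[OF o] by (auto simp: K_def)
  ultimately have "compactin (subtopology X (fst c)) K" using homeomorphic_map_compactness_eq[OF h, of K] by blast
  then have "compactin X K" by (simp add: compactin_subtopology)
  moreover have "Hausdorff_space X" using mfd by (simp add: smooth_manifold_def)
  ultimately have "closedin X K" by (simp add: compactin_imp_closedin)
  then have Ko: "openin X (topspace X - K)" by (simp add: openin_diff)
  define v where "v c' q = (if q \<in> fst c then \<beta> (snd c q) *\<^sub>R tmap c c' q x else 0)" for c' q
  have v0: "v c' q = 0" if "q \<notin> K" for c' q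
    using that \<beta>(3)[of "snd c q"] by (auto simp: v_def K_def)
  have "vector_field A v"
    unfolding vector_field_def
  proof (intro conjI ballI)
    fix c' assume c': "c' \<in> A"
    let ?W = "snd c' ` (fst c' \<inter> fst c)" and ?Z = "snd c' ` ((topspace X - K) \<inter> fst c')" and ?\<tau> = "trans c' c" and ?\<sigma> = "trans c c'"
    have W: "open ?W" by (rule overlap_open[OF c' c])
    have Z: "open ?Z" by (rule chart_image_open[OF chart[OF c'] Ko])
    have "K \<subseteq> fst c" by (auto simp: K_def)
    then have "snd c' ` fst c' = ?W \<union> ?Z" using openin_subset[OF chart_openin[OF c']] by blast
    moreover have "smooth_on ?W (v c' \<circ> chart_inv c')"
    proof (rule smooth_on_cong[OF W])
      have \<tau>: "smooth_on ?W ?\<tau>" by (rule trans_smooth[OF c' c])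
      let ?V = "snd c ` (fst c \<inter> fst c')"
      have i: "chart_inv c' y \<in> fst c' \<inter> fst c" if "y \<in> ?W" for y by (rule chart_inv_in[OF chart[OF c'] that]) blast
      have im: "?\<tau> ` ?W \<subseteq> ?V" using i by fastforce
      have "smooth_on ?W (\<lambda>y. frechet_derivative ?\<sigma> (at (?\<tau> y)) x)"
        by (rule smooth_on_compose[OF W overlap_open[OF c c'] im \<tau> smooth_on_frechet[OF trans_smooth[OF c c']]])
      moreover have "smooth_on ?W (\<lambda>y. \<beta> (?\<tau> y))"
        by (rule smooth_on_compose[OF W open_UNIV subset_UNIV \<tau> \<beta>(1)])
      ultimately show "smooth_on ?W (\<lambda>y. \<beta> (?\<tau> y) *\<^sub>R frechet_derivative ?\<sigma> (at (?\<tau> y)) x)"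
        by (rule smooth_on_scaleR[OF W, rotated])
      show "\<beta> (?\<tau> y) *\<^sub>R frechet_derivative ?\<sigma> (at (?\<tau> y)) x = (v c' \<circ> chart_inv c') y" if "y \<in> ?W" for y
        using i[OF that] by (simp add: v_def tmap_def)
    qed
    moreover have "smooth_on ?Z (v c' \<circ> chart_inv c')"
    proof (rule smooth_on_cong[OF Z _ smooth_on_const])
      fix y assume y: "y \<in> ?Z"
      have "chart_inv c' y \<in> (topspace X - K) \<inter> fst c'" by (rule chart_inv_in[OF chart[OF c'] y]) blast
      then show "0 = (v c' \<circ> chart_inv c') y" using v0 by simp
    qed
    ultimately show "smooth_on (snd c' ` fst c') (v c' \<circ> chart_inv c')" using smooth_on_Un[OF W Z] by simp
  next
    fix c1 c2 q assume c12: "c1 \<in> A" "c2 \<in> A" and q: "q \<in> fst c1 \<inter> fst c2"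
    have l: "linear (tmap c1 c2 q)" using tmap_linear c12 q by blast
    show "v c2 q = tmap c1 c2 q (v c1 q)"
    proof (cases "q \<in> fst c")
      case True
      then show ?thesis using tmap_chain[of c c1 c2 q x] c c12 q by (simp add: v_def linear_scale[OF l])
    next
      case False
      then show ?thesis by (simp add: v_def linear_0[OF l])
    qed
  qed
  moreover have "v c p = x" using p tmap_id[OF c p] by (simp add: v_def \<beta>)
  ultimately show thesis using that by blast
qed

text \<open>\<open>nabla_tensor3\<close> depends on the field only through its value at the point,
  and every tangent vector is such a value.\<close>

lemma nearly_integrable_iff:
  "nearly_integrable A g Y \<longleftrightarrow> (\<forall>c\<in>A. \<forall>p\<in>fst c. \<forall>x. nabla_tensor3 g Y c p x x x x = 0)"
proof
  assume ni: "nearly_integrable A g Y"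
  show "\<forall>c\<in>A. \<forall>p\<in>fst c. \<forall>x. nabla_tensor3 g Y c p x x x x = 0"
  proof (intro ballI allI)
    fix c p x assume c: "c \<in> A" "p \<in> fst c"
    obtain v where "vector_field A v" "v c p = x" using exists_vector_field[OF c] by metis
    then show "nabla_tensor3 g Y c p x x x x = 0" using ni c unfolding nearly_integrable_def by blast
  qed
qed (simp add: nearly_integrable_def)

end

section \<open>The Levi-Civita connection in a chart\<close>

context hk_manifold begin

definition metric_deriv :: "('a, 'e) chart \<Rightarrow> 'a \<Rightarrow> 'e \<Rightarrow> 'e \<Rightarrow> 'e \<Rightarrow> real" where
  "metric_deriv c p x y z = dird c (\<lambda>q. g c q y z) p x"

lemma
  assumes c: "c \<in> A" "p \<in> fst c"
  shows metric_deriv_linear: "linear (\<lambda>x. metric_deriv c p x y z)" "linear (\<lambda>y. metric_deriv c p x y z)" "linear (\<lambda>z. metric_deriv c p x y z)"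
    and metric_deriv_sym: "metric_deriv c p x y z = metric_deriv c p x z y"
proof -
  have pS: "snd c p \<in> snd c ` fst c" using c by blast
  have s: "smooth_on (snd c ` fst c) ((\<lambda>q. g c q y z) \<circ> chart_inv c)" for y z
    using g_smooth[OF c(1)] by (simp add: comp_def)
  have s': "smooth_on (snd c ` (fst c \<inter> fst c)) ((\<lambda>q. g c q y z) \<circ> chart_inv c)" for y z
    using s by simp
  show "linear (\<lambda>x. metric_deriv c p x y z)" unfolding metric_deriv_def by (rule dird_linear_dir[OF s pS])
  show "linear (\<lambda>y. metric_deriv c p x y z)" unfolding metric_deriv_def
    by (rule dird_linear_param[OF c(1) chart_openin[OF c(1)] c(2,2) g_linear(1)[OF c(1)] s'])
  show "linear (\<lambda>z. metric_deriv c p x y z)" unfolding metric_deriv_def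
    by (rule dird_linear_param[OF c(1) chart_openin[OF c(1)] c(2,2) g_linear(2)[OF c(1)] s'])
  show "metric_deriv c p x y z = metric_deriv c p x z y"
    unfolding metric_deriv_def
    by (rule dird_eqI[OF c(1) chart_openin[OF c(1)] c(2,2) _ dird_has_derivative[OF s pS]])
      (simp add: chart_inv_left[OF chart[OF c(1)]] g_sym[OF c(1)])
qed

definition is_levi_civita :: "('a, 'e) chart \<Rightarrow> 'a \<Rightarrow> ('e \<Rightarrow> 'e \<Rightarrow> 'e) \<Rightarrow> bool" where
  "is_levi_civita c p G \<longleftrightarrow> bilinear G \<and> (\<forall>x y. G x y = G y x) \<and>
     (\<forall>x y z. dird c (\<lambda>q. g c q y z) p x = g c p (G x y) z + g c p y (G x z))"

text \<open>The difference of two candidates, lowered by the metric, is symmetric in its first two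
  arguments and skew in its last two; such a trilinear form is zero.\<close>

lemma levi_civita_unique:
  assumes c: "c \<in> A" "p \<in> fst c" and G: "is_levi_civita c p G" "is_levi_civita c p H"
  shows "G = H"
proof (intro ext g_nondegenerate[OF c])
  fix x y z
  define B where "B x y z = g c p (G x y) z - g c p (H x y) z" for x y z
  have s: "B x y z = B y x z" for x y z using G unfolding is_levi_civita_def B_def by metis
  have a: "B x y z = - B x z y" for x y z
  proof -
    have "g c p (G x y) z + g c p y (G x z) = g c p (H x y) z + g c p y (H x z)"
      using G unfolding is_levi_civita_def by metis
    then show ?thesis unfolding B_def using g_sym[OF c, of y "G x z"] g_sym[OF c, of y "H x z"] by linarith
  qed
  have "B x y z = 0"
    using a[of x y z] s[of x z y] a[of z x y] s[of z y x] a[of y z x] s[of y x z] by linarith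
  then show "g c p (G x y) z = g c p (H x y) z" by (simp add: B_def)
qed

lemma levi_civita_exists:
  assumes c: "c \<in> A" "p \<in> fst c"
  shows "\<exists>G. is_levi_civita c p G"
proof -
  obtain v where v: "frame_at c p v" using exists_frame[OF c] .
  let ?d = "metric_deriv c p"
  \<comment> \<open>Koszul's formula for coordinate fields, whose brackets vanish.\<close>
  define K where "K x y z = (?d x y z + ?d y x z - ?d z x y) / 2" for x y z
  note dl = metric_deriv_linear[OF c]
  have Kl: "linear (\<lambda>x. K x y z)" "linear (\<lambda>y. K x y z)" "linear (\<lambda>z. K x y z)" for x y z
    unfolding K_def by (rule linearI; simp add: linear_add[OF dl(1)] linear_add[OF dl(2)] linear_add[OF dl(3)]
        linear_scale[OF dl(1)] linear_scale[OF dl(2)] linear_scale[OF dl(3)] field_simps)+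
  define G where "G x y = (\<Sum>I=1..n. K x y (v I) *\<^sub>R v I)" for x y
  have gG: "g c p (G x y) z = K x y z" for x y z
  proof -
    have "g c p (G x y) z = (\<Sum>I=1..n. K x y (v I) * g c p (v I) z)"
      unfolding G_def linear_sum[OF g_linear(1)[OF c]] linear_scale[OF g_linear(1)[OF c]] by simp
    also have "\<dots> = (\<Sum>I=1..n. g c p z (v I) *\<^sub>R K x y (v I))"
      by (rule sum.cong) (simp_all add: g_sym[OF c, of z])
    also have "\<dots> = K x y (\<Sum>I=1..n. g c p z (v I) *\<^sub>R v I)" by (simp only: linear_sum[OF Kl(3)] linear_scale[OF Kl(3)])
    finally show ?thesis using frame_expand[OF c v, of z] by simp
  qed
  have "bilinear G"
    unfolding bilinear_def
  proof (intro conjI allI)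
    show "linear (\<lambda>y. G x y)" for x
      by (rule linearI) (simp_all add: G_def linear_add[OF Kl(2)] linear_scale[OF Kl(2)] scaleR_add_left sum.distrib scaleR_sum_right)
    show "linear (\<lambda>x. G x y)" for y
      by (rule linearI) (simp_all add: G_def linear_add[OF Kl(1)] linear_scale[OF Kl(1)] scaleR_add_left sum.distrib scaleR_sum_right)
  qed
  moreover have "G x y = G y x" for x y
  proof -
    have "K x y z = K y x z" for z unfolding K_def using metric_deriv_sym[OF c, of z x y] by simp
    then show ?thesis unfolding G_def by simp
  qed
  moreover have "dird c (\<lambda>q. g c q y z) p x = g c p (G x y) z + g c p y (G x z)" for x y z
  proof -
    have "g c p y (G x z) = K x z y" using g_sym[OF c, of y "G x z"] gG by simp
    moreover have "dird c (\<lambda>q. g c q y z) p x = ?d x y z" by (simp add: metric_deriv_def)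
    ultimately show ?thesis
      unfolding gG K_def using metric_deriv_sym[OF c, of x z y] metric_deriv_sym[OF c, of y x z] metric_deriv_sym[OF c, of z x y]
      by (simp add: field_simps)
  qed
  ultimately show ?thesis unfolding is_levi_civita_def by blast
qed

lemma levi_civita_is: assumes c: "c \<in> A" "p \<in> fst c" shows "is_levi_civita c p (levi_civita g c p)"
proof -
  have "\<exists>!G. is_levi_civita c p G" using levi_civita_exists[OF c] levi_civita_unique[OF c] by blast
  from theI'[OF this] show ?thesis unfolding levi_civita_def is_levi_civita_def .
qed

end

section \<open>The connection coefficients in an adapted coframe\<close>

locale coframe_point = hk_manifold X A k g Y \<epsilon>
  for X :: "'a topology" and A :: "('a, 'e::euclidean_space) chart set" and k g Y \<epsilon> +
  fixes U :: "'a set" and \<theta> :: "nat \<Rightarrow> ('a, 'e) chart \<Rightarrow> 'a \<Rightarrow> 'e \<Rightarrow> real" and c p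
  assumes adapted: "adapted_coframe k X A g Y U \<theta>" and c: "c \<in> A" and p: "p \<in> U" "p \<in> fst c"
begin

lemma U: "openin X U" using adapted by (simp add: adapted_coframe_def)

lemma \<theta>_linear: "I \<in> {1..n} \<Longrightarrow> q \<in> U \<Longrightarrow> q \<in> fst c \<Longrightarrow> linear (\<theta> I c q)"
  and \<theta>_smooth: "I \<in> {1..n} \<Longrightarrow> smooth_on (snd c ` (U \<inter> fst c)) ((\<lambda>q. \<theta> I c q x) \<circ> chart_inv c)"
  and g_\<theta>: "q \<in> U \<Longrightarrow> q \<in> fst c \<Longrightarrow> g c q x y = (\<Sum>I=1..n. \<theta> I c q x * \<theta> I c q y)"
  and Y_\<theta>: "q \<in> U \<Longrightarrow> q \<in> fst c \<Longrightarrow> Y c q x y z = cubic_form3 n (model_tensor k) (\<lambda>I. \<theta> I c q x) (\<lambda>I. \<theta> I c q y) (\<lambda>I. \<theta> I c q z)"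
  using adapted c unfolding adapted_coframe_def covector_field_on_def cubic_form3_def by blast+

text \<open>The isometry from the tangent space at \<open>p\<close> to the model space; it takes the
  dual frame to \<epsilon>.\<close>

definition coords :: "'e \<Rightarrow> 'e" where "coords x = (\<Sum>I=1..n. \<theta> I c p x *\<^sub>R \<epsilon> I)"

lemma coords_inner: "I \<in> {1..n} \<Longrightarrow> coords x \<bullet> \<epsilon> I = \<theta> I c p x"
  unfolding coords_def by (rule comb)

lemma coords_linear: "linear coords"
  by (rule linearI) (simp_all add: coords_def linear_add[OF \<theta>_linear[OF _ p]] linear_scale[OF \<theta>_linear[OF _ p]]
      scaleR_add_left sum.distrib scaleR_sum_right)

lemma coords_inj: "inj coords"
proof (rule linear_injective_0[OF coords_linear, THEN iffD2], intro allI impI)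
  fix x assume "coords x = 0"
  then have "\<theta> I c p x = 0" if "I \<in> {1..n}" for I using coords_inner[OF that, of x] by simp
  then have "g c p x x = 0" unfolding g_\<theta>[OF p] by simp
  then show "x = 0" using g_pos[OF c p(2), of x] by fastforce
qed

lemma coords_surj: "surj coords"
  using linear_injective_imp_surjective[OF coords_linear] coords_inj by blast

abbreviation "v \<equiv> dual_frame n \<theta> c p"

lemma coords_dual: assumes J: "J \<in> {1..n}" shows "coords (v J) = \<epsilon> J"
proof -
  have iff: "(\<forall>I\<in>{1..n}. \<theta> I c p w = (if I = J then 1 else 0)) \<longleftrightarrow> coords w = \<epsilon> J" for w
  proof
    assume h: "\<forall>I\<in>{1..n}. \<theta> I c p w = (if I = J then 1 else 0)"
    have "coords w = (\<Sum>I=1..n. if I = J then \<epsilon> J else 0)"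
      unfolding coords_def by (rule sum.cong) (use h in auto)
    then show "coords w = \<epsilon> J" using J by simp
  next
    assume "coords w = \<epsilon> J"
    then show "\<forall>I\<in>{1..n}. \<theta> I c p w = (if I = J then 1 else 0)"
      using coords_inner[of _ w] \<epsilon>[OF J] by (metis inner_commute)
  qed
  obtain w where w: "coords w = \<epsilon> J" using coords_surj by (metis surjD)
  have "\<exists>!w. coords w = \<epsilon> J" using w coords_inj by (metis injD)
  from theI'[OF this] show ?thesis unfolding dual_frame_def iff .
qed

lemma \<theta>_dual: assumes "I \<in> {1..n}" "J \<in> {1..n}" shows "\<theta> I c p (v J) = (if I = J then 1 else 0)"
  using coords_inner[OF assms(1), of "v J"] coords_dual[OF assms(2)] \<epsilon>[OF assms(2,1)] by auto

lemma dual_expand: "x = (\<Sum>J=1..n. \<theta> J c p x *\<^sub>R v J)"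
proof (rule injD[OF coords_inj])
  have "coords (\<Sum>J=1..n. \<theta> J c p x *\<^sub>R v J) = (\<Sum>J=1..n. \<theta> J c p x *\<^sub>R \<epsilon> J)"
    unfolding linear_sum[OF coords_linear] linear_scale[OF coords_linear]
    by (rule sum.cong) (simp_all add: coords_dual)
  then show "coords x = coords (\<Sum>J=1..n. \<theta> J c p x *\<^sub>R v J)" by (simp add: coords_def)
qed

lemma dual_frame_at: "frame_at c p v"
  unfolding frame_at_def
proof (intro ballI)
  fix I J assume N: "I \<in> {1..n}" "J \<in> {1..n}"
  have "g c p (v I) (v J) = (\<Sum>L=1..n. if L = I then (if I = J then 1 else 0) else 0)"
    unfolding g_\<theta>[OF p] by (rule sum.cong) (use N \<theta>_dual in auto)
  then show "g c p (v I) (v J) = (if I = J then 1 else 0)" using N by simp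
qed

lemma Y_dual: assumes N: "I \<in> {1..n}" "J \<in> {1..n}" "K \<in> {1..n}" shows "Y c p (v I) (v J) (v K) = model_tensor k I J K"
proof -
  have "\<theta> L c p (v M) = id_matrix n L M" if "L \<in> {1..n}" "M \<in> {1..n}" for L M
    using \<theta>_dual[OF that] that by (simp add: id_matrix_def)
  then have "Y c p (v I) (v J) (v K) = cubic_form3 n (model_tensor k) (\<lambda>L. id_matrix n L I) (\<lambda>L. id_matrix n L J) (\<lambda>L. id_matrix n L K)"
    unfolding Y_\<theta>[OF p] cubic_form3_def using N by (intro sum.cong refl) simp
  then show ?thesis
    unfolding cubic_form3_def id_matrix_sum[OF N(3)] id_matrix_sum[OF N(2)] id_matrix_sum[OF N(1)] .
qed

sublocale model: model_point "prod_at c p v" k \<epsilon>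
proof -
  let ?P = "prod_at c p v"
  note cp = prod_at_cartan[OF c p(2) dual_frame_at]
  \<comment> \<open>A constant family of products lets the smooth construction supply coordinates at
    this single point.\<close>
  have sp: "smooth_prod UNIV (\<lambda>_. ?P)" unfolding smooth_prod_def using cp smooth_on_const by blast
  have "hermitian k ?P"
    by (rule smooth_adapted_frame[OF k dim open_UNIV UNIV_I sp prod_at_trace[OF c p(2) dual_frame_at]]) blast
  then show "model_point ?P k \<epsilon>"
    using Y_dual prod_at_entry[OF c p(2) dual_frame_at] k dim \<epsilon>
    by (intro model_point.intro[OF cp] model_point_axioms.intro) simp_all
qed

abbreviation "LC \<equiv> levi_civita g c p"

lemma LC: "linear (\<lambda>x. LC x y)" "linear (LC x)" "LC x y = LC y x"
  "dird c (\<lambda>q. g c q y z) p x = g c p (LC x y) z + g c p y (LC x z)"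
  using levi_civita_is[OF c p(2)] unfolding is_levi_civita_def bilinear_def by blast+

abbreviation "\<Delta> I \<equiv> nabla_covector g (\<theta> I) c p"

lemma pU: "snd c p \<in> snd c ` (U \<inter> fst c)" using p by blast

lemma d\<theta>_linear: assumes I: "I \<in> {1..n}"
  shows "linear (\<lambda>x. dird c (\<lambda>q. \<theta> I c q y) p x)" "linear (\<lambda>y. dird c (\<lambda>q. \<theta> I c q y) p x)"
  by (rule dird_linear_dir[OF \<theta>_smooth[OF I] pU])
    (rule dird_linear_param[OF c U p \<theta>_linear[OF I] \<theta>_smooth[OF I]])

lemma nabla_\<theta>_linear: assumes I: "I \<in> {1..n}"
  shows "linear (\<lambda>x. \<Delta> I x y)" "linear (\<lambda>y. \<Delta> I x y)"
  unfolding nabla_covector_def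
  using linear_compose[OF LC(1) \<theta>_linear[OF I p]] linear_compose[OF LC(2) \<theta>_linear[OF I p]] d\<theta>_linear[OF I]
  by (auto intro!: linear_compose_sub simp: comp_def)

lemma dird_metric:
  "dird c (\<lambda>q. g c q y z) p x = (\<Sum>I=1..n. dird c (\<lambda>q. \<theta> I c q y) p x * \<theta> I c p z + \<theta> I c p y * dird c (\<lambda>q. \<theta> I c q z) p x)"
proof -
  note d = dird_has_derivative[OF \<theta>_smooth pU]
  note inv = chart_inv_left[OF chart[OF c]]
  let ?h = "\<lambda>I y. (\<lambda>q. \<theta> I c q y) \<circ> chart_inv c"
  have "((\<lambda>w. \<Sum>I=1..n. ?h I y w * ?h I z w) has_derivative
      (\<lambda>x. \<Sum>I=1..n. ?h I y (snd c p) * dird c (\<lambda>q. \<theta> I c q z) p x + dird c (\<lambda>q. \<theta> I c q y) p x * ?h I z (snd c p))) (at (snd c p))"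
    by (intro has_derivative_sum has_derivative_mult d)
  from dird_eqI[OF c U p _ this] show ?thesis
    using g_\<theta> by (simp add: inv p add.commute)
qed

lemma dird_tensor:
  "dird c (\<lambda>q. Y c q y y y) p x = cubic_form3 n (model_tensor k) (\<lambda>I. dird c (\<lambda>q. \<theta> I c q y) p x) (\<lambda>I. \<theta> I c p y) (\<lambda>I. \<theta> I c p y)
    + cubic_form3 n (model_tensor k) (\<lambda>I. \<theta> I c p y) (\<lambda>I. dird c (\<lambda>q. \<theta> I c q y) p x) (\<lambda>I. \<theta> I c p y)
    + cubic_form3 n (model_tensor k) (\<lambda>I. \<theta> I c p y) (\<lambda>I. \<theta> I c p y) (\<lambda>I. dird c (\<lambda>q. \<theta> I c q y) p x)"
proof -
  note d = dird_has_derivative[OF \<theta>_smooth pU]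
  note inv = chart_inv_left[OF chart[OF c]]
  let ?h = "\<lambda>I y. (\<lambda>q. \<theta> I c q y) \<circ> chart_inv c" and ?D = "\<lambda>I. dird c (\<lambda>q. \<theta> I c q y) p" and ?M = "model_tensor k"
  let ?t = "\<lambda>I. ?h I y (snd c p)"
  have "((\<lambda>w. \<Sum>I=1..n. \<Sum>J=1..n. \<Sum>K=1..n. ?M I J K * ?h I y w * ?h J y w * ?h K y w) has_derivative
      (\<lambda>x. \<Sum>I=1..n. \<Sum>J=1..n. \<Sum>K=1..n. ?M I J K * ?t I * ?t J * ?D K x + (?M I J K * ?t I * ?D J x + ?M I J K * ?D I x * ?t J) * ?t K)) (at (snd c p))"
    by (intro has_derivative_sum has_derivative_mult has_derivative_mult_right d)
  from dird_eqI[OF c U p _ this, of "\<lambda>q. Y c q y y y"] show ?thesis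
    by (simp add: inv p Y_\<theta> cubic_form3_def distrib_right sum.distrib)
qed

text \<open>Metric compatibility: differentiate the expression of \<open>g\<close> through the
  coframe by the product rule and compare with the Levi-Civita condition.\<close>

lemma nabla_\<theta>_skew: assumes N: "I \<in> {1..n}" "J \<in> {1..n}"
  shows "\<Delta> I x (v J) = - \<Delta> J x (v I)"
proof -
  have gv: "(\<Sum>L=1..n. \<theta> L c p w * \<theta> L c p (v J)) = \<theta> J c p w" "(\<Sum>L=1..n. \<theta> L c p (v J) * \<theta> L c p w) = \<theta> J c p w" if J: "J \<in> {1..n}" for J w
  proof -
    have "(\<Sum>L=1..n. \<theta> L c p w * \<theta> L c p (v J)) = (\<Sum>L=1..n. if L = J then \<theta> J c p w else 0)"
      by (rule sum.cong) (use J \<theta>_dual in auto)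
    then show "(\<Sum>L=1..n. \<theta> L c p w * \<theta> L c p (v J)) = \<theta> J c p w" using J by simp
    then show "(\<Sum>L=1..n. \<theta> L c p (v J) * \<theta> L c p w) = \<theta> J c p w" by (simp add: mult.commute)
  qed
  have dv: "(\<Sum>L=1..n. F L * \<theta> L c p (v J)) = F J" "(\<Sum>L=1..n. \<theta> L c p (v J) * F L) = F J" if J: "J \<in> {1..n}" for J F
  proof -
    have "(\<Sum>L=1..n. F L * \<theta> L c p (v J)) = (\<Sum>L=1..n. if L = J then F J else 0)"
      by (rule sum.cong) (use J \<theta>_dual in auto)
    then show "(\<Sum>L=1..n. F L * \<theta> L c p (v J)) = F J" using J by simp
    then show "(\<Sum>L=1..n. \<theta> L c p (v J) * F L) = F J" by (simp add: mult.commute)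
  qed
  have "dird c (\<lambda>q. g c q (v J) (v I)) p x = dird c (\<lambda>q. \<theta> I c q (v J)) p x + dird c (\<lambda>q. \<theta> J c q (v I)) p x"
    unfolding dird_metric sum.distrib dv[OF N(1)] dv[OF N(2)] ..
  moreover have "dird c (\<lambda>q. g c q (v J) (v I)) p x = \<theta> I c p (LC x (v J)) + \<theta> J c p (LC x (v I))"
    unfolding LC(4) g_\<theta>[OF p] gv[OF N(1)] gv[OF N(2)] ..
  ultimately show ?thesis unfolding nabla_covector_def by linarith
qed

abbreviation "\<Gamma> \<equiv> lc_coeff n g \<theta> c p"

lemma op3_coords: "model.op3 \<Gamma> (coords w) (coords w) = - (\<Sum>I=1..n. \<Delta> I w w *\<^sub>R \<epsilon> I)"
proof (rule model.coord_eqI)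
  fix I assume I: "I \<in> {1..n}"
  note l = nabla_\<theta>_linear[OF I]
  have "\<Delta> I w w = \<Delta> I (\<Sum>K=1..n. \<theta> K c p w *\<^sub>R v K) (\<Sum>J=1..n. \<theta> J c p w *\<^sub>R v J)"
    using dual_expand[of w] by simp
  also have "\<dots> = (\<Sum>K=1..n. \<Sum>J=1..n. \<theta> K c p w * (\<theta> J c p w * \<Delta> I (v K) (v J)))"
    unfolding linear_sum[OF l(1)] linear_scale[OF l(1)] unfolding linear_sum[OF l(2)] linear_scale[OF l(2)]
    by (simp add: sum_distrib_left)
  finally have e: "\<Delta> I w w = (\<Sum>K=1..n. \<Sum>J=1..n. \<theta> K c p w * (\<theta> J c p w * \<Delta> I (v K) (v J)))" .
  have "model.op3 \<Gamma> (coords w) (coords w) \<bullet> \<epsilon> I = (\<Sum>K=1..n. \<Sum>J=1..n. \<theta> K c p w * (\<Gamma> I J K * \<theta> J c p w))"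
    unfolding model.op3_def inner_sum_left inner_scaleR_left model.op_coord[OF I] sum_distrib_left
    by (intro sum.cong refl) (simp only: coords_inner)
  also have "\<dots> = (\<Sum>K=1..n. \<Sum>J=1..n. - (\<theta> K c p w * (\<theta> J c p w * \<Delta> I (v K) (v J))))"
    by (intro sum.cong refl) (use I in \<open>simp add: lc_coeff_def\<close>)
  also have "\<dots> = - \<Delta> I w w" unfolding e sum_negf ..
  finally show "model.op3 \<Gamma> (coords w) (coords w) \<bullet> \<epsilon> I = - (\<Sum>I=1..n. \<Delta> I w w *\<^sub>R \<epsilon> I) \<bullet> \<epsilon> I"
    by (simp only: inner_minus_left comb[OF I])
qed

lemma cubic_form3_model: "cubic_form3 n (model_tensor k) x y z
    = prod_at c p v (\<Sum>I=1..n. x I *\<^sub>R \<epsilon> I) (\<Sum>I=1..n. y I *\<^sub>R \<epsilon> I) \<bullet> (\<Sum>I=1..n. z I *\<^sub>R \<epsilon> I)"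
  by (rule cubic_form3_vec[OF model.P.bounded_bilinear_axioms]) (rule model.model)

text \<open>In an adapted coframe the tensor has constant components, so only the coframe is
  differentiated. The three equal slots give the factor 3, and the sign is that of
  \<open>lc_coeff\<close>, which is minus the covariant derivative of the coframe.\<close>

lemma nabla_tensor_diag:
  "nabla_tensor3 g Y c p w w w w = - 3 * (model.op3 \<Gamma> (coords w) (coords w) \<bullet> prod_at c p v (coords w) (coords w))"
proof -
  let ?P = "prod_at c p v" and ?T = "cubic_form3 n (model_tensor k)" and ?t = "\<lambda>I. \<theta> I c p w"
  have c3: "?P x y \<bullet> z = ?P x z \<bullet> y" for x y z using model.P_sym[of x y z] by (simp only: inner_commute)
  have s: "?T x y z = ?T y x z" "?T x y z = ?T x z y" for x y z
    unfolding cubic_form3_model by (rule arg_cong2[of _ _ _ _ inner, OF model.P_comm refl], rule c3)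
  have "nabla_tensor3 g Y c p w w w w = 3 * ?T (\<lambda>I. dird c (\<lambda>q. \<theta> I c q w) p w) ?t ?t - 3 * ?T (\<lambda>I. \<theta> I c p (LC w w)) ?t ?t"
    unfolding nabla_tensor3_def dird_tensor Y_\<theta>[OF p]
    using s(1)[of ?t "\<lambda>I. \<theta> I c p (LC w w)" ?t] s(2)[of ?t ?t "\<lambda>I. \<theta> I c p (LC w w)"]
      s(1)[of ?t "\<lambda>I. dird c (\<lambda>q. \<theta> I c q w) p w" ?t] s(2)[of ?t ?t "\<lambda>I. dird c (\<lambda>q. \<theta> I c q w) p w"] by linarith
  also have "\<dots> = 3 * ?T (\<lambda>I. \<Delta> I w w) ?t ?t"
    unfolding nabla_covector_def cubic_form3_def by (simp add: left_diff_distrib right_diff_distrib sum_subtractf)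
  also have "\<dots> = 3 * (?P (- model.op3 \<Gamma> (coords w) (coords w)) (coords w) \<bullet> coords w)"
    unfolding op3_coords minus_minus unfolding cubic_form3_model coords_def ..
  also have "\<dots> = - 3 * (model.op3 \<Gamma> (coords w) (coords w) \<bullet> ?P (coords w) (coords w))"
    using model.P_sym[of "coords w" "model.op3 \<Gamma> (coords w) (coords w)" "coords w"]
      model.P_comm[of "coords w" "model.op3 \<Gamma> (coords w) (coords w)"] by (simp add: model.P.minus_left)
  finally show ?thesis .
qed

theorem pointwise_decomposition_iff:
  "(\<exists>!D. fst D \<in> h_tensor_Rn k \<and> snd D \<in> three_forms n \<and> (\<forall>I J K. \<Gamma> I J K = fst D I J K + 1/2 * snd D I J K))
    \<longleftrightarrow> (\<forall>w. nabla_tensor3 g Y c p w w w w = 0)"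
proof -
  have out: "\<Gamma> I J K = 0" if "\<not> {I, J, K} \<subseteq> {1..n}" for I J K using that by (simp only: lc_coeff_def if_False)
  have skew: "\<Gamma> I J K = - \<Gamma> J I K" if "I \<in> {1..n}" "J \<in> {1..n}" "K \<in> {1..n}" for I J K
    using that nabla_\<theta>_skew[OF that(1,2), of "v K"] by (simp add: lc_coeff_def)
  have "(\<forall>x. model.op3 \<Gamma> x x \<bullet> prod_at c p v x x = 0) \<longleftrightarrow> (\<forall>w. model.op3 \<Gamma> (coords w) (coords w) \<bullet> prod_at c p v (coords w) (coords w) = 0)"
  proof (intro iffI allI)
    fix x assume h: "\<forall>w. model.op3 \<Gamma> (coords w) (coords w) \<bullet> prod_at c p v (coords w) (coords w) = 0"
    obtain w where w: "x = coords w" using surjD[OF coords_surj] by blast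
    show "model.op3 \<Gamma> x x \<bullet> prod_at c p v x x = 0" unfolding w using h by (rule spec)
  qed (erule spec)
  also have "\<dots> \<longleftrightarrow> (\<forall>w. nabla_tensor3 g Y c p w w w w = 0)" unfolding nabla_tensor_diag by simp
  finally show ?thesis using model.decomposition_iff[OF out skew] by simp
qed

end

theorem theorem6p7:
  fixes k :: nat
    and X :: "'a topology"
    and A :: "('a, 'e::euclidean_space) chart set"
    and g :: "('a, 'e) chart \<Rightarrow> 'a \<Rightarrow> 'e \<Rightarrow> 'e \<Rightarrow> real"
    and Y :: "('a, 'e) chart \<Rightarrow> 'a \<Rightarrow> 'e \<Rightarrow> 'e \<Rightarrow> 'e \<Rightarrow> real"
  assumes "k \<in> {1, 4}"
    and "Hk_structure k X A g Y"
  shows "admits_characteristic_connection k X A g Y \<longleftrightarrow> nearly_integrable A g Y"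
proof -
  have D: "DIM('e) = dim_n k" using assms(2) by (simp add: Hk_structure_def)
  obtain \<epsilon> :: "nat \<Rightarrow> 'e" where \<epsilon>: "bij_betw \<epsilon> {1..dim_n k} Basis"
    using ex_bij_betw_nat_finite_1[OF finite_Basis] D by metis
  interpret hk_manifold X A k g Y \<epsilon>
    using assms \<epsilon> by unfold_locales (simp_all add: Hk_structure_def)
  have pt: "(\<exists>!D. fst D \<in> h_tensor_Rn k \<and> snd D \<in> three_forms (dim_n k) \<and>
        (\<forall>I J K. lc_coeff (dim_n k) g \<theta> c p I J K = fst D I J K + 1/2 * snd D I J K))
      \<longleftrightarrow> (\<forall>w. nabla_tensor3 g Y c p w w w w = 0)"
    if "adapted_coframe k X A g Y U \<theta>" "c \<in> A" "p \<in> U" "p \<in> fst c" for U \<theta> c p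
  proof -
    interpret coframe_point X A k g Y \<epsilon> U \<theta> c p using that by unfold_locales
    show ?thesis by (rule pointwise_decomposition_iff)
  qed
  show ?thesis
    unfolding nearly_integrable_iff
  proof
    assume L: "admits_characteristic_connection k X A g Y"
    show "\<forall>c\<in>A. \<forall>p\<in>fst c. \<forall>x. nabla_tensor3 g Y c p x x x x = 0"
    proof (intro ballI allI)
      fix c p x assume c: "c \<in> A" "p \<in> fst c"
      then obtain U \<theta> where U: "p \<in> U" "adapted_coframe k X A g Y U \<theta>"
        using exists_adapted_coframe[of p] topspace_charts by blast
      then have "\<exists>!D. fst D \<in> h_tensor_Rn k \<and> snd D \<in> three_forms (dim_n k) \<and>
          (\<forall>I J K. lc_coeff (dim_n k) g \<theta> c p I J K = fst D I J K + 1/2 * snd D I J K)"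
        using L c unfolding admits_characteristic_connection_def by blast
      then show "nabla_tensor3 g Y c p x x x x = 0" unfolding pt[OF U(2) c(1) U(1) c(2)] by blast
    qed
  next
    assume R: "\<forall>c\<in>A. \<forall>p\<in>fst c. \<forall>x. nabla_tensor3 g Y c p x x x x = 0"
    show "admits_characteristic_connection k X A g Y"
      unfolding admits_characteristic_connection_def
    proof (intro conjI ballI allI impI)
      show "\<exists>U \<theta>. p \<in> U \<and> adapted_coframe k X A g Y U \<theta>" if "p \<in> topspace X" for p
        by (rule exists_adapted_coframe[OF that])
      fix U \<theta> c p assume a: "adapted_coframe k X A g Y U \<theta>" "c \<in> A" "p \<in> U \<inter> fst c"
      then have i: "p \<in> U" "p \<in> fst c" by auto
      show "\<exists>!D. fst D \<in> h_tensor_Rn k \<and> snd D \<in> three_forms (dim_n k) \<and>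
          (\<forall>I J K. lc_coeff (dim_n k) g \<theta> c p I J K = fst D I J K + 1/2 * snd D I J K)"
        unfolding pt[OF a(1,2) i] using R a(2) i(2) by blast
    qed
  qed
qed

end
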